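(* Let $p$ be a prime and let $1\to K\to\pi\xrightarrow{\nu}\mathbb{Z}_p\to1$ be an exact sequence of groups. There is then a spectral sequence $$E^1_{-s,s+q}=H_q(\pi,\mathbb{F}_p)\Rightarrow H_q(K,\mathbb{F}_p),\qquad q\ge 0,\ 0\le s\le p-1$$ (with $E^1_{-s,s+q}=0$ for all other $s,q$), with differential $d^1\colon E^1_{-s,s+q}=H_q(\pi,\mathbb{F}_p)\to E^1_{-s-1,s+q}=H_{q-1}(\pi,\mathbb{F}_p)$ (for $0\le s\le p-2$) equal to $\varrho_q=(\nu_*\otimes\mathrm{id})\circ\nabla_{K(\pi,1)}$, and converging in finitely many steps.
   Context: $\mathbb{Z}_p$ is the cyclic group of order $p$. The differentials $d^r$ have bidegree $(-r,r-1)$. The map $\nu_*\colon H_1(\pi,\mathbb{F}_p)\to H_1(\mathbb{Z}_p,\mathbb{F}_p)=\mathbb{F}_p$ is induced by $\nu$. For $X=K(\pi,1)$, the map $\nabla_X\colon H_q(X,\mathbb{F}_p)\to H_1(X,\mathbb{F}_p)\otimes H_{q-1}(X,\mathbb{F}_p)$ is the composite of the diagonal-induced map $H_q(X,\mathbb{F}_p)\to H_q(X\times X,\mathbb{F}_p)$, the Künneth isomorphism with $\bigoplus_iH_i(X,\mathbb{F}_p)\otimes H_{q-i}(X,\mathbb{F}_p)$, and projection onto the $i=1$ summand; and $\mathbb{F}_p\otimes H_{q-1}(\pi,\mathbb{F}_p)$ is identified with $H_{q-1}(\pi,\mathbb{F}_p)$. *)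

theory Defs
  imports "HOL-Algebra.Algebra" "HOL-Number_Theory.Residues"
begin

section \<open>Modules\<close>

text \<open>
  In all records of type \<open>module\<close> built below, the ring fields \<open>mult\<close> and \<open>one\<close> are irrelevant
  (the locale \<^locale>\<open>Module.module\<close> does not look at them) and are filled with the zero element.
\<close>

definition lin_hom :: "('r,'s) ring_scheme \<Rightarrow> ('r,'m) module \<Rightarrow> ('r,'n) module \<Rightarrow> ('m \<Rightarrow> 'n) set" where
  "lin_hom R M N =
     {f \<in> carrier M \<rightarrow> carrier N.
        (\<forall>x\<in>carrier M. \<forall>y\<in>carrier M. f (x \<oplus>\<^bsub>M\<^esub> y) = f x \<oplus>\<^bsub>N\<^esub> f y) \<and>
        (\<forall>a\<in>carrier R. \<forall>x\<in>carrier M. f (a \<odot>\<^bsub>M\<^esub> x) = a \<odot>\<^bsub>N\<^esub> f x)}"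

definition lin_isomorphic :: "('r,'s) ring_scheme \<Rightarrow> ('r,'m) module \<Rightarrow> ('r,'n) module \<Rightarrow> bool" where
  "lin_isomorphic R M N \<longleftrightarrow> (\<exists>f \<in> lin_hom R M N. bij_betw f (carrier M) (carrier N))"

definition zero_mod :: "('r,'m) module \<Rightarrow> bool" where
  "zero_mod M \<longleftrightarrow> carrier M = {\<zero>\<^bsub>M\<^esub>}"

definition ring_as_mod :: "('r,'s) ring_scheme \<Rightarrow> ('r,'r) module" where
  "ring_as_mod R =
     \<lparr>carrier = carrier R, monoid.mult = (\<lambda>_ _. \<zero>\<^bsub>R\<^esub>), one = \<zero>\<^bsub>R\<^esub>,
      ring.zero = \<zero>\<^bsub>R\<^esub>, ring.add = (\<lambda>x y. x \<oplus>\<^bsub>R\<^esub> y), smult = (\<lambda>a x. a \<otimes>\<^bsub>R\<^esub> x)\<rparr>"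

definition quot_mod :: "('r,'m) module \<Rightarrow> 'm set \<Rightarrow> ('r,'m set) module" where
  "quot_mod M N =
     \<lparr>carrier = a_rcosets\<^bsub>M\<^esub> N, monoid.mult = (\<lambda>_ _. N), one = N,
      ring.zero = N, ring.add = set_add M, smult = (\<lambda>a A. \<Union>x\<in>A. N +>\<^bsub>M\<^esub> (a \<odot>\<^bsub>M\<^esub> x))\<rparr>"

text \<open>Free module on \<open>S\<close>: finitely supported functions with support in \<open>S\<close>.\<close>

definition free_mod :: "('r,'s) ring_scheme \<Rightarrow> 'x set \<Rightarrow> ('r,'x \<Rightarrow> 'r) module" where
  "free_mod R S =
     \<lparr>carrier = {f. (\<forall>x. f x \<in> carrier R) \<and> finite {x. f x \<noteq> \<zero>\<^bsub>R\<^esub>} \<and> {x. f x \<noteq> \<zero>\<^bsub>R\<^esub>} \<subseteq> S},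
      monoid.mult = (\<lambda>_ _ _. \<zero>\<^bsub>R\<^esub>), one = (\<lambda>_. \<zero>\<^bsub>R\<^esub>),
      ring.zero = (\<lambda>_. \<zero>\<^bsub>R\<^esub>), ring.add = (\<lambda>f g x. f x \<oplus>\<^bsub>R\<^esub> g x), smult = (\<lambda>a f x. a \<otimes>\<^bsub>R\<^esub> f x)\<rparr>"

definition fbasis :: "('r,'s) ring_scheme \<Rightarrow> 'x \<Rightarrow> 'x \<Rightarrow> 'r" where
  "fbasis R x = (\<lambda>y. if y = x then \<one>\<^bsub>R\<^esub> else \<zero>\<^bsub>R\<^esub>)"

text \<open>The linear map from a free module to \<open>M\<close> taking the values \<open>\<phi>\<close> on the basis.\<close>

definition lin_ext :: "('r,'s) ring_scheme \<Rightarrow> ('r,'m) module \<Rightarrow> ('x \<Rightarrow> 'm) \<Rightarrow> ('x \<Rightarrow> 'r) \<Rightarrow> 'm" where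
  "lin_ext R M \<phi> f = (\<Oplus>\<^bsub>M\<^esub>x\<in>{x. f x \<noteq> \<zero>\<^bsub>R\<^esub>}. f x \<odot>\<^bsub>M\<^esub> \<phi> x)"

definition alt_sign :: "('r,'s) ring_scheme \<Rightarrow> nat \<Rightarrow> 'r" where
  "alt_sign R i = (\<ominus>\<^bsub>R\<^esub> \<one>\<^bsub>R\<^esub>) [^]\<^bsub>R\<^esub> i"


subsection \<open>Tensor products\<close>

definition submod_gen :: "('r,'s) ring_scheme \<Rightarrow> ('r,'m) module \<Rightarrow> 'm set \<Rightarrow> 'm set" where
  "submod_gen R M S = \<Inter>{N. submodule N R M \<and> S \<subseteq> N}"

definition tensor_relators ::
    "('r,'s) ring_scheme \<Rightarrow> ('r,'m) module \<Rightarrow> ('r,'n) module \<Rightarrow> ('m \<times> 'n \<Rightarrow> 'r) set" where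
  "tensor_relators R M N =
     (let V = free_mod R (carrier M \<times> carrier N); e = (\<lambda>m n. fbasis R (m, n)) in
       {e (m \<oplus>\<^bsub>M\<^esub> m') n \<ominus>\<^bsub>V\<^esub> (e m n \<oplus>\<^bsub>V\<^esub> e m' n) | m m' n.
          m \<in> carrier M \<and> m' \<in> carrier M \<and> n \<in> carrier N} \<union>
       {e m (n \<oplus>\<^bsub>N\<^esub> n') \<ominus>\<^bsub>V\<^esub> (e m n \<oplus>\<^bsub>V\<^esub> e m n') | m n n'.
          m \<in> carrier M \<and> n \<in> carrier N \<and> n' \<in> carrier N} \<union>
       {e (a \<odot>\<^bsub>M\<^esub> m) n \<ominus>\<^bsub>V\<^esub> a \<odot>\<^bsub>V\<^esub> e m n | a m n.
          a \<in> carrier R \<and> m \<in> carrier M \<and> n \<in> carrier N} \<union>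
       {e m (a \<odot>\<^bsub>N\<^esub> n) \<ominus>\<^bsub>V\<^esub> a \<odot>\<^bsub>V\<^esub> e m n | a m n.
          a \<in> carrier R \<and> m \<in> carrier M \<and> n \<in> carrier N})"

definition tensor_rel ::
    "('r,'s) ring_scheme \<Rightarrow> ('r,'m) module \<Rightarrow> ('r,'n) module \<Rightarrow> ('m \<times> 'n \<Rightarrow> 'r) set" where
  "tensor_rel R M N = submod_gen R (free_mod R (carrier M \<times> carrier N)) (tensor_relators R M N)"

definition tensor ::
    "('r,'s) ring_scheme \<Rightarrow> ('r,'m) module \<Rightarrow> ('r,'n) module \<Rightarrow> ('r,('m \<times> 'n \<Rightarrow> 'r) set) module" where
  "tensor R M N = quot_mod (free_mod R (carrier M \<times> carrier N)) (tensor_rel R M N)"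

text \<open>
  The value at \<open>t\<close> of the linear map \<open>M \<otimes> N \<rightarrow> P\<close> given by a bilinear map \<open>\<beta>\<close>.  As for the maps
  induced on homology below, a map induced on a quotient is obtained from a map constant on cosets
  through \<^const>\<open>the_elem\<close> of the image of the coset.
\<close>

definition tensor_lift :: "('r,'s) ring_scheme \<Rightarrow> ('r,'k) module \<Rightarrow> ('m \<Rightarrow> 'n \<Rightarrow> 'k) \<Rightarrow>
    ('m \<times> 'n \<Rightarrow> 'r) set \<Rightarrow> 'k" where
  "tensor_lift R P \<beta> t = the_elem (lin_ext R P (\<lambda>(m, n). \<beta> m n) ` t)"

definition pure_tensor ::
    "('r,'s) ring_scheme \<Rightarrow> ('r,'m) module \<Rightarrow> ('r,'n) module \<Rightarrow> 'm \<Rightarrow> 'n \<Rightarrow> ('m \<times> 'n \<Rightarrow> 'r) set" where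
  "pure_tensor R M N m n =
     tensor_rel R M N +>\<^bsub>free_mod R (carrier M \<times> carrier N)\<^esub> fbasis R (m, n)"

text \<open>The map \<open>f \<otimes> g\<close> into \<open>M' \<otimes> N'\<close>.\<close>

definition tensor_map :: "('r,'s) ring_scheme \<Rightarrow> ('r,'m1) module \<Rightarrow> ('r,'n1) module \<Rightarrow>
    ('m \<Rightarrow> 'm1) \<Rightarrow> ('n \<Rightarrow> 'n1) \<Rightarrow> ('m \<times> 'n \<Rightarrow> 'r) set \<Rightarrow> ('m1 \<times> 'n1 \<Rightarrow> 'r) set" where
  "tensor_map R M' N' f g =
     tensor_lift R (tensor R M' N') (\<lambda>m n. pure_tensor R M' N' (f m) (g n))"

text \<open>The identification \<open>R \<otimes> N = N\<close>.\<close>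

definition tensor_unit :: "('r,'s) ring_scheme \<Rightarrow> ('r,'n) module \<Rightarrow> ('r \<times> 'n \<Rightarrow> 'r) set \<Rightarrow> 'n" where
  "tensor_unit R N = tensor_lift R N (\<lambda>a n. a \<odot>\<^bsub>N\<^esub> n)"


section \<open>Homology\<close>

text \<open>Homology at \<open>M\<close> of a sequence \<open>L \<rightarrow>\<^sup>f M \<rightarrow>\<^sup>g N\<close>.\<close>

definition homology_at :: "('r,'l) module \<Rightarrow> ('l \<Rightarrow> 'm) \<Rightarrow> ('r,'m) module \<Rightarrow> ('m \<Rightarrow> 'n) \<Rightarrow>
    ('r,'n) module \<Rightarrow> ('r,'m set) module" where
  "homology_at L f M g N = quot_mod (M\<lparr>carrier := a_kernel M N g\<rparr>) (f ` carrier L)"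

record ('r,'c) complex_data =
  chains :: "nat \<Rightarrow> ('r,'c) module"
  bdry :: "nat \<Rightarrow> 'c \<Rightarrow> 'c"

text \<open>
  \<open>bdry C n\<close> maps \<open>chains C n\<close> to \<open>chains C (n - 1)\<close>.  In degree \<open>0\<close> it is the zero map, so that
  truncated subtraction does no harm.
\<close>

definition homology :: "('r,'c) complex_data \<Rightarrow> nat \<Rightarrow> ('r,'c set) module" where
  "homology C q = homology_at (chains C (Suc q)) (bdry C (Suc q)) (chains C q) (bdry C q) (chains C (q - 1))"

definition hclass :: "('r,'c) complex_data \<Rightarrow> nat \<Rightarrow> 'c \<Rightarrow> 'c set" where
  "hclass C q z = bdry C (Suc q) ` carrier (chains C (Suc q)) +>\<^bsub>chains C q\<^esub> z"

text \<open>The map to the \<open>q\<close>-th homology of \<open>C'\<close> induced by a chain map \<open>\<phi>\<close> to \<open>C'\<close>.\<close>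

definition homology_map :: "('r,'c) complex_data \<Rightarrow> nat \<Rightarrow> ('b \<Rightarrow> 'c) \<Rightarrow> 'b set \<Rightarrow> 'c set" where
  "homology_map C' q \<phi> Z = the_elem ((\<lambda>z. hclass C' q (\<phi> z)) ` Z)"


section \<open>Simplicial sets\<close>

text \<open>
  Only the simplices and the face maps are recorded: degeneracies do not enter into the unnormalized
  chain complex, nor into the Alexander--Whitney map.
\<close>

record 'x simplicial_data =
  simplices :: "nat \<Rightarrow> 'x set"
  face :: "nat \<Rightarrow> nat \<Rightarrow> 'x \<Rightarrow> 'x"  \<comment> \<open>\<open>face A n i\<close> is \<open>d\<^sub>i\<close> on \<open>n\<close>-simplices\<close>

definition prod_sset :: "'x simplicial_data \<Rightarrow> 'y simplicial_data \<Rightarrow> ('x \<times> 'y) simplicial_data" where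
  "prod_sset A B =
     \<lparr>simplices = (\<lambda>n. simplices A n \<times> simplices B n),
      face = (\<lambda>n i (x, y). (face A n i x, face B n i y))\<rparr>"

definition sset_complex ::
    "('r,'s) ring_scheme \<Rightarrow> 'x simplicial_data \<Rightarrow> ('r,'x \<Rightarrow> 'r) complex_data" where
  "sset_complex R A =
     \<lparr>chains = (\<lambda>n. free_mod R (simplices A n)),
      bdry = (\<lambda>n.
        let V = free_mod R (simplices A (n - 1)) in
        if n = 0 then (\<lambda>_. \<zero>\<^bsub>V\<^esub>)
        else lin_ext R V (\<lambda>x. \<Oplus>\<^bsub>V\<^esub>i\<in>{..n}. alt_sign R i \<odot>\<^bsub>V\<^esub> fbasis R (face A n i x)))\<rparr>"

abbreviation sset_homology ::
    "('r,'s) ring_scheme \<Rightarrow> 'x simplicial_data \<Rightarrow> nat \<Rightarrow> ('r,('x \<Rightarrow> 'r) set) module" where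
  "sset_homology R A q \<equiv> homology (sset_complex R A) q"

text \<open>The map to the \<open>q\<close>-th homology of \<open>B\<close> induced by a simplicial map \<open>h\<close> to \<open>B\<close>.\<close>

definition sset_homology_map :: "('r,'s) ring_scheme \<Rightarrow> 'y simplicial_data \<Rightarrow> nat \<Rightarrow> ('x \<Rightarrow> 'y) \<Rightarrow>
    ('x \<Rightarrow> 'r) set \<Rightarrow> ('y \<Rightarrow> 'r) set" where
  "sset_homology_map R B q h =
     homology_map (sset_complex R B) q (lin_ext R (free_mod R (simplices B q)) (\<lambda>x. fbasis R (h x)))"


subsection \<open>The Kuenneth isomorphism and the map \<open>\<nabla>\<close>\<close>

text \<open>
  The tensor product of the chain complexes of \<open>A\<close> and \<open>B\<close>: \<open>C\<^sub>i(A) \<otimes> C\<^sub>j(B)\<close> is identified with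
  the free module on \<open>A\<^sub>i \<times> B\<^sub>j\<close>; the first component of a basis element is the degree \<open>i\<close>.
\<close>

definition tensor_basis :: "'x simplicial_data \<Rightarrow> 'y simplicial_data \<Rightarrow> nat \<Rightarrow> (nat \<times> 'x \<times> 'y) set" where
  "tensor_basis A B n = {(i, x, y). i \<le> n \<and> x \<in> simplices A i \<and> y \<in> simplices B (n - i)}"

definition chain_tensor :: "('r,'s) ring_scheme \<Rightarrow> nat \<Rightarrow> ('x \<Rightarrow> 'r) \<Rightarrow> ('y \<Rightarrow> 'r) \<Rightarrow>
    (nat \<times> 'x \<times> 'y \<Rightarrow> 'r)" where
  "chain_tensor R i z w = (\<lambda>(k, x, y). if k = i then z x \<otimes>\<^bsub>R\<^esub> w y else \<zero>\<^bsub>R\<^esub>)"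

definition tensor_complex :: "('r,'s) ring_scheme \<Rightarrow> 'x simplicial_data \<Rightarrow> 'y simplicial_data \<Rightarrow>
    ('r,nat \<times> 'x \<times> 'y \<Rightarrow> 'r) complex_data" where
  "tensor_complex R A B =
     \<lparr>chains = (\<lambda>n. free_mod R (tensor_basis A B n)),
      bdry = (\<lambda>n.
        let V = free_mod R (tensor_basis A B (n - 1)) in
        if n = 0 then (\<lambda>_. \<zero>\<^bsub>V\<^esub>)
        else lin_ext R V (\<lambda>(i, x, y).
          chain_tensor R (i - 1) (bdry (sset_complex R A) i (fbasis R x)) (fbasis R y) \<oplus>\<^bsub>V\<^esub>
          alt_sign R i \<odot>\<^bsub>V\<^esub> chain_tensor R i (fbasis R x) (bdry (sset_complex R B) (n - i) (fbasis R y))))\<rparr>"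

text \<open>
  \<open>front_face A i k\<close> and \<open>back_face A j k\<close> are the front \<open>i\<close>-face \<open>d\<^sub>i\<^sub>+\<^sub>1 \<dots> d\<^sub>i\<^sub>+\<^sub>k\<close> of an \<open>(i+k)\<close>-simplex
  and the back \<open>j\<close>-face \<open>d\<^sub>0 \<dots> d\<^sub>0\<close> of a \<open>(j+k)\<close>-simplex.
\<close>

primrec front_face :: "'x simplicial_data \<Rightarrow> nat \<Rightarrow> nat \<Rightarrow> 'x \<Rightarrow> 'x" where
  "front_face A i 0 x = x"
| "front_face A i (Suc k) x = front_face A i k (face A (i + Suc k) (i + Suc k) x)"

primrec back_face :: "'x simplicial_data \<Rightarrow> nat \<Rightarrow> nat \<Rightarrow> 'x \<Rightarrow> 'x" where
  "back_face A j 0 x = x"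
| "back_face A j (Suc k) x = back_face A j k (face A (j + Suc k) 0 x)"

definition alexander_whitney :: "('r,'s) ring_scheme \<Rightarrow> 'x simplicial_data \<Rightarrow> 'y simplicial_data \<Rightarrow> nat \<Rightarrow>
    ('x \<times> 'y \<Rightarrow> 'r) \<Rightarrow> (nat \<times> 'x \<times> 'y \<Rightarrow> 'r)" where
  "alexander_whitney R A B n =
     (let V = free_mod R (tensor_basis A B n) in
      lin_ext R V (\<lambda>(x, y). \<Oplus>\<^bsub>V\<^esub>i\<in>{..n}. fbasis R (i, front_face A i (n - i) x, back_face B (n - i) i y)))"

text \<open>Underlying set of \<open>\<Oplus>\<^sub>i H\<^sub>i(A) \<otimes> H\<^sub>q\<^sub>-\<^sub>i(B)\<close>.\<close>

definition kunneth_sum :: "('r,'s) ring_scheme \<Rightarrow> 'x simplicial_data \<Rightarrow> 'y simplicial_data \<Rightarrow> nat \<Rightarrow>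
    (nat \<Rightarrow> (('x \<Rightarrow> 'r) set \<times> ('y \<Rightarrow> 'r) set \<Rightarrow> 'r) set) set" where
  "kunneth_sum R A B q =
     (\<Pi>\<^sub>E i\<in>{..q}. carrier (tensor R (sset_homology R A i) (sset_homology R B (q - i))))"

text \<open>
  The algebraic Kuenneth map \<open>\<Oplus>\<^sub>i H\<^sub>i(A) \<otimes> H\<^sub>q\<^sub>-\<^sub>i(B) \<rightarrow> H\<^sub>q(C(A) \<otimes> C(B))\<close>, \<open>[z] \<otimes> [w] \<mapsto> [z \<otimes> w]\<close>.
\<close>

definition kunneth_alg :: "('r,'s) ring_scheme \<Rightarrow> 'x simplicial_data \<Rightarrow> 'y simplicial_data \<Rightarrow> nat \<Rightarrow>
    (nat \<Rightarrow> (('x \<Rightarrow> 'r) set \<times> ('y \<Rightarrow> 'r) set \<Rightarrow> 'r) set) \<Rightarrow> (nat \<times> 'x \<times> 'y \<Rightarrow> 'r) set" where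
  "kunneth_alg R A B q t =
     (let T = tensor_complex R A B in
      \<Oplus>\<^bsub>homology T q\<^esub>i\<in>{..q}.
        tensor_lift R (homology T q)
          (\<lambda>Z W. the_elem ((\<lambda>(z, w). hclass T q (chain_tensor R i z w)) ` (Z \<times> W))) (t i))"

text \<open>
  The Kuenneth isomorphism \<open>H\<^sub>q(A \<times> B) \<rightarrow> \<Oplus>\<^sub>i H\<^sub>i(A) \<otimes> H\<^sub>q\<^sub>-\<^sub>i(B)\<close> over a field: the Eilenberg--Zilber
  isomorphism \<open>H\<^sub>q(A \<times> B) \<rightarrow> H\<^sub>q(C(A) \<otimes> C(B))\<close>, given by the Alexander--Whitney map, followed by the
  inverse of the algebraic Kuenneth map.
\<close>

definition kunneth :: "('r,'s) ring_scheme \<Rightarrow> 'x simplicial_data \<Rightarrow> 'y simplicial_data \<Rightarrow> nat \<Rightarrow>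
    ('x \<times> 'y \<Rightarrow> 'r) set \<Rightarrow> (nat \<Rightarrow> (('x \<Rightarrow> 'r) set \<times> ('y \<Rightarrow> 'r) set \<Rightarrow> 'r) set)" where
  "kunneth R A B q Z =
     inv_into (kunneth_sum R A B q) (kunneth_alg R A B q)
       (homology_map (tensor_complex R A B) q (alexander_whitney R A B q) Z)"

text \<open>\<open>\<nabla>\<^sub>A: H\<^sub>q(A) \<rightarrow> H\<^sub>1(A) \<otimes> H\<^sub>q\<^sub>-\<^sub>1(A)\<close>, for \<open>q \<ge> 1\<close>\<close>

definition nabla :: "('r,'s) ring_scheme \<Rightarrow> 'x simplicial_data \<Rightarrow> nat \<Rightarrow> ('x \<Rightarrow> 'r) set \<Rightarrow>
    (('x \<Rightarrow> 'r) set \<times> ('x \<Rightarrow> 'r) set \<Rightarrow> 'r) set" where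
  "nabla R A q Z = kunneth R A A q (sset_homology_map R (prod_sset A A) q (\<lambda>x. (x, x)) Z) 1"


section \<open>Group homology\<close>

text \<open>
  The nerve of \<open>G\<close>, the standard simplicial model of \<open>K(G, 1)\<close>.  The list \<open>[g\<^sub>1, \<dots>, g\<^sub>n]\<close> is the
  \<open>n\<close>-simplex \<open>[g\<^sub>1|\<dots>|g\<^sub>n]\<close>, with \<open>d\<^sub>0\<close> dropping \<open>g\<^sub>1\<close>, \<open>d\<^sub>n\<close> dropping \<open>g\<^sub>n\<close> and \<open>d\<^sub>i\<close> multiplying
  \<open>g\<^sub>i\<close> and \<open>g\<^sub>i\<^sub>+\<^sub>1\<close> otherwise.
\<close>

definition nerve :: "'a monoid \<Rightarrow> 'a list simplicial_data" where
  "nerve G =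
     \<lparr>simplices = (\<lambda>n. {gs. length gs = n \<and> set gs \<subseteq> carrier G}),
      face = (\<lambda>n i gs.
        if i = 0 then tl gs
        else if i = n then butlast gs
        else take (i - 1) gs @ (gs ! (i - 1) \<otimes>\<^bsub>G\<^esub> gs ! i) # drop (i + 1) gs)\<rparr>"

text \<open>
  \<open>H\<^sub>q(G, R)\<close> with trivial action: the homology of the (unnormalized, inhomogeneous) bar complex, i.e.
  of the nerve.
\<close>

abbreviation group_homology ::
    "('r,'s) ring_scheme \<Rightarrow> 'a monoid \<Rightarrow> nat \<Rightarrow> ('r,('a list \<Rightarrow> 'r) set) module" where
  "group_homology R G q \<equiv> sset_homology R (nerve G) q"

abbreviation Fp :: "nat \<Rightarrow> int ring" where
  "Fp p \<equiv> residue_ring (int p)"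

abbreviation Zp :: "nat \<Rightarrow> int monoid" where
  "Zp p \<equiv> integer_mod_group p"

text \<open>
  The identification \<open>H\<^sub>1(\<int>\<^sub>p, \<bbbF>\<^sub>p) = \<bbbF>\<^sub>p\<close>, sending the class of \<open>[k]\<close> to \<open>k\<close>; both \<open>Zp p\<close> and \<open>Fp p\<close>
  have carrier \<open>{0..<p}\<close>.
\<close>

definition H1_Zp :: "nat \<Rightarrow> (int list \<Rightarrow> int) set \<Rightarrow> int" where
  "H1_Zp p A = the_elem (lin_ext (Fp p) (ring_as_mod (Fp p)) hd ` A)"

definition nu_star :: "nat \<Rightarrow> ('a \<Rightarrow> int) \<Rightarrow> ('a list \<Rightarrow> int) set \<Rightarrow> int" where
  "nu_star p \<nu> A = H1_Zp p (sset_homology_map (Fp p) (nerve (Zp p)) 1 (map \<nu>) A)"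

text \<open>\<open>\<rho>\<^sub>q = (\<nu>\<^sub>* \<otimes> id) \<circ> \<nabla>\<close> on \<open>H\<^sub>q(G, \<bbbF>\<^sub>p)\<close>, for \<open>q \<ge> 1\<close>\<close>

definition rho :: "nat \<Rightarrow> 'a monoid \<Rightarrow> ('a \<Rightarrow> int) \<Rightarrow> nat \<Rightarrow> ('a list \<Rightarrow> int) set \<Rightarrow> ('a list \<Rightarrow> int) set" where
  "rho p G \<nu> q A =
     tensor_unit (Fp p) (group_homology (Fp p) G (q - 1))
       (tensor_map (Fp p) (ring_as_mod (Fp p)) (group_homology (Fp p) G (q - 1)) (nu_star p \<nu>) id
         (nabla (Fp p) (nerve G) q A))"


section \<open>Spectral sequences\<close>

text \<open>
  Homological spectral sequences starting at \<open>E\<^sup>1\<close>; \<open>d r a b\<close> is the differential out of \<open>E r a b\<close>.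
  All pages have the same element type \<open>'m\<close>, so the next page is only isomorphic to the homology of
  the current one.
\<close>

definition spectral_sequence :: "('r,'s) ring_scheme \<Rightarrow> (nat \<Rightarrow> int \<Rightarrow> int \<Rightarrow> ('r,'m) module) \<Rightarrow>
    (nat \<Rightarrow> int \<Rightarrow> int \<Rightarrow> 'm \<Rightarrow> 'm) \<Rightarrow> bool" where
  "spectral_sequence R E d \<longleftrightarrow>
     (\<forall>r\<ge>1. \<forall>a b.
        module R (E r a b) \<and>
        d r a b \<in> lin_hom R (E r a b) (E r (a - int r) (b + int r - 1)) \<and>
        (\<forall>x\<in>carrier (E r a b).
           d r (a - int r) (b + int r - 1) (d r a b x) =
             \<zero>\<^bsub>E r (a - 2 * int r) (b + 2 * int r - 2)\<^esub>) \<and>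
        lin_isomorphic R (E (Suc r) a b)
          (homology_at (E r (a + int r) (b - int r + 1)) (d r (a + int r) (b - int r + 1))
             (E r a b)
             (d r a b) (E r (a - int r) (b + int r - 1))))"

text \<open>
  Convergence to \<open>H\<close> in finitely many steps: all differentials vanish from some page \<open>N\<close> on, so that
  \<open>E\<^sup>N = E\<^sup>\<infinity>\<close>, and each \<open>H\<^sub>n\<close> has a finite increasing filtration whose subquotient in filtration
  degree \<open>a\<close> is \<open>E\<^sup>\<infinity>\<^sub>a\<^sub>,\<^sub>n\<^sub>-\<^sub>a\<close>.  As \<open>H\<close> is indexed by natural numbers (with \<open>H\<^sub>n = 0\<close> for \<open>n < 0\<close>
  understood), \<open>E\<^sup>\<infinity>\<close> has to vanish in negative total degrees.
\<close>

definition converges_finitely :: "('r,'s) ring_scheme \<Rightarrow> (nat \<Rightarrow> int \<Rightarrow> int \<Rightarrow> ('r,'m) module) \<Rightarrow>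
    (nat \<Rightarrow> int \<Rightarrow> int \<Rightarrow> 'm \<Rightarrow> 'm) \<Rightarrow> (nat \<Rightarrow> ('r,'h) module) \<Rightarrow> bool" where
  "converges_finitely R E d H \<longleftrightarrow>
     (\<exists>N\<ge>1.
        (\<forall>r\<ge>N. \<forall>a b. \<forall>x\<in>carrier (E r a b). d r a b x = \<zero>\<^bsub>E r (a - int r) (b + int r - 1)\<^esub>) \<and>
        (\<forall>a b. a + b < 0 \<longrightarrow> zero_mod (E N a b)) \<and>
        (\<forall>n. \<exists>Fil :: int \<Rightarrow> 'h set.
           (\<forall>a. submodule (Fil a) R (H n)) \<and>
           (\<forall>a. Fil (a - 1) \<subseteq> Fil a) \<and>
           (\<exists>a. Fil a = {\<zero>\<^bsub>H n\<^esub>}) \<and> (\<exists>a. Fil a = carrier (H n)) \<and>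
           (\<forall>a. lin_isomorphic R (E N a (int n - a)) (quot_mod ((H n)\<lparr>carrier := Fil a\<rparr>) (Fil (a - 1))))))"

end

theory Submission
  imports Defs
begin

text \<open>
  By Shapiro's lemma the homology of \<open>K\<close> is that of \<open>\<pi>\<close> with coefficients in the group ring
  \<open>\<bbbF>\<^sub>p[\<int>\<^sub>p] = \<bbbF>\<^sub>p[t]/(t - 1)\<^sup>p\<close>, and the spectral sequence is that of the filtration by the powers of
  \<open>t - 1\<close>, whose \<open>p\<close> subquotients are all trivial modules \<open>\<bbbF>\<^sub>p\<close>.  The chains with these coefficients
  are the chains on the nerve of the groupoid of the action of \<open>\<pi>\<close> on \<open>\<int>\<^sub>p\<close> by translations, which is
  equivalent to \<open>K\<close>.  As \<open>t\<^sup>k (t - 1)\<^sup>s\<close> equals \<open>(t - 1)\<^sup>s + k (t - 1)\<^sup>s\<^sup>+\<^sup>1\<close> up to higher powers, the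
  differential \<open>d\<^sup>1\<close> is induced by \<open>[g\<^sub>1|\<dots>|g\<^sub>q] \<mapsto> \<nu>(g\<^sub>1) [g\<^sub>2|\<dots>|g\<^sub>q]\<close>; this is the slant product with \<open>\<nu>\<close>
  of the \<open>(1, q - 1)\<close>-component of the Alexander--Whitney diagonal.
\<close>

section \<open>Linear maps and quotient modules\<close>

text \<open>Two demands of the statement shape the proof. The entries of the first page must equal
  the group homology modules, not merely be isomorphic to them. Hence a page is formed inside the
  graded piece, which is a copy of the bar chains of \<open>G\<close>: leading coefficients of
  approximate cycles modulo leading coefficients of boundaries. And \<open>rho\<close> is defined
  through \<open>inv_into\<close> of the algebraic Kuenneth map, so the surjectivity of that map has
  to be proved, for chain modules of infinite rank. Primality of \<open>p\<close> enters in two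
  ways. Over a field the boundaries have a complement, which gives the Kuenneth surjectivity. And
  \<open>p\<close> divides (p choose k) for 0 < k < p, so that modulo \<open>p\<close> the
  coefficients of t^x with respect to the powers of t - 1 below the p-th depend only on x modulo
  \<open>p\<close>, as they must because t^p = 1. No sign occurs in the comparison of the
  differential with \<open>rho\<close>: d_0, the only face that moves the base point, enters the bar
  differential with a plus sign, and the Alexander-Whitney map is unsigned.\<close>

lemma minus_eq_zero_iff:
  assumes "abelian_group M" "x \<in> carrier M" "y \<in> carrier M"
  shows "x \<ominus>\<^bsub>M\<^esub> y = \<zero>\<^bsub>M\<^esub> \<longleftrightarrow> x = y"
proof -
  interpret abelian_group M by fact
  show ?thesis
    using assms(2,3) minus_equality[of x "\<ominus>\<^bsub>M\<^esub> y"] by (auto simp: a_minus_def r_neg)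
qed

lemma minus_zero_right:
  assumes "abelian_group M" "x \<in> carrier M"
  shows "x \<ominus>\<^bsub>M\<^esub> \<zero>\<^bsub>M\<^esub> = x"
proof -
  interpret abelian_group M by fact
  have "\<ominus>\<^bsub>M\<^esub> \<zero>\<^bsub>M\<^esub> = \<zero>\<^bsub>M\<^esub>" by (rule minus_equality) auto
  then show ?thesis using assms(2) by (simp add: a_minus_def)
qed

lemma minus_add_cancel:
  assumes "abelian_group M" "x \<in> carrier M" "y \<in> carrier M"
  shows "x \<ominus>\<^bsub>M\<^esub> y \<oplus>\<^bsub>M\<^esub> y = x"
proof -
  interpret abelian_group M by fact
  show ?thesis using assms(2,3) by (simp add: a_minus_def a_assoc l_neg)
qed

lemma lin_homI:
  assumes "\<And>x. x \<in> carrier M \<Longrightarrow> f x \<in> carrier N"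
    and "\<And>x y. x \<in> carrier M \<Longrightarrow> y \<in> carrier M \<Longrightarrow> f (x \<oplus>\<^bsub>M\<^esub> y) = f x \<oplus>\<^bsub>N\<^esub> f y"
    and "\<And>a x. a \<in> carrier R \<Longrightarrow> x \<in> carrier M \<Longrightarrow> f (a \<odot>\<^bsub>M\<^esub> x) = a \<odot>\<^bsub>N\<^esub> f x"
  shows "f \<in> lin_hom R M N"
  using assms by (auto simp: lin_hom_def)

lemma lin_hom_closed: "f \<in> lin_hom R M N \<Longrightarrow> x \<in> carrier M \<Longrightarrow> f x \<in> carrier N"
  by (auto simp: lin_hom_def)

lemma lin_hom_add:
  "f \<in> lin_hom R M N \<Longrightarrow> x \<in> carrier M \<Longrightarrow> y \<in> carrier M \<Longrightarrow> f (x \<oplus>\<^bsub>M\<^esub> y) = f x \<oplus>\<^bsub>N\<^esub> f y"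
  by (auto simp: lin_hom_def)

lemma lin_hom_smult:
  "f \<in> lin_hom R M N \<Longrightarrow> a \<in> carrier R \<Longrightarrow> x \<in> carrier M \<Longrightarrow> f (a \<odot>\<^bsub>M\<^esub> x) = a \<odot>\<^bsub>N\<^esub> f x"
  by (auto simp: lin_hom_def)

lemma lin_hom_zero:
  assumes "module R M" "module R N" "f \<in> lin_hom R M N"
  shows "f \<zero>\<^bsub>M\<^esub> = \<zero>\<^bsub>N\<^esub>"
proof -
  interpret M: module R M by fact
  interpret N: module R N by fact
  have "f (\<zero>\<^bsub>R\<^esub> \<odot>\<^bsub>M\<^esub> \<zero>\<^bsub>M\<^esub>) = \<zero>\<^bsub>R\<^esub> \<odot>\<^bsub>N\<^esub> f \<zero>\<^bsub>M\<^esub>"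
    using assms(3) by (intro lin_hom_smult) auto
  then show ?thesis
    using lin_hom_closed[OF assms(3), of "\<zero>\<^bsub>M\<^esub>"] by simp
qed

lemma lin_hom_inv:
  assumes "module R M" "module R N" "f \<in> lin_hom R M N" "x \<in> carrier M"
  shows "f (\<ominus>\<^bsub>M\<^esub> x) = \<ominus>\<^bsub>N\<^esub> f x"
proof -
  interpret M: module R M by fact
  interpret N: module R N by fact
  have "f ((\<ominus>\<^bsub>R\<^esub> \<one>\<^bsub>R\<^esub>) \<odot>\<^bsub>M\<^esub> x) = (\<ominus>\<^bsub>R\<^esub> \<one>\<^bsub>R\<^esub>) \<odot>\<^bsub>N\<^esub> f x"
    using assms(3,4) by (intro lin_hom_smult) auto
  then show ?thesis
    using lin_hom_closed[OF assms(3,4)] assms(4) by (simp add: M.smult_l_minus N.smult_l_minus)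
qed

lemma lin_hom_diff:
  assumes "module R M" "module R N" "f \<in> lin_hom R M N" "x \<in> carrier M" "y \<in> carrier M"
  shows "f (x \<ominus>\<^bsub>M\<^esub> y) = f x \<ominus>\<^bsub>N\<^esub> f y"
proof -
  interpret M: module R M by fact
  show ?thesis
    using assms by (simp add: a_minus_def lin_hom_add[OF assms(3)] lin_hom_inv[OF assms(1-3)])
qed

lemma lin_hom_comp:
  "f \<in> lin_hom R M N \<Longrightarrow> g \<in> lin_hom R N P \<Longrightarrow> (\<lambda>x. g (f x)) \<in> lin_hom R M P"
  by (auto simp: lin_hom_def Pi_def)

lemma lin_hom_restrict: "f \<in> lin_hom R M N \<Longrightarrow> Z \<subseteq> carrier M \<Longrightarrow> f \<in> lin_hom R (M\<lparr>carrier := Z\<rparr>) N"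
  by (auto simp: lin_hom_def Pi_def subset_iff)

lemma lin_hom_corestrict:
  "f \<in> lin_hom R M N \<Longrightarrow> f ` carrier M \<subseteq> W \<Longrightarrow> f \<in> lin_hom R M (N\<lparr>carrier := W\<rparr>)"
  by (auto simp: lin_hom_def Pi_def)

lemma submodule_subset: "submodule N R M \<Longrightarrow> N \<subseteq> carrier M"
  using subgroup.subset[of N "add_monoid M"] by (auto simp: submodule_def)

lemma submodule_add: "submodule N R M \<Longrightarrow> x \<in> N \<Longrightarrow> y \<in> N \<Longrightarrow> x \<oplus>\<^bsub>M\<^esub> y \<in> N"
  using subgroup.m_closed[of N "add_monoid M"] by (auto simp: submodule_def)

lemma submodule_zero: "submodule N R M \<Longrightarrow> \<zero>\<^bsub>M\<^esub> \<in> N"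
  using subgroup.one_closed[of N "add_monoid M"] by (auto simp: submodule_def)

lemma submodule_inv: "submodule N R M \<Longrightarrow> x \<in> N \<Longrightarrow> \<ominus>\<^bsub>M\<^esub> x \<in> N"
  using subgroup.m_inv_closed[of N "add_monoid M"] by (auto simp: submodule_def a_inv_def)

lemma submodule_diff: "submodule N R M \<Longrightarrow> x \<in> N \<Longrightarrow> y \<in> N \<Longrightarrow> x \<ominus>\<^bsub>M\<^esub> y \<in> N"
  unfolding a_minus_def by (intro submodule_add submodule_inv)

lemma submodule_smult: "submodule N R M \<Longrightarrow> a \<in> carrier R \<Longrightarrow> x \<in> N \<Longrightarrow> a \<odot>\<^bsub>M\<^esub> x \<in> N"
  by (rule submodule.smult_closed)

lemma submodule_image:
  assumes "module R M" "module R N" "f \<in> lin_hom R M N" "submodule Z R M"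
  shows "submodule (f ` Z) R N"
proof -
  interpret M: module R M by fact
  interpret N: module R N by fact
  note sub = submodule_subset[OF assms(4)]
  show ?thesis
  proof (rule N.submoduleI)
    show "f ` Z \<subseteq> carrier N" using sub lin_hom_closed[OF assms(3)] by auto
    show "\<zero>\<^bsub>N\<^esub> \<in> f ` Z"
      using submodule_zero[OF assms(4)] lin_hom_zero[OF assms(1-3)] by (metis imageI)
    show "\<ominus>\<^bsub>N\<^esub> a \<in> f ` Z" if "a \<in> f ` Z" for a
      using that sub submodule_inv[OF assms(4)] lin_hom_inv[OF assms(1-3)]
      by (smt (verit) imageE imageI subsetD)
    show "a \<oplus>\<^bsub>N\<^esub> b \<in> f ` Z" if "a \<in> f ` Z" "b \<in> f ` Z" for a b
      using that sub submodule_add[OF assms(4)] lin_hom_add[OF assms(3)]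
      by (smt (verit) imageE imageI subsetD)
    show "a \<odot>\<^bsub>N\<^esub> x \<in> f ` Z" if "a \<in> carrier R" "x \<in> f ` Z" for a x
      using that sub submodule_smult[OF assms(4)] lin_hom_smult[OF assms(3)]
      by (smt (verit) imageE imageI subsetD)
  qed
qed

lemma submodule_vimage:
  assumes "module R M" "module R N" "f \<in> lin_hom R M N" "submodule W R N" "submodule Z R M"
  shows "submodule {x \<in> Z. f x \<in> W} R M"
proof -
  interpret M: module R M by fact
  interpret N: module R N by fact
  have Z: "x \<in> carrier M" if "x \<in> Z" for x
    using submodule_subset[OF assms(5)] that by auto
  show ?thesis
    by (rule M.submoduleI)
      (auto simp: lin_hom_zero[OF assms(1-3)] lin_hom_inv[OF assms(1-3)] lin_hom_add[OF assms(3)]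
        lin_hom_smult[OF assms(3)] Z intro: submodule_zero submodule_inv submodule_add submodule_smult
        assms(4,5))
qed

lemma submodule_zero_set: "module R M \<Longrightarrow> submodule {\<zero>\<^bsub>M\<^esub>} R M"
proof -
  assume "module R M"
  then interpret M: module R M .
  show ?thesis by (rule M.submoduleI) auto
qed

lemma submodule_carrier: "module R M \<Longrightarrow> submodule (carrier M) R M"
  by (rule module.carrier_is_submodule)

lemma submodule_restrict:
  assumes "module R M" "submodule Z R M" "submodule B R M" "B \<subseteq> Z"
  shows "submodule B R (M\<lparr>carrier := Z\<rparr>)"
proof -
  interpret M: module R M by fact
  have "module R (M\<lparr>carrier := Z\<rparr>)"
    by (rule submodule.submodule_is_module[OF assms(2,1)])
  moreover have "module R (M\<lparr>carrier := B\<rparr>)"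
    by (rule submodule.submodule_is_module[OF assms(3,1)])
  ultimately show ?thesis
    using assms(4) module.module_incl_imp_submodule[of R "M\<lparr>carrier := Z\<rparr>" B] by simp
qed

text \<open>\<open>P\<close> is only a record here; its axioms are pulled back through
  representatives, so quotient modules need no computation with cosets. As \<open>P\<close> is not
  yet known to be a group, preservation of zero is a separate assumption.\<close>

lemma module_image:
  assumes "module R M" "f \<in> lin_hom R M P" "f ` carrier M = carrier P" "f \<zero>\<^bsub>M\<^esub> = \<zero>\<^bsub>P\<^esub>"
  shows "module R P"
proof -
  interpret M: module R M by fact
  have repr: "\<exists>x. x \<in> carrier M \<and> U = f x" if "U \<in> carrier P" for U
    using that assms(3) by auto
  note [simp] = lin_hom_add[OF assms(2), symmetric] lin_hom_smult[OF assms(2), symmetric]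
    assms(4)[symmetric] lin_hom_closed[OF assms(2)]
  show ?thesis
  proof (rule moduleI)
    show "cring R" by unfold_locales
    show "abelian_group P"
    proof (rule abelian_groupI)
      show "\<zero>\<^bsub>P\<^esub> \<in> carrier P" by simp
    next
      fix U V assume "U \<in> carrier P" "V \<in> carrier P"
      then obtain x y where "x \<in> carrier M" "U = f x" "y \<in> carrier M" "V = f y"
        by (metis repr)
      then show "U \<oplus>\<^bsub>P\<^esub> V \<in> carrier P" "U \<oplus>\<^bsub>P\<^esub> V = V \<oplus>\<^bsub>P\<^esub> U"
        by (simp_all add: M.a_comm)
    next
      fix U V W assume "U \<in> carrier P" "V \<in> carrier P" "W \<in> carrier P"
      then obtain x y z where "x \<in> carrier M" "U = f x" "y \<in> carrier M" "V = f y"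
        "z \<in> carrier M" "W = f z"
        by (metis repr)
      then show "U \<oplus>\<^bsub>P\<^esub> V \<oplus>\<^bsub>P\<^esub> W = U \<oplus>\<^bsub>P\<^esub> (V \<oplus>\<^bsub>P\<^esub> W)"
        by (simp add: M.a_assoc)
    next
      fix U assume "U \<in> carrier P"
      then obtain x where "x \<in> carrier M" "U = f x" by (metis repr)
      then show "\<zero>\<^bsub>P\<^esub> \<oplus>\<^bsub>P\<^esub> U = U" "\<exists>V\<in>carrier P. V \<oplus>\<^bsub>P\<^esub> U = \<zero>\<^bsub>P\<^esub>"
        by (auto simp: M.l_neg intro!: bexI[of _ "f (\<ominus>\<^bsub>M\<^esub> x)"])
    qed
  next
    fix a U assume "a \<in> carrier R" "U \<in> carrier P"
    then show "a \<odot>\<^bsub>P\<^esub> U \<in> carrier P"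
      using repr[of U] by auto
  next
    fix U assume "U \<in> carrier P"
    then show "\<one>\<^bsub>R\<^esub> \<odot>\<^bsub>P\<^esub> U = U"
      using repr[of U] by auto
  next
    fix a b U assume "a \<in> carrier R" "b \<in> carrier R" "U \<in> carrier P"
    then show "(a \<oplus>\<^bsub>R\<^esub> b) \<odot>\<^bsub>P\<^esub> U = a \<odot>\<^bsub>P\<^esub> U \<oplus>\<^bsub>P\<^esub> b \<odot>\<^bsub>P\<^esub> U"
      "(a \<otimes>\<^bsub>R\<^esub> b) \<odot>\<^bsub>P\<^esub> U = a \<odot>\<^bsub>P\<^esub> (b \<odot>\<^bsub>P\<^esub> U)"
      using repr[of U] by (auto simp: M.smult_l_distr M.smult_assoc1)
  next
    fix a U V assume "a \<in> carrier R" "U \<in> carrier P" "V \<in> carrier P"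
    then show "a \<odot>\<^bsub>P\<^esub> (U \<oplus>\<^bsub>P\<^esub> V) = a \<odot>\<^bsub>P\<^esub> U \<oplus>\<^bsub>P\<^esub> a \<odot>\<^bsub>P\<^esub> V"
      using repr[of U] repr[of V] by (auto simp: M.smult_r_distr)
  qed
qed

section \<open>Cosets and quotient modules\<close>

lemma coset_mem: "x \<in> B +>\<^bsub>M\<^esub> y \<longleftrightarrow> (\<exists>b\<in>B. x = b \<oplus>\<^bsub>M\<^esub> y)"
  by (auto simp: a_r_coset_def r_coset_def)

lemma coset_restrict [simp]: "B +>\<^bsub>M\<lparr>carrier := Z\<rparr>\<^esub> x = B +>\<^bsub>M\<^esub> x"
  by (auto simp: coset_mem)

lemma submodule_abelian_subgroup: "module R M \<Longrightarrow> submodule B R M \<Longrightarrow> abelian_subgroup B M"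
  by (intro abelian_subgroupI3 additive_subgroup.intro)
    (auto simp: submodule_def module_def)

lemma coset_eq_iff:
  assumes "module R M" "submodule B R M" "x \<in> carrier M" "y \<in> carrier M"
  shows "B +>\<^bsub>M\<^esub> x = B +>\<^bsub>M\<^esub> y \<longleftrightarrow> x \<ominus>\<^bsub>M\<^esub> y \<in> B"
proof -
  interpret M: module R M by fact
  interpret B: abelian_subgroup B M using assms by (intro submodule_abelian_subgroup)
  have "x \<in> B +>\<^bsub>M\<^esub> y \<longleftrightarrow> x \<ominus>\<^bsub>M\<^esub> y \<in> B"
    using assms B.a_rcos_module by (simp add: a_minus_def)
  then show ?thesis
    using B.a_repr_independence'[of x y] B.a_rcos_self[of x] assms(3,4)
      B.a_repr_independence'[of y x] by auto
qed

lemma coset_eq_self_iff: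
  assumes "module R M" "submodule B R M" "x \<in> carrier M"
  shows "B +>\<^bsub>M\<^esub> x = B \<longleftrightarrow> x \<in> B"
proof -
  interpret M: module R M by fact
  have "B +>\<^bsub>M\<^esub> \<zero>\<^bsub>M\<^esub> = B"
    using submodule_subset[OF assms(2)] by (auto simp: coset_mem subset_iff)
  moreover have "x \<ominus>\<^bsub>M\<^esub> \<zero>\<^bsub>M\<^esub> = x"
    by (rule minus_zero_right[OF M.abelian_group_axioms assms(3)])
  ultimately show ?thesis
    using coset_eq_iff[OF assms, of "\<zero>\<^bsub>M\<^esub>"] by simp
qed

lemma quot_mod_simps:
  "carrier (quot_mod M B) = (\<lambda>x. B +>\<^bsub>M\<^esub> x) ` carrier M"
  "\<zero>\<^bsub>quot_mod M B\<^esub> = B"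
  by (auto simp: quot_mod_def A_RCOSETS_def RCOSETS_def a_r_coset_def)

lemma quot_mod_hom:
  assumes "module R M" "submodule B R M"
  shows "(\<lambda>x. B +>\<^bsub>M\<^esub> x) \<in> lin_hom R M (quot_mod M B)"
proof -
  interpret M: module R M by fact
  interpret B: abelian_subgroup B M using assms by (intro submodule_abelian_subgroup)
  have B: "b \<in> carrier M" if "b \<in> B" for b using submodule_subset[OF assms(2)] that by auto
  show ?thesis
  proof (rule lin_homI)
    fix x y assume "x \<in> carrier M" "y \<in> carrier M"
    then show "B +>\<^bsub>M\<^esub> (x \<oplus>\<^bsub>M\<^esub> y) = (B +>\<^bsub>M\<^esub> x) \<oplus>\<^bsub>quot_mod M B\<^esub> (B +>\<^bsub>M\<^esub> y)"
      by (simp add: quot_mod_def B.a_rcos_sum)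
  next
    fix a x assume a: "a \<in> carrier R" and x: "x \<in> carrier M"
    \<comment> \<open>Scalar multiplication in \<open>quot_mod\<close> is a union over all
      representatives; it is a single coset because every representative contributes the same
      one.\<close>
    have "B +>\<^bsub>M\<^esub> (a \<odot>\<^bsub>M\<^esub> y) = B +>\<^bsub>M\<^esub> (a \<odot>\<^bsub>M\<^esub> x)" if y: "y \<in> B +>\<^bsub>M\<^esub> x" for y
    proof -
      obtain b where b: "b \<in> B" "y = b \<oplus>\<^bsub>M\<^esub> x" using y by (auto simp: coset_mem)
      have "a \<odot>\<^bsub>M\<^esub> y \<ominus>\<^bsub>M\<^esub> a \<odot>\<^bsub>M\<^esub> x = a \<odot>\<^bsub>M\<^esub> b"
        using a x b B by (simp add: M.smult_r_distr a_minus_def M.a_assoc M.r_neg)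
      then show ?thesis
        using a x b B submodule_smult[OF assms(2) a b(1)] by (subst coset_eq_iff[OF assms]) auto
    qed
    moreover have "x \<in> B +>\<^bsub>M\<^esub> x" using x B.a_rcos_self by simp
    ultimately show "B +>\<^bsub>M\<^esub> (a \<odot>\<^bsub>M\<^esub> x) = a \<odot>\<^bsub>quot_mod M B\<^esub> (B +>\<^bsub>M\<^esub> x)"
    proof -
      assume const: "\<And>y. y \<in> B +>\<^bsub>M\<^esub> x \<Longrightarrow> B +>\<^bsub>M\<^esub> (a \<odot>\<^bsub>M\<^esub> y) = B +>\<^bsub>M\<^esub> (a \<odot>\<^bsub>M\<^esub> x)"
        and "x \<in> B +>\<^bsub>M\<^esub> x"
      then have "(\<Union>y\<in>B +>\<^bsub>M\<^esub> x. B +>\<^bsub>M\<^esub> (a \<odot>\<^bsub>M\<^esub> y)) = B +>\<^bsub>M\<^esub> (a \<odot>\<^bsub>M\<^esub> x)"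
        by blast
      then show ?thesis by (simp add: quot_mod_def)
    qed
  qed (simp add: quot_mod_simps)
qed

lemma quot_mod_module:
  assumes "module R M" "submodule B R M"
  shows "module R (quot_mod M B)"
proof (rule module_image[OF assms(1) quot_mod_hom[OF assms]])
  interpret M: module R M by fact
  show "B +>\<^bsub>M\<^esub> \<zero>\<^bsub>M\<^esub> = \<zero>\<^bsub>quot_mod M B\<^esub>"
    using coset_eq_self_iff[OF assms, of "\<zero>\<^bsub>M\<^esub>"] submodule_zero[OF assms(2)]
    by (simp add: quot_mod_simps)
qed (simp add: quot_mod_simps)

text \<open>
  The map sending \<open>f x\<close> to \<open>g x\<close>; meaningful if the kernel of \<open>f\<close> is contained in that of \<open>g\<close>.
\<close>

definition induced_map :: "('r,'m) module \<Rightarrow> ('m \<Rightarrow> 'p) \<Rightarrow> ('m \<Rightarrow> 'q) \<Rightarrow> 'p \<Rightarrow> 'q" where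
  "induced_map M f g U = g (SOME x. x \<in> carrier M \<and> f x = U)"

lemma induced_map_eq:
  assumes "module R M" "module R P" "module R Q" "f \<in> lin_hom R M P" "g \<in> lin_hom R M Q"
    and ker: "\<And>x. x \<in> carrier M \<Longrightarrow> f x = \<zero>\<^bsub>P\<^esub> \<Longrightarrow> g x = \<zero>\<^bsub>Q\<^esub>"
    and x: "x \<in> carrier M"
  shows "induced_map M f g (f x) = g x"
proof -
  interpret M: module R M by fact
  interpret P: module R P by fact
  interpret Q: module R Q by fact
  define y where "y = (SOME y. y \<in> carrier M \<and> f y = f x)"
  have y: "y \<in> carrier M" "f y = f x"
    using someI[of "\<lambda>y. y \<in> carrier M \<and> f y = f x" x] x by (auto simp: y_def)
  note cl = lin_hom_closed[OF assms(4)] lin_hom_closed[OF assms(5)]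
  have "f (y \<ominus>\<^bsub>M\<^esub> x) = \<zero>\<^bsub>P\<^esub>"
    using x y cl by (simp add: lin_hom_diff[OF assms(1,2,4)] minus_eq_zero_iff[OF P.abelian_group_axioms])
  then have "g y \<ominus>\<^bsub>Q\<^esub> g x = \<zero>\<^bsub>Q\<^esub>"
    using ker[of "y \<ominus>\<^bsub>M\<^esub> x"] x y by (simp add: lin_hom_diff[OF assms(1,3,5)])
  then show ?thesis
    using x y cl by (simp add: induced_map_def y_def[symmetric] minus_eq_zero_iff[OF Q.abelian_group_axioms])
qed

lemma induced_map_hom:
  assumes "module R M" "module R P" "module R Q" "f \<in> lin_hom R M P" "g \<in> lin_hom R M Q"
    and "\<And>x. x \<in> carrier M \<Longrightarrow> f x = \<zero>\<^bsub>P\<^esub> \<Longrightarrow> g x = \<zero>\<^bsub>Q\<^esub>"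
    and surj: "f ` carrier M = carrier P"
  shows "induced_map M f g \<in> lin_hom R P Q"
proof -
  interpret M: module R M by fact
  note eq = induced_map_eq[OF assms(1-6)]
  have repr: "\<exists>x. x \<in> carrier M \<and> U = f x" if "U \<in> carrier P" for U
    using that surj by auto
  note [simp] = lin_hom_add[OF assms(4), symmetric] lin_hom_smult[OF assms(4), symmetric]
    lin_hom_closed[OF assms(4)] lin_hom_closed[OF assms(5)] eq
  show ?thesis
  proof (rule lin_homI)
    fix U V assume "U \<in> carrier P" "V \<in> carrier P"
    then show "induced_map M f g (U \<oplus>\<^bsub>P\<^esub> V) = induced_map M f g U \<oplus>\<^bsub>Q\<^esub> induced_map M f g V"
      using repr[of U] repr[of V] by (auto simp: lin_hom_add[OF assms(5)])
  next
    fix a U assume "a \<in> carrier R" "U \<in> carrier P"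
    then show "induced_map M f g (a \<odot>\<^bsub>P\<^esub> U) = a \<odot>\<^bsub>Q\<^esub> induced_map M f g U"
      using repr[of U] by (auto simp: lin_hom_smult[OF assms(5)])
  next
    fix U assume "U \<in> carrier P"
    then show "induced_map M f g U \<in> carrier Q"
      using repr[of U] by auto
  qed
qed

text \<open>Two surjections from one module with the same kernel have isomorphic targets, the
  inverse being induced with the roles exchanged. The isomorphisms of the spectral sequence are
  obtained in this way, which leaves only kernels and images to compute.\<close>

lemma lin_isomorphicI:
  assumes "module R M" "module R P" "module R Q" "f \<in> lin_hom R M P" "g \<in> lin_hom R M Q"
    and ker: "\<And>x. x \<in> carrier M \<Longrightarrow> f x = \<zero>\<^bsub>P\<^esub> \<longleftrightarrow> g x = \<zero>\<^bsub>Q\<^esub>"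
    and "f ` carrier M = carrier P" "g ` carrier M = carrier Q"
  shows "lin_isomorphic R P Q"
proof -
  have h: "induced_map M f g \<in> lin_hom R P Q"
    using assms by (intro induced_map_hom) auto
  have 1: "induced_map M f g (f x) = g x" if "x \<in> carrier M" for x
    using assms that by (intro induced_map_eq) auto
  have 2: "induced_map M g f (g x) = f x" if "x \<in> carrier M" for x
    using assms that by (intro induced_map_eq[where P = Q and Q = P]) auto
  have "bij_betw (induced_map M f g) (carrier P) (carrier Q)"
  proof (rule bij_betw_byWitness[where f' = "induced_map M g f"])
    show "\<forall>U\<in>carrier P. induced_map M g f (induced_map M f g U) = U"
      "\<forall>U\<in>carrier Q. induced_map M f g (induced_map M g f U) = U"
      using assms(7,8) by (auto simp flip: assms(7,8) simp: 1 2)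
    show "induced_map M f g ` carrier P \<subseteq> carrier Q" "induced_map M g f ` carrier Q \<subseteq> carrier P"
      using lin_hom_closed[OF assms(4)] lin_hom_closed[OF assms(5)]
      by (auto simp flip: assms(7,8) simp: 1 2)
  qed
  with h show ?thesis by (auto simp: lin_isomorphic_def)
qed


section \<open>The spectral sequence of a filtered complex\<close>

text \<open>
  A decreasing filtration of the complex \<open>V\<close> is described by maps \<open>\<sigma> s\<close> to the graded pieces: the
  \<open>s\<close>-th stage consists of the common zeros of the \<open>\<sigma> j\<close>, \<open>j < s\<close>.
\<close>

locale filtered_complex =
  fixes R :: "('r,'s) ring_scheme"
    and V :: "int \<Rightarrow> ('r,'x) module" and C :: "int \<Rightarrow> ('r,'y) module"
    and D :: "'x \<Rightarrow> 'x" and \<sigma> :: "int \<Rightarrow> 'x \<Rightarrow> 'y" and L :: nat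
  assumes V_module: "module R (V q)"
    and C_module: "module R (C q)"
    and D_hom: "D \<in> lin_hom R (V q) (V (q - 1))"
    and D_D: "x \<in> carrier (V q) \<Longrightarrow> D (D x) = \<zero>\<^bsub>V (q - 2)\<^esub>"
    and \<sigma>_hom: "\<sigma> s \<in> lin_hom R (V q) (C q)"
    and \<sigma>_low: "s < 0 \<Longrightarrow> x \<in> carrier (V q) \<Longrightarrow> \<sigma> s x = \<zero>\<^bsub>C q\<^esub>"
    and \<sigma>_high: "int L \<le> s \<Longrightarrow> x \<in> carrier (V q) \<Longrightarrow> \<sigma> s x = \<zero>\<^bsub>C q\<^esub>"
    and \<sigma>_sep: "x \<in> carrier (V q) \<Longrightarrow> (\<And>s. \<sigma> s x = \<zero>\<^bsub>C q\<^esub>) \<Longrightarrow> x = \<zero>\<^bsub>V q\<^esub>"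
    and D_filtered: "x \<in> carrier (V q) \<Longrightarrow> (\<And>j. j < s \<Longrightarrow> \<sigma> j x = \<zero>\<^bsub>C q\<^esub>) \<Longrightarrow> j < s \<Longrightarrow>
      \<sigma> j (D x) = \<zero>\<^bsub>C (q - 1)\<^esub>"
    and V_negative: "q < 0 \<Longrightarrow> carrier (V q) = {\<zero>\<^bsub>V q\<^esub>}"
    and L_pos: "1 \<le> L"
begin

section \<open>Approximate cycles and the pages\<close>

definition F :: "int \<Rightarrow> int \<Rightarrow> 'x set" where
  "F s q = {x \<in> carrier (V q). \<forall>j<s. \<sigma> j x = \<zero>\<^bsub>C q\<^esub>}"

text \<open>The classical r-cycles Z^r: their boundary lies \<open>r\<close> steps deeper in the
  filtration.\<close>

definition A :: "int \<Rightarrow> int \<Rightarrow> int \<Rightarrow> 'x set" where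
  "A r s q = {x \<in> F s q. D x \<in> F (s + r) (q - 1)}"

definition AV :: "int \<Rightarrow> int \<Rightarrow> int \<Rightarrow> ('r,'x) module" where
  "AV r s q = (V q)\<lparr>carrier := A r s q\<rparr>"

definition page_cycles :: "int \<Rightarrow> int \<Rightarrow> int \<Rightarrow> 'y set" where
  "page_cycles r s q = \<sigma> s ` A r s q"

definition page_boundaries :: "int \<Rightarrow> int \<Rightarrow> int \<Rightarrow> 'y set" where
  "page_boundaries r s q = (\<lambda>x. \<sigma> s (D x)) ` A (r - 1) (s - r + 1) (q + 1)"

text \<open>The usual quotient of Z^r_s by Z^(r-1)_(s+1) and boundaries, carried by
  \<open>\<sigma> s\<close> into the graded piece: the kernel of \<open>\<sigma> s\<close> on
  \<open>A r s q\<close> is \<open>A (r - 1) (s + 1) q\<close>. This form keeps one element type for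
  all pages and makes the first page literally the homology of a graded piece.\<close>

definition page :: "int \<Rightarrow> int \<Rightarrow> int \<Rightarrow> ('r,'y set) module" where
  "page r s q = quot_mod ((C q)\<lparr>carrier := page_cycles r s q\<rparr>) (page_boundaries r s q)"

definition page_class :: "int \<Rightarrow> int \<Rightarrow> int \<Rightarrow> 'x \<Rightarrow> 'y set" where
  "page_class r s q x = page_boundaries r s q +>\<^bsub>C q\<^esub> \<sigma> s x"

definition page_diff :: "int \<Rightarrow> int \<Rightarrow> int \<Rightarrow> 'y set \<Rightarrow> 'y set" where
  "page_diff r s q =
     induced_map (AV r s q) (page_class r s q) (\<lambda>x. page_class r (s + r) (q - 1) (D x))"

lemmas \<sigma>_zero = lin_hom_zero[OF V_module C_module \<sigma>_hom]
lemmas \<sigma>_inv = lin_hom_inv[OF V_module C_module \<sigma>_hom]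
lemmas \<sigma>_diff = lin_hom_diff[OF V_module C_module \<sigma>_hom]
lemmas D_diff = lin_hom_diff[OF V_module V_module D_hom]
lemmas D_add = lin_hom_add[OF D_hom]
lemmas D_closed = lin_hom_closed[OF D_hom]
lemmas \<sigma>_add = lin_hom_add[OF \<sigma>_hom]
lemmas \<sigma>_closed = lin_hom_closed[OF \<sigma>_hom]

lemma F_sub: "submodule (F s q) R (V q)"
proof -
  interpret V: module R "V q" by (rule V_module)
  interpret C: module R "C q" by (rule C_module)
  have "\<ominus>\<^bsub>C q\<^esub> \<zero>\<^bsub>C q\<^esub> = \<zero>\<^bsub>C q\<^esub>" by (rule C.minus_equality) auto
  then show ?thesis
    by (intro V.submoduleI)
      (auto simp: F_def \<sigma>_zero \<sigma>_inv \<sigma>_add lin_hom_smult[OF \<sigma>_hom] C.smult_r_null)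
qed

lemma F_carrier: "x \<in> F s q \<Longrightarrow> x \<in> carrier (V q)"
  by (simp add: F_def)

lemma F_mono: "s \<le> s' \<Longrightarrow> x \<in> F s' q \<Longrightarrow> x \<in> F s q"
  by (simp add: F_def)

lemma F_SucI: "x \<in> F s q \<Longrightarrow> \<sigma> s x = \<zero>\<^bsub>C q\<^esub> \<Longrightarrow> x \<in> F (s + 1) q"
  using zless_add1_eq by (auto simp: F_def)

lemma F_SucD: "x \<in> F (s + 1) q \<Longrightarrow> \<sigma> s x = \<zero>\<^bsub>C q\<^esub>"
  by (simp add: F_def)

lemma F_low: "s \<le> 0 \<Longrightarrow> F s q = carrier (V q)"
  by (auto simp: F_def \<sigma>_low)

lemma F_high:
  assumes "int L \<le> s" shows "F s q = {\<zero>\<^bsub>V q\<^esub>}"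
proof -
  have "x = \<zero>\<^bsub>V q\<^esub>" if "x \<in> F s q" for x
  proof (rule \<sigma>_sep)
    show "x \<in> carrier (V q)" using that by (simp add: F_def)
    then show "\<sigma> j x = \<zero>\<^bsub>C q\<^esub>" for j
      using that assms \<sigma>_high[of j x q] by (cases "j < s") (auto simp: F_def)
  qed
  then show ?thesis
    using submodule_zero[OF F_sub] by blast
qed

lemma D_F: "x \<in> F s q \<Longrightarrow> D x \<in> F s (q - 1)"
  using D_filtered[of x q s] D_closed[of x q] by (auto simp: F_def)

lemma A_sub: "submodule (A r s q) R (V q)"
  unfolding A_def by (rule submodule_vimage[OF V_module V_module D_hom F_sub F_sub])

lemma AV_module: "module R (AV r s q)"
  unfolding AV_def by (rule submodule.submodule_is_module[OF A_sub V_module])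

lemma A_F: "x \<in> A r s q \<Longrightarrow> x \<in> F s q"
  by (simp add: A_def)

lemma A_carrier: "x \<in> A r s q \<Longrightarrow> x \<in> carrier (V q)"
  by (simp add: A_def F_def)

lemma A_D: "x \<in> A r s q \<Longrightarrow> D x \<in> F (s + r) (q - 1)"
  by (simp add: A_def)

lemma AI: "x \<in> F s q \<Longrightarrow> D x \<in> F (s + r) (q - 1) \<Longrightarrow> x \<in> A r s q"
  by (simp add: A_def)

lemma D_D_F: "x \<in> carrier (V q) \<Longrightarrow> D (D x) \<in> F s (q - 2)"
  using D_D submodule_zero[OF F_sub] by simp

lemma A_D_A: "x \<in> A r s q \<Longrightarrow> s' = s + r \<Longrightarrow> q' = q - 1 \<Longrightarrow> D x \<in> A r' s' q'"
  using D_D_F[OF A_carrier, of x r s q "s' + r'"] by (simp add: A_def)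

lemma page_cycles_sub: "submodule (page_cycles r s q) R (C q)"
  unfolding page_cycles_def by (rule submodule_image[OF V_module C_module \<sigma>_hom A_sub])

lemma page_boundaries_sub: "submodule (page_boundaries r s q) R (C q)"
proof -
  have "D \<in> lin_hom R (V (q + 1)) (V q)" using D_hom[of "q + 1"] by simp
  then show ?thesis
    unfolding page_boundaries_def
    by (rule submodule_image[OF V_module C_module lin_hom_comp[OF _ \<sigma>_hom] A_sub])
qed

lemma page_boundaries_cycles: "page_boundaries r s q \<subseteq> page_cycles r s q"
  unfolding page_boundaries_def page_cycles_def
  using A_D_A[of _ "r - 1" "s - r + 1" "q + 1" s q r] by fastforce

lemma page_cycles_module: "module R ((C q)\<lparr>carrier := page_cycles r s q\<rparr>)"
  by (rule submodule.submodule_is_module[OF page_cycles_sub C_module])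

lemma page_boundaries_sub': "submodule (page_boundaries r s q) R ((C q)\<lparr>carrier := page_cycles r s q\<rparr>)"
  by (rule submodule_restrict[OF C_module page_cycles_sub page_boundaries_sub page_boundaries_cycles])

lemma page_module: "module R (page r s q)"
  unfolding page_def by (rule quot_mod_module[OF page_cycles_module page_boundaries_sub'])

lemma page_zero: "\<zero>\<^bsub>page r s q\<^esub> = page_boundaries r s q"
  by (simp add: page_def quot_mod_simps)

lemma page_class_hom: "page_class r s q \<in> lin_hom R (AV r s q) (page r s q)"
proof -
  have "\<sigma> s \<in> lin_hom R (AV r s q) ((C q)\<lparr>carrier := page_cycles r s q\<rparr>)"
    unfolding AV_def
    by (intro lin_hom_corestrict lin_hom_restrict[OF \<sigma>_hom]) (auto simp: A_carrier page_cycles_def)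
  from lin_hom_comp[OF this quot_mod_hom[OF page_cycles_module page_boundaries_sub']]
  show ?thesis by (simp add: page_class_def[abs_def] page_def)
qed

lemma page_class_surj: "page_class r s q ` A r s q = carrier (page r s q)"
  by (auto simp: page_def quot_mod_simps page_class_def page_cycles_def)

lemma page_class_eq_zero_iff:
  "x \<in> A r s q \<Longrightarrow> page_class r s q x = \<zero>\<^bsub>page r s q\<^esub> \<longleftrightarrow> \<sigma> s x \<in> page_boundaries r s q"
  by (simp add: page_class_def page_zero coset_eq_self_iff[OF C_module page_boundaries_sub]
      \<sigma>_closed A_carrier)

lemma page_class_eq_zeroI:
  "x \<in> A r s q \<Longrightarrow> \<sigma> s x = \<zero>\<^bsub>C q\<^esub> \<Longrightarrow> page_class r s q x = \<zero>\<^bsub>page r s q\<^esub>"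
  using page_class_eq_zero_iff submodule_zero[OF page_boundaries_sub] by metis

lemma page_class_eq_iff:
  "x \<in> A r s q \<Longrightarrow> y \<in> A r s q \<Longrightarrow>
     page_class r s q x = page_class r s q y \<longleftrightarrow> \<sigma> s (x \<ominus>\<^bsub>V q\<^esub> y) \<in> page_boundaries r s q"
  by (simp add: page_class_def coset_eq_iff[OF C_module page_boundaries_sub]
      \<sigma>_closed A_carrier \<sigma>_diff)

lemma D_AV_hom:
  "s' = s + r \<Longrightarrow> q' = q - 1 \<Longrightarrow> D \<in> lin_hom R (AV r s q) (AV r' s' q')"
  unfolding AV_def using A_D_A[of _ r s q s' q' r'] D_hom[of q]
  by (intro lin_hom_corestrict lin_hom_restrict) (auto simp: A_carrier)

lemma page_class_D_hom:
  "(\<lambda>x. page_class r (s + r) (q - 1) (D x)) \<in> lin_hom R (AV r s q) (page r (s + r) (q - 1))"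
  by (rule lin_hom_comp[OF D_AV_hom page_class_hom]) auto

text \<open>
  If \<open>x\<close> and \<open>D y\<close> agree to leading order, then \<open>x\<close> may be replaced by \<open>x - D y\<close>, which lies one
  filtration step deeper and has the same boundary.
\<close>

lemma page_class_D_eq_zero:
  assumes x: "x \<in> A r s q" and zero: "page_class r s q x = \<zero>\<^bsub>page r s q\<^esub>"
  shows "page_class r (s + r) (q - 1) (D x) = \<zero>\<^bsub>page r (s + r) (q - 1)\<^esub>"
proof -
  interpret V: module R "V q" by (rule V_module)
  interpret V1: module R "V (q - 1)" by (rule V_module)
  obtain y where y: "y \<in> A (r - 1) (s - r + 1) (q + 1)" "\<sigma> s x = \<sigma> s (D y)"
    using zero page_class_eq_zero_iff[OF x] by (auto simp: page_boundaries_def)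
  have Dy: "D y \<in> F s q" using A_D[OF y(1)] by simp
  define u where "u = x \<ominus>\<^bsub>V q\<^esub> D y"
  have xV: "x \<in> carrier (V q)" and yV: "D y \<in> carrier (V q)"
    using A_carrier[OF x] F_carrier[OF Dy] by auto
  have "D (D y) = \<zero>\<^bsub>V (q - 1)\<^esub>" using D_D[OF A_carrier[OF y(1)]] by simp
  then have Du: "D u = D x"
    using xV yV D_closed[OF xV] by (simp add: u_def D_diff minus_zero_right[OF V1.abelian_group_axioms])
  have "u \<in> F s q" unfolding u_def by (rule submodule_diff[OF F_sub A_F[OF x] Dy])
  moreover have "\<sigma> s u = \<zero>\<^bsub>C q\<^esub>"
    using xV yV y(2) \<sigma>_closed[OF yV, of s] module.axioms(2)[OF C_module]
    by (simp add: u_def \<sigma>_diff minus_eq_zero_iff)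
  ultimately have "u \<in> F (s + 1) q" by (rule F_SucI)
  then have "u \<in> A (r - 1) (s + 1) q"
    using A_D[OF x] Du by (intro AI) (auto simp: algebra_simps)
  then have "\<sigma> (s + r) (D x) \<in> page_boundaries r (s + r) (q - 1)"
    unfolding page_boundaries_def Du[symmetric] by (auto intro!: imageI simp: algebra_simps)
  then show ?thesis
    using page_class_eq_zero_iff[OF A_D_A[OF x refl refl]] by simp
qed

lemma page_diff_eq:
  "x \<in> A r s q \<Longrightarrow> page_diff r s q (page_class r s q x) = page_class r (s + r) (q - 1) (D x)"
  unfolding page_diff_def
  by (rule induced_map_eq[OF AV_module page_module page_module page_class_hom page_class_D_hom])
    (auto simp: AV_def page_class_D_eq_zero)

lemma page_diff_hom: "page_diff r s q \<in> lin_hom R (page r s q) (page r (s + r) (q - 1))"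
  unfolding page_diff_def
  by (rule induced_map_hom[OF AV_module page_module page_module page_class_hom page_class_D_hom])
    (auto simp: AV_def page_class_D_eq_zero page_class_surj)

text \<open>If the differential kills the class of \<open>x\<close>, then \<open>D x\<close> agrees
  to leading order with \<open>D y\<close> for some \<open>y\<close> one step deeper than
  \<open>x\<close>. Replacing \<open>x\<close> by \<open>x - y\<close> leaves the class unchanged
  and pushes the boundary one step further down.\<close>

lemma page_diff_kernel:
  "a_kernel (page r s q) (page r (s + r) (q - 1)) (page_diff r s q) = page_class r s q ` A (r + 1) s q"
proof (intro equalityI subsetI)
  fix u assume u: "u \<in> a_kernel (page r s q) (page r (s + r) (q - 1)) (page_diff r s q)"
  then obtain x where x: "x \<in> A r s q" "u = page_class r s q x"
    by (auto simp: a_kernel_def kernel_def page_class_surj[symmetric])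
  then have "page_class r (s + r) (q - 1) (D x) = \<zero>\<^bsub>page r (s + r) (q - 1)\<^esub>"
    using u by (simp add: a_kernel_def kernel_def page_diff_eq)
  then have "\<sigma> (s + r) (D x) \<in> page_boundaries r (s + r) (q - 1)"
    using page_class_eq_zero_iff[OF A_D_A[OF x(1) refl refl]] by simp
  \<comment> \<open>The indices of \<open>page_boundaries r (s + r) (q - 1)\<close> simplify to
    \<open>A (r - 1) (s + 1) q\<close>, so \<open>y\<close> has no component in filtration degree
    \<open>s\<close>.\<close>
  then obtain y where y: "y \<in> A (r - 1) (s + 1) q" "\<sigma> (s + r) (D x) = \<sigma> (s + r) (D y)"
    by (auto simp: page_boundaries_def algebra_simps)
  define v where "v = x \<ominus>\<^bsub>V q\<^esub> y"
  have xV: "x \<in> carrier (V q)" and yV: "y \<in> carrier (V q)"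
    using A_carrier x(1) y(1) by auto
  interpret V: module R "V q" by (rule V_module)
  interpret V1: module R "V (q - 1)" by (rule V_module)
  interpret C: module R "C q" by (rule C_module)
  have Dv: "D v = D x \<ominus>\<^bsub>V (q - 1)\<^esub> D y" using xV yV by (simp add: v_def D_diff)
  have yF: "y \<in> F s q" using A_F[OF y(1)] by (rule F_mono[rotated]) simp
  have "D y \<in> F (s + r) (q - 1)" using A_D[OF y(1)] by (simp add: algebra_simps)
  then have "D v \<in> F (s + r) (q - 1)"
    unfolding Dv by (rule submodule_diff[OF F_sub A_D[OF x(1)]])
  moreover have "\<sigma> (s + r) (D v) = \<zero>\<^bsub>C (q - 1)\<^esub>"
    using xV yV y(2) D_closed \<sigma>_closed module.axioms(2)[OF C_module]
    by (simp add: Dv \<sigma>_diff minus_eq_zero_iff)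
  ultimately have "D v \<in> F (s + r + 1) (q - 1)" by (rule F_SucI)
  moreover have "v \<in> F s q" unfolding v_def by (rule submodule_diff[OF F_sub A_F[OF x(1)] yF])
  ultimately have v: "v \<in> A (r + 1) s q" by (intro AI) (auto simp: algebra_simps)
  have "\<sigma> s y = \<zero>\<^bsub>C q\<^esub>" using A_F[OF y(1)] by (rule F_SucD)
  then have "\<sigma> s v = \<sigma> s x"
    using xV yV \<sigma>_closed[OF xV, of s]
    by (simp add: v_def \<sigma>_diff minus_zero_right[OF C.abelian_group_axioms])
  then show "u \<in> page_class r s q ` A (r + 1) s q"
    using v x(2) by (auto simp: page_class_def intro!: image_eqI[of _ _ v])
next
  fix u assume "u \<in> page_class r s q ` A (r + 1) s q"
  then obtain x where x: "x \<in> A (r + 1) s q" "u = page_class r s q x" by auto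
  have Dx: "D x \<in> F (s + r + 1) (q - 1)" using A_D[OF x(1)] by (simp add: algebra_simps)
  then have xA: "x \<in> A r s q" using A_F[OF x(1)] by (intro AI) (auto elim: F_mono[rotated])
  have "\<sigma> (s + r) (D x) = \<zero>\<^bsub>C (q - 1)\<^esub>" using Dx by (rule F_SucD)
  then have "page_class r (s + r) (q - 1) (D x) = \<zero>\<^bsub>page r (s + r) (q - 1)\<^esub>"
    using page_class_eq_zero_iff[OF A_D_A[OF xA refl refl]] submodule_zero[OF page_boundaries_sub]
    by simp
  then show "u \<in> a_kernel (page r s q) (page r (s + r) (q - 1)) (page_diff r s q)"
    using xA x(2) by (auto simp: a_kernel_def kernel_def page_diff_eq page_class_surj[symmetric])
qed

text \<open>Both sides are quotients of \<open>A (r + 1) s q\<close>, so their kernels are compared.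
  A boundary of page \<open>r\<close> comes from \<open>A (r - 1) (s - r + 1)\<close>, an element of
  the image of the differential from \<open>A r (s - r)\<close>. The former set is contained in the
  latter, so the two contributions add up to a single boundary of page \<open>r + 1\<close>.\<close>

lemma next_page:
  "lin_isomorphic R (page (r + 1) s q)
     (homology_at (page r (s - r) (q + 1)) (page_diff r (s - r) (q + 1))
        (page r s q) (page_diff r s q) (page r (s + r) (q - 1)))"
proof -
  define K where "K = (page r s q)\<lparr>carrier := page_class r s q ` A (r + 1) s q\<rparr>"
  define I where "I = page_diff r (s - r) (q + 1) ` carrier (page r (s - r) (q + 1))"
  have I: "I = (\<lambda>y. page_class r s q (D y)) ` A r (s - r) (q + 1)"
    unfolding I_def page_class_surj[symmetric] image_image using page_diff_eq[of _ r "s - r" "q + 1"]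
    by auto
  have H: "homology_at (page r (s - r) (q + 1)) (page_diff r (s - r) (q + 1))
        (page r s q) (page_diff r s q) (page r (s + r) (q - 1)) = quot_mod K I"
    unfolding homology_at_def page_diff_kernel K_def I_def ..
  have A1: "x \<in> A r s q" if "x \<in> A (r + 1) s q" for x
    using A_F[OF that] A_D[OF that] by (intro AI) (auto elim: F_mono[rotated])
  have DA: "D y \<in> A r' s q" if "y \<in> A r (s - r) (q + 1)" for y r'
    using A_D_A[OF that] by simp
  have Isub: "submodule I R (page r s q)"
    unfolding I_def using page_diff_hom[of r "s - r" "q + 1"]
    by (intro submodule_image[OF page_module page_module _ submodule_carrier[OF page_module]]) simp
  have AVsub: "submodule (A (r + 1) s q) R (AV r s q)"
    unfolding AV_def by (rule submodule_restrict[OF V_module A_sub A_sub]) (use A1 in auto)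
  have Ksub: "submodule (page_class r s q ` A (r + 1) s q) R (page r s q)"
    by (rule submodule_image[OF AV_module page_module page_class_hom AVsub])
  have IK: "I \<subseteq> page_class r s q ` A (r + 1) s q"
    unfolding I using DA by auto
  have Kmod: "module R K"
    unfolding K_def by (rule submodule.submodule_is_module[OF Ksub page_module])
  have IsubK: "submodule I R K"
    unfolding K_def by (rule submodule_restrict[OF page_module Ksub Isub IK])
  have cl: "page_class r s q \<in> lin_hom R (AV (r + 1) s q) K"
    unfolding K_def
    by (intro lin_hom_corestrict) (use page_class_hom[of r s q] A1 in \<open>auto simp: AV_def lin_hom_def\<close>)
  show ?thesis
    unfolding H
  proof (rule lin_isomorphicI[OF AV_module page_module quot_mod_module[OF Kmod IsubK] page_class_hom
        lin_hom_comp[OF cl quot_mod_hom[OF Kmod IsubK]]])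
    show "page_class (r + 1) s q ` carrier (AV (r + 1) s q) = carrier (page (r + 1) s q)"
      by (simp add: AV_def page_class_surj)
    show "(\<lambda>x. I +>\<^bsub>K\<^esub> page_class r s q x) ` carrier (AV (r + 1) s q) = carrier (quot_mod K I)"
      by (auto simp: quot_mod_simps AV_def K_def)
    fix x assume "x \<in> carrier (AV (r + 1) s q)"
    then have x: "x \<in> A (r + 1) s q" by (simp add: AV_def)
    then have xV: "x \<in> carrier (V q)" and xA: "x \<in> A r s q" using A_carrier A1 by auto
    have "I +>\<^bsub>K\<^esub> page_class r s q x = \<zero>\<^bsub>quot_mod K I\<^esub> \<longleftrightarrow> page_class r s q x \<in> I"
      using coset_eq_self_iff[OF page_module Isub lin_hom_closed[OF page_class_hom, of x r s q]] xA
      by (simp add: quot_mod_simps K_def AV_def)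
    also have "\<dots> \<longleftrightarrow> (\<exists>y\<in>A r (s - r) (q + 1). page_class r s q x = page_class r s q (D y))"
      by (auto simp: I)
    also have "\<dots> \<longleftrightarrow> (\<exists>y\<in>A r (s - r) (q + 1). \<sigma> s (x \<ominus>\<^bsub>V q\<^esub> D y) \<in> page_boundaries r s q)"
      using page_class_eq_iff[OF xA DA] by auto
    also have "\<dots> \<longleftrightarrow> \<sigma> s x \<in> page_boundaries (r + 1) s q"
    proof
      interpret C: module R "C q" by (rule C_module)
      interpret V1: module R "V (q + 1)" by (rule V_module)
      assume "\<exists>y\<in>A r (s - r) (q + 1). \<sigma> s (x \<ominus>\<^bsub>V q\<^esub> D y) \<in> page_boundaries r s q"
      then obtain y z where y: "y \<in> A r (s - r) (q + 1)" and z: "z \<in> A (r - 1) (s - r + 1) (q + 1)"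
        and e: "\<sigma> s (x \<ominus>\<^bsub>V q\<^esub> D y) = \<sigma> s (D z)"
        by (auto simp: page_boundaries_def)
      have zA: "z \<in> A r (s - r) (q + 1)"
        using A_F[OF z] A_D[OF z] by (intro AI) (auto elim: F_mono[rotated])
      have DyV: "D y \<in> carrier (V q)" and DzV: "D z \<in> carrier (V q)"
        using A_carrier[OF DA[OF y]] A_carrier[OF DA[OF zA]] by auto
      have "\<sigma> s x = \<sigma> s (D z) \<oplus>\<^bsub>C q\<^esub> \<sigma> s (D y)"
        using xV DyV \<sigma>_closed[of _ q s]
        by (simp add: e[symmetric] \<sigma>_diff minus_add_cancel[OF C.abelian_group_axioms])
      also have "\<dots> = \<sigma> s (D (z \<oplus>\<^bsub>V (q + 1)\<^esub> y))"
        using DyV DzV A_carrier[OF y] A_carrier[OF zA] D_add[of z "q + 1" y]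
        by (simp add: \<sigma>_add)
      finally show "\<sigma> s x \<in> page_boundaries (r + 1) s q"
        using submodule_add[OF A_sub zA y] by (auto simp: page_boundaries_def)
    next
      interpret C: module R "C q" by (rule C_module)
      assume "\<sigma> s x \<in> page_boundaries (r + 1) s q"
      then obtain y where y: "y \<in> A r (s - r) (q + 1)" and e: "\<sigma> s x = \<sigma> s (D y)"
        by (auto simp: page_boundaries_def)
      have "D y \<in> carrier (V q)" using A_carrier[OF DA[OF y]] .
      then have "\<sigma> s (x \<ominus>\<^bsub>V q\<^esub> D y) = \<zero>\<^bsub>C q\<^esub>"
        using xV e \<sigma>_closed[of _ q s] C.abelian_group_axioms
        by (simp add: \<sigma>_diff minus_eq_zero_iff)
      then show "\<exists>y\<in>A r (s - r) (q + 1). \<sigma> s (x \<ominus>\<^bsub>V q\<^esub> D y) \<in> page_boundaries r s q"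
        using y submodule_zero[OF page_boundaries_sub] by metis
    qed
    finally show "page_class (r + 1) s q x = \<zero>\<^bsub>page (r + 1) s q\<^esub> \<longleftrightarrow>
        I +>\<^bsub>K\<^esub> page_class r s q x = \<zero>\<^bsub>quot_mod K I\<^esub>"
      using page_class_eq_zero_iff[OF x] by simp
  qed
qed

text \<open>The filtration descends, so its index is \<open>- a\<close> in the increasing convention
  of the statement; \<open>a + b\<close> is the degree in the complex.\<close>

definition E :: "nat \<Rightarrow> int \<Rightarrow> int \<Rightarrow> ('r,'y set) module" where
  "E r a b = page (int r) (- a) (a + b)"

definition d :: "nat \<Rightarrow> int \<Rightarrow> int \<Rightarrow> 'y set \<Rightarrow> 'y set" where
  "d r a b = page_diff (int r) (- a) (a + b)"

theorem is_spectral_sequence: "spectral_sequence R E d"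
  unfolding spectral_sequence_def
proof (intro allI impI conjI)
  fix r :: nat and a b :: int assume "1 \<le> r"
  have E': "E r (a - int r) (b + int r - 1) = page (int r) (- a + int r) (a + b - 1)"
    "E r (a - 2 * int r) (b + 2 * int r - 2) = page (int r) (- a + int r + int r) (a + b - 1 - 1)"
    "E r (a + int r) (b - int r + 1) = page (int r) (- a - int r) (a + b + 1)"
    "E (Suc r) a b = page (int r + 1) (- a) (a + b)"
    by (simp_all add: E_def algebra_simps)
  have d': "d r (a - int r) (b + int r - 1) = page_diff (int r) (- a + int r) (a + b - 1)"
    "d r (a + int r) (b - int r + 1) = page_diff (int r) (- a - int r) (a + b + 1)"
    by (simp_all add: d_def algebra_simps)
  show "module R (E r a b)" unfolding E_def by (rule page_module)
  show "d r a b \<in> lin_hom R (E r a b) (E r (a - int r) (b + int r - 1))"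
    unfolding E' unfolding E_def d_def by (rule page_diff_hom)
  show "lin_isomorphic R (E (Suc r) a b)
      (homology_at (E r (a + int r) (b - int r + 1)) (d r (a + int r) (b - int r + 1)) (E r a b)
        (d r a b) (E r (a - int r) (b + int r - 1)))"
    unfolding E' d' unfolding E_def d_def by (rule next_page)
  show "\<forall>x\<in>carrier (E r a b). d r (a - int r) (b + int r - 1) (d r a b x) =
      \<zero>\<^bsub>E r (a - 2 * int r) (b + 2 * int r - 2)\<^esub>"
  proof
    fix u assume "u \<in> carrier (E r a b)"
    then obtain x where x: "x \<in> A (int r) (- a) (a + b)" "u = page_class (int r) (- a) (a + b) x"
      by (auto simp: E_def page_class_surj[symmetric])
    note Dx = A_D_A[OF x(1) refl refl]
    have "D (D x) = \<zero>\<^bsub>V (a + b - 1 - 1)\<^esub>"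
      using D_D[OF A_carrier[OF x(1)]] by (simp add: algebra_simps)
    then have "\<sigma> (- a + int r + int r) (D (D x)) = \<zero>\<^bsub>C (a + b - 1 - 1)\<^esub>"
      using \<sigma>_zero by metis
    then have "page_class (int r) (- a + int r + int r) (a + b - 1 - 1) (D (D x)) =
        \<zero>\<^bsub>page (int r) (- a + int r + int r) (a + b - 1 - 1)\<^esub>"
      by (rule page_class_eq_zeroI[OF A_D_A[OF Dx refl refl]])
    then show "d r (a - int r) (b + int r - 1) (d r a b u) =
        \<zero>\<^bsub>E r (a - 2 * int r) (b + 2 * int r - 2)\<^esub>"
      unfolding E' d' unfolding d_def x(2) page_diff_eq[OF x(1)] page_diff_eq[OF Dx] .
  qed
qed

lemma page_outside:
  assumes "s < 0 \<or> int L \<le> s \<or> q < 0"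
  shows "zero_mod (page r s q)"
proof -
  have "\<sigma> s x = \<zero>\<^bsub>C q\<^esub>" if "x \<in> A r s q" for x
    using assms A_carrier[OF that] \<sigma>_low \<sigma>_high V_negative[of q] \<sigma>_zero by (metis singletonD)
  then have "u = \<zero>\<^bsub>page r s q\<^esub>" if "u \<in> carrier (page r s q)" for u
    using that page_class_eq_zeroI unfolding page_class_surj[symmetric] by blast
  moreover have "\<zero>\<^bsub>page r s q\<^esub> \<in> carrier (page r s q)"
    using page_module[of r s q] by (rule submodule_zero[OF submodule_carrier])
  ultimately show ?thesis unfolding zero_mod_def by blast
qed

text \<open>Of the source degree \<open>s\<close> and the target degree \<open>s + r\<close>, at
  least one lies outside 0..L - 1 once \<open>r\<close> reaches the length \<open>L\<close> of the
  filtration.\<close>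

lemma page_diff_late:
  assumes "int L \<le> r" "u \<in> carrier (page r s q)"
  shows "page_diff r s q u = \<zero>\<^bsub>page r (s + r) (q - 1)\<^esub>"
proof (cases "s < 0")
  case True
  then have "u = \<zero>\<^bsub>page r s q\<^esub>" using page_outside[of s q r] assms(2) by (auto simp: zero_mod_def)
  then show ?thesis using lin_hom_zero[OF page_module page_module page_diff_hom] by simp
next
  case False
  then have "zero_mod (page r (s + r) (q - 1))" using assms(1) by (intro page_outside) auto
  then show ?thesis using lin_hom_closed[OF page_diff_hom assms(2)] by (auto simp: zero_mod_def)
qed

section \<open>Convergence to the homology of the filtered complex\<close>

definition cycles :: "nat \<Rightarrow> 'x set" where
  "cycles n = {x \<in> carrier (V (int n)). D x = \<zero>\<^bsub>V (int n - 1)\<^esub>}"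

lemma cycles_sub: "submodule (cycles n) R (V (int n))"
  using submodule_vimage[OF V_module V_module D_hom submodule_zero_set[OF V_module]
      submodule_carrier[OF V_module], of "int n"]
  by (simp add: cycles_def)

text \<open>The maps \<open>g n\<close> present \<open>H n\<close> as cycles modulo boundaries
  without fixing how homology is represented, since the intended limit is the homology of another
  complex. The filtration of \<open>H n\<close> is the image of that of the cycles. Page
  \<open>L\<close> is already final: for 0 \<le> s all elements of \<open>A L s\<close> are cycles,
  and for s < L boundaries may come from arbitrarily low filtration degree.\<close>

theorem converges:
  fixes H :: "nat \<Rightarrow> ('r,'h) module" and g :: "nat \<Rightarrow> 'x \<Rightarrow> 'h"
  assumes H_module: "\<And>n. module R (H n)"
    and g_hom: "\<And>n. g n \<in> lin_hom R ((V (int n))\<lparr>carrier := cycles n\<rparr>) (H n)"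
    and g_surj: "\<And>n. g n ` cycles n = carrier (H n)"
    and g_ker: "\<And>n x. x \<in> cycles n \<Longrightarrow> g n x = \<zero>\<^bsub>H n\<^esub> \<longleftrightarrow> x \<in> D ` carrier (V (int n + 1))"
  shows "converges_finitely R E d H"
  unfolding converges_finitely_def
proof (intro exI[of _ L] conjI allI impI ballI)
  show "1 \<le> L" by (rule L_pos)
next
  fix r a b x assume "L \<le> r" "x \<in> carrier (E r a b)"
  then show "d r a b x = \<zero>\<^bsub>E r (a - int r) (b + int r - 1)\<^esub>"
    using page_diff_late[of "int r" x "- a" "a + b"] by (simp add: E_def d_def algebra_simps)
next
  fix a b :: int assume "a + b < 0"
  then show "zero_mod (E L a b)" unfolding E_def by (intro page_outside) auto
next
  fix n
  define M where "M = (V (int n))\<lparr>carrier := cycles n\<rparr>"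
  have M_module: "module R M" unfolding M_def by (rule submodule.submodule_is_module[OF cycles_sub V_module])
  define Z where "Z s = {x \<in> cycles n. x \<in> F s (int n)}" for s
  have Z_eq: "Z s = {x \<in> cycles n. id x \<in> F s (int n)}" for s by (simp add: Z_def)
  have id_hom: "id \<in> lin_hom R (V (int n)) (V (int n))" by (rule lin_homI) auto
  have Z_subV: "submodule (Z s) R (V (int n))" for s
    unfolding Z_eq by (rule submodule_vimage[OF V_module V_module id_hom F_sub cycles_sub])
  have Z_sub: "submodule (Z s) R M" for s
    unfolding M_def by (rule submodule_restrict[OF V_module cycles_sub Z_subV]) (auto simp: Z_def)
  have g_hom': "g n \<in> lin_hom R M (H n)" unfolding M_def by (rule g_hom)
  define Fil where "Fil a = g n ` Z (- a)" for a
  have Fil_sub: "submodule (Fil a) R (H n)" for a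
    unfolding Fil_def by (rule submodule_image[OF M_module H_module g_hom' Z_sub])
  have Fil_mono: "Fil (a - 1) \<subseteq> Fil a" for a
    using F_mono[of "- a" "1 - a"] by (force simp: Fil_def Z_def)
  have Z0: "Z s = {\<zero>\<^bsub>V (int n)\<^esub>}" if "int L \<le> s" for s
    using F_high[OF that, of "int n"] submodule_zero[OF cycles_sub, of n] by (auto simp: Z_def)
  have g0: "g n \<zero>\<^bsub>V (int n)\<^esub> = \<zero>\<^bsub>H n\<^esub>"
    using lin_hom_zero[OF M_module H_module g_hom'] by (simp add: M_def)
  have "Fil (- int L) = {\<zero>\<^bsub>H n\<^esub>}" by (simp add: Fil_def Z0 g0)
  moreover have "Fil 0 = carrier (H n)"
    using F_low[of 0 "int n"] by (auto simp: Fil_def g_surj[symmetric] Z_def cycles_def)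
  moreover have "lin_isomorphic R (E L a (int n - a)) (quot_mod ((H n)\<lparr>carrier := Fil a\<rparr>) (Fil (a - 1)))"
    for a
  proof -
    define s where "s = - a"
    define N where "N = (V (int n))\<lparr>carrier := Z s\<rparr>"
    have N_module: "module R N" unfolding N_def by (rule submodule.submodule_is_module[OF Z_subV V_module])
    have H'_module: "module R ((H n)\<lparr>carrier := Fil a\<rparr>)"
      by (rule submodule.submodule_is_module[OF Fil_sub H_module])
    have Fil_sub': "submodule (Fil (a - 1)) R ((H n)\<lparr>carrier := Fil a\<rparr>)"
      by (rule submodule_restrict[OF H_module Fil_sub Fil_sub Fil_mono])
    have gN: "g n \<in> lin_hom R N ((H n)\<lparr>carrier := Fil a\<rparr>)"
      using g_hom'
      by (intro lin_hom_corestrict) (auto simp: N_def M_def lin_hom_def Z_def Fil_def s_def)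
    have ZA: "x \<in> A r s (int n)" if "x \<in> Z s" for x r
      using that submodule_zero[OF F_sub] by (auto simp: Z_def cycles_def A_def)
    have clN: "page_class (int L) s (int n) \<in> lin_hom R N (page (int L) s (int n))"
      using page_class_hom[of "int L" s "int n"] ZA by (auto simp: N_def AV_def lin_hom_def)
    have surj: "page_class (int L) s (int n) ` Z s = carrier (page (int L) s (int n))"
    \<comment> \<open>For negative \<open>s\<close> the elements of \<open>A (int L) s\<close> need
      not be cycles, since \<open>s + L\<close> stays below \<open>L\<close>; but there the page
      vanishes.\<close>
    proof (cases "s < 0")
      case True
      then have "zero_mod (page (int L) s (int n))" by (intro page_outside) auto
      moreover have "page_class (int L) s (int n) ` Z s \<subseteq> carrier (page (int L) s (int n))"
        using ZA page_class_surj by blast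
      moreover have "Z s \<noteq> {}" using submodule_zero[OF Z_subV] by blast
      ultimately show ?thesis by (auto simp: zero_mod_def)
    next
      case False
      then have "A (int L) s (int n) = Z s"
        using F_high[of "s + int L" "int n - 1"] by (auto simp: A_def Z_def cycles_def F_def)
      then show ?thesis using page_class_surj by metis
    qed
    have "lin_isomorphic R (page (int L) s (int n)) (quot_mod ((H n)\<lparr>carrier := Fil a\<rparr>) (Fil (a - 1)))"
    proof (rule lin_isomorphicI[OF N_module page_module quot_mod_module[OF H'_module Fil_sub'] clN
          lin_hom_comp[OF gN quot_mod_hom[OF H'_module Fil_sub']]])
      show "page_class (int L) s (int n) ` carrier N = carrier (page (int L) s (int n))"
        using surj by (simp add: N_def)
      show "(\<lambda>x. Fil (a - 1) +>\<^bsub>(H n)\<lparr>carrier := Fil a\<rparr>\<^esub> g n x) ` carrier N =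
          carrier (quot_mod ((H n)\<lparr>carrier := Fil a\<rparr>) (Fil (a - 1)))"
        by (auto simp: quot_mod_simps N_def Fil_def s_def)
      fix x assume "x \<in> carrier N"
      then have x: "x \<in> Z s" by (simp add: N_def)
      then have xc: "x \<in> cycles n" and xF: "x \<in> F s (int n)" and xV: "x \<in> carrier (V (int n))"
        by (auto simp: Z_def cycles_def)
      have gx: "g n x \<in> carrier (H n)" using g_surj xc by blast
      have "Fil (a - 1) +>\<^bsub>(H n)\<lparr>carrier := Fil a\<rparr>\<^esub> g n x =
          \<zero>\<^bsub>quot_mod ((H n)\<lparr>carrier := Fil a\<rparr>) (Fil (a - 1))\<^esub> \<longleftrightarrow> g n x \<in> Fil (a - 1)"
        by (simp add: quot_mod_simps coset_eq_self_iff[OF H_module Fil_sub gx])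
      also have "\<dots> \<longleftrightarrow> (\<exists>z\<in>Z (s + 1). g n x = g n z)"
        by (auto simp: Fil_def s_def algebra_simps)
      also have "\<dots> \<longleftrightarrow> (\<exists>z\<in>Z (s + 1). x \<ominus>\<^bsub>V (int n)\<^esub> z \<in> D ` carrier (V (int n + 1)))"
      proof (rule bex_cong[OF refl])
        fix z assume "z \<in> Z (s + 1)"
        then have zc: "z \<in> cycles n" by (simp add: Z_def)
        have minus: "x \<ominus>\<^bsub>M\<^esub> z = x \<ominus>\<^bsub>V (int n)\<^esub> z"
          using lin_hom_diff[OF M_module V_module, of id "int n" x z] id_hom xc zc
          by (auto simp: M_def lin_hom_def cycles_def)
        have "g n x = g n z \<longleftrightarrow> g n x \<ominus>\<^bsub>H n\<^esub> g n z = \<zero>\<^bsub>H n\<^esub>"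
          using minus_eq_zero_iff[OF module.axioms(2)[OF H_module]] gx g_surj zc by blast
        also have "\<dots> \<longleftrightarrow> g n (x \<ominus>\<^bsub>V (int n)\<^esub> z) = \<zero>\<^bsub>H n\<^esub>"
          using lin_hom_diff[OF M_module H_module g_hom', of x z] xc zc minus by (simp add: M_def)
        also have "\<dots> \<longleftrightarrow> x \<ominus>\<^bsub>V (int n)\<^esub> z \<in> D ` carrier (V (int n + 1))"
          by (rule g_ker[OF submodule_diff[OF cycles_sub xc zc]])
        finally show "g n x = g n z \<longleftrightarrow> x \<ominus>\<^bsub>V (int n)\<^esub> z \<in> D ` carrier (V (int n + 1))" .
      qed
      also have "\<dots> \<longleftrightarrow> \<sigma> s x \<in> page_boundaries (int L) s (int n)"
      proof
        assume "\<exists>z\<in>Z (s + 1). x \<ominus>\<^bsub>V (int n)\<^esub> z \<in> D ` carrier (V (int n + 1))"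
        then obtain z y where z: "z \<in> Z (s + 1)" and y: "y \<in> carrier (V (int n + 1))"
          and e: "x \<ominus>\<^bsub>V (int n)\<^esub> z = D y" by auto
        show "\<sigma> s x \<in> page_boundaries (int L) s (int n)"
        \<comment> \<open>For L \<le> s the map \<open>\<sigma> s\<close> is zero. Otherwise s - L +
          1 \<le> 0, so \<open>y\<close> satisfies the filtration condition automatically.\<close>
        proof (cases "int L \<le> s")
          case True
          then show ?thesis using \<sigma>_high[OF True xV] submodule_zero[OF page_boundaries_sub] by simp
        next
          case False
          interpret C: module R "C (int n)" by (rule C_module)
          have zF: "z \<in> F (s + 1) (int n)" "z \<in> carrier (V (int n))"
            using z by (auto simp: Z_def cycles_def)
          then have "D y \<in> F s (int n)"
            unfolding e[symmetric] using xF by (intro submodule_diff[OF F_sub]) (auto elim: F_mono[rotated])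
          then have "y \<in> A (int L - 1) (s - int L + 1) (int n + 1)"
            using y False F_low[of "s - int L + 1" "int n + 1"] by (intro AI) auto
          moreover have "\<sigma> s (D y) = \<sigma> s x"
            using F_SucD[OF zF(1)] xV zF(2) \<sigma>_closed[OF xV, of s]
            by (simp add: e[symmetric] \<sigma>_diff minus_zero_right[OF C.abelian_group_axioms])
          ultimately show ?thesis by (auto simp: page_boundaries_def intro!: image_eqI[of _ _ y])
        qed
      next
        assume "\<sigma> s x \<in> page_boundaries (int L) s (int n)"
        then obtain y where y: "y \<in> A (int L - 1) (s - int L + 1) (int n + 1)"
          and e: "\<sigma> s x = \<sigma> s (D y)" by (auto simp: page_boundaries_def)
        interpret V: module R "V (int n)" by (rule V_module)
        interpret C: module R "C (int n)" by (rule C_module)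
        have DyF: "D y \<in> F s (int n)" using A_D[OF y] by simp
        have yV: "y \<in> carrier (V (int n + 1))" using A_carrier[OF y] .
        have DyV: "D y \<in> carrier (V (int n))" using F_carrier[OF DyF] .
        have Dyc: "D y \<in> cycles n" using D_D[OF yV] DyV by (simp add: cycles_def)
        \<comment> \<open>Subtracting the boundary with the same leading coefficient gives a
          homologous cycle one step deeper in the filtration.\<close>
        define z where "z = x \<ominus>\<^bsub>V (int n)\<^esub> D y"
        have "z \<in> F s (int n)" unfolding z_def by (rule submodule_diff[OF F_sub xF DyF])
        moreover have "\<sigma> s z = \<zero>\<^bsub>C (int n)\<^esub>"
          using xV DyV e \<sigma>_closed C.abelian_group_axioms
          by (simp add: z_def \<sigma>_diff minus_eq_zero_iff)
        ultimately have "z \<in> Z (s + 1)"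
          using F_SucI submodule_diff[OF cycles_sub xc Dyc] by (simp add: Z_def z_def)
        moreover have "x \<ominus>\<^bsub>V (int n)\<^esub> z = D y"
          using xV DyV
          by (simp add: z_def a_minus_def V.minus_add V.minus_minus V.a_assoc[symmetric] V.r_neg)
        ultimately show "\<exists>z\<in>Z (s + 1). x \<ominus>\<^bsub>V (int n)\<^esub> z \<in> D ` carrier (V (int n + 1))"
          using yV by (metis imageI)
      qed
      finally show "page_class (int L) s (int n) x = \<zero>\<^bsub>page (int L) s (int n)\<^esub> \<longleftrightarrow>
          Fil (a - 1) +>\<^bsub>(H n)\<lparr>carrier := Fil a\<rparr>\<^esub> g n x =
          \<zero>\<^bsub>quot_mod ((H n)\<lparr>carrier := Fil a\<rparr>) (Fil (a - 1))\<^esub>"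
        using page_class_eq_zero_iff[OF ZA[OF x]] by simp
    qed
    then show ?thesis by (simp add: E_def s_def)
  qed
  ultimately show "\<exists>Fil. (\<forall>a. submodule (Fil a) R (H n)) \<and> (\<forall>a. Fil (a - 1) \<subseteq> Fil a) \<and>
      (\<exists>a. Fil a = {\<zero>\<^bsub>H n\<^esub>}) \<and> (\<exists>a. Fil a = carrier (H n)) \<and>
      (\<forall>a. lin_isomorphic R (E L a (int n - a))
        (quot_mod ((H n)\<lparr>carrier := Fil a\<rparr>) (Fil (a - 1))))"
    using Fil_sub Fil_mono by (intro exI[of _ Fil]) blast
qed

end


section \<open>Homology of complexes\<close>

locale chain_complex =
  fixes R :: "('r,'s) ring_scheme" and C :: "('r,'c) complex_data"
  assumes chains_module: "module R (chains C n)"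
    and bdry_hom: "bdry C n \<in> lin_hom R (chains C n) (chains C (n - 1))"
    and bdry_bdry: "x \<in> carrier (chains C (Suc n)) \<Longrightarrow>
      bdry C n (bdry C (Suc n) x) = \<zero>\<^bsub>chains C (n - 1)\<^esub>"
begin

definition cyc :: "nat \<Rightarrow> 'c set" where
  "cyc n = a_kernel (chains C n) (chains C (n - 1)) (bdry C n)"

definition bnd :: "nat \<Rightarrow> 'c set" where
  "bnd n = bdry C (Suc n) ` carrier (chains C (Suc n))"

abbreviation cyc_mod :: "nat \<Rightarrow> ('r,'c) module" where
  "cyc_mod n \<equiv> (chains C n)\<lparr>carrier := cyc n\<rparr>"

lemma cyc_iff: "x \<in> cyc n \<longleftrightarrow> x \<in> carrier (chains C n) \<and> bdry C n x = \<zero>\<^bsub>chains C (n - 1)\<^esub>"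
  by (auto simp: cyc_def a_kernel_def kernel_def)

lemma cyc_sub: "submodule (cyc n) R (chains C n)"
proof -
  have "cyc n = {x \<in> carrier (chains C n). bdry C n x \<in> {\<zero>\<^bsub>chains C (n - 1)\<^esub>}}"
    by (auto simp: cyc_iff)
  then show ?thesis
    using submodule_vimage[OF chains_module chains_module bdry_hom submodule_zero_set[OF chains_module]
        submodule_carrier[OF chains_module], of n]
    by simp
qed

lemma bdry_hom_Suc: "bdry C (Suc n) \<in> lin_hom R (chains C (Suc n)) (chains C n)"
  using bdry_hom[of "Suc n"] by simp

lemma bnd_sub: "submodule (bnd n) R (chains C n)"
  unfolding bnd_def
  by (rule submodule_image[OF chains_module chains_module bdry_hom_Suc submodule_carrier[OF chains_module]])

lemma bnd_cyc: "bnd n \<subseteq> cyc n"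
  using lin_hom_closed[OF bdry_hom_Suc] bdry_bdry by (auto simp: bnd_def cyc_iff)

lemma cyc_module: "module R (cyc_mod n)"
  by (rule submodule.submodule_is_module[OF cyc_sub chains_module])

lemma bnd_sub': "submodule (bnd n) R (cyc_mod n)"
  by (rule submodule_restrict[OF chains_module cyc_sub bnd_sub bnd_cyc])

lemma homology_eq: "homology C n = quot_mod (cyc_mod n) (bnd n)"
  by (simp add: homology_def homology_at_def cyc_def bnd_def)

lemma hclass_eq: "hclass C n z = bnd n +>\<^bsub>chains C n\<^esub> z"
  by (simp add: hclass_def bnd_def)

lemma homology_module: "module R (homology C n)"
  unfolding homology_eq by (rule quot_mod_module[OF cyc_module bnd_sub'])

lemma hclass_hom: "hclass C n \<in> lin_hom R (cyc_mod n) (homology C n)"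
  using quot_mod_hom[OF cyc_module bnd_sub'] by (simp add: hclass_eq[abs_def] homology_eq)

lemma hclass_surj: "hclass C n ` cyc n = carrier (homology C n)"
  by (auto simp: hclass_eq homology_eq quot_mod_simps)

lemma hclass_closed: "z \<in> cyc n \<Longrightarrow> hclass C n z \<in> carrier (homology C n)"
  using hclass_surj by blast

lemma homology_zero: "\<zero>\<^bsub>homology C n\<^esub> = bnd n"
  by (simp add: homology_eq quot_mod_simps)

lemma cyc_carrier: "z \<in> cyc n \<Longrightarrow> z \<in> carrier (chains C n)"
  by (simp add: cyc_iff)

lemma hclass_eq_iff:
  "z \<in> cyc n \<Longrightarrow> w \<in> cyc n \<Longrightarrow> hclass C n z = hclass C n w \<longleftrightarrow> z \<ominus>\<^bsub>chains C n\<^esub> w \<in> bnd n"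
  unfolding hclass_eq by (rule coset_eq_iff[OF chains_module bnd_sub cyc_carrier cyc_carrier])

lemma hclass_eq_zero_iff: "z \<in> cyc n \<Longrightarrow> hclass C n z = \<zero>\<^bsub>homology C n\<^esub> \<longleftrightarrow> z \<in> bnd n"
  unfolding hclass_eq homology_zero by (rule coset_eq_self_iff[OF chains_module bnd_sub cyc_carrier])

lemma mem_hclass: "z \<in> cyc n \<Longrightarrow> z \<in> hclass C n z"
proof -
  assume "z \<in> cyc n"
  moreover interpret M: module R "chains C n" by (rule chains_module)
  have "z \<in> carrier (chains C n) \<Longrightarrow> z = \<zero>\<^bsub>chains C n\<^esub> \<oplus>\<^bsub>chains C n\<^esub> z" by simp
  ultimately show ?thesis
    using submodule_zero[OF bnd_sub] unfolding hclass_eq coset_mem cyc_iff by blast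
qed

lemma hclassD:
  assumes "z \<in> cyc n" "w \<in> hclass C n z"
  shows "w \<in> cyc n" "hclass C n w = hclass C n z"
proof -
  interpret B: abelian_subgroup "bnd n" "chains C n"
    by (rule submodule_abelian_subgroup[OF chains_module bnd_sub])
  obtain b where "b \<in> bnd n" "w = b \<oplus>\<^bsub>chains C n\<^esub> z"
    using assms(2) by (auto simp: hclass_eq coset_mem)
  then show "w \<in> cyc n" using submodule_add[OF cyc_sub] bnd_cyc assms(1) by blast
  show "hclass C n w = hclass C n z"
    using B.a_repr_independence'[of w z] assms cyc_carrier by (simp add: hclass_eq)
qed

text \<open>Evaluates maps on homology that are defined by \<open>the_elem\<close> of the image of a
  coset; constancy has to be checked only on homologous cycles.\<close>

lemma the_elem_hclass:
  assumes "z \<in> cyc n" "\<And>w. w \<in> cyc n \<Longrightarrow> hclass C n w = hclass C n z \<Longrightarrow> f w = f z"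
  shows "the_elem (f ` hclass C n z) = f z"
proof -
  have "f ` hclass C n z = {f z}"
    using assms mem_hclass[OF assms(1)] hclassD[OF assms(1)] by blast
  then show ?thesis by simp
qed

end

text \<open>The conditions are preservation of cycles and of boundaries, with independent degrees on
  the two sides, so that the slant product, which lowers the degree and anticommutes with the
  differentials, is covered as well.\<close>

lemma homology_map_hclass:
  assumes "chain_complex R C" "chain_complex R C'"
    and \<phi>: "\<phi> \<in> lin_hom R (chains C m) (chains C' n)"
    and cyc: "\<And>z. z \<in> chain_complex.cyc C m \<Longrightarrow> \<phi> z \<in> chain_complex.cyc C' n"
    and bnd: "\<And>z. z \<in> chain_complex.bnd C m \<Longrightarrow> \<phi> z \<in> chain_complex.bnd C' n"
    and z: "z \<in> chain_complex.cyc C m"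
  shows "homology_map C' n \<phi> (hclass C m z) = hclass C' n (\<phi> z)"
proof -
  interpret C: chain_complex R C by fact
  interpret C': chain_complex R C' by fact
  show ?thesis
    unfolding homology_map_def
  proof (rule C.the_elem_hclass[OF z])
    fix w assume w: "w \<in> C.cyc m" "hclass C m w = hclass C m z"
    then have "w \<ominus>\<^bsub>chains C m\<^esub> z \<in> C.bnd m" using C.hclass_eq_iff z by simp
    then have "\<phi> w \<ominus>\<^bsub>chains C' n\<^esub> \<phi> z \<in> C'.bnd n"
      using bnd lin_hom_diff[OF C.chains_module C'.chains_module \<phi>] w z C.cyc_carrier by metis
    then show "hclass C' n (\<phi> w) = hclass C' n (\<phi> z)"
      using w z cyc by (subst C'.hclass_eq_iff) auto
  qed
qed

lemma homology_map_hom: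
  assumes "chain_complex R C" "chain_complex R C'"
    and \<phi>: "\<phi> \<in> lin_hom R (chains C m) (chains C' n)"
    and cyc: "\<And>z. z \<in> chain_complex.cyc C m \<Longrightarrow> \<phi> z \<in> chain_complex.cyc C' n"
    and bnd: "\<And>z. z \<in> chain_complex.bnd C m \<Longrightarrow> \<phi> z \<in> chain_complex.bnd C' n"
  shows "homology_map C' n \<phi> \<in> lin_hom R (homology C m) (homology C' n)"
proof -
  interpret C: chain_complex R C by fact
  interpret C': chain_complex R C' by fact
  note eq = homology_map_hclass[OF assms]
  note add = lin_hom_add[OF C.hclass_hom[of m]] lin_hom_add[OF C'.hclass_hom[of n]]
  note smult = lin_hom_smult[OF C.hclass_hom[of m]] lin_hom_smult[OF C'.hclass_hom[of n]]
  note \<phi>' = lin_hom_add[OF \<phi>] lin_hom_smult[OF \<phi>]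
  show ?thesis
  proof (rule lin_homI)
    fix U V assume "U \<in> carrier (homology C m)" "V \<in> carrier (homology C m)"
    then obtain z w where z: "z \<in> C.cyc m" "U = hclass C m z" and w: "w \<in> C.cyc m" "V = hclass C m w"
      by (auto simp: C.hclass_surj[symmetric])
    have "U \<oplus>\<^bsub>homology C m\<^esub> V = hclass C m (z \<oplus>\<^bsub>chains C m\<^esub> w)" using z w add(1)[of z w] by simp
    then show "homology_map C' n \<phi> (U \<oplus>\<^bsub>homology C m\<^esub> V) =
        homology_map C' n \<phi> U \<oplus>\<^bsub>homology C' n\<^esub> homology_map C' n \<phi> V"
      using z w add(2)[of "\<phi> z" "\<phi> w"] submodule_add[OF C.cyc_sub z(1) w(1)]
      by (simp add: eq cyc \<phi>' C.cyc_carrier)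
  next
    fix a U assume a: "a \<in> carrier R" and "U \<in> carrier (homology C m)"
    then obtain z where z: "z \<in> C.cyc m" "U = hclass C m z"
      by (auto simp: C.hclass_surj[symmetric])
    have "a \<odot>\<^bsub>homology C m\<^esub> U = hclass C m (a \<odot>\<^bsub>chains C m\<^esub> z)" using z a smult(1)[of a z] by simp
    then show "homology_map C' n \<phi> (a \<odot>\<^bsub>homology C m\<^esub> U) = a \<odot>\<^bsub>homology C' n\<^esub> homology_map C' n \<phi> U"
      using z a smult(2)[of a "\<phi> z"] submodule_smult[OF C.cyc_sub a z(1)]
      by (simp add: eq cyc \<phi>' C.cyc_carrier)
  next
    fix U assume "U \<in> carrier (homology C m)"
    then show "homology_map C' n \<phi> U \<in> carrier (homology C' n)"
      using eq cyc C'.hclass_closed by (auto simp: C.hclass_surj[symmetric])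
  qed
qed


section \<open>Linear maps on free modules\<close>

lemma free_mod_module:
  fixes R :: "('r,'s) ring_scheme" and S :: "'x set"
  assumes "cring R" shows "module R (free_mod R S)"
proof -
  interpret R: cring R by fact
  have fin: "finite {x. f x \<oplus>\<^bsub>R\<^esub> g x \<noteq> \<zero>\<^bsub>R\<^esub>}" "f x \<oplus>\<^bsub>R\<^esub> g x \<noteq> \<zero>\<^bsub>R\<^esub> \<Longrightarrow> x \<in> S"
    if "f \<in> carrier (free_mod R S)" "g \<in> carrier (free_mod R S)" for f g :: "'x \<Rightarrow> 'r" and x
  proof -
    have "{x. f x \<oplus>\<^bsub>R\<^esub> g x \<noteq> \<zero>\<^bsub>R\<^esub>} \<subseteq> {x. f x \<noteq> \<zero>\<^bsub>R\<^esub>} \<union> {x. g x \<noteq> \<zero>\<^bsub>R\<^esub>}"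
      by force
    moreover have "finite ({x. f x \<noteq> \<zero>\<^bsub>R\<^esub>} \<union> {x. g x \<noteq> \<zero>\<^bsub>R\<^esub>})"
      using that by (simp add: free_mod_def)
    ultimately show "finite {x. f x \<oplus>\<^bsub>R\<^esub> g x \<noteq> \<zero>\<^bsub>R\<^esub>}" by (rule finite_subset)
    show "f x \<oplus>\<^bsub>R\<^esub> g x \<noteq> \<zero>\<^bsub>R\<^esub> \<Longrightarrow> x \<in> S"
      using that by (cases "f x = \<zero>\<^bsub>R\<^esub> \<and> g x = \<zero>\<^bsub>R\<^esub>") (auto simp: free_mod_def)
  qed
  have fin2: "finite {x. a \<otimes>\<^bsub>R\<^esub> f x \<noteq> \<zero>\<^bsub>R\<^esub>}" "a \<otimes>\<^bsub>R\<^esub> f x \<noteq> \<zero>\<^bsub>R\<^esub> \<Longrightarrow> x \<in> S"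
    if "a \<in> carrier R" "f \<in> carrier (free_mod R S)" for a and f :: "'x \<Rightarrow> 'r" and x
  proof -
    have "{x. a \<otimes>\<^bsub>R\<^esub> f x \<noteq> \<zero>\<^bsub>R\<^esub>} \<subseteq> {x. f x \<noteq> \<zero>\<^bsub>R\<^esub>}" using that by auto
    then show "finite {x. a \<otimes>\<^bsub>R\<^esub> f x \<noteq> \<zero>\<^bsub>R\<^esub>}" "a \<otimes>\<^bsub>R\<^esub> f x \<noteq> \<zero>\<^bsub>R\<^esub> \<Longrightarrow> x \<in> S"
      using that by (auto simp: free_mod_def dest: finite_subset)
  qed
  have val: "f x \<in> carrier R" if "f \<in> carrier (free_mod R S)" for f :: "'x \<Rightarrow> 'r" and x
    using that by (simp add: free_mod_def)
  have ops: "(f \<oplus>\<^bsub>free_mod R S\<^esub> g) x = f x \<oplus>\<^bsub>R\<^esub> g x" "(a \<odot>\<^bsub>free_mod R S\<^esub> f) x = a \<otimes>\<^bsub>R\<^esub> f x"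
    "\<zero>\<^bsub>free_mod R S\<^esub> x = \<zero>\<^bsub>R\<^esub>" for f g :: "'x \<Rightarrow> 'r" and a x
    by (simp_all add: free_mod_def)
  have mem: "f \<in> carrier (free_mod R S)"
    if "\<And>x. f x \<in> carrier R" "finite {x. f x \<noteq> \<zero>\<^bsub>R\<^esub>}" "\<And>x. f x \<noteq> \<zero>\<^bsub>R\<^esub> \<Longrightarrow> x \<in> S" for f :: "'x \<Rightarrow> 'r"
    using that by (auto simp: free_mod_def)
  have add: "f \<oplus>\<^bsub>free_mod R S\<^esub> g \<in> carrier (free_mod R S)"
    if "f \<in> carrier (free_mod R S)" "g \<in> carrier (free_mod R S)" for f g :: "'x \<Rightarrow> 'r"
    using fin[OF that] val[OF that(1)] val[OF that(2)] by (intro mem) (simp_all add: ops)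
  have smult: "a \<odot>\<^bsub>free_mod R S\<^esub> f \<in> carrier (free_mod R S)"
    if "a \<in> carrier R" "f \<in> carrier (free_mod R S)" for a and f :: "'x \<Rightarrow> 'r"
    using fin2[OF that] val[OF that(2)] that(1) by (intro mem) (simp_all add: ops)
  show ?thesis
  proof (rule moduleI)
    show "abelian_group (free_mod R S)"
    proof (rule abelian_groupI)
      fix f assume f: "f \<in> carrier (free_mod R S)"
      have "(\<ominus>\<^bsub>R\<^esub> \<one>\<^bsub>R\<^esub>) \<odot>\<^bsub>free_mod R S\<^esub> f \<oplus>\<^bsub>free_mod R S\<^esub> f = \<zero>\<^bsub>free_mod R S\<^esub>"
        using val[OF f] by (simp add: ops fun_eq_iff R.l_minus R.l_neg)
      with smult[OF _ f, of "\<ominus>\<^bsub>R\<^esub> \<one>\<^bsub>R\<^esub>"]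
      show "\<exists>g\<in>carrier (free_mod R S). g \<oplus>\<^bsub>free_mod R S\<^esub> f = \<zero>\<^bsub>free_mod R S\<^esub>"
        by auto
      show "\<zero>\<^bsub>free_mod R S\<^esub> \<oplus>\<^bsub>free_mod R S\<^esub> f = f"
        using val[OF f] by (simp add: ops fun_eq_iff)
    next
      show "\<zero>\<^bsub>free_mod R S\<^esub> \<in> carrier (free_mod R S)" by (rule mem) (simp_all add: ops)
    qed (use add val in \<open>simp_all add: fun_eq_iff ops R.a_ac\<close>)
    show "cring R" by fact
  qed (use smult val in \<open>simp_all add: fun_eq_iff ops R.l_distr R.r_distr R.m_assoc\<close>)
qed

text \<open>\<open>lin_ext\<close> sums over the support, which changes under addition and scaling;
  a common finite index set makes the sums comparable.\<close>

lemma lin_ext_superset: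
  fixes M :: "('r,'m) module"
  assumes "module R M" and "finite B" "{x. f x \<noteq> \<zero>\<^bsub>R\<^esub>} \<subseteq> B" "\<phi> \<in> B \<rightarrow> carrier M" "f \<in> B \<rightarrow> carrier R"
  shows "lin_ext R M \<phi> f = (\<Oplus>\<^bsub>M\<^esub>x\<in>B. f x \<odot>\<^bsub>M\<^esub> \<phi> x)"
proof -
  interpret M: module R M by fact
  show ?thesis
    unfolding lin_ext_def using assms
    by (intro M.M.add.finprod_mono_neutral_cong_left) (auto simp: Pi_def)
qed

lemma lin_ext_hom:
  fixes M :: "('r,'m) module"
  assumes "module R M" and \<phi>: "\<phi> \<in> S \<rightarrow> carrier M"
  shows "lin_ext R M \<phi> \<in> lin_hom R (free_mod R S) M"
proof -
  interpret M: module R M by fact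
  note lin_ext_superset = lin_ext_superset[OF M.module_axioms]
  show ?thesis
  proof (rule lin_homI)
  fix f g assume f: "f \<in> carrier (free_mod R S)" and g: "g \<in> carrier (free_mod R S)"
  define B where "B = {x. f x \<noteq> \<zero>\<^bsub>R\<^esub>} \<union> {x. g x \<noteq> \<zero>\<^bsub>R\<^esub>}"
  have B: "finite B" "B \<subseteq> S" using f g by (auto simp: B_def free_mod_def)
  have fg: "f x \<in> carrier R" "g x \<in> carrier R" for x using f g by (auto simp: free_mod_def)
  have \<phi>B: "\<phi> \<in> B \<rightarrow> carrier M" using \<phi> B by auto
  have "lin_ext R M \<phi> (\<lambda>x. f x \<oplus>\<^bsub>R\<^esub> g x) = (\<Oplus>\<^bsub>M\<^esub>x\<in>B. (f x \<oplus>\<^bsub>R\<^esub> g x) \<odot>\<^bsub>M\<^esub> \<phi> x)"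
    using B \<phi>B fg by (intro lin_ext_superset) (auto simp: B_def)
  also have "\<dots> = (\<Oplus>\<^bsub>M\<^esub>x\<in>B. f x \<odot>\<^bsub>M\<^esub> \<phi> x \<oplus>\<^bsub>M\<^esub> g x \<odot>\<^bsub>M\<^esub> \<phi> x)"
    using \<phi>B fg by (intro M.finsum_cong') (auto simp: M.smult_l_distr Pi_def)
  also have "\<dots> = (\<Oplus>\<^bsub>M\<^esub>x\<in>B. f x \<odot>\<^bsub>M\<^esub> \<phi> x) \<oplus>\<^bsub>M\<^esub> (\<Oplus>\<^bsub>M\<^esub>x\<in>B. g x \<odot>\<^bsub>M\<^esub> \<phi> x)"
    using \<phi>B fg by (intro M.finsum_addf) (auto simp: Pi_def)
  also have "\<dots> = lin_ext R M \<phi> f \<oplus>\<^bsub>M\<^esub> lin_ext R M \<phi> g"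
    using B \<phi>B fg by (subst (1 2) lin_ext_superset[of B]) (auto simp: B_def)
  finally show "lin_ext R M \<phi> (f \<oplus>\<^bsub>free_mod R S\<^esub> g) = lin_ext R M \<phi> f \<oplus>\<^bsub>M\<^esub> lin_ext R M \<phi> g"
    by (simp add: free_mod_def)
next
  fix a f assume a: "a \<in> carrier R" and f: "f \<in> carrier (free_mod R S)"
  define B where "B = {x. f x \<noteq> \<zero>\<^bsub>R\<^esub>}"
  have B: "finite B" "B \<subseteq> S" using f by (auto simp: B_def free_mod_def)
  have fx: "f x \<in> carrier R" for x using f by (auto simp: free_mod_def)
  have \<phi>B: "\<phi> \<in> B \<rightarrow> carrier M" using \<phi> B by auto
  have "lin_ext R M \<phi> (\<lambda>x. a \<otimes>\<^bsub>R\<^esub> f x) = (\<Oplus>\<^bsub>M\<^esub>x\<in>B. (a \<otimes>\<^bsub>R\<^esub> f x) \<odot>\<^bsub>M\<^esub> \<phi> x)"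
    using B \<phi>B fx a by (intro lin_ext_superset) (auto simp: B_def)
  also have "\<dots> = (\<Oplus>\<^bsub>M\<^esub>x\<in>B. a \<odot>\<^bsub>M\<^esub> (f x \<odot>\<^bsub>M\<^esub> \<phi> x))"
    using \<phi>B fx a by (intro M.finsum_cong') (auto simp: M.smult_assoc1 Pi_def)
  also have "\<dots> = a \<odot>\<^bsub>M\<^esub> (\<Oplus>\<^bsub>M\<^esub>x\<in>B. f x \<odot>\<^bsub>M\<^esub> \<phi> x)"
    using B \<phi>B fx a by (intro M.finsum_smult_ldistr[symmetric]) (auto simp: Pi_def)
  finally show "lin_ext R M \<phi> (a \<odot>\<^bsub>free_mod R S\<^esub> f) = a \<odot>\<^bsub>M\<^esub> lin_ext R M \<phi> f"
    by (simp add: free_mod_def lin_ext_def B_def)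
next
  fix f assume f: "f \<in> carrier (free_mod R S)"
  then show "lin_ext R M \<phi> f \<in> carrier M"
    unfolding lin_ext_def using \<phi> by (intro M.finsum_closed) (auto simp: free_mod_def Pi_def)
qed
qed

lemma lin_ext_fbasis:
  fixes M :: "('r,'m) module"
  assumes "module R M" and "\<one>\<^bsub>R\<^esub> \<noteq> \<zero>\<^bsub>R\<^esub>" "\<phi> x \<in> carrier M"
  shows "lin_ext R M \<phi> (fbasis R x) = \<phi> x"
proof -
  interpret M: module R M by fact
  have "lin_ext R M \<phi> (fbasis R x) = (\<Oplus>\<^bsub>M\<^esub>y\<in>{x}. fbasis R x y \<odot>\<^bsub>M\<^esub> \<phi> y)"
    using assms by (intro lin_ext_superset[OF assms(1)]) (auto simp: fbasis_def)
  then show ?thesis using assms by (simp add: fbasis_def)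
qed

section \<open>Chains modulo a prime\<close>

text \<open>
  Computations in free modules over \<open>Fp p\<close> are done with integer coefficients, in the free abelian
  groups of \<^theory>\<open>HOL-Library.Poly_Mapping\<close>, and reduced modulo \<open>p\<close>.
\<close>

definition red :: "nat \<Rightarrow> ('x \<Rightarrow>\<^sub>0 int) \<Rightarrow> 'x \<Rightarrow> int" where
  "red p c = (\<lambda>x. poly_mapping.lookup c x mod int p)"

text \<open>An element of a free module over \<open>Fp p\<close> is itself a finitely supported
  integer function, which serves as its integral lift; by \<open>lft_red\<close> below any other
  lift gives the same result.\<close>

definition lft :: "nat \<Rightarrow> ('x \<Rightarrow> 'y \<Rightarrow>\<^sub>0 int) \<Rightarrow> ('x \<Rightarrow> int) \<Rightarrow> 'y \<Rightarrow> int" where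
  "lft p \<phi> f = red p (frag_extend \<phi> (Abs_poly_mapping f))"

lemma lookup_frag_extend:
  "finite B \<Longrightarrow> Poly_Mapping.keys c \<subseteq> B \<Longrightarrow> poly_mapping.lookup (frag_extend \<phi> c) y =
     (\<Sum>x\<in>B. poly_mapping.lookup c x * poly_mapping.lookup (\<phi> x) y)"
  unfolding frag_extend_def lookup_sum
  by (rule sum.mono_neutral_cong_left) (auto simp: in_keys_iff)

lemma frag_extend_frag_extend:
  "frag_extend \<psi> (frag_extend \<phi> c) = frag_extend (\<lambda>x. frag_extend \<psi> (\<phi> x)) c"
  using subset_UNIV[of "Poly_Mapping.keys c"] by (induction c rule: frag_induction) (auto simp: frag_extend_diff)

lemma frag_extend_fun_add: "frag_extend (\<lambda>x. \<phi> x + \<psi> x) c = frag_extend \<phi> c + frag_extend \<psi> c"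
  using subset_UNIV[of "Poly_Mapping.keys c"] by (induction c rule: frag_induction) (auto simp: frag_extend_diff)

lemma frag_extend_fun_diff: "frag_extend (\<lambda>x. \<phi> x - \<psi> x) c = frag_extend \<phi> c - frag_extend \<psi> c"
  using subset_UNIV[of "Poly_Mapping.keys c"] by (induction c rule: frag_induction) (auto simp: frag_extend_diff)

lemma frag_extend_fun_minus: "frag_extend (\<lambda>x. - \<phi> x) c = - frag_extend \<phi> c"
  using subset_UNIV[of "Poly_Mapping.keys c"] by (induction c rule: frag_induction) (auto simp: frag_extend_diff)

lemma frag_extend_fun_cmul: "frag_extend (\<lambda>x. frag_cmul k (\<phi> x)) c = frag_cmul k (frag_extend \<phi> c)"
  by (simp add: frag_extend_def frag_cmul_sum mult.commute)

text \<open>Chains congruent modulo \<open>p\<close> may have different supports, so both extensions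
  are evaluated as sums over the union of the two.\<close>

lemma red_frag_extend_cong:
  assumes "\<And>x. x \<in> Poly_Mapping.keys c \<union> Poly_Mapping.keys d \<Longrightarrow> red p (\<phi> x) = red p (\<psi> x)"
    and "red p c = red p d"
  shows "red p (frag_extend \<phi> c) = red p (frag_extend \<psi> d)"
proof
  fix y
  define B where "B = Poly_Mapping.keys c \<union> Poly_Mapping.keys d"
  have "(\<Sum>x\<in>B. poly_mapping.lookup c x * poly_mapping.lookup (\<phi> x) y) mod int p =
    (\<Sum>x\<in>B. poly_mapping.lookup d x * poly_mapping.lookup (\<psi> x) y) mod int p"
    by (subst (1 2) mod_sum_eq[symmetric], rule arg_cong[where f = "\<lambda>k. k mod int p"], rule sum.cong)
      (use assms in \<open>auto simp: red_def fun_eq_iff B_def intro!: mod_mult_cong\<close>)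
  then show "red p (frag_extend \<phi> c) y = red p (frag_extend \<psi> d) y"
    by (subst (1 2) red_def) (subst (1 2) lookup_frag_extend[of B], auto simp: B_def)
qed

lemma red_add_cong: "red p a = red p a' \<Longrightarrow> red p b = red p b' \<Longrightarrow> red p (a + b) = red p (a' + b')"
  by (auto simp: red_def fun_eq_iff lookup_add intro: mod_add_cong)

lemma red_diff_cong: "red p a = red p a' \<Longrightarrow> red p b = red p b' \<Longrightarrow> red p (a - b) = red p (a' - b')"
  by (auto simp: red_def fun_eq_iff lookup_minus intro: mod_diff_cong)

lemma red_cmul_cong:
  "k mod int p = l mod int p \<Longrightarrow> red p a = red p b \<Longrightarrow> red p (frag_cmul k a) = red p (frag_cmul l b)"
  by (auto simp: red_def fun_eq_iff intro: mod_mult_cong)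

locale mod_prime =
  fixes p :: nat
  assumes prime_p: "Factorial_Ring.prime p"
begin

sublocale Fp: residues_prime p "Fp p"
  by unfold_locales (rule prime_p, simp)

lemma p_gt_1: "1 < p"
  using prime_p by (rule prime_gt_1_nat)

abbreviation free :: "'x set \<Rightarrow> (int, 'x \<Rightarrow> int) module" where
  "free S \<equiv> free_mod (Fp p) S"

lemma Fp_cring: "cring (Fp p)" ..

lemma Fp_simps:
  "carrier (Fp p) = {0..int p - 1}" "\<zero>\<^bsub>Fp p\<^esub> = 0" "\<one>\<^bsub>Fp p\<^esub> = 1"
  "x \<oplus>\<^bsub>Fp p\<^esub> y = (x + y) mod int p" "x \<otimes>\<^bsub>Fp p\<^esub> y = (x * y) mod int p"
  by (simp_all add: residue_ring_def)

lemma free_module: "module (Fp p) (free S)"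
  by (rule free_mod_module[OF Fp_cring])

lemma free_simps:
  "f \<in> carrier (free S) \<longleftrightarrow> (\<forall>x. 0 \<le> f x \<and> f x < int p) \<and> finite {x. f x \<noteq> 0} \<and> {x. f x \<noteq> 0} \<subseteq> S"
  "\<zero>\<^bsub>free S\<^esub> = (\<lambda>_. 0)" "f \<oplus>\<^bsub>free S\<^esub> g = (\<lambda>x. (f x + g x) mod int p)"
  "a \<odot>\<^bsub>free S\<^esub> f = (\<lambda>x. (a * f x) mod int p)"
  by (auto simp: free_mod_def Fp_simps)

lemma red_carrier: "Poly_Mapping.keys c \<subseteq> S \<Longrightarrow> red p c \<in> carrier (free S)"
proof -
  assume c: "Poly_Mapping.keys c \<subseteq> S"
  have "{x. red p c x \<noteq> 0} \<subseteq> Poly_Mapping.keys c" by (auto simp: red_def in_keys_iff)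
  then show ?thesis
    using c p_gt_1 finite_subset[OF _ finite_keys[of c]] by (auto simp: free_simps red_def)
qed

text \<open>The coefficients already lie between 0 and p - 1, so reduction returns them
  unchanged.\<close>

lemma red_lift:
  assumes "f \<in> carrier (free S)"
  shows "red p (Abs_poly_mapping f) = f" "Poly_Mapping.keys (Abs_poly_mapping f) \<subseteq> S"
proof -
  have "poly_mapping.lookup (Abs_poly_mapping f) = f"
    using assms by (intro Abs_poly_mapping_inverse) (auto simp: free_simps)
  then show "red p (Abs_poly_mapping f) = f" "Poly_Mapping.keys (Abs_poly_mapping f) \<subseteq> S"
    using assms by (auto simp: red_def free_simps in_keys_iff fun_eq_iff)
qed

lemma carrier_redE:
  assumes "f \<in> carrier (free S)"
  obtains c where "f = red p c" "Poly_Mapping.keys c \<subseteq> S"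
  using red_lift[OF assms] by metis

lemma red_zero: "red p 0 = \<zero>\<^bsub>free S\<^esub>"
  by (simp add: red_def free_simps)

lemma red_add: "red p (a + b) = red p a \<oplus>\<^bsub>free S\<^esub> red p b"
  by (simp add: red_def free_simps lookup_add mod_add_eq)

lemma red_cmul: "red p (frag_cmul k c) = k \<odot>\<^bsub>free S\<^esub> red p c"
  by (simp add: red_def free_simps mod_mult_right_eq)

lemma red_diff:
  assumes "Poly_Mapping.keys a \<subseteq> S" "Poly_Mapping.keys b \<subseteq> S"
  shows "red p (a - b) = red p a \<ominus>\<^bsub>free S\<^esub> red p b"
proof -
  interpret M: module "Fp p" "free S" by (rule free_module)
  have "red p (a - b) \<oplus>\<^bsub>free S\<^esub> red p b = red p a"
    unfolding red_add[symmetric] by simp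
  moreover have "Poly_Mapping.keys (a - b) \<subseteq> S" using assms keys_diff[of a b] by blast
  ultimately show ?thesis
    using assms red_carrier M.add.inv_solve_right by (metis a_minus_def)
qed

lemma red_sum:
  assumes "finite I" "\<And>i. i \<in> I \<Longrightarrow> Poly_Mapping.keys (c i) \<subseteq> S"
  shows "red p (\<Sum>i\<in>I. c i) = (\<Oplus>\<^bsub>free S\<^esub>i\<in>I. red p (c i))"
proof -
  interpret M: module "Fp p" "free S" by (rule free_module)
  show ?thesis
    using assms
    by (induction I rule: finite_induct)
      (auto simp: red_zero red_add[where S = S] Pi_def red_carrier)
qed

lemma fbasis_eq: "fbasis (Fp p) x = red p (frag_of x)"
  using p_gt_1 by (auto simp: fbasis_def red_def Fp_simps fun_eq_iff)

text \<open>In the residue ring the sign is represented by 1 or p - 1, which is congruent to the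
  integer (-1)^i.\<close>

lemma alt_sign_smult: "alt_sign (Fp p) i \<odot>\<^bsub>free S\<^esub> red p c = red p (frag_cmul ((-1) ^ i) c)"
proof -
  have "alt_sign (Fp p) i mod int p = (-1) ^ i mod int p"
  proof (induction i)
    case (Suc i)
    have "\<ominus>\<^bsub>Fp p\<^esub> 1 = (- 1) mod int p" using Fp.neg_cong[of 1] p_gt_1 by simp
    with Suc show ?case
      by (simp add: alt_sign_def Fp_simps nat_pow_def mod_simps mult.commute)
        (metis mod_minus_eq mult.commute mult_minus1 mod_mult_right_eq mod_mult_left_eq)
  qed (simp add: alt_sign_def Fp_simps nat_pow_def)
  then show ?thesis
    unfolding red_cmul[symmetric] by (intro red_cmul_cong) auto
qed

lemma lft_red: "red p c = f \<Longrightarrow> lft p \<phi> f = red p (frag_extend \<phi> c)"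
proof -
  assume f: "red p c = f"
  then have "f \<in> carrier (free UNIV)" using red_carrier[of c UNIV] by simp
  from red_lift(1)[OF this] show ?thesis
    unfolding lft_def using f by (intro red_frag_extend_cong) auto
qed

lemma keys_frag_extend_subset:
  "(\<And>x. x \<in> Poly_Mapping.keys c \<Longrightarrow> Poly_Mapping.keys (\<phi> x) \<subseteq> T) \<Longrightarrow>
     Poly_Mapping.keys (frag_extend \<phi> c) \<subseteq> T"
  using keys_frag_extend[of \<phi> c] by blast

lemma lft_hom:
  assumes "\<And>x. x \<in> S \<Longrightarrow> Poly_Mapping.keys (\<phi> x) \<subseteq> T"
  shows "lft p \<phi> \<in> lin_hom (Fp p) (free S) (free T)"
proof (rule lin_homI)
  fix f assume f: "f \<in> carrier (free S)"
  then obtain c where c: "f = red p c" "Poly_Mapping.keys c \<subseteq> S" by (rule carrier_redE)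
  then show "lft p \<phi> f \<in> carrier (free T)"
    unfolding c(1) lft_red[OF refl] by (intro red_carrier keys_frag_extend_subset assms) auto
  fix a show "lft p \<phi> (a \<odot>\<^bsub>free S\<^esub> f) = a \<odot>\<^bsub>free T\<^esub> lft p \<phi> f"
    by (simp add: c red_cmul[symmetric] lft_red[OF refl] frag_extend_cmul)
next
  fix f g assume "f \<in> carrier (free S)" "g \<in> carrier (free S)"
  then obtain c d where "f = red p c" "g = red p d" by (metis carrier_redE)
  then show "lft p \<phi> (f \<oplus>\<^bsub>free S\<^esub> g) = lft p \<phi> f \<oplus>\<^bsub>free T\<^esub> lft p \<phi> g"
    by (simp add: red_add[symmetric] lft_red[OF refl] frag_extend_add)
qed

text \<open>Integral lifts are generated from the basis by subtraction, so scalar multiples need no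
  separate case.\<close>

lemma lin_hom_eqI:
  assumes "module (Fp p) M" "h \<in> lin_hom (Fp p) (free S) M" "h' \<in> lin_hom (Fp p) (free S) M"
    and basis: "\<And>x. x \<in> S \<Longrightarrow> h (fbasis (Fp p) x) = h' (fbasis (Fp p) x)"
    and f: "f \<in> carrier (free S)"
  shows "h f = h' f"
proof -
  obtain c where c: "f = red p c" "Poly_Mapping.keys c \<subseteq> S" using f by (rule carrier_redE)
  have "Poly_Mapping.keys c \<subseteq> S \<and> h (red p c) = h' (red p c)"
    using c(2)
  proof (induction c rule: frag_induction)
    case zero
    show ?case
      using lin_hom_zero[OF free_module assms(1,2)] lin_hom_zero[OF free_module assms(1,3)]
      by (simp add: red_zero[where S = S])
  next
    case (one x)
    then show ?case using basis by (simp add: fbasis_eq)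
  next
    case (diff a b)
    then have "Poly_Mapping.keys (a - b) \<subseteq> S" using keys_diff[of a b] by blast
    with diff show ?case
      by (simp add: red_diff[where S = S] red_carrier lin_hom_diff[OF free_module assms(1,2)]
          lin_hom_diff[OF free_module assms(1,3)])
  qed
  then show ?thesis by (simp add: c(1))
qed

text \<open>The bridge from the module sums in the definitions to integral computations. Equality is
  claimed on the carrier, where both sides are linear maps determined by the basis.\<close>

lemma lin_ext_eq_lft:
  assumes \<psi>: "\<And>x. x \<in> S \<Longrightarrow> \<psi> x = red p (\<phi> x)"
    and keys: "\<And>x. x \<in> S \<Longrightarrow> Poly_Mapping.keys (\<phi> x) \<subseteq> T"
    and f: "f \<in> carrier (free S)"
  shows "lin_ext (Fp p) (free T) \<psi> f = lft p \<phi> f"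
proof -
  have \<psi>': "\<psi> x \<in> carrier (free T)" if "x \<in> S" for x
    using that by (simp add: \<psi> keys red_carrier)
  show ?thesis
  proof (rule lin_hom_eqI[OF free_module lin_ext_hom[OF free_module] lft_hom _ f])
    fix x assume x: "x \<in> S"
    have "lin_ext (Fp p) (free T) \<psi> (fbasis (Fp p) x) = \<psi> x"
      using x \<psi>' by (intro lin_ext_fbasis[OF free_module]) (auto simp: Fp_simps)
    also have "\<dots> = lft p \<phi> (fbasis (Fp p) x)"
      using x by (simp add: fbasis_eq lft_red[OF refl] \<psi>)
    finally show "lin_ext (Fp p) (free T) \<psi> (fbasis (Fp p) x) = lft p \<phi> (fbasis (Fp p) x)" .
  qed (use \<psi>' keys in auto)
qed

end


section \<open>The bar complex by recursion\<close>

lemma frag_linear_induct [case_names zero basis diff]: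
  "P 0 \<Longrightarrow> (\<And>x. P (frag_of x)) \<Longrightarrow> (\<And>a b. P a \<Longrightarrow> P b \<Longrightarrow> P (a - b)) \<Longrightarrow> P c"
  using subset_UNIV by (rule frag_induction[of c UNIV P]) auto

lemma frag_cmul_diff_right: "frag_cmul k (a - b) = frag_cmul k a - frag_cmul k b"
  by (rule poly_mapping_eqI) (simp add: lookup_minus algebra_simps)

abbreviation frag_map :: "('x \<Rightarrow> 'y) \<Rightarrow> ('x \<Rightarrow>\<^sub>0 int) \<Rightarrow> 'y \<Rightarrow>\<^sub>0 int" where
  "frag_map f \<equiv> frag_extend (\<lambda>x. frag_of (f x))"

definition cns :: "'a \<Rightarrow> ('a list \<Rightarrow>\<^sub>0 int) \<Rightarrow> 'a list \<Rightarrow>\<^sub>0 int" where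
  "cns a = frag_map ((#) a)"

lemma cns_simps [simp]:
  "cns a 0 = 0" "cns a (frag_of u) = frag_of (a # u)" "cns a (c + d) = cns a c + cns a d"
  "cns a (c - d) = cns a c - cns a d" "cns a (- c) = - cns a c"
  by (simp_all add: cns_def frag_extend_add frag_extend_diff frag_extend_minus)

lemma keys_cns: "Poly_Mapping.keys (cns a c) \<subseteq> (#) a ` Poly_Mapping.keys c"
  unfolding cns_def using keys_frag_extend[of "\<lambda>u. frag_of (a # u)" c] by (auto simp: keys_frag_of)

lemma frag_extend_cns: "frag_extend \<phi> (cns a c) = frag_extend (\<lambda>u. \<phi> (a # u)) c"
  by (simp add: cns_def frag_extend_frag_extend)

text \<open>
  The alternating sum of all faces of a bar simplex but \<open>d\<^sub>0\<close>, starting with a plus sign; up to a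
  shift of degree, this is the differential of the bar resolution.
\<close>

fun bar_e :: "('a,'b) monoid_scheme \<Rightarrow> 'a list \<Rightarrow> 'a list \<Rightarrow>\<^sub>0 int" where
  "bar_e G [] = 0"
| "bar_e G [a] = frag_of []"
| "bar_e G (a # b # u) = frag_of ((a \<otimes>\<^bsub>G\<^esub> b) # u) - cns a (bar_e G (b # u))"

fun bar_d :: "('a,'b) monoid_scheme \<Rightarrow> 'a list \<Rightarrow> 'a list \<Rightarrow>\<^sub>0 int" where
  "bar_d G [] = 0"
| "bar_d G (a # u) = frag_of u - bar_e G (a # u)"

text \<open>The recursion of \<open>bar_e\<close> extended to chains; two letters are split off
  because the first face in \<open>bar_e\<close> multiplies them.\<close>

lemma bar_e_cns_cns:
  "frag_extend (bar_e G) (cns a (cns b c)) =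
     cns (a \<otimes>\<^bsub>G\<^esub> b) c - cns a (frag_extend (bar_e G) (cns b c))"
  by (induction c rule: frag_linear_induct) (auto simp: frag_extend_diff)

lemma bar_d_cns: "frag_extend (bar_d G) (cns a c) = c - frag_extend (bar_e G) (cns a c)"
  by (induction c rule: frag_linear_induct) (auto simp: frag_extend_diff)

lemma bar_e_keys:
  assumes "monoid G" "set w \<subseteq> carrier G" "u \<in> Poly_Mapping.keys (bar_e G w)"
  shows "Suc (length u) = length w \<and> set u \<subseteq> carrier G"
  using assms(2,3)
proof (induction w arbitrary: u rule: induct_list012)
  case (3 a b v)
  interpret monoid G by fact
  have "u = (a \<otimes>\<^bsub>G\<^esub> b) # v \<or> u \<in> (#) a ` Poly_Mapping.keys (bar_e G (b # v))"
    using "3.prems"(2) keys_diff[of "frag_of ((a \<otimes>\<^bsub>G\<^esub> b) # v)" "cns a (bar_e G (b # v))"]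
      keys_cns[of a "bar_e G (b # v)"] by (auto simp: keys_frag_of)
  then show ?case
  proof (elim disjE imageE)
    fix x assume "u = a # x" "x \<in> Poly_Mapping.keys (bar_e G (b # v))"
    then show ?thesis using "3.prems"(1) "3.IH"(2)[of x] by simp
  qed (use "3.prems"(1) in auto)
qed (auto simp: keys_frag_of)

lemma bar_d_keys:
  assumes "monoid G" "set w \<subseteq> carrier G" "u \<in> Poly_Mapping.keys (bar_d G w)"
  shows "Suc (length u) = length w \<and> set u \<subseteq> carrier G"
proof (cases w)
  case (Cons a v)
  then have "u = v \<or> u \<in> Poly_Mapping.keys (bar_e G w)"
    using assms(3) keys_diff[of "frag_of v" "bar_e G w"] by (auto simp: keys_frag_of)
  then show ?thesis using bar_e_keys[OF assms(1,2)] assms(2) Cons by auto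
qed (use assms in auto)

text \<open>The hypothesis for the shorter word, solved for \<open>bar_e\<close> of the word in
  which \<open>h\<close> and \<open>k\<close> are multiplied, leaves terms that cancel in pairs, one
  pair by associativity. The recursion thus avoids double sums over face indices.\<close>

lemma bar_e_bar_e:
  assumes "monoid G" "set w \<subseteq> carrier G"
  shows "frag_extend (bar_e G) (bar_e G w) = 0"
  using assms(2)
proof (induction w rule: induct_list012)
  case (3 g h v)
  interpret monoid G by fact
  show ?case
  proof (cases v)
    case (Cons k u)
    have c: "g \<in> carrier G" "h \<in> carrier G" "k \<in> carrier G" using "3.prems" Cons by auto
    have "frag_extend (bar_e G) (bar_e G (h # v)) = 0" using 3 by simp
    then have IH: "bar_e G ((h \<otimes>\<^bsub>G\<^esub> k) # u) = frag_extend (bar_e G) (cns h (bar_e G (k # u)))"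
      using Cons by (simp add: frag_extend_diff)
    show ?thesis
      using c by (simp add: Cons frag_extend_diff bar_e_cns_cns IH m_assoc)
  qed (simp add: frag_extend_diff)
qed auto

text \<open>As \<open>bar_d\<close> is d_0 minus \<open>bar_e\<close>, the vanishing square of
  \<open>bar_e\<close> leaves only the zeroth faces of \<open>bar_e G (g # w)\<close>. The square of
  \<open>bar_d\<close> then cancels at once.\<close>

lemma bar_d_bar_e:
  assumes "monoid G" "set (g # w) \<subseteq> carrier G"
  shows "frag_extend (bar_d G) (bar_e G (g # w)) = bar_d G w"
proof (cases w)
  case (Cons h v)
  have "frag_extend (bar_e G) (bar_e G (g # h # v)) = 0"
    using bar_e_bar_e[OF assms] Cons by simp
  then show ?thesis by (simp add: Cons frag_extend_diff bar_d_cns)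
qed simp

lemma bar_d_bar_d:
  assumes "monoid G" "set w \<subseteq> carrier G"
  shows "frag_extend (bar_d G) (bar_d G w) = 0"
  using assms bar_d_bar_e[OF assms(1)] by (cases w) (auto simp: frag_extend_diff)

text \<open>Stated for maps multiplicative on the carrier, to cover projections and the diagonal of
  \<open>G \<times>\<times> G\<close> as well as \<open>\<nu>\<close>, \<open>\<iota>\<close> and
  the partial inverse of \<open>\<iota>\<close>.\<close>

lemma bar_e_map:
  assumes "\<And>a b. a \<in> carrier G \<Longrightarrow> b \<in> carrier G \<Longrightarrow> f (a \<otimes>\<^bsub>G\<^esub> b) = f a \<otimes>\<^bsub>H\<^esub> f b"
    and "set w \<subseteq> carrier G"
  shows "frag_map (map f) (bar_e G w) = bar_e H (map f w)"
  using assms(2)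
proof (induction w rule: induct_list012)
  case (3 a b u)
  have "frag_map (map f) (cns a c) = cns (f a) (frag_map (map f) c)" for c
    by (simp add: frag_extend_cns cns_def frag_extend_frag_extend)
  then show ?case using 3 assms(1) by (simp add: frag_extend_diff)
qed auto

lemma bar_d_map:
  assumes "\<And>a b. a \<in> carrier G \<Longrightarrow> b \<in> carrier G \<Longrightarrow> f (a \<otimes>\<^bsub>G\<^esub> b) = f a \<otimes>\<^bsub>H\<^esub> f b"
    and "set w \<subseteq> carrier G"
  shows "frag_map (map f) (bar_d G w) = bar_d H (map f w)"
  using bar_e_map[OF assms] by (cases w) (auto simp: frag_extend_diff)


section \<open>The action groupoid and its retraction\<close>

text \<open>
  Simplices of the nerve of the action groupoid of a right action of \<open>G\<close>: a base point together with
  a bar simplex.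
\<close>

abbreviation at_base :: "'b \<Rightarrow> ('a list \<Rightarrow>\<^sub>0 int) \<Rightarrow> 'b \<times> 'a list \<Rightarrow>\<^sub>0 int" where
  "at_base x \<equiv> frag_map (Pair x)"

text \<open>The zeroth face drops the arrow that starts at the base point and so moves the base
  point to the end of that arrow; every other face keeps it.\<close>

fun act_d :: "('a,'c) monoid_scheme \<Rightarrow> ('b \<Rightarrow> 'a \<Rightarrow> 'b) \<Rightarrow> 'b \<times> 'a list \<Rightarrow> 'b \<times> 'a list \<Rightarrow>\<^sub>0 int" where
  "act_d G act (x, []) = 0"
| "act_d G act (x, g # w) = frag_of (act x g, w) - at_base x (bar_e G (g # w))"

lemma act_d_at_base_cns:
  "frag_extend (act_d G act) (at_base x (cns g c)) =
     at_base (act x g) c - at_base x (frag_extend (bar_e G) (cns g c))"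
  by (induction c rule: frag_linear_induct) (auto simp: frag_extend_diff)

locale right_action = group G for G :: "('a,'c) monoid_scheme" (structure) +
  fixes act :: "'b \<Rightarrow> 'a \<Rightarrow> 'b" and S :: "'b set"
  assumes act_closed: "x \<in> S \<Longrightarrow> g \<in> carrier G \<Longrightarrow> act x g \<in> S"
    and act_mult: "x \<in> S \<Longrightarrow> g \<in> carrier G \<Longrightarrow> h \<in> carrier G \<Longrightarrow> act x (g \<otimes> h) = act (act x g) h"
begin

lemma act_d_keys:
  assumes "x \<in> S" "set w \<subseteq> carrier G" "(y, u) \<in> Poly_Mapping.keys (act_d G act (x, w))"
  shows "y \<in> S \<and> Suc (length u) = length w \<and> set u \<subseteq> carrier G"
proof (cases w)
  case (Cons g v)
  have "(y, u) = (act x g, v) \<or> (y, u) \<in> Poly_Mapping.keys (at_base x (bar_e G w))"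
    using assms(3) Cons keys_diff[of "frag_of (act x g, v)" "at_base x (bar_e G w)"]
    by (auto simp: keys_frag_of)
  moreover have "Poly_Mapping.keys (at_base x (bar_e G w)) \<subseteq> Pair x ` Poly_Mapping.keys (bar_e G w)"
    using keys_frag_extend[of "\<lambda>u. frag_of (x, u)" "bar_e G w"] by (auto simp: keys_frag_of)
  ultimately show ?thesis
    using bar_e_keys[OF is_monoid assms(2)] act_closed assms(1,2) Cons by auto
qed (use assms in auto)

text \<open>Over a fixed base point this is the vanishing square of \<open>bar_e\<close>; the terms
  in which the base point moves along two arrows, at once or one after the other, match because
  \<open>act\<close> is an action.\<close>

lemma act_d_act_d:
  assumes "x \<in> S" "set w \<subseteq> carrier G"
  shows "frag_extend (act_d G act) (act_d G act (x, w)) = 0"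
proof (cases w)
  case (Cons g v)
  have "frag_extend (act_d G act) (at_base x (bar_e G (g # v))) = act_d G act (act x g, v)"
  proof (cases v)
    case v: (Cons h u)
    have "frag_extend (bar_e G) (bar_e G (g # h # u)) = 0"
      using bar_e_bar_e[OF is_monoid assms(2)] Cons v by simp
    then have "bar_e G ((g \<otimes> h) # u) = frag_extend (bar_e G) (cns g (bar_e G (h # u)))"
      by (simp add: frag_extend_diff)
    then show ?thesis
      using assms Cons v act_mult[of x g h] by (simp add: frag_extend_diff act_d_at_base_cns)
  qed simp
  then show ?thesis by (simp add: Cons frag_extend_diff)
qed simp

end

text \<open>
  \<open>c\<close> is the functor from the action groupoid to \<open>G\<close>, viewed as the endomorphisms of the base point
  \<open>o'\<close>, that conjugation by the isomorphisms \<open>\<eta> x\<close> from \<open>x\<close> to \<open>o'\<close> gives.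
\<close>

locale action_retract = right_action G act S
  for G :: "('a,'c) monoid_scheme" (structure) and act :: "'b \<Rightarrow> 'a \<Rightarrow> 'b" and S :: "'b set" +
  fixes \<eta> :: "'b \<Rightarrow> 'a" and o' :: 'b and c :: "'b \<Rightarrow> 'a \<Rightarrow> 'a"
  assumes \<eta>_closed: "x \<in> S \<Longrightarrow> \<eta> x \<in> carrier G"
    and c_closed: "x \<in> S \<Longrightarrow> g \<in> carrier G \<Longrightarrow> c x g \<in> carrier G"
    and act_\<eta>: "x \<in> S \<Longrightarrow> act x (\<eta> x) = o'"
    and c_mult: "x \<in> S \<Longrightarrow> g \<in> carrier G \<Longrightarrow> h \<in> carrier G \<Longrightarrow> c x (g \<otimes> h) = c x g \<otimes> c (act x g) h"
    and c_natural: "x \<in> S \<Longrightarrow> g \<in> carrier G \<Longrightarrow> g \<otimes> \<eta> (act x g) = \<eta> x \<otimes> c x g"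
begin

fun rt :: "'b \<Rightarrow> 'a list \<Rightarrow> 'a list" where
  "rt x [] = []"
| "rt x (g # w) = c x g # rt (act x g) w"

text \<open>The prism operator of the natural isomorphism \<open>\<eta>\<close>: unfolded, it is the
  alternating sum over the places at which \<open>\<eta>\<close> can be inserted, with the original
  arrows before it and their images under \<open>c\<close> after it.\<close>

fun htp :: "'b \<Rightarrow> 'a list \<Rightarrow> 'a list \<Rightarrow>\<^sub>0 int" where
  "htp x [] = frag_of [\<eta> x]"
| "htp x (g # w) = frag_of (\<eta> x # rt x (g # w)) - cns g (htp (act x g) w)"

lemma rt_closed: "x \<in> S \<Longrightarrow> set w \<subseteq> carrier G \<Longrightarrow> set (rt x w) \<subseteq> carrier G"
  by (induction w arbitrary: x) (simp_all add: c_closed act_closed)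

lemma length_rt [simp]: "length (rt x w) = length w"
  by (induction w arbitrary: x) auto

lemma rt_cns: "frag_map (rt x) (cns g d) = cns (c x g) (frag_map (rt (act x g)) d)"
  by (induction d rule: frag_linear_induct) (auto simp: frag_extend_diff)

lemma rt_bar_e:
  "x \<in> S \<Longrightarrow> set w \<subseteq> carrier G \<Longrightarrow> frag_map (rt x) (bar_e G w) = bar_e G (rt x w)"
proof (induction w arbitrary: x rule: induct_list012)
  case (3 g h v)
  then show ?case
    by (simp add: frag_extend_diff rt_cns act_mult c_mult act_closed)
qed auto

lemma htp_keys:
  assumes "x \<in> S" "set w \<subseteq> carrier G" "u \<in> Poly_Mapping.keys (htp x w)"
  shows "length u = Suc (length w) \<and> set u \<subseteq> carrier G"
  using assms
proof (induction w arbitrary: x u)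
  case (Cons g w)
  have "u = \<eta> x # rt x (g # w) \<or> u \<in> (#) g ` Poly_Mapping.keys (htp (act x g) w)"
    using Cons.prems(3) keys_diff[of "frag_of (\<eta> x # rt x (g # w))" "cns g (htp (act x g) w)"]
      keys_cns[of g "htp (act x g) w"] by (auto simp: keys_frag_of)
  then show ?case
  proof (elim disjE imageE)
    assume "u = \<eta> x # rt x (g # w)"
    then show ?thesis using Cons.prems \<eta>_closed rt_closed[of x "g # w"] by simp
  next
    fix v assume "u = g # v" "v \<in> Poly_Mapping.keys (htp (act x g) w)"
    then show ?thesis using Cons.prems Cons.IH[of "act x g" v] act_closed by simp
  qed
qed (simp add: keys_frag_of \<eta>_closed)

lemma htp_cns:
  "frag_extend (htp x) (cns g d) =
     cns (\<eta> x) (frag_map (rt x) (cns g d)) - cns g (frag_extend (htp (act x g)) d)"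
  by (induction d rule: frag_linear_induct) (auto simp: frag_extend_diff)

text \<open>The homotopy formula with all zeroth faces left out, which makes it a statement about
  words over a fixed base point. Neighbouring prisms share the face in which \<open>\<eta>\<close>
  is multiplied with the adjacent arrow, by naturality.\<close>

lemma htp_bar_e:
  "x \<in> S \<Longrightarrow> set w \<subseteq> carrier G \<Longrightarrow> w \<noteq> [] \<Longrightarrow>
     frag_extend (bar_e G) (htp x w) + frag_extend (htp x) (bar_e G w) = frag_of w"
proof (induction w arbitrary: x rule: induct_list012)
  case (2 g)
  then show ?case by (simp add: frag_extend_diff c_natural)
next
  case (3 g h v)
  define y where "y = act x g"
  define z where "z = act y h"
  have y: "y \<in> S" using 3 by (simp add: y_def act_closed)
  have IH: "frag_extend (bar_e G) (htp y (h # v)) = frag_of (h # v) - frag_extend (htp y) (bar_e G (h # v))"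
    using 3 y by (simp add: algebra_simps)
  have nat: "g \<otimes> \<eta> y = \<eta> x \<otimes> c x g"
    using 3 by (simp add: y_def c_natural)
  have e1: "bar_e G (\<eta> x # rt x (g # h # v)) =
      frag_of ((\<eta> x \<otimes> c x g) # rt y (h # v)) - cns (\<eta> x) (bar_e G (rt x (g # h # v)))"
    by (simp add: y_def)
  have e2: "frag_extend (bar_e G) (cns g (htp y (h # v))) =
      frag_of ((g \<otimes> \<eta> y) # rt y (h # v)) - cns (g \<otimes> h) (htp z v) - cns g (frag_extend (bar_e G) (htp y (h # v)))"
    by (simp add: z_def frag_extend_diff bar_e_cns_cns)
  have rt: "rt x ((g \<otimes> h) # v) = c x (g \<otimes> h) # rt z v" "act x (g \<otimes> h) = z"
    using 3 by (auto simp: z_def y_def act_mult)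
  have e3: "frag_extend (htp x) (bar_e G (g # h # v)) =
      cns (\<eta> x) (frag_map (rt x) (bar_e G (g # h # v))) - cns (g \<otimes> h) (htp z v)
        + cns g (frag_extend (htp y) (bar_e G (h # v)))"
    by (simp add: frag_extend_diff htp_cns rt y_def[symmetric] del: rt.simps)
  have "htp x (g # h # v) = frag_of (\<eta> x # rt x (g # h # v)) - cns g (htp y (h # v))"
    by (simp add: y_def)
  then show ?case
    using 3 rt_bar_e[of x "g # h # v"]
    by (simp add: frag_extend_diff e1 e2 e3 IH nat del: rt.simps bar_e.simps htp.simps)
qed auto

text \<open>Restores the zeroth faces in \<open>htp_bar_e\<close>. That of the first prism starts at
  the end \<open>o'\<close> of \<open>\<eta> x\<close> and is the retracted simplex; those of the
  other prisms cancel against the homotopy applied to the zeroth face of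
  \<open>(x, w)\<close>.\<close>

lemma act_htp:
  assumes "x \<in> S" "set w \<subseteq> carrier G"
  shows "frag_extend (act_d G act) (at_base x (htp x w)) +
      frag_extend (\<lambda>(y, u). at_base y (htp y u)) (act_d G act (x, w)) =
    frag_of (o', rt x w) - frag_of (x, w)"
proof (cases w)
  case Nil
  then show ?thesis using assms by (simp add: act_\<eta>)
next
  case (Cons g v)
  define P where "P = at_base x (frag_extend (bar_e G) (htp x (g # v)))"
  define Q where "Q = at_base x (frag_extend (htp x) (bar_e G (g # v)))"
  have "frag_extend (\<lambda>(y, u). at_base y (htp y u)) (at_base x d) = at_base x (frag_extend (htp x) d)" for d
    by (simp add: frag_extend_frag_extend)
  then have "frag_extend (\<lambda>(y, u). at_base y (htp y u)) (act_d G act (x, g # v)) =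
      at_base (act x g) (htp (act x g) v) - Q"
    by (simp add: Q_def frag_extend_diff del: bar_e.simps)
  moreover have "at_base x (frag_of (g # v)) = P + Q"
    using htp_bar_e[of x "g # v"] assms Cons unfolding P_def Q_def frag_extend_add[symmetric]
    by simp
  then have "frag_of (x, g # v) = P + Q" by simp
  moreover have "frag_extend (act_d G act) (at_base x (htp x (g # v))) =
      frag_of (o', rt x (g # v)) - at_base (act x g) (htp (act x g) v) - P"
    using assms by (simp add: P_def frag_extend_diff frag_extend_add act_d_at_base_cns act_\<eta> algebra_simps)
  ultimately show ?thesis
    by (simp add: Cons del: htp.simps rt.simps act_d.simps)
qed

text \<open>Retracted simplices all live over the single object \<open>o'\<close>, so forgetting the
  base point turns the differential of the groupoid into that of the bar complex.\<close>

lemma rt_act_d: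
  assumes "x \<in> S" "set w \<subseteq> carrier G"
  shows "frag_extend (\<lambda>(y, u). frag_of (rt y u)) (act_d G act (x, w)) = bar_d G (rt x w)"
proof (cases w)
  case (Cons g v)
  have "frag_extend (\<lambda>(y, u). frag_of (rt y u)) (at_base x d) = frag_map (rt x) d" for d
    by (simp add: frag_extend_frag_extend)
  then show ?thesis
    using rt_bar_e[OF assms] by (simp add: Cons frag_extend_diff del: bar_e.simps)
qed simp

end


section \<open>Tensor products and the Alexander--Whitney map\<close>

text \<open>
  \<open>tens i c d\<close> is \<open>c \<otimes> d\<close>, for \<open>c\<close> of degree \<open>i\<close>.
\<close>

definition tens :: "nat \<Rightarrow> ('x \<Rightarrow>\<^sub>0 int) \<Rightarrow> ('y \<Rightarrow>\<^sub>0 int) \<Rightarrow> nat \<times> 'x \<times> 'y \<Rightarrow>\<^sub>0 int" where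
  "tens i c d = frag_extend (\<lambda>x. frag_map (\<lambda>y. (i, x, y)) d) c"

lemma tens_of [simp]: "tens i (frag_of x) (frag_of y) = frag_of (i, x, y)"
  by (simp add: tens_def)

lemma tens_bilinear [simp]:
  "tens i 0 d = 0" "tens i c 0 = 0"
  "tens i (c + c') d = tens i c d + tens i c' d" "tens i c (d + d') = tens i c d + tens i c d'"
  "tens i (c - c') d = tens i c d - tens i c' d" "tens i c (d - d') = tens i c d - tens i c d'"
  "tens i (- c) d = - tens i c d" "tens i c (- d) = - tens i c d"
  "tens i (frag_cmul k c) d = frag_cmul k (tens i c d)" "tens i c (frag_cmul k d) = frag_cmul k (tens i c d)"
  by (simp_all add: tens_def frag_extend_add frag_extend_diff frag_extend_minus frag_extend_cmul
      frag_extend_fun_add frag_extend_fun_diff frag_extend_fun_minus frag_extend_fun_cmul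
      frag_extend_eq_0)

lemma frag_extend_tens:
  "frag_extend \<phi> (tens i c d) = frag_extend (\<lambda>x. frag_extend (\<lambda>y. \<phi> (i, x, y)) d) c"
  by (simp add: tens_def frag_extend_frag_extend)

lemma frag_extend_tens_tens:
  "frag_extend (\<lambda>(j, x, y). tens (f j) (\<phi> x) (\<psi> y)) (tens i c d) =
     tens (f i) (frag_extend \<phi> c) (frag_extend \<psi> d)"
proof (induction c rule: frag_linear_induct)
  case (basis x)
  show ?case by (induction d rule: frag_linear_induct) (auto simp: frag_extend_diff)
qed (auto simp: frag_extend_diff)

fun tensor_d :: "('a,'b) monoid_scheme \<Rightarrow> nat \<times> 'a list \<times> 'a list \<Rightarrow> nat \<times> 'a list \<times> 'a list \<Rightarrow>\<^sub>0 int" where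
  "tensor_d G (i, u, v) =
     tens (i - 1) (bar_d G u) (frag_of v) + frag_cmul ((-1) ^ i) (tens i (frag_of u) (bar_d G v))"

text \<open>The differential without d_0 of the left factor. It is what can be computed under
  \<open>tensor_cns\<close>, as \<open>bar_e\<close> can under \<open>cns\<close>; but it enters
  \<open>tensor_d\<close> with a plus sign, whereas \<open>bar_e\<close> enters \<open>bar_d\<close>
  with a minus sign.\<close>

fun tensor_e :: "('a,'b) monoid_scheme \<Rightarrow> nat \<times> 'a list \<times> 'a list \<Rightarrow> nat \<times> 'a list \<times> 'a list \<Rightarrow>\<^sub>0 int" where
  "tensor_e G (i, u, v) =
     frag_cmul ((-1) ^ i) (tens i (frag_of u) (bar_d G v)) - tens (i - 1) (bar_e G u) (frag_of v)"

fun tensor_tl :: "nat \<times> 'a list \<times> 'a list \<Rightarrow> nat \<times> 'a list \<times> 'a list \<Rightarrow>\<^sub>0 int" where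
  "tensor_tl (i, [], v) = 0"
| "tensor_tl (i, a # u, v) = frag_of (i - 1, u, v)"

lemma tensor_d_eq: "tensor_d G t = tensor_tl t + tensor_e G t"
  by (cases t rule: tensor_tl.cases) auto

definition tensor_cns :: "'a \<Rightarrow> (nat \<times> 'a list \<times> 'a list \<Rightarrow>\<^sub>0 int) \<Rightarrow> nat \<times> 'a list \<times> 'a list \<Rightarrow>\<^sub>0 int" where
  "tensor_cns a = frag_map (\<lambda>(i, u, v). (Suc i, a # u, v))"

lemma tensor_cns_simps [simp]:
  "tensor_cns a 0 = 0" "tensor_cns a (frag_of (i, u, v)) = frag_of (Suc i, a # u, v)"
  "tensor_cns a (c + d) = tensor_cns a c + tensor_cns a d"
  "tensor_cns a (c - d) = tensor_cns a c - tensor_cns a d" "tensor_cns a (- c) = - tensor_cns a c"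
  "tensor_cns a (frag_cmul k c) = frag_cmul k (tensor_cns a c)"
  by (simp_all add: tensor_cns_def frag_extend_add frag_extend_diff frag_extend_minus frag_extend_cmul)

lemma tensor_cns_tens [simp]: "tensor_cns a (tens i c d) = tens (Suc i) (cns a c) d"
proof (induction c rule: frag_linear_induct)
  case (basis x)
  show ?case by (induction d rule: frag_linear_induct) auto
qed auto

lemma tensor_e_cns_cns:
  "frag_extend (tensor_e G) (tensor_cns a (tensor_cns b c)) =
     - tensor_cns (a \<otimes>\<^bsub>G\<^esub> b) c - tensor_cns a (frag_extend (tensor_e G) (tensor_cns b c))"
proof (induction c rule: frag_linear_induct)
  case (basis t)
  then show ?case by (cases t) simp
qed (auto simp: frag_extend_diff)

lemma tensor_e_cns_nil:
  "frag_extend (tensor_e G) (tensor_cns a (frag_of (0, [], v))) =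
     - frag_of (0, [], v) - tensor_cns a (tensor_e G (0, [], v))"
  by simp

text \<open>
  A simplex of the product of the nerve of \<open>G\<close> with itself is written as a list of pairs, that is, as
  a simplex of the nerve of \<open>G \<times> G\<close>.
\<close>

fun aw :: "('a \<times> 'a) list \<Rightarrow> nat \<times> 'a list \<times> 'a list \<Rightarrow>\<^sub>0 int" where
  "aw [] = frag_of (0, [], [])"
| "aw (z # zs) = frag_of (0, [], map snd (z # zs)) + tensor_cns (fst z) (aw zs)"

text \<open>The closed form matches the front and back faces of \<open>alexander_whitney\<close>;
  the recursion is what the inductions use.\<close>

lemma aw_eq: "aw z = (\<Sum>i\<le>length z. frag_of (i, take i (map fst z), drop i (map snd z)))"
proof (induction z)
  case (Cons a z)
  have "tensor_cns x (\<Sum>i\<in>I. f i) = (\<Sum>i\<in>I. tensor_cns x (f i))"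
    if "finite I" for x :: 'a and f and I :: "nat set"
    using that by (induction I rule: finite_induct) auto
  then show ?case
    by (simp add: Cons sum.atMost_Suc_shift del: sum.atMost_Suc)
qed simp

lemma aw_cns:
  "frag_extend aw (cns z c) = tens 0 (frag_of []) (cns (snd z) (frag_map (map snd) c))
     + tensor_cns (fst z) (frag_extend aw c)"
  by (induction c rule: frag_linear_induct) (auto simp: frag_extend_diff)

text \<open>The chain map property with d_0 removed on both sides, where induction on the word
  works. The minus sign is that of \<open>bar_e\<close> in \<open>bar_d\<close>.\<close>

lemma aw_bar_e:
  assumes "set z \<subseteq> carrier G \<times> carrier G" "z \<noteq> []"
  shows "frag_extend (tensor_e G) (aw z) = - frag_extend aw (bar_e (G \<times>\<times> G) z)"
  using assms
proof (induction z rule: induct_list012)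
  case (2 z)
  then show ?case by (simp add: frag_extend_add frag_extend_diff)
next
  case (3 z z' w)
  define ys where "ys = map snd (z' # w)"
  have IH: "frag_extend aw (bar_e (G \<times>\<times> G) (z' # w)) = - frag_extend (tensor_e G) (aw (z' # w))"
    using 3 by simp
  have e: "frag_map (map snd) (bar_e (G \<times>\<times> G) (z' # w)) = bar_e G ys"
    unfolding ys_def using "3.prems" by (intro bar_e_map) auto
  have "frag_extend aw (bar_e (G \<times>\<times> G) (z # z' # w)) =
      frag_of (0, [], (snd z \<otimes>\<^bsub>G\<^esub> snd z') # map snd w) + tensor_cns (fst z \<otimes>\<^bsub>G\<^esub> fst z') (aw w)
      - (tens 0 (frag_of []) (cns (snd z) (bar_e G ys)) - tensor_cns (fst z) (frag_extend (tensor_e G) (aw (z' # w))))"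
  proof -
    have "frag_extend aw (bar_e (G \<times>\<times> G) (z # z' # w)) =
        aw ((z \<otimes>\<^bsub>G \<times>\<times> G\<^esub> z') # w) - frag_extend aw (cns z (bar_e (G \<times>\<times> G) (z' # w)))"
      by (simp add: frag_extend_diff del: aw.simps)
    then show ?thesis
      unfolding aw_cns e IH by (cases z; cases z') simp
  qed
  moreover have "frag_extend (tensor_e G) (aw (z # z' # w)) =
      tensor_e G (0, [], snd z # ys) + frag_extend (tensor_e G) (tensor_cns (fst z) (frag_of (0, [], ys)))
      + frag_extend (tensor_e G) (tensor_cns (fst z) (tensor_cns (fst z') (aw w)))"
    by (simp add: ys_def frag_extend_add del: tensor_e.simps)
  ultimately show ?case
    unfolding tensor_e_cns_nil tensor_e_cns_cns
    by (simp add: ys_def frag_extend_add del: bar_e.simps(3)) (simp add: algebra_simps)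
qed auto

text \<open>Beyond \<open>aw_bar_e\<close> only d_0 is left: in the left factor it kills the summand
  with empty front face and turns the others into \<open>aw\<close> of the tail.\<close>

lemma aw_bar_d:
  assumes "set z \<subseteq> carrier G \<times> carrier G"
  shows "frag_extend (tensor_d G) (aw z) = frag_extend aw (bar_d (G \<times>\<times> G) z)"
proof (cases z)
  case (Cons a w)
  have "frag_extend tensor_tl (tensor_cns x c) = c" for x :: 'a and c
  proof (induction c rule: frag_linear_induct)
    case (basis t)
    then show ?case by (cases t) simp
  qed (auto simp: frag_extend_diff)
  then have "frag_extend tensor_tl (aw z) = aw w"
    by (simp add: Cons frag_extend_add)
  then show ?thesis
    using aw_bar_e[OF assms] Cons
    by (simp add: tensor_d_eq[abs_def] frag_extend_fun_add frag_extend_diff del: aw.simps bar_e.simps tensor_d.simps)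
qed simp

lemma tensor_d_tens:
  "frag_extend (tensor_d G) (tens i c d) =
     tens (i - 1) (frag_extend (bar_d G) c) d + frag_cmul ((-1) ^ i) (tens i c (frag_extend (bar_d G) d))"
proof (induction c rule: frag_linear_induct)
  case (basis x)
  show ?case
    by (induction d rule: frag_linear_induct)
      (auto simp: frag_extend_diff frag_cmul_diff_right algebra_simps)
qed (auto simp: frag_extend_diff frag_cmul_diff_right algebra_simps)


section \<open>Tensor products of modules\<close>

definition bilinear_map ::
    "('r,'s) ring_scheme \<Rightarrow> ('r,'m) module \<Rightarrow> ('r,'n) module \<Rightarrow> ('r,'k) module \<Rightarrow> ('m \<Rightarrow> 'n \<Rightarrow> 'k) \<Rightarrow> bool" where
  "bilinear_map R M N P \<beta> \<longleftrightarrow>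
     (\<forall>m\<in>carrier M. \<beta> m \<in> lin_hom R N P) \<and> (\<forall>n\<in>carrier N. (\<lambda>m. \<beta> m n) \<in> lin_hom R M P)"

locale tensor_product =
  fixes R :: "('r,'s) ring_scheme" and M :: "('r,'m) module" and N :: "('r,'n) module"
  assumes M_module: "module R M" and N_module: "module R N" and one_neq_zero: "\<one>\<^bsub>R\<^esub> \<noteq> \<zero>\<^bsub>R\<^esub>"
begin

definition T :: "('r,'m \<times> 'n \<Rightarrow> 'r) module" where
  "T = free_mod R (carrier M \<times> carrier N)"

lemma R_cring: "cring R"
  using M_module by (simp add: module_def)

lemma T_module: "module R T"
  unfolding T_def by (rule free_mod_module[OF R_cring])

lemma fbasis_T: "m \<in> carrier M \<Longrightarrow> n \<in> carrier N \<Longrightarrow> fbasis R (m, n) \<in> carrier T"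
proof -
  assume mn: "m \<in> carrier M" "n \<in> carrier N"
  interpret R: cring R by (rule R_cring)
  have "{x. fbasis R (m, n) x \<noteq> \<zero>\<^bsub>R\<^esub>} \<subseteq> {(m, n)}" by (auto simp: fbasis_def)
  then have "finite {x. fbasis R (m, n) x \<noteq> \<zero>\<^bsub>R\<^esub>}" by (rule finite_subset) simp
  then show ?thesis using mn by (auto simp: T_def free_mod_def fbasis_def)
qed

lemma relators_cases:
  assumes "r \<in> tensor_relators R M N"
  obtains (left) m m' n where "m \<in> carrier M" "m' \<in> carrier M" "n \<in> carrier N"
      "r = fbasis R (m \<oplus>\<^bsub>M\<^esub> m', n) \<ominus>\<^bsub>T\<^esub> (fbasis R (m, n) \<oplus>\<^bsub>T\<^esub> fbasis R (m', n))"
  | (right) m n n' where "m \<in> carrier M" "n \<in> carrier N" "n' \<in> carrier N"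
      "r = fbasis R (m, n \<oplus>\<^bsub>N\<^esub> n') \<ominus>\<^bsub>T\<^esub> (fbasis R (m, n) \<oplus>\<^bsub>T\<^esub> fbasis R (m, n'))"
  | (smult_left) a m n where "a \<in> carrier R" "m \<in> carrier M" "n \<in> carrier N"
      "r = fbasis R (a \<odot>\<^bsub>M\<^esub> m, n) \<ominus>\<^bsub>T\<^esub> a \<odot>\<^bsub>T\<^esub> fbasis R (m, n)"
  | (smult_right) a m n where "a \<in> carrier R" "m \<in> carrier M" "n \<in> carrier N"
      "r = fbasis R (m, a \<odot>\<^bsub>N\<^esub> n) \<ominus>\<^bsub>T\<^esub> a \<odot>\<^bsub>T\<^esub> fbasis R (m, n)"
  using assms unfolding tensor_relators_def Let_def T_def[symmetric] by blast

lemma relators_carrier: "tensor_relators R M N \<subseteq> carrier T"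
proof
  interpret T: module R T by (rule T_module)
  interpret M: module R M by (rule M_module)
  interpret N: module R N by (rule N_module)
  fix r assume "r \<in> tensor_relators R M N"
  then show "r \<in> carrier T"
    by (cases rule: relators_cases) (simp_all add: fbasis_T)
qed

lemma rel_sub: "submodule (tensor_rel R M N) R T"
proof -
  interpret T: module R T by (rule T_module)
  have eq: "tensor_rel R M N = \<Inter>{U. submodule U R T \<and> tensor_relators R M N \<subseteq> U}"
    by (simp add: tensor_rel_def submod_gen_def T_def)
  have "tensor_rel R M N \<subseteq> carrier T"
    unfolding eq using submodule_carrier[OF T_module] relators_carrier by blast
  then show ?thesis
    by (rule T.submoduleI)
      (auto simp: eq intro: submodule_zero submodule_inv submodule_add submodule_smult)
qed

lemma relators_rel: "tensor_relators R M N \<subseteq> tensor_rel R M N"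
  by (auto simp: tensor_rel_def submod_gen_def)

lemma tensor_eq: "tensor R M N = quot_mod T (tensor_rel R M N)"
  by (simp add: tensor_def T_def)

lemma tensor_module: "module R (tensor R M N)"
  unfolding tensor_eq by (rule quot_mod_module[OF T_module rel_sub])

lemma tensor_proj_hom: "(\<lambda>f. tensor_rel R M N +>\<^bsub>T\<^esub> f) \<in> lin_hom R T (tensor R M N)"
  unfolding tensor_eq by (rule quot_mod_hom[OF T_module rel_sub])

lemma tensor_carrier: "carrier (tensor R M N) = (\<lambda>f. tensor_rel R M N +>\<^bsub>T\<^esub> f) ` carrier T"
  unfolding tensor_eq by (rule quot_mod_simps)

lemma pure_tensor_eq: "pure_tensor R M N m n = tensor_rel R M N +>\<^bsub>T\<^esub> fbasis R (m, n)"
  by (simp add: pure_tensor_def T_def)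

lemma pure_tensor_closed:
  "m \<in> carrier M \<Longrightarrow> n \<in> carrier N \<Longrightarrow> pure_tensor R M N m n \<in> carrier (tensor R M N)"
  by (simp add: pure_tensor_eq tensor_carrier fbasis_T)

lemma pure_tensor_bilinear: "bilinear_map R M N (tensor R M N) (pure_tensor R M N)"
proof -
  interpret M: module R M by (rule M_module)
  interpret N: module R N by (rule N_module)
  interpret T: module R T by (rule T_module)
  note proj = lin_hom_add[OF tensor_proj_hom] lin_hom_smult[OF tensor_proj_hom]
  have eqI: "tensor_rel R M N +>\<^bsub>T\<^esub> f = tensor_rel R M N +>\<^bsub>T\<^esub> g"
    if "f \<ominus>\<^bsub>T\<^esub> g \<in> tensor_relators R M N" "f \<in> carrier T" "g \<in> carrier T" for f g
    using coset_eq_iff[OF T_module rel_sub that(2,3)] that(1) relators_rel by blast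
  show ?thesis
    unfolding bilinear_map_def
  proof (intro conjI ballI lin_homI)
    fix m n n' assume mn: "m \<in> carrier M" "n \<in> carrier N" "n' \<in> carrier N"
    then have "fbasis R (m, n \<oplus>\<^bsub>N\<^esub> n') \<ominus>\<^bsub>T\<^esub> (fbasis R (m, n) \<oplus>\<^bsub>T\<^esub> fbasis R (m, n')) \<in> tensor_relators R M N"
      unfolding tensor_relators_def Let_def T_def by blast
    from eqI[OF this] mn show "pure_tensor R M N m (n \<oplus>\<^bsub>N\<^esub> n') =
        pure_tensor R M N m n \<oplus>\<^bsub>tensor R M N\<^esub> pure_tensor R M N m n'"
      by (simp add: pure_tensor_eq proj fbasis_T)
  next
    fix m m' n assume mn: "m \<in> carrier M" "m' \<in> carrier M" "n \<in> carrier N"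
    then have "fbasis R (m \<oplus>\<^bsub>M\<^esub> m', n) \<ominus>\<^bsub>T\<^esub> (fbasis R (m, n) \<oplus>\<^bsub>T\<^esub> fbasis R (m', n)) \<in> tensor_relators R M N"
      unfolding tensor_relators_def Let_def T_def by blast
    from eqI[OF this] mn show "pure_tensor R M N (m \<oplus>\<^bsub>M\<^esub> m') n =
        pure_tensor R M N m n \<oplus>\<^bsub>tensor R M N\<^esub> pure_tensor R M N m' n"
      by (simp add: pure_tensor_eq proj fbasis_T)
  next
    fix a m n assume mn: "a \<in> carrier R" "m \<in> carrier M" "n \<in> carrier N"
    then have "fbasis R (a \<odot>\<^bsub>M\<^esub> m, n) \<ominus>\<^bsub>T\<^esub> a \<odot>\<^bsub>T\<^esub> fbasis R (m, n) \<in> tensor_relators R M N"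
      unfolding tensor_relators_def Let_def T_def by blast
    from eqI[OF this] mn show "pure_tensor R M N (a \<odot>\<^bsub>M\<^esub> m) n = a \<odot>\<^bsub>tensor R M N\<^esub> pure_tensor R M N m n"
      by (simp add: pure_tensor_eq proj fbasis_T)
  next
    fix m a n assume mn: "a \<in> carrier R" "m \<in> carrier M" "n \<in> carrier N"
    then have "fbasis R (m, a \<odot>\<^bsub>N\<^esub> n) \<ominus>\<^bsub>T\<^esub> a \<odot>\<^bsub>T\<^esub> fbasis R (m, n) \<in> tensor_relators R M N"
      unfolding tensor_relators_def Let_def T_def by blast
    from eqI[OF this] mn show "pure_tensor R M N m (a \<odot>\<^bsub>N\<^esub> n) = a \<odot>\<^bsub>tensor R M N\<^esub> pure_tensor R M N m n"
      by (simp add: pure_tensor_eq proj fbasis_T)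
  qed (auto simp: pure_tensor_closed)
qed

context
  fixes P :: "('r,'k) module" and \<beta> :: "'m \<Rightarrow> 'n \<Rightarrow> 'k"
  assumes P_module: "module R P" and \<beta>: "bilinear_map R M N P \<beta>"
begin

lemma \<beta>_closed: "m \<in> carrier M \<Longrightarrow> n \<in> carrier N \<Longrightarrow> \<beta> m n \<in> carrier P"
  using \<beta> lin_hom_closed by (fastforce simp: bilinear_map_def)

lemma \<beta>_ext_hom: "lin_ext R P (\<lambda>(m, n). \<beta> m n) \<in> lin_hom R T P"
  unfolding T_def by (rule lin_ext_hom[OF P_module]) (auto simp: \<beta>_closed)

lemma \<beta>_ext_fbasis:
  "m \<in> carrier M \<Longrightarrow> n \<in> carrier N \<Longrightarrow> lin_ext R P (\<lambda>(m, n). \<beta> m n) (fbasis R (m, n)) = \<beta> m n"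
  using lin_ext_fbasis[OF P_module one_neq_zero, of "\<lambda>(m, n). \<beta> m n" "(m, n)"] by (simp add: \<beta>_closed)

text \<open>The relators lie in the kernel by bilinearity, and this kernel is a submodule, hence
  contains the submodule that they generate.\<close>

lemma \<beta>_ext_rel:
  assumes "r \<in> tensor_rel R M N"
  shows "lin_ext R P (\<lambda>(m, n). \<beta> m n) r = \<zero>\<^bsub>P\<^esub>"
proof -
  interpret M: module R M by (rule M_module)
  interpret N: module R N by (rule N_module)
  interpret T: module R T by (rule T_module)
  interpret P: module R P by (rule P_module)
  define L where "L = lin_ext R P (\<lambda>(m, n). \<beta> m n)"
  have L: "L \<in> lin_hom R T P" unfolding L_def by (rule \<beta>_ext_hom)
  have Lb: "L (fbasis R (m, n)) = \<beta> m n" if "m \<in> carrier M" "n \<in> carrier N" for m n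
    unfolding L_def using that by (rule \<beta>_ext_fbasis)
  have Ldiff: "L (f \<ominus>\<^bsub>T\<^esub> g) = \<zero>\<^bsub>P\<^esub>" if "L f = L g" "f \<in> carrier T" "g \<in> carrier T" for f g
    using that lin_hom_closed[OF L]
    by (simp add: lin_hom_diff[OF T_module P_module L] minus_eq_zero_iff[OF P.abelian_group_axioms])
  have right: "\<beta> m \<in> lin_hom R N P" if "m \<in> carrier M" for m
    using \<beta> that by (simp add: bilinear_map_def)
  have left: "(\<lambda>m. \<beta> m n) \<in> lin_hom R M P" if "n \<in> carrier N" for n
    using \<beta> that by (simp add: bilinear_map_def)
  have "tensor_relators R M N \<subseteq> {f \<in> carrier T. L f \<in> {\<zero>\<^bsub>P\<^esub>}}"
  proof
    fix r assume r: "r \<in> tensor_relators R M N"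
    then have "L r = \<zero>\<^bsub>P\<^esub>"
    proof (cases rule: relators_cases)
      case (left m m' n)
      then show ?thesis unfolding left(4)
        by (intro Ldiff) (simp_all add: fbasis_T lin_hom_add[OF L] Lb lin_hom_add[OF \<open>n \<in> carrier N \<Longrightarrow> (\<lambda>m. \<beta> m n) \<in> lin_hom R M P\<close>])
    next
      case (right m n n')
      then show ?thesis unfolding right(4)
        by (intro Ldiff) (simp_all add: fbasis_T lin_hom_add[OF L] Lb lin_hom_add[OF \<open>m \<in> carrier M \<Longrightarrow> \<beta> m \<in> lin_hom R N P\<close>])
    next
      case (smult_left a m n)
      then show ?thesis unfolding smult_left(4)
        by (intro Ldiff) (simp_all add: fbasis_T lin_hom_smult[OF L] Lb lin_hom_smult[OF \<open>n \<in> carrier N \<Longrightarrow> (\<lambda>m. \<beta> m n) \<in> lin_hom R M P\<close>])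
    next
      case (smult_right a m n)
      then show ?thesis unfolding smult_right(4)
        by (intro Ldiff) (simp_all add: fbasis_T lin_hom_smult[OF L] Lb lin_hom_smult[OF \<open>m \<in> carrier M \<Longrightarrow> \<beta> m \<in> lin_hom R N P\<close>])
    qed
    then show "r \<in> {f \<in> carrier T. L f \<in> {\<zero>\<^bsub>P\<^esub>}}" using r relators_carrier by auto
  qed
  moreover have "submodule {f \<in> carrier T. L f \<in> {\<zero>\<^bsub>P\<^esub>}} R T"
    by (rule submodule_vimage[OF T_module P_module L submodule_zero_set[OF P_module]
          submodule_carrier[OF T_module]])
  ultimately have "tensor_rel R M N \<subseteq> {f \<in> carrier T. L f \<in> {\<zero>\<^bsub>P\<^esub>}}"
    unfolding tensor_rel_def submod_gen_def T_def by blast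
  then show ?thesis using assms by (auto simp: L_def)
qed

lemma tensor_lift_coset:
  assumes f: "f \<in> carrier T"
  shows "tensor_lift R P \<beta> (tensor_rel R M N +>\<^bsub>T\<^esub> f) = lin_ext R P (\<lambda>(m, n). \<beta> m n) f"
proof -
  interpret T: module R T by (rule T_module)
  interpret P: module R P by (rule P_module)
  have "lin_ext R P (\<lambda>(m, n). \<beta> m n) g = lin_ext R P (\<lambda>(m, n). \<beta> m n) f"
    if "g \<in> tensor_rel R M N +>\<^bsub>T\<^esub> f" for g
    using that submodule_subset[OF rel_sub] f lin_hom_closed[OF \<beta>_ext_hom f]
    by (auto simp: coset_mem lin_hom_add[OF \<beta>_ext_hom] \<beta>_ext_rel)
  moreover have "f \<in> tensor_rel R M N +>\<^bsub>T\<^esub> f"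
    using f submodule_zero[OF rel_sub] unfolding coset_mem by (metis T.l_zero)
  ultimately have "lin_ext R P (\<lambda>(m, n). \<beta> m n) ` (tensor_rel R M N +>\<^bsub>T\<^esub> f) =
      {lin_ext R P (\<lambda>(m, n). \<beta> m n) f}"
    by blast
  then show ?thesis by (simp add: tensor_lift_def)
qed

lemma tensor_lift_pure:
  "m \<in> carrier M \<Longrightarrow> n \<in> carrier N \<Longrightarrow> tensor_lift R P \<beta> (pure_tensor R M N m n) = \<beta> m n"
  by (simp add: pure_tensor_eq tensor_lift_coset fbasis_T \<beta>_ext_fbasis)

lemma tensor_lift_hom: "tensor_lift R P \<beta> \<in> lin_hom R (tensor R M N) P"
proof (rule lin_homI)
  fix t u assume "t \<in> carrier (tensor R M N)" "u \<in> carrier (tensor R M N)"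
  then obtain f g where f: "f \<in> carrier T" "t = tensor_rel R M N +>\<^bsub>T\<^esub> f"
    and g: "g \<in> carrier T" "u = tensor_rel R M N +>\<^bsub>T\<^esub> g"
    by (auto simp: tensor_carrier)
  interpret T: module R T by (rule T_module)
  show "tensor_lift R P \<beta> (t \<oplus>\<^bsub>tensor R M N\<^esub> u) = tensor_lift R P \<beta> t \<oplus>\<^bsub>P\<^esub> tensor_lift R P \<beta> u"
    using f g by (simp add: lin_hom_add[OF tensor_proj_hom, symmetric] tensor_lift_coset
        lin_hom_add[OF \<beta>_ext_hom])
next
  fix a t assume a: "a \<in> carrier R" and "t \<in> carrier (tensor R M N)"
  then obtain f where f: "f \<in> carrier T" "t = tensor_rel R M N +>\<^bsub>T\<^esub> f"
    by (auto simp: tensor_carrier)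
  interpret T: module R T by (rule T_module)
  show "tensor_lift R P \<beta> (a \<odot>\<^bsub>tensor R M N\<^esub> t) = a \<odot>\<^bsub>P\<^esub> tensor_lift R P \<beta> t"
    using f a by (simp add: lin_hom_smult[OF tensor_proj_hom, symmetric] tensor_lift_coset
        lin_hom_smult[OF \<beta>_ext_hom])
next
  fix t assume "t \<in> carrier (tensor R M N)"
  then show "tensor_lift R P \<beta> t \<in> carrier P"
    by (auto simp: tensor_carrier tensor_lift_coset lin_hom_closed[OF \<beta>_ext_hom])
qed

end

end

lemma (in mod_prime) tensor_hom_eqI:
  assumes "module (Fp p) M" "module (Fp p) N" "module (Fp p) P"
    and h: "h \<in> lin_hom (Fp p) (tensor (Fp p) M N) P" and h': "h' \<in> lin_hom (Fp p) (tensor (Fp p) M N) P"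
    and pure: "\<And>m n. m \<in> carrier M \<Longrightarrow> n \<in> carrier N \<Longrightarrow>
      h (pure_tensor (Fp p) M N m n) = h' (pure_tensor (Fp p) M N m n)"
    and t: "t \<in> carrier (tensor (Fp p) M N)"
  shows "h t = h' t"
proof -
  interpret tensor_product "Fp p" M N
    by (rule tensor_product.intro[OF assms(1,2)]) (simp add: Fp_simps)
  obtain f where f: "f \<in> carrier T" "t = tensor_rel (Fp p) M N +>\<^bsub>T\<^esub> f"
    using t by (auto simp: tensor_carrier)
  have "h (tensor_rel (Fp p) M N +>\<^bsub>T\<^esub> f) = h' (tensor_rel (Fp p) M N +>\<^bsub>T\<^esub> f)"
    unfolding T_def
  proof (rule lin_hom_eqI[OF assms(3) _ _ _ f(1)[unfolded T_def],
        where h = "\<lambda>f. h (tensor_rel (Fp p) M N +>\<^bsub>free (carrier M \<times> carrier N)\<^esub> f)"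
          and h' = "\<lambda>f. h' (tensor_rel (Fp p) M N +>\<^bsub>free (carrier M \<times> carrier N)\<^esub> f)"])
    fix x assume "x \<in> carrier M \<times> carrier N"
    then show "h (tensor_rel (Fp p) M N +>\<^bsub>free (carrier M \<times> carrier N)\<^esub> fbasis (Fp p) x) =
        h' (tensor_rel (Fp p) M N +>\<^bsub>free (carrier M \<times> carrier N)\<^esub> fbasis (Fp p) x)"
      using pure[of "fst x" "snd x"] by (simp add: mem_Times_iff pure_tensor_def)
  qed (use lin_hom_comp[OF tensor_proj_hom h] lin_hom_comp[OF tensor_proj_hom h'] in
      \<open>simp_all add: T_def\<close>)
  then show ?thesis by (simp add: f(2))
qed


section \<open>Complements of subspaces\<close>

text \<open>By Zorn's lemma, as the chain modules of an infinite group have infinite rank: a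
  submodule maximal among those meeting \<open>W\<close> trivially is a complement.\<close>

lemma submodule_complement:
  fixes M :: "('r,'m) module"
  assumes "field R" "module R M" and W: "submodule W R M"
  obtains U where "submodule U R M" "U \<inter> W = {\<zero>\<^bsub>M\<^esub>}"
    "\<And>v. v \<in> carrier M \<Longrightarrow> \<exists>w\<in>W. \<exists>u\<in>U. v = w \<oplus>\<^bsub>M\<^esub> u"
proof -
  interpret R: field R by fact
  interpret M: module R M by fact
  define \<A> where "\<A> = {U. submodule U R M \<and> U \<inter> W = {\<zero>\<^bsub>M\<^esub>}}"
  have "{\<zero>\<^bsub>M\<^esub>} \<in> \<A>"
    using submodule_zero_set[OF assms(2)] submodule_zero[OF W] by (auto simp: \<A>_def)
  moreover have "\<Union>\<C> \<in> \<A>" if \<C>: "\<C> \<noteq> {}" "subset.chain \<A> \<C>" for \<C>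
  proof -
    have sub: "submodule U R M" if "U \<in> \<C>" for U
      using \<C> that by (auto simp: subset_chain_def \<A>_def)
    have two: "\<exists>U\<in>\<C>. x \<in> U \<and> y \<in> U" if xy: "x \<in> \<Union>\<C>" "y \<in> \<Union>\<C>" for x y
    proof -
      obtain U U' where UU: "U \<in> \<C>" "x \<in> U" "U' \<in> \<C>" "y \<in> U'" using xy by auto
      then have "U \<subseteq> U' \<or> U' \<subseteq> U" using \<C>(2) by (simp add: subset_chain_def)
      then show ?thesis using UU by blast
    qed
    obtain U0 where U0: "U0 \<in> \<C>" using \<C>(1) by auto
    have "submodule (\<Union>\<C>) R M"
    proof (rule M.submoduleI)
      show "\<Union>\<C> \<subseteq> carrier M" using sub submodule_subset by blast
      show "\<zero>\<^bsub>M\<^esub> \<in> \<Union>\<C>" using U0 submodule_zero[OF sub] by blast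
      show "\<ominus>\<^bsub>M\<^esub> x \<in> \<Union>\<C>" if "x \<in> \<Union>\<C>" for x using that submodule_inv[OF sub] by blast
      show "x \<oplus>\<^bsub>M\<^esub> y \<in> \<Union>\<C>" if "x \<in> \<Union>\<C>" "y \<in> \<Union>\<C>" for x y
        using two[OF that] submodule_add[OF sub] by blast
      show "a \<odot>\<^bsub>M\<^esub> x \<in> \<Union>\<C>" if "a \<in> carrier R" "x \<in> \<Union>\<C>" for a x
        using that submodule_smult[OF sub] by blast
    qed
    moreover have "\<Union>\<C> \<inter> W = {\<zero>\<^bsub>M\<^esub>}"
      using \<C> U0 by (auto simp: subset_chain_def \<A>_def)
    ultimately show ?thesis by (simp add: \<A>_def)
  qed
  ultimately obtain U where U: "U \<in> \<A>" and max: "\<And>U'. U' \<in> \<A> \<Longrightarrow> U \<subseteq> U' \<Longrightarrow> U' = U"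
    using subset_Zorn_nonempty[of \<A>] by blast
  have Usub: "submodule U R M" and UW: "U \<inter> W = {\<zero>\<^bsub>M\<^esub>}" using U by (auto simp: \<A>_def)
  note Uc = subsetD[OF submodule_subset[OF Usub]] and Wc = subsetD[OF submodule_subset[OF W]]
  have "\<exists>w\<in>W. \<exists>u\<in>U. v = w \<oplus>\<^bsub>M\<^esub> u" if v: "v \<in> carrier M" for v
  proof (rule ccontr)
    assume contra: "\<not> (\<exists>w\<in>W. \<exists>u\<in>U. v = w \<oplus>\<^bsub>M\<^esub> u)"
    \<comment> \<open>Adjoining a vector outside W + U would contradict maximality: a nonzero
      element of \<open>W\<close> in the enlarged submodule involves \<open>v\<close> with an
      invertible coefficient and so puts \<open>v\<close> into W + U.\<close>
    define U' where "U' = {u \<oplus>\<^bsub>M\<^esub> a \<odot>\<^bsub>M\<^esub> v | u a. u \<in> U \<and> a \<in> carrier R}"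
    have mem: "u \<oplus>\<^bsub>M\<^esub> a \<odot>\<^bsub>M\<^esub> v \<in> U'" if "u \<in> U" "a \<in> carrier R" for u a
      using that by (auto simp: U'_def)
    have "submodule U' R M"
    proof (rule M.submoduleI)
      show "U' \<subseteq> carrier M" using Uc v by (auto simp: U'_def)
      show "\<zero>\<^bsub>M\<^esub> \<in> U'" using mem[OF submodule_zero[OF Usub] R.zero_closed] v by simp
      show "x \<oplus>\<^bsub>M\<^esub> y \<in> U'" if "x \<in> U'" "y \<in> U'" for x y
      proof -
        obtain u a u' a' where x: "x = u \<oplus>\<^bsub>M\<^esub> a \<odot>\<^bsub>M\<^esub> v" "u \<in> U" "a \<in> carrier R"
          and y: "y = u' \<oplus>\<^bsub>M\<^esub> a' \<odot>\<^bsub>M\<^esub> v" "u' \<in> U" "a' \<in> carrier R"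
          using \<open>x \<in> U'\<close> \<open>y \<in> U'\<close> by (auto simp: U'_def)
        have "u \<in> carrier M" "u' \<in> carrier M" "a \<odot>\<^bsub>M\<^esub> v \<in> carrier M" "a' \<odot>\<^bsub>M\<^esub> v \<in> carrier M"
          using x y v Uc by auto
        then have "x \<oplus>\<^bsub>M\<^esub> y = (u \<oplus>\<^bsub>M\<^esub> u') \<oplus>\<^bsub>M\<^esub> (a \<odot>\<^bsub>M\<^esub> v \<oplus>\<^bsub>M\<^esub> a' \<odot>\<^bsub>M\<^esub> v)"
          unfolding x(1) y(1) by (simp add: M.M.a_assoc M.M.a_lcomm)
        also have "\<dots> = (u \<oplus>\<^bsub>M\<^esub> u') \<oplus>\<^bsub>M\<^esub> (a \<oplus>\<^bsub>R\<^esub> a') \<odot>\<^bsub>M\<^esub> v"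
          using v x(3) y(3) by (simp add: M.smult_l_distr)
        finally have "x \<oplus>\<^bsub>M\<^esub> y = (u \<oplus>\<^bsub>M\<^esub> u') \<oplus>\<^bsub>M\<^esub> (a \<oplus>\<^bsub>R\<^esub> a') \<odot>\<^bsub>M\<^esub> v" .
        then show ?thesis using x y submodule_add[OF Usub] mem by simp
      qed
      show smult: "b \<odot>\<^bsub>M\<^esub> x \<in> U'" if "b \<in> carrier R" "x \<in> U'" for b x
      proof -
        obtain u a where x: "x = u \<oplus>\<^bsub>M\<^esub> a \<odot>\<^bsub>M\<^esub> v" "u \<in> U" "a \<in> carrier R"
          using \<open>x \<in> U'\<close> by (auto simp: U'_def)
        then have "b \<odot>\<^bsub>M\<^esub> x = b \<odot>\<^bsub>M\<^esub> u \<oplus>\<^bsub>M\<^esub> (b \<otimes>\<^bsub>R\<^esub> a) \<odot>\<^bsub>M\<^esub> v"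
          using v Uc \<open>b \<in> carrier R\<close> by (simp add: M.smult_r_distr M.smult_assoc1)
        then show ?thesis using x submodule_smult[OF Usub] mem \<open>b \<in> carrier R\<close> by simp
      qed
      show "\<ominus>\<^bsub>M\<^esub> x \<in> U'" if "x \<in> U'" for x
      proof -
        have "x \<in> carrier M" using that Uc v by (auto simp: U'_def)
        then have "\<ominus>\<^bsub>M\<^esub> x = (\<ominus>\<^bsub>R\<^esub> \<one>\<^bsub>R\<^esub>) \<odot>\<^bsub>M\<^esub> x" by (simp add: M.smult_l_minus)
        then show ?thesis using smult[OF _ that] by simp
      qed
    qed
    moreover have "U' \<inter> W = {\<zero>\<^bsub>M\<^esub>}"
    proof -
      have "x = \<zero>\<^bsub>M\<^esub>" if "x \<in> U'" "x \<in> W" for x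
      proof -
        obtain u a where x: "x = u \<oplus>\<^bsub>M\<^esub> a \<odot>\<^bsub>M\<^esub> v" "u \<in> U" "a \<in> carrier R"
          using \<open>x \<in> U'\<close> by (auto simp: U'_def)
        have "a = \<zero>\<^bsub>R\<^esub>"
        proof (rule ccontr)
          assume "a \<noteq> \<zero>\<^bsub>R\<^esub>"
          then obtain b where b: "b \<in> carrier R" "b \<otimes>\<^bsub>R\<^esub> a = \<one>\<^bsub>R\<^esub>"
            using x(3) R.field_Units R.Units_l_inv_ex by (metis DiffI singletonD)
          have "v = b \<odot>\<^bsub>M\<^esub> (a \<odot>\<^bsub>M\<^esub> v)" using b v x(3) by (simp flip: M.smult_assoc1)
          also have "a \<odot>\<^bsub>M\<^esub> v = x \<oplus>\<^bsub>M\<^esub> \<ominus>\<^bsub>M\<^esub> u"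
          proof -
            have "u \<in> carrier M" "a \<odot>\<^bsub>M\<^esub> v \<in> carrier M" using x v Uc by auto
            then show ?thesis unfolding x(1) by (simp add: M.M.a_comm[of u] M.M.a_assoc M.M.r_neg)
          qed
          also have "b \<odot>\<^bsub>M\<^esub> (x \<oplus>\<^bsub>M\<^esub> \<ominus>\<^bsub>M\<^esub> u) = b \<odot>\<^bsub>M\<^esub> x \<oplus>\<^bsub>M\<^esub> b \<odot>\<^bsub>M\<^esub> (\<ominus>\<^bsub>M\<^esub> u)"
            using x(2) Uc Wc[OF \<open>x \<in> W\<close>] b by (intro M.smult_r_distr) auto
          finally show False
            using contra submodule_smult[OF W b(1) \<open>x \<in> W\<close>]
              submodule_smult[OF Usub b(1) submodule_inv[OF Usub x(2)]] by blast
        qed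
        then have "x = u" using x v Uc by simp
        then show ?thesis using UW x(2) \<open>x \<in> W\<close> by blast
      qed
      then show ?thesis
        using submodule_zero[OF \<open>submodule U' R M\<close>] submodule_zero[OF W] by blast
    qed
    moreover have "U \<subseteq> U'"
    proof
      fix u assume "u \<in> U"
      then show "u \<in> U'" using mem[of u "\<zero>\<^bsub>R\<^esub>"] Uc v by simp
    qed
    ultimately have "U' = U" using max by (simp add: \<A>_def)
    then have "v \<in> U" using mem[OF submodule_zero[OF Usub] R.one_closed] v by simp
    then show False using contra submodule_zero[OF W] v by (metis M.l_zero)
  qed
  with Usub UW show ?thesis by (rule that)
qed


section \<open>The complexes of a nerve\<close>

text \<open>A complex over \<open>Fp p\<close> with an integral model: one differential
  \<open>\<phi>\<close> on the bases of all degrees. Agreement with the boundary is asked for on the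
  carriers, where module sums and integral extensions coincide.\<close>

locale frag_complex = mod_prime p for p +
  fixes S :: "nat \<Rightarrow> 'x set" and \<phi> :: "'x \<Rightarrow> 'x \<Rightarrow>\<^sub>0 int" and C :: "(int, 'x \<Rightarrow> int) complex_data"
  assumes chains_eq: "chains C n = free (S n)"
    and bdry_eq: "f \<in> carrier (free (S n)) \<Longrightarrow> bdry C n f = lft p \<phi> f"
    and \<phi>_keys: "x \<in> S n \<Longrightarrow> Poly_Mapping.keys (\<phi> x) \<subseteq> S (n - 1)"
    and \<phi>_\<phi>: "x \<in> S n \<Longrightarrow> frag_extend \<phi> (\<phi> x) = 0"
begin

lemma frag_extend_keys: "Poly_Mapping.keys c \<subseteq> S n \<Longrightarrow> Poly_Mapping.keys (frag_extend \<phi> c) \<subseteq> S (n - 1)"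
  using \<phi>_keys by (intro keys_frag_extend_subset) auto

lemma bdry_red: "Poly_Mapping.keys c \<subseteq> S n \<Longrightarrow> bdry C n (red p c) = red p (frag_extend \<phi> c)"
  by (simp add: bdry_eq red_carrier lft_red[OF refl])

lemma frag_extend_frag_extend_zero: "Poly_Mapping.keys c \<subseteq> S n \<Longrightarrow> frag_extend \<phi> (frag_extend \<phi> c) = 0"
  unfolding frag_extend_frag_extend by (rule frag_extend_eq_0) (use \<phi>_\<phi> in auto)

sublocale chain_complex "Fp p" C
proof (rule chain_complex.intro)
  show "module (Fp p) (chains C n)" for n
    unfolding chains_eq by (rule free_module)
  show "bdry C n \<in> lin_hom (Fp p) (chains C n) (chains C (n - 1))" for n
    using lft_hom[of "S n" \<phi> "S (n - 1)"] \<phi>_keys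
    by (auto simp: chains_eq lin_hom_def bdry_eq module.smult_closed[OF free_module]
        abelian_monoid.a_closed[OF abelian_group.axioms(1)[OF module.axioms(2)[OF free_module]]])
  show "bdry C n (bdry C (Suc n) f) = \<zero>\<^bsub>chains C (n - 1)\<^esub>" if "f \<in> carrier (chains C (Suc n))" for n f
  proof -
    have "f \<in> carrier (free (S (Suc n)))" using that by (simp add: chains_eq)
    then obtain c where c: "f = red p c" "Poly_Mapping.keys c \<subseteq> S (Suc n)"
      by (rule carrier_redE)
    then show ?thesis
      using frag_extend_keys[OF c(2)]
      by (simp add: bdry_red frag_extend_frag_extend_zero[OF c(2)] chains_eq red_zero)
  qed
qed

lemma cyc_red:
  "Poly_Mapping.keys c \<subseteq> S n \<Longrightarrow> red p c \<in> cyc n \<longleftrightarrow> red p (frag_extend \<phi> c) = red p 0"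
  by (simp add: cyc_iff chains_eq red_carrier bdry_red red_zero[symmetric])

text \<open>The integral representative is in general a cycle only modulo \<open>p\<close>;
  boundaries, in contrast, are reductions of integral boundaries (\<open>bnd_iff\<close>).\<close>

lemma cycE:
  assumes "z \<in> cyc n"
  obtains c where "z = red p c" "Poly_Mapping.keys c \<subseteq> S n" "red p (frag_extend \<phi> c) = red p 0"
proof -
  have "z \<in> carrier (free (S n))" using assms by (simp add: cyc_iff chains_eq)
  then obtain c where "z = red p c" "Poly_Mapping.keys c \<subseteq> S n" by (rule carrier_redE)
  with assms that show ?thesis by (auto simp: cyc_red)
qed

lemma bnd_iff: "z \<in> bnd n \<longleftrightarrow> (\<exists>c. Poly_Mapping.keys c \<subseteq> S (Suc n) \<and> z = red p (frag_extend \<phi> c))"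
proof
  assume "z \<in> bnd n"
  then obtain f where f: "f \<in> carrier (free (S (Suc n)))" "z = bdry C (Suc n) f"
    by (auto simp: bnd_def chains_eq)
  then obtain c where "f = red p c" "Poly_Mapping.keys c \<subseteq> S (Suc n)" by (metis carrier_redE)
  with f show "\<exists>c. Poly_Mapping.keys c \<subseteq> S (Suc n) \<and> z = red p (frag_extend \<phi> c)"
    by (auto simp: bdry_red)
next
  assume "\<exists>c. Poly_Mapping.keys c \<subseteq> S (Suc n) \<and> z = red p (frag_extend \<phi> c)"
  then obtain c where "Poly_Mapping.keys c \<subseteq> S (Suc n)" "z = red p (frag_extend \<phi> c)" by auto
  then show "z \<in> bnd n"
    unfolding bnd_def chains_eq by (intro image_eqI[of _ _ "red p c"]) (auto simp: bdry_red red_carrier)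
qed

end

text \<open>The sign \<open>\<epsilon>\<close> allows for maps of odd degree.\<close>

lemma frag_homology_map:
  assumes "frag_complex p S \<phi> C" "frag_complex p S' \<phi>' C'"
    and f: "\<And>z. z \<in> carrier (free_mod (Fp p) (S m)) \<Longrightarrow> f z = lft p \<psi> z"
    and keys: "\<And>x. x \<in> S m \<Longrightarrow> Poly_Mapping.keys (\<psi> x) \<subseteq> S' n"
      "\<And>x. x \<in> S (Suc m) \<Longrightarrow> Poly_Mapping.keys (\<psi> x) \<subseteq> S' (Suc n)"
    and comm: "\<And>x. x \<in> S m \<Longrightarrow>
        red p (frag_extend \<phi>' (\<psi> x)) = red p (frag_cmul \<epsilon> (frag_extend \<psi> (\<phi> x)))"
      "\<And>x. x \<in> S (Suc m) \<Longrightarrow>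
        red p (frag_extend \<psi> (\<phi> x)) = red p (frag_cmul \<epsilon> (frag_extend \<phi>' (\<psi> x)))"
  shows "z \<in> chain_complex.cyc C m \<Longrightarrow> lft p \<psi> z \<in> chain_complex.cyc C' n"
    and "z \<in> chain_complex.bnd C m \<Longrightarrow> lft p \<psi> z \<in> chain_complex.bnd C' n"
    and "z \<in> chain_complex.cyc C m \<Longrightarrow> homology_map C' n f (hclass C m z) = hclass C' n (lft p \<psi> z)"
    and "homology_map C' n f \<in> lin_hom (Fp p) (homology C m) (homology C' n)"
proof -
  interpret C: frag_complex p S \<phi> C by fact
  interpret C': frag_complex p S' \<phi>' C' by fact
  have \<psi>: "lft p \<psi> \<in> lin_hom (Fp p) (chains C m) (chains C' n)"
    unfolding C.chains_eq C'.chains_eq by (rule C.lft_hom) (rule keys)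
  have "f \<in> lin_hom (Fp p) (chains C m) (chains C' n)"
    using \<psi> by (auto simp: lin_hom_def f C.chains_eq module.smult_closed[OF C.free_module]
        abelian_monoid.a_closed[OF abelian_group.axioms(1)[OF module.axioms(2)[OF C.free_module]]])
  note hom = this
  show cyc: "lft p \<psi> z \<in> C'.cyc n" if z: "z \<in> C.cyc m" for z
  proof -
    obtain c where c: "z = red p c" "Poly_Mapping.keys c \<subseteq> S m" "red p (frag_extend \<phi> c) = red p 0"
      using z by (rule C.cycE)
    have k: "Poly_Mapping.keys (frag_extend \<psi> c) \<subseteq> S' n"
      using c(2) keys by (intro C.keys_frag_extend_subset) auto
    have "red p (frag_extend \<phi>' (frag_extend \<psi> c)) =
        red p (frag_extend (\<lambda>x. frag_cmul \<epsilon> (frag_extend \<psi> (\<phi> x))) c)"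
      unfolding frag_extend_frag_extend[of \<phi>'] using c(2) comm by (intro red_frag_extend_cong) auto
    also have "\<dots> = red p (frag_cmul \<epsilon> (frag_extend \<psi> (frag_extend \<phi> c)))"
      by (simp add: frag_extend_fun_cmul frag_extend_frag_extend)
    also have "\<dots> = red p (frag_cmul \<epsilon> (frag_extend \<psi> 0))"
      using c(3) by (intro red_cmul_cong red_frag_extend_cong) auto
    finally show ?thesis using k by (simp add: c(1) C.lft_red[OF refl] C'.cyc_red)
  qed
  show bnd: "lft p \<psi> z \<in> C'.bnd n" if z: "z \<in> C.bnd m" for z
  proof -
    obtain c where c: "Poly_Mapping.keys c \<subseteq> S (Suc m)" "z = red p (frag_extend \<phi> c)"
      using z by (auto simp: C.bnd_iff)
    have k: "Poly_Mapping.keys (frag_cmul \<epsilon> (frag_extend \<psi> c)) \<subseteq> S' (Suc n)"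
      using C.keys_frag_extend_subset[of c \<psi> "S' (Suc n)"] c(1) keys(2) keys_cmul by fast
    have "red p (frag_extend \<psi> (frag_extend \<phi> c)) =
        red p (frag_extend (\<lambda>x. frag_cmul \<epsilon> (frag_extend \<phi>' (\<psi> x))) c)"
      unfolding frag_extend_frag_extend[of \<psi>] using c(1) comm by (intro red_frag_extend_cong) auto
    also have "\<dots> = red p (frag_extend \<phi>' (frag_cmul \<epsilon> (frag_extend \<psi> c)))"
      by (simp add: frag_extend_fun_cmul frag_extend_frag_extend frag_extend_cmul)
    finally show ?thesis using k by (auto simp: c(2) C.lft_red[OF refl] C'.bnd_iff)
  qed
  have fc: "f z = lft p \<psi> z" if "z \<in> C.cyc m \<or> z \<in> C.bnd m" for z
    using that C.bnd_cyc[of m] C.cyc_carrier[of z m] f[of z] by (auto simp: C.chains_eq)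
  show "homology_map C' n f (hclass C m z) = hclass C' n (lft p \<psi> z)" if "z \<in> C.cyc m" for z
    using homology_map_hclass[OF C.chain_complex_axioms C'.chain_complex_axioms hom _ _ that] fc cyc bnd that
    by simp
  show "homology_map C' n f \<in> lin_hom (Fp p) (homology C m) (homology C' n)"
    using fc cyc bnd by (intro homology_map_hom[OF C.chain_complex_axioms C'.chain_complex_axioms hom]) simp_all
qed

section \<open>The bar differential as the alternating sum of the faces of the nerve\<close>

lemma nerve_simplices: "gs \<in> simplices (nerve G) n \<longleftrightarrow> length gs = n \<and> set gs \<subseteq> carrier G"
  by (simp add: nerve_def)

lemma nerve_face_closed:
  assumes "monoid G" "gs \<in> simplices (nerve G) (Suc m)" "i \<le> Suc m"
  shows "face (nerve G) (Suc m) i gs \<in> simplices (nerve G) m"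
proof -
  interpret monoid G by fact
  have gs: "length gs = Suc m" "set gs \<subseteq> carrier G" using assms by (auto simp: nerve_simplices)
  consider "i = 0" | "i = Suc m" | "0 < i" "i \<le> m" using assms(3) by linarith
  then show ?thesis
  proof cases
    case 1
    then show ?thesis using gs list.set_sel(2)[of gs] by (cases gs) (auto simp: nerve_def)
  next
    case 2
    then show ?thesis using gs by (auto simp: nerve_def dest: in_set_butlastD)
  next
    case 3
    then have "gs ! (i - 1) \<in> carrier G" "gs ! i \<in> carrier G"
      using gs by (auto intro!: subsetD[OF gs(2)])
    then show ?thesis
      using 3 gs by (auto simp: nerve_def dest!: in_set_takeD in_set_dropD)
  qed
qed

lemma nerve_face_Cons:
  assumes "length (b # u) = Suc m" "j \<le> m"
  shows "face (nerve G) (Suc (Suc m)) (Suc (Suc j)) (a # b # u) = a # face (nerve G) (Suc m) (Suc j) (b # u)"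
  using assms by (auto simp: nerve_def)

text \<open>From d_2 on, the faces of \<open>a # b # u\<close> keep \<open>a\<close> in front of a
  face of \<open>b # u\<close> with index lowered by one; this shift is the minus sign in the
  recursion of \<open>bar_e\<close>.\<close>

lemma nerve_face_sum_e:
  "length gs = Suc m \<Longrightarrow>
     (\<Sum>j\<le>m. frag_cmul ((-1) ^ j) (frag_of (face (nerve G) (Suc m) (Suc j) gs))) = bar_e G gs"
proof (induction gs arbitrary: m rule: induct_list012)
  case (3 a b u)
  then obtain k where k: "m = Suc k" "length (b # u) = Suc k" by auto
  have cns_sum: "cns a (\<Sum>j\<in>I. c j) = (\<Sum>j\<in>I. cns a (c j))" if "finite I" for I :: "nat set" and c
    using that by (induction I rule: finite_induct) auto
  have cns_cmul: "cns a (frag_cmul l c) = frag_cmul l (cns a c)" for l c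
    by (simp add: cns_def frag_extend_cmul)
  have "(\<Sum>j\<le>m. frag_cmul ((-1) ^ j) (frag_of (face (nerve G) (Suc m) (Suc j) (a # b # u)))) =
      frag_of (face (nerve G) (Suc (Suc k)) 1 (a # b # u)) -
      cns a (\<Sum>j\<le>k. frag_cmul ((-1) ^ j) (frag_of (face (nerve G) (Suc k) (Suc j) (b # u))))"
    unfolding k(1) sum.atMost_Suc_shift cns_sum[OF finite_atMost] sum_negf[symmetric] diff_conv_add_uminus
    by (intro arg_cong2[where f = "(+)"] sum.cong)
      (use k(2) in \<open>auto simp: cns_cmul nerve_face_Cons\<close>)
  moreover have "face (nerve G) (Suc (Suc k)) 1 (a # b # u) = (a \<otimes>\<^bsub>G\<^esub> b) # u"
    by (simp add: nerve_def)
  ultimately show ?case using "3.IH"(2)[OF k(2)] by simp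
qed (auto simp: nerve_def)

lemma nerve_face_sum:
  assumes "length gs = Suc m"
  shows "(\<Sum>i\<le>Suc m. frag_cmul ((-1) ^ i) (frag_of (face (nerve G) (Suc m) i gs))) = bar_d G gs"
proof -
  obtain a u where gs: "gs = a # u" using assms by (cases gs) auto
  have "(\<Sum>i\<le>Suc m. frag_cmul ((-1) ^ i) (frag_of (face (nerve G) (Suc m) i gs))) =
      frag_of (face (nerve G) (Suc m) 0 gs) -
      (\<Sum>j\<le>m. frag_cmul ((-1) ^ j) (frag_of (face (nerve G) (Suc m) (Suc j) gs)))"
    unfolding sum.atMost_Suc_shift by (simp add: sum_negf[symmetric])
  then show ?thesis
    using nerve_face_sum_e[OF assms] by (simp add: gs nerve_def)
qed

lemma bar_d_simplices:
  assumes "monoid G" "w \<in> simplices (nerve G) n"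
  shows "Poly_Mapping.keys (bar_d G w) \<subseteq> simplices (nerve G) (n - 1)"
proof
  fix u assume "u \<in> Poly_Mapping.keys (bar_d G w)"
  then show "u \<in> simplices (nerve G) (n - 1)"
    using bar_d_keys[OF assms(1), of w u] assms(2) by (auto simp: nerve_simplices)
qed

context mod_prime
begin

lemma keys_sum_subset:
  "(\<And>i. i \<in> I \<Longrightarrow> Poly_Mapping.keys (c i) \<subseteq> T) \<Longrightarrow> Poly_Mapping.keys (\<Sum>i\<in>I. c i) \<subseteq> T"
  using keys_sum[of c I] by blast

lemma sset_bdry:
  assumes face: "\<And>x i. x \<in> simplices A (Suc m) \<Longrightarrow> i \<le> Suc m \<Longrightarrow> face A (Suc m) i x \<in> simplices A m"
    and \<phi>: "\<And>x. x \<in> simplices A (Suc m) \<Longrightarrow>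
      (\<Sum>i\<le>Suc m. frag_cmul ((-1) ^ i) (frag_of (face A (Suc m) i x))) = \<phi> x"
    and f: "f \<in> carrier (free (simplices A (Suc m)))"
  shows "bdry (sset_complex (Fp p) A) (Suc m) f = lft p \<phi> f"
proof -
  let ?V = "free (simplices A m)"
  have "lin_ext (Fp p) ?V (\<lambda>x. \<Oplus>\<^bsub>?V\<^esub>i\<in>{..Suc m}. alt_sign (Fp p) i \<odot>\<^bsub>?V\<^esub> fbasis (Fp p) (face A (Suc m) i x)) f
      = lft p \<phi> f"
  proof (rule lin_ext_eq_lft[OF _ _ f])
    fix x assume x: "x \<in> simplices A (Suc m)"
    have k: "Poly_Mapping.keys (frag_cmul ((-1) ^ i) (frag_of (face A (Suc m) i x))) \<subseteq> simplices A m"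
      if "i \<in> {..Suc m}" for i
      using that face[OF x, of i] by (auto simp: keys_frag_of)
    show "(\<Oplus>\<^bsub>?V\<^esub>i\<in>{..Suc m}. alt_sign (Fp p) i \<odot>\<^bsub>?V\<^esub> fbasis (Fp p) (face A (Suc m) i x)) = red p (\<phi> x)"
      unfolding \<phi>[OF x, symmetric] fbasis_eq alt_sign_smult
      by (rule red_sum[symmetric]) (use k in auto)
    show "Poly_Mapping.keys (\<phi> x) \<subseteq> simplices A m"
      unfolding \<phi>[OF x, symmetric] by (rule keys_sum_subset) (rule k)
  qed
  then show ?thesis by (simp add: sset_complex_def Let_def)
qed

lemma nerve_complex:
  assumes "monoid G"
  shows "frag_complex p (simplices (nerve G)) (bar_d G) (sset_complex (Fp p) (nerve G))"
proof
  show "chains (sset_complex (Fp p) (nerve G)) n = free (simplices (nerve G) n)" for n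
    by (simp add: sset_complex_def)
  show "Poly_Mapping.keys (bar_d G x) \<subseteq> simplices (nerve G) (n - 1)" if "x \<in> simplices (nerve G) n" for x n
    using bar_d_simplices[OF assms that] .
  show "frag_extend (bar_d G) (bar_d G x) = 0" if "x \<in> simplices (nerve G) n" for x n
    using bar_d_bar_d[OF assms, of x] that by (auto simp: nerve_simplices)
  show "bdry (sset_complex (Fp p) (nerve G)) n f = lft p (bar_d G) f"
    if f: "f \<in> carrier (free (simplices (nerve G) n))" for f n
  proof (cases n)
    case 0
    obtain c where c: "f = red p c" "Poly_Mapping.keys c \<subseteq> simplices (nerve G) n"
      using f by (rule carrier_redE)
    then have "frag_extend (bar_d G) c = 0"
      using 0 by (intro frag_extend_eq_0) (auto simp: nerve_simplices subset_iff)
    then show ?thesis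
      using 0 by (simp add: sset_complex_def c lft_red[OF refl] flip: red_zero)
  next
    case (Suc m)
    show ?thesis
      unfolding Suc
      by (rule sset_bdry) (use f Suc nerve_face_closed[OF assms] nerve_face_sum in
          \<open>auto simp: nerve_simplices\<close>)
  qed
qed

section \<open>The product of the nerve with itself\<close>

abbreviation (input) unzip :: "('u \<times> 'v) list \<Rightarrow> 'u list \<times> 'v list" where
  "unzip z \<equiv> (map fst z, map snd z)"

text \<open>Zipping identifies this product with the nerve of \<open>G \<times>\<times> G\<close>,
  so that the results on the bar differential apply to it.\<close>

definition prod_d :: "'a monoid \<Rightarrow> 'a list \<times> 'a list \<Rightarrow> 'a list \<times> 'a list \<Rightarrow>\<^sub>0 int" where
  "prod_d G = (\<lambda>(x, y). frag_map unzip (bar_d (G \<times>\<times> G) (zip x y)))"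

lemma prod_simplices_iff:
  "(x, y) \<in> simplices (prod_sset (nerve G) (nerve G)) n \<longleftrightarrow>
     length x = n \<and> length y = n \<and> zip x y \<in> simplices (nerve (G \<times>\<times> G)) n"
proof (cases "length x = length y")
  case True
  then have "set x = fst ` set (zip x y)" "set y = snd ` set (zip x y)"
    by (metis map_fst_zip set_map) (metis True map_snd_zip set_map)
  then show ?thesis
    using True by (auto simp: prod_sset_def nerve_simplices DirProd_def subset_iff)
qed (auto simp: prod_sset_def nerve_simplices)

lemma prod_face:
  assumes "length x = Suc m" "length y = Suc m" "i \<le> Suc m"
  shows "face (prod_sset (nerve G) (nerve G)) (Suc m) i (x, y) =
    unzip (face (nerve (G \<times>\<times> G)) (Suc m) i (zip x y))"
proof -
  define z where "z = zip x y"
  have z: "x = map fst z" "y = map snd z" "length z = Suc m" using assms by (auto simp: z_def)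
  show ?thesis
    unfolding z_def[symmetric] z(1,2) using assms(3) z(3)
    by (auto simp: prod_sset_def nerve_def map_tl map_butlast take_map drop_map mult_DirProd' zip_map_fst_snd)
qed

lemma prod_complex:
  assumes "monoid G"
  shows "frag_complex p (simplices (prod_sset (nerve G) (nerve G))) (prod_d G)
    (sset_complex (Fp p) (prod_sset (nerve G) (nerve G)))"
proof -
  let ?P = "prod_sset (nerve G) (nerve G)"
  have GG: "monoid (G \<times>\<times> G)" using assms by (rule DirProd_monoid[OF assms])
  have unz: "unzip z \<in> simplices ?P n" if "z \<in> simplices (nerve (G \<times>\<times> G)) n" for z n
    using that by (simp add: prod_simplices_iff zip_map_fst_snd nerve_simplices)
  have keys: "Poly_Mapping.keys (prod_d G x) \<subseteq> simplices ?P (n - 1)" if "x \<in> simplices ?P n" for x n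
  proof (cases x)
    case (Pair u v)
    then have "zip u v \<in> simplices (nerve (G \<times>\<times> G)) n" using that by (simp add: prod_simplices_iff)
    then have "Poly_Mapping.keys (bar_d (G \<times>\<times> G) (zip u v)) \<subseteq> simplices (nerve (G \<times>\<times> G)) (n - 1)"
      by (rule bar_d_simplices[OF GG])
    then show ?thesis
      unfolding Pair prod_d_def using unz by (auto intro!: keys_frag_extend_subset simp: keys_frag_of)
  qed
  show ?thesis
  proof
    show "chains (sset_complex (Fp p) ?P) n = free (simplices ?P n)" for n
      by (simp add: sset_complex_def)
    show "Poly_Mapping.keys (prod_d G x) \<subseteq> simplices ?P (n - 1)" if "x \<in> simplices ?P n" for x n
      using that by (rule keys)
    show "frag_extend (prod_d G) (prod_d G x) = 0" if "x \<in> simplices ?P n" for x n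
    proof (cases x)
      case (Pair u v)
      then have "set (zip u v) \<subseteq> carrier (G \<times>\<times> G)" using that by (simp add: prod_simplices_iff nerve_simplices)
      then have "frag_map unzip (frag_extend (bar_d (G \<times>\<times> G)) (bar_d (G \<times>\<times> G) (zip u v))) = 0"
        using bar_d_bar_d[OF GG] by simp
      then show ?thesis
        by (simp add: Pair prod_d_def frag_extend_frag_extend zip_map_fst_snd)
    qed
    show "bdry (sset_complex (Fp p) ?P) n f = lft p (prod_d G) f" if f: "f \<in> carrier (free (simplices ?P n))" for f n
    proof (cases n)
      case 0
      obtain c where c: "f = red p c" "Poly_Mapping.keys c \<subseteq> simplices ?P n"
        using f by (rule carrier_redE)
      have "frag_extend (prod_d G) c = 0"
      proof (rule frag_extend_eq_0)
        fix x assume "x \<in> Poly_Mapping.keys c"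
        then have "x \<in> simplices ?P 0" using c 0 by auto
        then have "x = ([], [])" by (cases x) (auto simp: prod_simplices_iff)
        then show "prod_d G x = 0" by (simp add: prod_d_def)
      qed
      then show ?thesis
        using 0 by (simp add: sset_complex_def c lft_red[OF refl] flip: red_zero)
    next
      case (Suc m)
      show ?thesis
        unfolding Suc
      proof (rule sset_bdry)
        fix x i assume x: "x \<in> simplices ?P (Suc m)" "i \<le> Suc m"
        obtain u v where uv: "x = (u, v)" by (cases x)
        have "face ?P (Suc m) i x = unzip (face (nerve (G \<times>\<times> G)) (Suc m) i (zip u v))"
          unfolding uv using x uv by (intro prod_face) (auto simp: prod_simplices_iff)
        then show "face ?P (Suc m) i x \<in> simplices ?P m"
          using nerve_face_closed[OF GG _ x(2)] x(1) unz by (simp add: uv prod_simplices_iff)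
      next
        fix x assume x: "x \<in> simplices ?P (Suc m)"
        obtain u v where uv: "x = (u, v)" by (cases x)
        have len: "length u = Suc m" "length v = Suc m" using x uv by (auto simp: prod_simplices_iff)
        have "(\<Sum>i\<le>Suc m. frag_cmul ((-1) ^ i) (frag_of (face ?P (Suc m) i x))) =
          (\<Sum>i\<le>Suc m. frag_map unzip (frag_cmul ((-1) ^ i) (frag_of (face (nerve (G \<times>\<times> G)) (Suc m) i (zip u v)))))"
          using len by (intro sum.cong) (auto simp: uv prod_face frag_extend_cmul simp del: sum.atMost_Suc)
        also have "\<dots> = frag_map unzip (bar_d (G \<times>\<times> G) (zip u v))"
          using nerve_face_sum[of "zip u v" m "G \<times>\<times> G"] len
          by (simp only: frag_extend_sum[OF finite_atMost, symmetric, unfolded o_def] length_zip min.idem)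
        finally show "(\<Sum>i\<le>Suc m. frag_cmul ((-1) ^ i) (frag_of (face ?P (Suc m) i x))) = prod_d G x"
          by (simp add: uv prod_d_def)
      qed (use f Suc in simp)
    qed
  qed
qed

section \<open>The tensor product complex\<close>

lemma lookup_tens:
  "poly_mapping.lookup (tens i c d) (k, x, y) =
     (if k = i then poly_mapping.lookup c x * poly_mapping.lookup d y else 0)"
proof (induction c rule: frag_linear_induct)
  case (basis u)
  show ?case
    by (induction d rule: frag_linear_induct) (auto simp: lookup_minus algebra_simps)
qed (auto simp: lookup_minus algebra_simps)

lemma keys_tens: "Poly_Mapping.keys (tens i c d) \<subseteq> {i} \<times> Poly_Mapping.keys c \<times> Poly_Mapping.keys d"
  by (auto simp: in_keys_iff lookup_tens split: if_splits)

text \<open>Multiplying residues agrees with reducing the integral product; in particular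
  congruences modulo \<open>p\<close> pass through \<open>tens\<close>.\<close>

lemma chain_tensor_red: "chain_tensor (Fp p) i (red p c) (red p d) = red p (tens i c d)"
  by (auto simp: chain_tensor_def red_def lookup_tens Fp_simps fun_eq_iff mod_mult_eq)

lemma red_tens_cong:
  "red p c = red p c' \<Longrightarrow> red p d = red p d' \<Longrightarrow> red p (tens i c d) = red p (tens i c' d')"
  by (metis chain_tensor_red)

abbreviation tbasis :: "'a monoid \<Rightarrow> nat \<Rightarrow> (nat \<times> 'a list \<times> 'a list) set" where
  "tbasis G \<equiv> tensor_basis (nerve G) (nerve G)"

lemma tbasis_iff:
  "(i, u, v) \<in> tbasis G n \<longleftrightarrow>
     i \<le> n \<and> length u = i \<and> set u \<subseteq> carrier G \<and> length v = n - i \<and> set v \<subseteq> carrier G"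
  by (auto simp: tensor_basis_def nerve_simplices)

text \<open>The mixed terms cancel through the signs (-1)^(i-1) and (-1)^i. For \<open>i = 0\<close>
  the truncated \<open>i - 1\<close> is harmless, as then \<open>u\<close> is empty and
  \<open>bar_d\<close> vanishes on it.\<close>

lemma tensor_d_tensor_d:
  assumes "monoid G" "(i, u, v) \<in> tbasis G n"
  shows "frag_extend (tensor_d G) (tensor_d G (i, u, v)) = 0"
proof -
  have "set u \<subseteq> carrier G" "set v \<subseteq> carrier G" using assms by (auto simp: tbasis_iff)
  then have "frag_extend (bar_d G) (bar_d G u) = 0" "frag_extend (bar_d G) (bar_d G v) = 0"
    using bar_d_bar_d[OF assms(1)] by auto
  then show ?thesis
    using assms(2) by (cases i) (auto simp: frag_extend_add frag_extend_cmul tensor_d_tens tbasis_iff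
        frag_cmul_distrib[symmetric])
qed

lemma keys_tensor_d:
  assumes "monoid G" "t \<in> tbasis G n"
  shows "Poly_Mapping.keys (tensor_d G t) \<subseteq> tbasis G (n - 1)"
proof -
  obtain i u v where t: "t = (i, u, v)" by (cases t)
  have iuv: "i \<le> n" "length u = i" "set u \<subseteq> carrier G" "length v = n - i" "set v \<subseteq> carrier G"
    using assms(2) by (auto simp: t tbasis_iff)
  have "Poly_Mapping.keys (tensor_d G t) \<subseteq> Poly_Mapping.keys (tens (i - 1) (bar_d G u) (frag_of v)) \<union>
      Poly_Mapping.keys (tens i (frag_of u) (bar_d G v))"
    using keys_add[of "tens (i - 1) (bar_d G u) (frag_of v)" "frag_cmul ((-1) ^ i) (tens i (frag_of u) (bar_d G v))"]
    by (auto simp: t)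
  also have "\<dots> \<subseteq> tbasis G (n - 1)"
  proof -
    have "x \<in> tbasis G (n - 1)" if x: "x \<in> Poly_Mapping.keys (tens (i - 1) (bar_d G u) (frag_of v))" for x
    proof -
      obtain u' where "x = (i - 1, u', v)" "u' \<in> Poly_Mapping.keys (bar_d G u)"
        using subsetD[OF keys_tens x] by (auto simp: keys_frag_of)
      then show ?thesis using bar_d_keys[OF assms(1) iuv(3), of u'] iuv by (auto simp: tbasis_iff)
    qed
    moreover have "x \<in> tbasis G (n - 1)" if x: "x \<in> Poly_Mapping.keys (tens i (frag_of u) (bar_d G v))" for x
    proof -
      obtain v' where "x = (i, u, v')" "v' \<in> Poly_Mapping.keys (bar_d G v)"
        using subsetD[OF keys_tens x] by (auto simp: keys_frag_of)
      then show ?thesis using bar_d_keys[OF assms(1) iuv(5), of v'] iuv by (auto simp: tbasis_iff)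
    qed
    ultimately show ?thesis by blast
  qed
  finally show ?thesis .
qed

lemma tensor_complex:
  assumes "monoid G"
  shows "frag_complex p (tbasis G) (tensor_d G) (tensor_complex (Fp p) (nerve G) (nerve G))"
proof -
  interpret C: frag_complex p "simplices (nerve G)" "bar_d G" "sset_complex (Fp p) (nerve G)"
    by (rule nerve_complex[OF assms])
  show ?thesis
  proof
    show "chains (tensor_complex (Fp p) (nerve G) (nerve G)) n = free (tbasis G n)" for n
      by (simp add: tensor_complex_def)
    show keys: "Poly_Mapping.keys (tensor_d G t) \<subseteq> tbasis G (n - 1)" if "t \<in> tbasis G n" for t n
      using keys_tensor_d[OF assms that] .
    show "frag_extend (tensor_d G) (tensor_d G t) = 0" if "t \<in> tbasis G n" for t n
      using that tensor_d_tensor_d[OF assms] by (cases t) blast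
    show "bdry (tensor_complex (Fp p) (nerve G) (nerve G)) n f = lft p (tensor_d G) f"
      if f: "f \<in> carrier (free (tbasis G n))" for f n
    proof (cases n)
      case 0
      obtain c where c: "f = red p c" "Poly_Mapping.keys c \<subseteq> tbasis G n"
        using f by (rule carrier_redE)
      have "frag_extend (tensor_d G) c = 0"
      proof (rule frag_extend_eq_0)
        fix t assume "t \<in> Poly_Mapping.keys c"
        then have "t \<in> tbasis G 0" using c 0 by auto
        then have "t = (0, [], [])" by (cases t) (auto simp: tbasis_iff)
        then show "tensor_d G t = 0" by simp
      qed
      then show ?thesis
        using 0 by (simp add: tensor_complex_def c lft_red[OF refl] flip: red_zero)
    next
      case (Suc m)
      have bdry: "bdry (sset_complex (Fp p) (nerve G)) k (fbasis (Fp p) x) = red p (bar_d G x)"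
        if "x \<in> simplices (nerve G) k" for x k
        using C.bdry_red[of "frag_of x" k] that by (simp add: fbasis_eq keys_frag_of)
      have "bdry (tensor_complex (Fp p) (nerve G) (nerve G)) n f = lin_ext (Fp p) (free (tbasis G m))
          (\<lambda>(i, x, y). chain_tensor (Fp p) (i - 1) (bdry (sset_complex (Fp p) (nerve G)) i (fbasis (Fp p) x)) (fbasis (Fp p) y)
            \<oplus>\<^bsub>free (tbasis G m)\<^esub> alt_sign (Fp p) i \<odot>\<^bsub>free (tbasis G m)\<^esub>
            chain_tensor (Fp p) i (fbasis (Fp p) x) (bdry (sset_complex (Fp p) (nerve G)) (n - i) (fbasis (Fp p) y))) f"
        by (simp add: tensor_complex_def Suc Let_def)
      also have "\<dots> = lft p (tensor_d G) f"
      proof (rule lin_ext_eq_lft[OF _ _ f])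
        fix t assume t: "t \<in> tbasis G n"
        show "Poly_Mapping.keys (tensor_d G t) \<subseteq> tbasis G m" using keys[OF t] Suc by simp
        obtain i x y where ixy: "t = (i, x, y)" by (cases t)
        then have xy: "x \<in> simplices (nerve G) i" "y \<in> simplices (nerve G) (n - i)"
          using t by (auto simp: tensor_basis_def)
        show "(case t of (i, x, y) \<Rightarrow>
          chain_tensor (Fp p) (i - 1) (bdry (sset_complex (Fp p) (nerve G)) i (fbasis (Fp p) x)) (fbasis (Fp p) y)
            \<oplus>\<^bsub>free (tbasis G m)\<^esub> alt_sign (Fp p) i \<odot>\<^bsub>free (tbasis G m)\<^esub>
            chain_tensor (Fp p) i (fbasis (Fp p) x) (bdry (sset_complex (Fp p) (nerve G)) (n - i) (fbasis (Fp p) y))) =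
          red p (tensor_d G t)"
          unfolding ixy prod.case bdry[OF xy(1)] bdry[OF xy(2)]
          unfolding fbasis_eq chain_tensor_red alt_sign_smult red_add[symmetric] tensor_d.simps ..
      qed
      finally show ?thesis .
    qed
  qed
qed

section \<open>The Alexander-Whitney map on the nerve\<close>

lemma front_face_nerve: "length x = i + k \<Longrightarrow> front_face (nerve G) i k x = take i x"
proof (induction k arbitrary: x)
  case (Suc k)
  then show ?case by (simp add: nerve_def butlast_conv_take)
qed simp

lemma back_face_nerve: "length x = j + k \<Longrightarrow> back_face (nerve G) j k x = drop k x"
proof (induction k arbitrary: x)
  case (Suc k)
  then show ?case by (simp add: nerve_def drop_Suc)
qed simp

lemma aw_keys:
  assumes "(x, y) \<in> simplices (prod_sset (nerve G) (nerve G)) n"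
  shows "Poly_Mapping.keys (aw (zip x y)) \<subseteq> tbasis G n"
proof -
  have xy: "length x = n" "length y = n" "set x \<subseteq> carrier G" "set y \<subseteq> carrier G"
    using assms by (auto simp: prod_sset_def nerve_simplices)
  then show ?thesis
    unfolding aw_eq
    by (intro keys_sum_subset) (auto simp: keys_frag_of tbasis_iff dest!: in_set_takeD in_set_dropD)
qed

lemma alexander_whitney_eq:
  assumes f: "f \<in> carrier (free (simplices (prod_sset (nerve G) (nerve G)) n))"
  shows "alexander_whitney (Fp p) (nerve G) (nerve G) n f = lft p (\<lambda>(x, y). aw (zip x y)) f"
  unfolding alexander_whitney_def Let_def
proof (rule lin_ext_eq_lft[OF _ _ f])
  fix z assume z: "z \<in> simplices (prod_sset (nerve G) (nerve G)) n"
  obtain x y where xy: "z = (x, y)" by (cases z)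
  then show "Poly_Mapping.keys (case z of (x, y) \<Rightarrow> aw (zip x y)) \<subseteq> tbasis G n"
    using z by (simp add: aw_keys)
  have len: "length x = n" "length y = n" "set x \<subseteq> carrier G" "set y \<subseteq> carrier G"
    using z xy by (auto simp: prod_sset_def nerve_simplices)
  have k: "Poly_Mapping.keys (frag_of (i, take i x, drop i y)) \<subseteq> tbasis G n" if "i \<le> n" for i
    using that len by (auto simp: keys_frag_of tbasis_iff dest!: in_set_takeD in_set_dropD)
  interpret M: module "Fp p" "free (tbasis G n)" by (rule free_module)
  have "(\<Oplus>\<^bsub>free (tbasis G n)\<^esub>i\<in>{..n}. fbasis (Fp p)
      (i, front_face (nerve G) i (n - i) x, back_face (nerve G) (n - i) i y)) =
      (\<Oplus>\<^bsub>free (tbasis G n)\<^esub>i\<in>{..n}. red p (frag_of (i, take i x, drop i y)))"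
    using len k by (intro M.M.finsum_cong') (auto simp: fbasis_eq front_face_nerve back_face_nerve red_carrier)
  also have "\<dots> = red p (aw (zip x y))"
    unfolding aw_eq using len k by (subst red_sum[symmetric]) auto
  finally show "(case z of (x, y) \<Rightarrow> \<Oplus>\<^bsub>free (tbasis G n)\<^esub>i\<in>{..n}. fbasis (Fp p)
      (i, front_face (nerve G) i (n - i) x, back_face (nerve G) (n - i) i y)) =
      red p (case z of (x, y) \<Rightarrow> aw (zip x y))"
    by (simp add: xy)
qed

end


section \<open>Surjectivity of the Kuenneth map\<close>

lemma lin_hom_finsum:
  fixes M :: "('r,'m) module" and N :: "('r,'n) module"
  assumes "module R M" "module R N" "f \<in> lin_hom R M N" "finite I" "g \<in> I \<rightarrow> carrier M"
  shows "f (\<Oplus>\<^bsub>M\<^esub>i\<in>I. g i) = (\<Oplus>\<^bsub>N\<^esub>i\<in>I. f (g i))"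
proof -
  interpret M: module R M by fact
  interpret N: module R N by fact
  show ?thesis
    using assms(4,5)
  proof (induction I rule: finite_induct)
    case (insert i I)
    then show ?case
      using lin_hom_closed[OF assms(3)]
      by (simp add: Pi_def lin_hom_add[OF assms(3)])
  qed (simp add: lin_hom_zero[OF assms(1-3)])
qed

lemma red_diff_eq_zero_iff: "red p (a - b) = red p 0 \<longleftrightarrow> red p a = red p b"
proof
  assume "red p (a - b) = red p 0"
  from red_add_cong[OF this refl, of b] show "red p a = red p b" by simp
next
  assume "red p a = red p b"
  from red_diff_cong[OF this refl, of b] show "red p (a - b) = red p 0" by simp
qed

text \<open>
  This replaces a splitting of the complex into its homology and an acyclic part: with \<open>d\<close> the
  differential, \<open>1 - d h - h d\<close> is a chain map with values in the cycles, homotopic to the identity.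
\<close>

lemma (in frag_complex) generalized_inverse:
  obtains h where "\<And>x. x \<in> S n \<Longrightarrow> Poly_Mapping.keys (h x) \<subseteq> S (Suc n)"
    "\<And>b. Poly_Mapping.keys b \<subseteq> S (Suc n) \<Longrightarrow>
      red p (frag_extend \<phi> (frag_extend h (frag_extend \<phi> b))) = red p (frag_extend \<phi> b)"
proof -
  interpret M: module "Fp p" "free (S n)" by (rule free_module)
  have bnd_sub': "submodule (bnd n) (Fp p) (free (S n))"
    using bnd_sub[of n] by (simp add: chains_eq)
  obtain U where U: "submodule U (Fp p) (free (S n))" "U \<inter> bnd n = {\<zero>\<^bsub>free (S n)\<^esub>}"
    "\<And>v. v \<in> carrier (free (S n)) \<Longrightarrow> \<exists>w\<in>bnd n. \<exists>u\<in>U. v = w \<oplus>\<^bsub>free (S n)\<^esub> u"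
    using submodule_complement[OF Fp.is_field free_module bnd_sub'] by metis
  have keys_\<phi>: "Poly_Mapping.keys (frag_extend \<phi> c) \<subseteq> S n" if "Poly_Mapping.keys c \<subseteq> S (Suc n)" for c
    using frag_extend_keys[OF that] by simp
  \<comment> \<open>Splitting \<open>x\<close> along the boundaries and \<open>U\<close> yields a
    chain whose boundary is the first part of \<open>x\<close>. With \<open>h x\<close> chosen as
    such a chain, \<open>h\<close> followed by the differential is the projection onto the
    boundaries along \<open>U\<close>.\<close>
  have "\<exists>c. Poly_Mapping.keys c \<subseteq> S (Suc n) \<and> red p (frag_of x - frag_extend \<phi> c) \<in> U" if x: "x \<in> S n" for x
  proof -
    have x': "red p (frag_of x) \<in> carrier (free (S n))" using x by (simp add: red_carrier)
    then obtain w u where w: "w \<in> bnd n" and u: "u \<in> U" and e: "red p (frag_of x) = w \<oplus>\<^bsub>free (S n)\<^esub> u"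
      using U(3) by blast
    obtain c where c: "Poly_Mapping.keys c \<subseteq> S (Suc n)" "w = red p (frag_extend \<phi> c)"
      using w bnd_iff by auto
    have wc: "w \<in> carrier (free (S n))" and uc: "u \<in> carrier (free (S n))"
      using submodule_subset[OF bnd_sub'] submodule_subset[OF U(1)] w u by auto
    have "red p (frag_of x - frag_extend \<phi> c) = red p (frag_of x) \<ominus>\<^bsub>free (S n)\<^esub> w"
      unfolding c(2) using x keys_\<phi>[OF c(1)] by (intro red_diff) auto
    also have "\<dots> = (u \<oplus>\<^bsub>free (S n)\<^esub> w) \<ominus>\<^bsub>free (S n)\<^esub> w"
      unfolding e using wc uc by (simp add: M.M.a_comm)
    also have "\<dots> = u"
      using wc uc by (simp add: a_minus_def M.M.a_assoc M.M.r_neg)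
    finally show ?thesis using c(1) u by auto
  qed
  then obtain h where h: "\<And>x. x \<in> S n \<Longrightarrow> Poly_Mapping.keys (h x) \<subseteq> S (Suc n)"
    "\<And>x. x \<in> S n \<Longrightarrow> red p (frag_of x - frag_extend \<phi> (h x)) \<in> U"
    by metis
  have hk: "Poly_Mapping.keys (frag_extend h c) \<subseteq> S (Suc n)" if "Poly_Mapping.keys c \<subseteq> S n" for c
    using h(1) that by (intro keys_frag_extend_subset) auto
  have inU: "Poly_Mapping.keys c \<subseteq> S n \<and> red p (c - frag_extend \<phi> (frag_extend h c)) \<in> U"
    if "Poly_Mapping.keys c \<subseteq> S n" for c
    using that
  proof (induction c rule: frag_induction)
    case zero
    show ?case using submodule_zero[OF U(1)] by (simp add: red_zero[where S = "S n"])
  next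
    case (one x)
    then show ?case using h(2) by simp
  next
    case (diff a b)
    define a' where "a' = a - frag_extend \<phi> (frag_extend h a)"
    define b' where "b' = b - frag_extend \<phi> (frag_extend h b)"
    have k: "Poly_Mapping.keys a' \<subseteq> S n" "Poly_Mapping.keys b' \<subseteq> S n"
      using diff keys_\<phi>[OF hk] keys_diff[of a] keys_diff[of b] unfolding a'_def b'_def by blast+
    have "red p (a' - b') \<in> U"
      using diff red_diff[OF k] submodule_diff[OF U(1)] by (simp add: a'_def b'_def)
    moreover have "a - b - frag_extend \<phi> (frag_extend h (a - b)) = a' - b'"
      by (simp add: a'_def b'_def frag_extend_diff)
    moreover have "Poly_Mapping.keys (a - b) \<subseteq> S n" using diff keys_diff[of a b] by blast
    ultimately show ?case by simp
  qed
  show ?thesis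
  proof
    fix b :: "'x \<Rightarrow>\<^sub>0 int" assume b: "Poly_Mapping.keys b \<subseteq> S (Suc n)"
    define c where "c = frag_extend \<phi> b"
    have c: "Poly_Mapping.keys c \<subseteq> S n" unfolding c_def by (rule keys_\<phi>[OF b])
    have "Poly_Mapping.keys (b - frag_extend h c) \<subseteq> S (Suc n)"
      using b hk[OF c] keys_diff[of b "frag_extend h c"] by blast
    moreover have "c - frag_extend \<phi> (frag_extend h c) = frag_extend \<phi> (b - frag_extend h c)"
      by (simp add: c_def frag_extend_diff)
    ultimately have "red p (c - frag_extend \<phi> (frag_extend h c)) \<in> bnd n"
      using bnd_iff by metis
    \<comment> \<open>For a boundary \<open>c\<close> the difference is both a boundary and an
      element of \<open>U\<close>, hence zero.\<close>
    then have "red p (c - frag_extend \<phi> (frag_extend h c)) = red p 0"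
      using inU[OF c] U(2) unfolding red_zero[where S = "S n"] by blast
    then show "red p (frag_extend \<phi> (frag_extend h c)) = red p c"
      by (simp add: red_diff_eq_zero_iff)
  qed (rule h(1))
qed

text \<open>Chooses the lift of the second cycle so that the two lifts differ exactly by an integral
  boundary, not only modulo \<open>p\<close>.\<close>

lemma (in frag_complex) hclass_red_cong:
  assumes "z \<in> cyc n" "z' \<in> cyc n" "hclass C n z = hclass C n z'" "z = red p c"
    "Poly_Mapping.keys c \<subseteq> S n"
  obtains b where "Poly_Mapping.keys b \<subseteq> S (Suc n)" "z' = red p (c - frag_extend (\<phi>) b)"
    "Poly_Mapping.keys (c - frag_extend (\<phi>) b) \<subseteq> S n"
proof -
  obtain c' where c': "z' = red p c'" "Poly_Mapping.keys c' \<subseteq> S n"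
    using assms(2) by (rule cycE)
  have "z \<ominus>\<^bsub>free (S n)\<^esub> z' \<in> bnd n"
    using assms(1-3) by (simp add: hclass_eq_iff chains_eq)
  then obtain b where b: "Poly_Mapping.keys b \<subseteq> S (Suc n)" "z \<ominus>\<^bsub>free (S n)\<^esub> z' = red p (frag_extend (\<phi>) b)"
    using bnd_iff by auto
  have "red p (c - c') = red p (frag_extend (\<phi>) b)"
    using b(2) red_diff[OF assms(5) c'(2)] by (simp add: assms(4) c'(1))
  from red_diff_cong[OF refl this, of c]
  have "red p c' = red p (c - frag_extend (\<phi>) b)" by simp
  moreover have "Poly_Mapping.keys (c - frag_extend (\<phi>) b) \<subseteq> S n"
    using assms(5) frag_extend_keys[OF b(1)] keys_diff[of c "frag_extend (\<phi>) b"] by auto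
  ultimately show ?thesis using that b(1) c'(1) by simp
qed

section \<open>Deforming cycles of the tensor complex into tensors of cycles\<close>

locale nerve_group = mod_prime p + group G for p :: nat and G :: "'a monoid" (structure)
begin

abbreviation N :: "nat \<Rightarrow> 'a list set" where
  "N \<equiv> simplices (nerve G)"

abbreviation CC :: "(int, 'a list \<Rightarrow> int) complex_data" where
  "CC \<equiv> sset_complex (Fp p) (nerve G)"

abbreviation PC :: "(int, 'a list \<times> 'a list \<Rightarrow> int) complex_data" where
  "PC \<equiv> sset_complex (Fp p) (prod_sset (nerve G) (nerve G))"

abbreviation TC :: "(int, nat \<times> 'a list \<times> 'a list \<Rightarrow> int) complex_data" where
  "TC \<equiv> tensor_complex (Fp p) (nerve G) (nerve G)"

sublocale C: frag_complex p N "bar_d G" CC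
  by (rule nerve_complex[OF is_monoid])

sublocale P: frag_complex p "simplices (prod_sset (nerve G) (nerve G))" "prod_d G" PC
  by (rule prod_complex[OF is_monoid])

sublocale T: frag_complex p "tbasis G" "tensor_d G" TC
  by (rule tensor_complex[OF is_monoid])

lemma tens_keys:
  assumes "Poly_Mapping.keys c \<subseteq> N i" "Poly_Mapping.keys e \<subseteq> N (q - i)" "i \<le> q"
  shows "Poly_Mapping.keys (tens i c e) \<subseteq> tbasis G q"
proof
  fix t assume "t \<in> Poly_Mapping.keys (tens i c e)"
  from subsetD[OF keys_tens this] show "t \<in> tbasis G q"
    using assms by (auto simp: tensor_basis_def)
qed

context
  fixes h :: "'a list \<Rightarrow> 'a list \<Rightarrow>\<^sub>0 int"
  assumes h_keys: "\<And>n x. x \<in> N n \<Longrightarrow> Poly_Mapping.keys (h x) \<subseteq> N (Suc n)"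
    and h_inverse: "\<And>n b. Poly_Mapping.keys b \<subseteq> N (Suc n) \<Longrightarrow>
      red p (frag_extend (bar_d G) (frag_extend h (frag_extend (bar_d G) b))) = red p (frag_extend (bar_d G) b)"
begin

definition pr :: "'a list \<Rightarrow> 'a list \<Rightarrow>\<^sub>0 int" where
  "pr x = frag_of x - frag_extend (bar_d G) (h x) - frag_extend h (bar_d G x)"

lemma pr_keys:
  assumes x: "x \<in> N n"
  shows "Poly_Mapping.keys (pr x) \<subseteq> N n"
proof -
  have "Poly_Mapping.keys (frag_extend h (bar_d G x)) \<subseteq> N n"
  proof (cases n)
    case 0
    then show ?thesis using x by (simp add: nerve_simplices)
  next
    case (Suc m)
    then show ?thesis
      using C.\<phi>_keys[OF x] h_keys[of _ m] by (intro keys_frag_extend_subset) auto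
  qed
  moreover have "Poly_Mapping.keys (frag_extend (bar_d G) (h x)) \<subseteq> N n"
    using C.frag_extend_keys[OF h_keys[OF x]] by simp
  moreover have "Poly_Mapping.keys (pr x) \<subseteq> Poly_Mapping.keys (frag_of x) \<union>
      Poly_Mapping.keys (frag_extend (bar_d G) (h x)) \<union> Poly_Mapping.keys (frag_extend h (bar_d G x))"
    unfolding pr_def using keys_diff[of "frag_of x - frag_extend (bar_d G) (h x)"] keys_diff[of "frag_of x"]
    by blast
  ultimately show ?thesis using x by (auto simp: keys_frag_of)
qed

text \<open>d (1 - d h - h d) = d - d h d because d d = 0, and d h d = d modulo \<open>p\<close> is
  the property for which \<open>h\<close> was chosen.\<close>

lemma pr_cycle:
  assumes x: "x \<in> N n"
  shows "red p (frag_extend (bar_d G) (pr x)) = red p 0"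
proof -
  have "red p (frag_extend (bar_d G) (frag_extend h (bar_d G x))) = red p (bar_d G x)"
  proof (cases n)
    case 0
    then show ?thesis using x by (simp add: nerve_simplices)
  next
    case (Suc m)
    then show ?thesis using x h_inverse[of "frag_of x" m] by (simp add: keys_frag_of)
  qed
  moreover have "frag_extend (bar_d G) (frag_extend (bar_d G) (h x)) = 0"
    by (rule C.frag_extend_frag_extend_zero[OF h_keys[OF x]])
  ultimately show ?thesis
    by (simp add: pr_def frag_extend_diff red_diff_eq_zero_iff)
qed

definition htp_left :: "nat \<times> 'a list \<times> 'a list \<Rightarrow> nat \<times> 'a list \<times> 'a list \<Rightarrow>\<^sub>0 int" where
  "htp_left = (\<lambda>(i, u, v). tens (Suc i) (h u) (frag_of v))"

text \<open>The sign is the Koszul sign for moving \<open>h\<close>, of degree one, past the left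
  factor.\<close>

definition htp_right :: "nat \<times> 'a list \<times> 'a list \<Rightarrow> nat \<times> 'a list \<times> 'a list \<Rightarrow>\<^sub>0 int" where
  "htp_right = (\<lambda>(i, u, v). frag_cmul ((-1) ^ i) (tens i (frag_of u) (h v)))"

lemma frag_extend_htp_left: "frag_extend htp_left (tens i c d) = tens (Suc i) (frag_extend h c) d"
  using frag_extend_tens_tens[of Suc h frag_of i c d]
  by (simp add: htp_left_def frag_expansion[symmetric])

lemma frag_extend_htp_right:
  "frag_extend htp_right (tens i c d) = frag_cmul ((-1) ^ i) (tens i c (frag_extend h d))"
proof -
  have "frag_extend htp_right (tens i c d) = frag_extend (\<lambda>x. frag_extend (\<lambda>y. frag_cmul ((-1) ^ i) (tens i (frag_of x) (h y))) d) c"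
    by (simp add: frag_extend_tens htp_right_def)
  also have "\<dots> = frag_cmul ((-1) ^ i) (frag_extend (\<lambda>x. frag_extend (\<lambda>y. tens i (frag_of x) (h y)) d) c)"
    by (simp add: frag_extend_fun_cmul)
  also have "frag_extend (\<lambda>x. frag_extend (\<lambda>y. tens i (frag_of x) (h y)) d) c = tens i c (frag_extend h d)"
    using frag_extend_tens_tens[of "\<lambda>j. j" frag_of h i c d]
    by (simp add: frag_extend_tens frag_expansion[symmetric])
  finally show ?thesis .
qed

text \<open>The terms with the differential of the right factor cancel, because \<open>h\<close>
  raises the degree \<open>i\<close> in their sign by one; what remains is the homotopy formula for
  \<open>h\<close> on the left factor.\<close>

lemma htp_left:
  assumes "(i, u, v) \<in> tbasis G q"
  shows "frag_extend (tensor_d G) (htp_left (i, u, v)) + frag_extend htp_left (tensor_d G (i, u, v)) =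
    frag_of (i, u, v) - tens i (pr u) (frag_of v)"
proof -
  have l: "htp_left (i, u, v) = tens (Suc i) (h u) (frag_of v)" by (simp add: htp_left_def)
  show ?thesis
  proof (cases i)
    case 0
    then have "u = []" using assms by (simp add: tbasis_iff)
    then show ?thesis
      unfolding l using 0
      by (simp add: tensor_d_tens frag_extend_add frag_extend_htp_left pr_def frag_extend_cmul)
  next
    case (Suc j)
    then show ?thesis
      unfolding l by (simp add: tensor_d_tens frag_extend_add frag_extend_diff frag_extend_htp_left
          frag_extend_cmul pr_def algebra_simps flip: minus_frag_cmul)
  qed
qed

lemma htp_right:
  assumes "(i, u, v) \<in> tbasis G q"
  shows "frag_extend (tensor_d G) (htp_right (i, u, v)) + frag_extend htp_right (tensor_d G (i, u, v)) =
    frag_of (i, u, v) - tens i (frag_of u) (pr v)"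
proof -
  define s :: int where "s = (-1) ^ i"
  have sq: "s * s = 1" by (simp add: s_def flip: power_mult_distrib)
  have r: "htp_right (i, u, v) = frag_cmul s (tens i (frag_of u) (h v))"
    "frag_extend htp_right (tens i c d) = frag_cmul s (tens i c (frag_extend h d))"
    "tensor_d G (i, u, v) = tens (i - 1) (bar_d G u) (frag_of v) + frag_cmul s (tens i (frag_of u) (bar_d G v))"
    "frag_extend (tensor_d G) (tens i c d) =
      tens (i - 1) (frag_extend (bar_d G) c) d + frag_cmul s (tens i c (frag_extend (bar_d G) d))" for c d
    by (auto simp: s_def frag_extend_htp_right tensor_d_tens htp_right_def[THEN fun_cong])
  have l: "frag_extend htp_right (tens (i - 1) (bar_d G u) (frag_of v)) = frag_cmul (- s) (tens (i - 1) (bar_d G u) (h v))"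
  proof (cases i)
    case 0
    then have "u = []" using assms by (simp add: tbasis_iff)
    then show ?thesis by simp
  qed (simp add: frag_extend_htp_right s_def)
  show ?thesis
    unfolding r(1,3) by (simp add: r l[simplified] frag_extend_add frag_extend_cmul frag_cmul_distrib2 sq pr_def
        del: tensor_d.simps flip: minus_frag_cmul)
qed

text \<open>Composes the homotopies from the identity to pr \<otimes> 1 and from there to pr
  \<otimes> pr. Both are integral identities; the cycle condition modulo \<open>p\<close> removes
  their terms that apply a homotopy to a boundary.\<close>

lemma tensor_homotopy:
  assumes t: "Poly_Mapping.keys t \<subseteq> tbasis G q" and cycle: "red p (frag_extend (tensor_d G) t) = red p 0"
  obtains b where "Poly_Mapping.keys b \<subseteq> tbasis G (Suc q)"
    "red p t = red p (frag_extend (\<lambda>(i, u, v). tens i (pr u) (pr v)) t + frag_extend (tensor_d G) b)"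
proof -
  let ?d = "frag_extend (tensor_d G)" and ?L = "frag_extend htp_left" and ?R = "frag_extend htp_right"
  let ?l = "frag_extend (\<lambda>(i, u, v). tens i (pr u) (frag_of v))"
  let ?r = "frag_extend (\<lambda>(i, u, v). tens i (frag_of u) (pr v))"
  have basis: "(i, u, v) \<in> tbasis G q \<Longrightarrow> u \<in> N i \<and> v \<in> N (q - i) \<and> i \<le> q" for i u v
    by (auto simp: tensor_basis_def)
  have L: "?d (?L c) + ?L (?d c) = c - ?l c" if "Poly_Mapping.keys c \<subseteq> tbasis G q" for c
  proof -
    have "?d (?L c) + ?L (?d c) =
        frag_extend (\<lambda>x. frag_extend (tensor_d G) (htp_left x) + ?L (tensor_d G x)) c"
      by (simp add: frag_extend_frag_extend frag_extend_fun_add)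
    also have "\<dots> = frag_extend (\<lambda>x. frag_of x - (case x of (i, u, v) \<Rightarrow> tens i (pr u) (frag_of v))) c"
    proof (rule frag_extend_eq)
      fix x assume "x \<in> Poly_Mapping.keys c"
      then show "frag_extend (tensor_d G) (htp_left x) + ?L (tensor_d G x) =
          frag_of x - (case x of (i, u, v) \<Rightarrow> tens i (pr u) (frag_of v))"
        using that htp_left[of "fst x" "fst (snd x)" "snd (snd x)" q] by (cases x) auto
    qed
    finally show ?thesis by (simp add: frag_extend_fun_diff frag_expansion[symmetric])
  qed
  have R: "?d (?R c) + ?R (?d c) = c - ?r c" if "Poly_Mapping.keys c \<subseteq> tbasis G q" for c
  proof -
    have "?d (?R c) + ?R (?d c) =
        frag_extend (\<lambda>x. frag_extend (tensor_d G) (htp_right x) + ?R (tensor_d G x)) c"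
      by (simp add: frag_extend_frag_extend frag_extend_fun_add)
    also have "\<dots> = frag_extend (\<lambda>x. frag_of x - (case x of (i, u, v) \<Rightarrow> tens i (frag_of u) (pr v))) c"
    proof (rule frag_extend_eq)
      fix x assume "x \<in> Poly_Mapping.keys c"
      then show "frag_extend (tensor_d G) (htp_right x) + ?R (tensor_d G x) =
          frag_of x - (case x of (i, u, v) \<Rightarrow> tens i (frag_of u) (pr v))"
        using that htp_right[of "fst x" "fst (snd x)" "snd (snd x)" q] by (cases x) auto
    qed
    finally show ?thesis by (simp add: frag_extend_fun_diff frag_expansion[symmetric])
  qed
  have lk: "Poly_Mapping.keys (?l t) \<subseteq> tbasis G q"
  proof (rule keys_frag_extend_subset)
    fix x assume x: "x \<in> Poly_Mapping.keys t"
    obtain i u v where iuv: "x = (i, u, v)" by (cases x)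
    then have "u \<in> N i" "v \<in> N (q - i)" "i \<le> q" using x t basis by auto
    then show "Poly_Mapping.keys (case x of (i, u, v) \<Rightarrow> tens i (pr u) (frag_of v)) \<subseteq> tbasis G q"
      unfolding iuv prod.case using pr_keys by (intro tens_keys) (auto simp: keys_frag_of)
  qed
  have Lk: "Poly_Mapping.keys (?L t) \<subseteq> tbasis G (Suc q)"
  proof (rule keys_frag_extend_subset)
    fix x assume x: "x \<in> Poly_Mapping.keys t"
    obtain i u v where iuv: "x = (i, u, v)" by (cases x)
    then have "u \<in> N i" "v \<in> N (q - i)" "i \<le> q" using x t basis by auto
    then show "Poly_Mapping.keys (htp_left x) \<subseteq> tbasis G (Suc q)"
      unfolding iuv htp_left_def prod.case using h_keys by (intro tens_keys) (auto simp: keys_frag_of)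
  qed
  have Rk: "Poly_Mapping.keys (?R (?l t)) \<subseteq> tbasis G (Suc q)"
  proof (rule keys_frag_extend_subset)
    fix x assume x: "x \<in> Poly_Mapping.keys (?l t)"
    obtain i u v where iuv: "x = (i, u, v)" by (cases x)
    then have uv: "u \<in> N i" "v \<in> N (q - i)" "i \<le> q" using x lk basis by auto
    then have "Poly_Mapping.keys (tens i (frag_of u) (h v)) \<subseteq> tbasis G (Suc q)"
      using h_keys[OF uv(2)] by (intro tens_keys) (auto simp: keys_frag_of Suc_diff_le)
    then show "Poly_Mapping.keys (htp_right x) \<subseteq> tbasis G (Suc q)"
      unfolding iuv htp_right_def prod.case using keys_cmul by blast
  qed
  have dd: "?d (?d c) = 0" if "Poly_Mapping.keys c \<subseteq> tbasis G (Suc q)" for c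
    by (rule T.frag_extend_frag_extend_zero[OF that])
  have z: "red p (frag_extend f (?d c)) = red p 0" if "red p (?d c) = red p 0"
    for f :: "nat \<times> 'a list \<times> 'a list \<Rightarrow> nat \<times> 'a list \<times> 'a list \<Rightarrow>\<^sub>0 int" and c
    using red_frag_extend_cong[OF refl that, of f] by simp
  have lt: "?l t = t - ?d (?L t) - ?L (?d t)" using L[OF t] by (simp add: algebra_simps)
  have "red p (?l t) = red p (t - ?d (?L t) - 0)"
    unfolding lt by (intro red_diff_cong refl z cycle)
  then have 1: "red p t = red p (?l t + ?d (?L t))"
    using red_add_cong[of p "?l t" "t - ?d (?L t)" "?d (?L t)" "?d (?L t)"] by simp
  \<comment> \<open>The image of \<open>t\<close> under pr \<otimes> 1 differs from \<open>t\<close>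
    by a boundary modulo \<open>p\<close> and so is again a cycle; this is what the second homotopy
    requires.\<close>
  have "red p (?d (?l t)) = red p (?d (t - ?d (?L t)))"
    using \<open>red p (?l t) = red p (t - ?d (?L t) - 0)\<close> by (intro red_frag_extend_cong) auto
  also have "\<dots> = red p 0" using cycle dd[OF Lk] by (simp add: frag_extend_diff)
  finally have cycle': "red p (?d (?l t)) = red p 0" .
  have rl: "?r (?l t) = ?l t - ?d (?R (?l t)) - ?R (?d (?l t))" using R[OF lk] by (simp add: algebra_simps)
  have "red p (?r (?l t)) = red p (?l t - ?d (?R (?l t)) - 0)"
    unfolding rl by (intro red_diff_cong refl z cycle')
  then have 2: "red p (?l t) = red p (?r (?l t) + ?d (?R (?l t)))"
    using red_add_cong[of p "?r (?l t)" "?l t - ?d (?R (?l t))" "?d (?R (?l t))" "?d (?R (?l t))"] by simp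
  have 3: "?r (?l t) = frag_extend (\<lambda>(i, u, v). tens i (pr u) (pr v)) t"
  proof -
    have "?r (tens i (pr u) (frag_of v)) = tens i (pr u) (pr v)" for i u v
      using frag_extend_tens_tens[of "\<lambda>j. j" frag_of pr i "pr u" "frag_of v"]
      by (simp add: frag_expansion[symmetric])
    then show ?thesis
      unfolding frag_extend_frag_extend by (intro frag_extend_eq) auto
  qed
  show ?thesis
  proof
    show "Poly_Mapping.keys (?L t + ?R (?l t)) \<subseteq> tbasis G (Suc q)"
      using Lk Rk keys_add[of "?L t" "?R (?l t)"] by blast
    have "red p t = red p (?r (?l t) + ?d (?R (?l t)) + ?d (?L t))"
      unfolding 1 by (intro red_add_cong 2 refl)
    then show "red p t = red p (frag_extend (\<lambda>(i, u, v). tens i (pr u) (pr v)) t + ?d (?L t + ?R (?l t)))"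
      unfolding 3 by (simp add: frag_extend_add algebra_simps)
  qed
qed

end

section \<open>The cross product of homology classes and the Kuenneth map\<close>

definition kbeta :: "nat \<Rightarrow> nat \<Rightarrow> ('a list \<Rightarrow> int) set \<Rightarrow> ('a list \<Rightarrow> int) set \<Rightarrow> (nat \<times> 'a list \<times> 'a list \<Rightarrow> int) set" where
  "kbeta q i = (\<lambda>Z W. the_elem ((\<lambda>(z, w). hclass TC q (chain_tensor (Fp p) i z w)) ` (Z \<times> W)))"

lemma tensor_d_tens_cycle:
  assumes "red p (frag_extend (bar_d G) e) = red p 0"
  shows "red p (frag_extend (tensor_d G) (tens i b e)) = red p (tens (i - 1) (frag_extend (bar_d G) b) e)"
proof -
  have "red p (frag_cmul ((-1) ^ i) (tens i b (frag_extend (bar_d G) e))) = red p (frag_cmul ((-1) ^ i) (tens i b 0))"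
    by (intro red_cmul_cong red_tens_cong assms refl)
  from red_add_cong[OF refl this] show ?thesis by (simp add: tensor_d_tens)
qed

lemma chain_tensor_cyc:
  assumes "z \<in> C.cyc i" "w \<in> C.cyc (q - i)" "i \<le> q"
  shows "chain_tensor (Fp p) i z w \<in> T.cyc q"
proof -
  obtain c where c: "z = red p c" "Poly_Mapping.keys c \<subseteq> N i" "red p (frag_extend (bar_d G) c) = red p 0"
    using assms(1) by (rule C.cycE)
  obtain e where e: "w = red p e" "Poly_Mapping.keys e \<subseteq> N (q - i)" "red p (frag_extend (bar_d G) e) = red p 0"
    using assms(2) by (rule C.cycE)
  have "red p (tens (i - 1) (frag_extend (bar_d G) c) e) = red p (tens (i - 1) 0 e)"
    by (intro red_tens_cong c(3) refl)
  then show ?thesis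
    unfolding c(1) e(1) chain_tensor_red T.cyc_red[OF tens_keys[OF c(2) e(2) assms(3)]]
    using tensor_d_tens_cycle[OF e(3), of i c] by simp
qed

text \<open>Independence of representatives: altering either cycle by a boundary alters the tensor
  by a boundary.\<close>

lemma kbeta_hclass:
  assumes z: "z \<in> C.cyc i" and w: "w \<in> C.cyc (q - i)" and i: "i \<le> q"
  shows "kbeta q i (hclass CC i z) (hclass CC (q - i) w) = hclass TC q (chain_tensor (Fp p) i z w)"
proof -
  let ?d = "frag_extend (bar_d G)"
  obtain c where c: "z = red p c" "Poly_Mapping.keys c \<subseteq> N i" "red p (?d c) = red p 0"
    using z by (rule C.cycE)
  obtain e where e: "w = red p e" "Poly_Mapping.keys e \<subseteq> N (q - i)" "red p (?d e) = red p 0"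
    using w by (rule C.cycE)
  have const: "hclass TC q (chain_tensor (Fp p) i z' w') = hclass TC q (chain_tensor (Fp p) i z w)"
    if "z' \<in> hclass CC i z" "w' \<in> hclass CC (q - i) w" for z' w'
  proof -
    have z': "z' \<in> C.cyc i" "hclass CC i z' = hclass CC i z"
      using C.hclassD[OF z that(1)] by auto
    have w': "w' \<in> C.cyc (q - i)" "hclass CC (q - i) w' = hclass CC (q - i) w"
      using C.hclassD[OF w that(2)] by auto
    obtain b where b: "Poly_Mapping.keys b \<subseteq> N (Suc i)" "z' = red p (c - ?d b)"
      using C.hclass_red_cong[OF z z'(1) z'(2)[symmetric] c(1,2)] .
    obtain a where a: "Poly_Mapping.keys a \<subseteq> N (Suc (q - i))" "w' = red p (e - ?d a)"
        "Poly_Mapping.keys (e - ?d a) \<subseteq> N (q - i)"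
      using C.hclass_red_cong[OF w w'(1) w'(2)[symmetric] e(1,2)] .
    have e': "red p (?d (e - ?d a)) = red p 0"
      using w'(1) a by (simp add: C.cyc_red)
    \<comment> \<open>Modulo \<open>p\<close> the two summands are the boundaries of b \<otimes> (e
      - da) and, up to sign, of c \<otimes> a, because e - da and c are cycles modulo
      \<open>p\<close>.\<close>
    have "tens i c e - tens i (c - ?d b) (e - ?d a) = tens i (?d b) (e - ?d a) + tens i c (?d a)"
      by simp
    also have "red p \<dots> = red p (frag_extend (tensor_d G) (tens (Suc i) b (e - ?d a) + frag_cmul ((-1) ^ i) (tens i c a)))"
      unfolding frag_extend_add
    proof (rule red_add_cong)
      show "red p (tens i (?d b) (e - ?d a)) = red p (frag_extend (tensor_d G) (tens (Suc i) b (e - ?d a)))"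
        using tensor_d_tens_cycle[OF e', of "Suc i" b] by simp
      have "red p (frag_cmul ((-1) ^ i) (tens (i - 1) (?d c) a)) = red p (frag_cmul ((-1) ^ i) (tens (i - 1) 0 a))"
        by (intro red_cmul_cong red_tens_cong c(3) refl)
      moreover have "(-1::int) ^ i * (-1) ^ i = 1" by (simp flip: power_mult_distrib)
      ultimately show "red p (tens i c (?d a)) = red p (frag_extend (tensor_d G) (frag_cmul ((-1) ^ i) (tens i c a)))"
        using red_add_cong[of p _ "0" "tens i c (?d a)" "tens i c (?d a)"]
        by (simp add: frag_extend_cmul tensor_d_tens frag_cmul_distrib2)
    qed
    finally have r: "red p (tens i c e - tens i (c - ?d b) (e - ?d a)) =
        red p (frag_extend (tensor_d G) (tens (Suc i) b (e - ?d a) + frag_cmul ((-1) ^ i) (tens i c a)))" .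
    have ck: "Poly_Mapping.keys (c - ?d b) \<subseteq> N i"
      using c(2) C.frag_extend_keys[OF b(1)] keys_diff[of c "?d b"] by auto
    have k: "Poly_Mapping.keys (tens i c e) \<subseteq> tbasis G q" "Poly_Mapping.keys (tens i (c - ?d b) (e - ?d a)) \<subseteq> tbasis G q"
      using tens_keys[OF c(2) e(2) i] tens_keys[OF ck a(3) i] .
    have "Poly_Mapping.keys (tens (Suc i) b (e - ?d a)) \<subseteq> tbasis G (Suc q)"
      using b(1) a(3) i by (intro tens_keys) auto
    moreover have "Poly_Mapping.keys (tens i c a) \<subseteq> tbasis G (Suc q)"
      using c(2) a(1) i by (intro tens_keys) (auto simp: Suc_diff_le)
    ultimately have "Poly_Mapping.keys (tens (Suc i) b (e - ?d a) + frag_cmul ((-1) ^ i) (tens i c a)) \<subseteq> tbasis G (Suc q)"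
      using keys_add[of "tens (Suc i) b (e - ?d a)" "frag_cmul ((-1) ^ i) (tens i c a)"]
        keys_cmul[of "(-1) ^ i" "tens i c a"] by blast
    then have "chain_tensor (Fp p) i z w \<ominus>\<^bsub>chains TC q\<^esub> chain_tensor (Fp p) i z' w' \<in> T.bnd q"
      unfolding T.bnd_iff c(1) e(1) a(2) b(2) chain_tensor_red T.chains_eq red_diff[OF k, symmetric] using r by blast
    then show ?thesis
      using T.hclass_eq_iff[OF chain_tensor_cyc[OF z w i] chain_tensor_cyc[OF z'(1) w'(1) i]] by simp
  qed
  have "(\<lambda>(z, w). hclass TC q (chain_tensor (Fp p) i z w)) ` (hclass CC i z \<times> hclass CC (q - i) w) =
      {hclass TC q (chain_tensor (Fp p) i z w)}"
    (is "?f ` ?A = {?a}")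
  proof (intro equalityI subsetI)
    fix y assume "y \<in> ?f ` ?A"
    then obtain z' w' where "z' \<in> hclass CC i z" "w' \<in> hclass CC (q - i) w"
      "y = hclass TC q (chain_tensor (Fp p) i z' w')" by blast
    then show "y \<in> {?a}" using const by blast
  next
    fix y assume "y \<in> {?a}"
    moreover have "(z, w) \<in> ?A" using C.mem_hclass[OF z] C.mem_hclass[OF w] by blast
    ultimately show "y \<in> ?f ` ?A" by (intro image_eqI[of _ _ "(z, w)"]) simp_all
  qed
  then show ?thesis by (simp add: kbeta_def)
qed

lemma kbeta_bilinear:
  assumes i: "i \<le> q"
  shows "bilinear_map (Fp p) (homology CC i) (homology CC (q - i)) (homology TC q) (kbeta q i)"
proof -
  have Tadd: "hclass TC q (u \<oplus>\<^bsub>free (tbasis G q)\<^esub> v) = hclass TC q u \<oplus>\<^bsub>homology TC q\<^esub> hclass TC q v"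
    if "u \<in> T.cyc q" "v \<in> T.cyc q" for u v
    using lin_hom_add[OF T.hclass_hom, of u q v] that by (simp add: T.chains_eq)
  have Tsmult: "hclass TC q (a \<odot>\<^bsub>free (tbasis G q)\<^esub> u) = a \<odot>\<^bsub>homology TC q\<^esub> hclass TC q u"
    if "u \<in> T.cyc q" "a \<in> carrier (Fp p)" for u a
    using lin_hom_smult[OF T.hclass_hom, of a u q] that by (simp add: T.chains_eq)
  have Cadd: "hclass CC n u \<oplus>\<^bsub>homology CC n\<^esub> hclass CC n v = hclass CC n (u \<oplus>\<^bsub>free (N n)\<^esub> v)"
    "u \<oplus>\<^bsub>free (N n)\<^esub> v \<in> C.cyc n"
    if "u \<in> C.cyc n" "v \<in> C.cyc n" for u v n
    using lin_hom_add[OF C.hclass_hom, of u n v] submodule_add[OF C.cyc_sub that] that by (simp_all add: C.chains_eq)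
  have Csmult: "a \<odot>\<^bsub>homology CC n\<^esub> hclass CC n u = hclass CC n (a \<odot>\<^bsub>free (N n)\<^esub> u)"
    "a \<odot>\<^bsub>free (N n)\<^esub> u \<in> C.cyc n"
    if "u \<in> C.cyc n" "a \<in> carrier (Fp p)" for u a n
    using lin_hom_smult[OF C.hclass_hom, of a u n] submodule_smult[OF C.cyc_sub that(2,1)] that
    by (simp_all add: C.chains_eq)
  have ct: "chain_tensor (Fp p) i z (w \<oplus>\<^bsub>free (N (q - i))\<^esub> w') =
        chain_tensor (Fp p) i z w \<oplus>\<^bsub>free (tbasis G q)\<^esub> chain_tensor (Fp p) i z w'"
      "chain_tensor (Fp p) i z (a \<odot>\<^bsub>free (N (q - i))\<^esub> w) = a \<odot>\<^bsub>free (tbasis G q)\<^esub> chain_tensor (Fp p) i z w"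
    if zw: "z \<in> C.cyc i" "w \<in> C.cyc (q - i)" "w' \<in> C.cyc (q - i)" for z w w' a
  proof -
    obtain c where "z = red p c" using C.cycE[OF zw(1)] by metis
    moreover obtain e where "w = red p e" using C.cycE[OF zw(2)] by metis
    moreover obtain e' where "w' = red p e'" using C.cycE[OF zw(3)] by metis
    ultimately show "chain_tensor (Fp p) i z (w \<oplus>\<^bsub>free (N (q - i))\<^esub> w') =
        chain_tensor (Fp p) i z w \<oplus>\<^bsub>free (tbasis G q)\<^esub> chain_tensor (Fp p) i z w'"
      "chain_tensor (Fp p) i z (a \<odot>\<^bsub>free (N (q - i))\<^esub> w) = a \<odot>\<^bsub>free (tbasis G q)\<^esub> chain_tensor (Fp p) i z w"
      by (simp_all add: chain_tensor_red red_add[symmetric] red_cmul[symmetric])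
  qed
  have ct': "chain_tensor (Fp p) i (z \<oplus>\<^bsub>free (N i)\<^esub> z') w =
        chain_tensor (Fp p) i z w \<oplus>\<^bsub>free (tbasis G q)\<^esub> chain_tensor (Fp p) i z' w"
      "chain_tensor (Fp p) i (a \<odot>\<^bsub>free (N i)\<^esub> z) w = a \<odot>\<^bsub>free (tbasis G q)\<^esub> chain_tensor (Fp p) i z w"
    if zw: "z \<in> C.cyc i" "z' \<in> C.cyc i" "w \<in> C.cyc (q - i)" for z w z' a
  proof -
    obtain c where "z = red p c" using C.cycE[OF zw(1)] by metis
    moreover obtain c' where "z' = red p c'" using C.cycE[OF zw(2)] by metis
    moreover obtain e where "w = red p e" using C.cycE[OF zw(3)] by metis
    ultimately show "chain_tensor (Fp p) i (z \<oplus>\<^bsub>free (N i)\<^esub> z') w =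
        chain_tensor (Fp p) i z w \<oplus>\<^bsub>free (tbasis G q)\<^esub> chain_tensor (Fp p) i z' w"
      "chain_tensor (Fp p) i (a \<odot>\<^bsub>free (N i)\<^esub> z) w = a \<odot>\<^bsub>free (tbasis G q)\<^esub> chain_tensor (Fp p) i z w"
      by (simp_all add: chain_tensor_red red_add[symmetric] red_cmul[symmetric])
  qed
  show ?thesis
    unfolding bilinear_map_def C.hclass_surj[symmetric] ball_simps
  proof (intro conjI ballI lin_homI, unfold C.hclass_surj[symmetric])
    fix z U V assume z: "z \<in> C.cyc i" and "U \<in> hclass CC (q - i) ` C.cyc (q - i)" "V \<in> hclass CC (q - i) ` C.cyc (q - i)"
    then obtain w w' where w: "w \<in> C.cyc (q - i)" "U = hclass CC (q - i) w" "w' \<in> C.cyc (q - i)" "V = hclass CC (q - i) w'"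
      by auto
    show "kbeta q i (hclass CC i z) (U \<oplus>\<^bsub>homology CC (q - i)\<^esub> V) =
        kbeta q i (hclass CC i z) U \<oplus>\<^bsub>homology TC q\<^esub> kbeta q i (hclass CC i z) V"
      using z w i by (simp add: Cadd kbeta_hclass ct Tadd chain_tensor_cyc)
  next
    fix z a U assume z: "z \<in> C.cyc i" and a: "a \<in> carrier (Fp p)" and "U \<in> hclass CC (q - i) ` C.cyc (q - i)"
    then obtain w where w: "w \<in> C.cyc (q - i)" "U = hclass CC (q - i) w" by auto
    show "kbeta q i (hclass CC i z) (a \<odot>\<^bsub>homology CC (q - i)\<^esub> U) = a \<odot>\<^bsub>homology TC q\<^esub> kbeta q i (hclass CC i z) U"
      using z w i a by (simp add: Csmult kbeta_hclass ct[OF _ _ w(1)] Tsmult chain_tensor_cyc)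
  next
    fix z U assume z: "z \<in> C.cyc i" and "U \<in> hclass CC (q - i) ` C.cyc (q - i)"
    then show "kbeta q i (hclass CC i z) U \<in> carrier (homology TC q)"
      using i by (auto simp: kbeta_hclass chain_tensor_cyc intro!: T.hclass_closed)
  next
    fix w U V assume w: "w \<in> C.cyc (q - i)" and "U \<in> hclass CC i ` C.cyc i" "V \<in> hclass CC i ` C.cyc i"
    then obtain z z' where z: "z \<in> C.cyc i" "U = hclass CC i z" "z' \<in> C.cyc i" "V = hclass CC i z'"
      by auto
    show "kbeta q i (U \<oplus>\<^bsub>homology CC i\<^esub> V) (hclass CC (q - i) w) =
        kbeta q i U (hclass CC (q - i) w) \<oplus>\<^bsub>homology TC q\<^esub> kbeta q i V (hclass CC (q - i) w)"
      using z w i by (simp add: Cadd kbeta_hclass ct' Tadd chain_tensor_cyc)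
  next
    fix w a U assume w: "w \<in> C.cyc (q - i)" and a: "a \<in> carrier (Fp p)" and "U \<in> hclass CC i ` C.cyc i"
    then obtain z where z: "z \<in> C.cyc i" "U = hclass CC i z" by auto
    show "kbeta q i (a \<odot>\<^bsub>homology CC i\<^esub> U) (hclass CC (q - i) w) =
        a \<odot>\<^bsub>homology TC q\<^esub> kbeta q i U (hclass CC (q - i) w)"
      using z w i a by (simp add: Csmult kbeta_hclass ct'[OF _ z(1)] Tsmult chain_tensor_cyc)
  next
    fix w U assume w: "w \<in> C.cyc (q - i)" and "U \<in> hclass CC i ` C.cyc i"
    then show "kbeta q i U (hclass CC (q - i) w) \<in> carrier (homology TC q)"
      using i by (auto simp: kbeta_hclass chain_tensor_cyc intro!: T.hclass_closed)
  qed
qed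

end


context nerve_group
begin

lemma tensor_product_homology: "tensor_product (Fp p) (homology CC i) (homology CC j)"
  by (rule tensor_product.intro[OF C.homology_module C.homology_module]) (simp add: Fp_simps)

lemma frag_extend_fun_sum:
  "finite I \<Longrightarrow> frag_extend (\<lambda>x. \<Sum>i\<in>I. f i x) c = (\<Sum>i\<in>I. frag_extend (f i) c)"
  by (induction I rule: finite_induct) (auto simp: frag_extend_fun_add frag_extend_eq_0)

text \<open>By \<open>tensor_homotopy\<close> each cycle is homologous to a combination of tensors
  of pr u and pr v, which are cycles modulo \<open>p\<close>. Sorted by the degree of the left
  factor, the parts lie in the images of the summands of the Kuenneth map.\<close>

lemma kunneth_alg_surj:
  assumes U: "U \<in> carrier (homology TC q)"
  shows "\<exists>t\<in>kunneth_sum (Fp p) (nerve G) (nerve G) q. kunneth_alg (Fp p) (nerve G) (nerve G) q t = U"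
proof -
  have "\<exists>h. (\<forall>x\<in>N n. Poly_Mapping.keys (h x) \<subseteq> N (Suc n)) \<and>
      (\<forall>b. Poly_Mapping.keys b \<subseteq> N (Suc n) \<longrightarrow>
        red p (frag_extend (bar_d G) (frag_extend h (frag_extend (bar_d G) b))) = red p (frag_extend (bar_d G) b))"
    for n
    using C.generalized_inverse[of n] by metis
  then obtain h' where h': "\<And>n x. x \<in> N n \<Longrightarrow> Poly_Mapping.keys (h' n x) \<subseteq> N (Suc n)"
    "\<And>n b. Poly_Mapping.keys b \<subseteq> N (Suc n) \<Longrightarrow>
      red p (frag_extend (bar_d G) (frag_extend (h' n) (frag_extend (bar_d G) b))) = red p (frag_extend (bar_d G) b)"
    by metis
  \<comment> \<open>The choices made degree by degree combine into one function, since the length of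
    a simplex determines its degree.\<close>
  define h where "h x = h' (length x) x" for x
  have h_keys: "Poly_Mapping.keys (h x) \<subseteq> N (Suc n)" if "x \<in> N n" for x n
    using h'(1)[OF that] that by (simp add: h_def nerve_simplices)
  have h_inverse: "red p (frag_extend (bar_d G) (frag_extend h (frag_extend (bar_d G) b))) = red p (frag_extend (bar_d G) b)"
    if b: "Poly_Mapping.keys b \<subseteq> N (Suc n)" for n b
  proof -
    have "Poly_Mapping.keys (frag_extend (bar_d G) b) \<subseteq> N n"
      using C.frag_extend_keys[OF b] by simp
    then have "frag_extend h (frag_extend (bar_d G) b) = frag_extend (h' n) (frag_extend (bar_d G) b)"
      by (intro frag_extend_eq) (auto simp: h_def nerve_simplices subset_iff)
    then show ?thesis using h'(2)[OF b] by simp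
  qed
  let ?P = "pr h"
  have pk: "Poly_Mapping.keys (?P u) \<subseteq> N n" if "u \<in> N n" for u n
    by (rule pr_keys[OF _ _ that]) (fact h_keys h_inverse)+
  have pc: "red p (frag_extend (bar_d G) (?P u)) = red p 0" if "u \<in> N n" for u n
    by (rule pr_cycle[OF _ _ that]) (fact h_keys h_inverse)+
  define H where "H = homology TC q"
  interpret H: module "Fp p" H unfolding H_def by (rule T.homology_module)
  define Im where "Im i = tensor_lift (Fp p) H (kbeta q i) `
      carrier (tensor (Fp p) (homology CC i) (homology CC (q - i)))" for i
  have lift_hom: "tensor_lift (Fp p) H (kbeta q i) \<in>
      lin_hom (Fp p) (tensor (Fp p) (homology CC i) (homology CC (q - i))) H" if "i \<le> q" for i
    unfolding H_def
    by (rule tensor_product.tensor_lift_hom[OF tensor_product_homology T.homology_module kbeta_bilinear[OF that]])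
  have Im_sub: "submodule (Im i) (Fp p) H" if "i \<le> q" for i
    unfolding Im_def
    by (rule submodule_image[OF tensor_product.tensor_module[OF tensor_product_homology] H.module_axioms
          lift_hom[OF that] submodule_carrier[OF tensor_product.tensor_module[OF tensor_product_homology]]])
  \<comment> \<open>The part of bidegree (i, q - i) of the deformed chain. Each part is a cycle
    modulo \<open>p\<close> by itself, which is what lets the class of the sum split.\<close>
  define cmp where "cmp i = frag_extend (\<lambda>(j, u, v). if j = i then tens i (?P u) (?P v) else 0)" for i
  have cmp: "Poly_Mapping.keys c \<subseteq> tbasis G q \<and> Poly_Mapping.keys (cmp i c) \<subseteq> tbasis G q \<and>
      red p (cmp i c) \<in> T.cyc q \<and> hclass TC q (red p (cmp i c)) \<in> Im i"
    if i: "i \<le> q" and c: "Poly_Mapping.keys c \<subseteq> tbasis G q" for i c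
  proof -
    have z0: "red p 0 \<in> T.cyc q \<and> hclass TC q (red p 0) \<in> Im i"
    proof -
      have "red p 0 = \<zero>\<^bsub>T.cyc_mod q\<^esub>" by (simp add: T.chains_eq red_zero[where S = "tbasis G q"])
      then show ?thesis
        using submodule_zero[OF T.cyc_sub, of q] submodule_zero[OF Im_sub[OF i]]
          lin_hom_zero[OF T.cyc_module T.homology_module T.hclass_hom, of q]
        by (simp add: H_def)
    qed
    from c show ?thesis
    proof (induction c rule: frag_induction)
      case zero
      show ?case using z0 by (simp add: cmp_def)
    next
      case (one x)
      obtain j u v where x: "x = (j, u, v)" by (cases x)
      show ?case
      proof (cases "j = i")
        case True
        have uv: "u \<in> N i" "v \<in> N (q - i)" using one by (auto simp: x True tensor_basis_def)
        have e: "cmp i (frag_of x) = tens i (?P u) (?P v)" by (simp add: cmp_def x True)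
        have cu: "red p (?P u) \<in> C.cyc i" and cv: "red p (?P v) \<in> C.cyc (q - i)"
          using C.cyc_red[OF pk[OF uv(1)]] C.cyc_red[OF pk[OF uv(2)]] pc[OF uv(1)] pc[OF uv(2)] by auto
        have "hclass TC q (red p (cmp i (frag_of x))) =
            kbeta q i (hclass CC i (red p (?P u))) (hclass CC (q - i) (red p (?P v)))"
          by (simp add: kbeta_hclass[OF cu cv i] e chain_tensor_red)
        also have "\<dots> = tensor_lift (Fp p) H (kbeta q i) (pure_tensor (Fp p) (homology CC i) (homology CC (q - i))
            (hclass CC i (red p (?P u))) (hclass CC (q - i) (red p (?P v))))"
          unfolding H_def
          by (rule tensor_product.tensor_lift_pure[OF tensor_product_homology T.homology_module
                kbeta_bilinear[OF i] C.hclass_closed[OF cu] C.hclass_closed[OF cv], symmetric])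
        also have "\<dots> \<in> Im i"
          unfolding Im_def
          by (intro imageI tensor_product.pure_tensor_closed[OF tensor_product_homology]
              C.hclass_closed cu cv)
        finally show ?thesis
          using tens_keys[OF pk[OF uv(1)] pk[OF uv(2)] i] chain_tensor_cyc[OF cu cv i] one
          by (simp add: e chain_tensor_red keys_frag_of)
      next
        case False
        then show ?thesis using z0 one by (simp add: cmp_def x keys_frag_of)
      qed
    next
      case (diff a b)
      have e: "cmp i (a - b) = cmp i a - cmp i b" by (simp add: cmp_def frag_extend_diff)
      have r: "red p (cmp i a - cmp i b) = red p (cmp i a) \<ominus>\<^bsub>T.cyc_mod q\<^esub> red p (cmp i b)"
      proof -
        have id: "id \<in> lin_hom (Fp p) (T.cyc_mod q) (chains TC q)"
          using T.cyc_carrier by (intro lin_homI) auto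
        show ?thesis
          using lin_hom_diff[OF T.cyc_module T.chains_module id, of "red p (cmp i a)" "red p (cmp i b)"] diff
            red_diff[of "cmp i a" "tbasis G q" "cmp i b"]
          by (simp add: T.chains_eq)
      qed
      have "hclass TC q (red p (cmp i a - cmp i b)) \<in> Im i"
        unfolding r using diff
          lin_hom_diff[OF T.cyc_module T.homology_module T.hclass_hom, of "red p (cmp i a)" q "red p (cmp i b)"]
          submodule_diff[OF Im_sub[OF i]] by (simp add: H_def)
      moreover have "red p (cmp i a - cmp i b) \<in> T.cyc q"
        unfolding r using diff submodule_diff[OF submodule_carrier[OF T.cyc_module], of "red p (cmp i a)" q "red p (cmp i b)"]
        by simp
      moreover have "Poly_Mapping.keys (a - b) \<subseteq> tbasis G q"
        using diff.IH(1,2) keys_diff[of a b] by blast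
      moreover have "Poly_Mapping.keys (cmp i a - cmp i b) \<subseteq> tbasis G q"
        using diff.IH(1,2) keys_diff[of "cmp i a" "cmp i b"] by blast
      ultimately show ?case unfolding e by simp
    qed
  qed
  obtain z where z: "z \<in> T.cyc q" "U = hclass TC q z"
    using U by (auto simp: T.hclass_surj[symmetric])
  obtain t where t: "z = red p t" "Poly_Mapping.keys t \<subseteq> tbasis G q" "red p (frag_extend (tensor_d G) t) = red p 0"
    using z(1) by (rule T.cycE)
  obtain b where b: "Poly_Mapping.keys b \<subseteq> tbasis G (Suc q)"
    "red p t = red p (frag_extend (\<lambda>(i, u, v). tens i (?P u) (?P v)) t + frag_extend (tensor_d G) b)"
  proof (rule tensor_homotopy[OF _ _ t(2,3), of h])
    show "Poly_Mapping.keys (h x) \<subseteq> N (Suc n)" if "x \<in> N n" for n x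
      using that by (rule h_keys)
    show "red p (frag_extend (bar_d G) (frag_extend h (frag_extend (bar_d G) b))) = red p (frag_extend (bar_d G) b)"
      if "Poly_Mapping.keys b \<subseteq> N (Suc n)" for n b
      using that by (rule h_inverse)
  qed (rule that)
  have sum: "frag_extend (\<lambda>(i, u, v). tens i (?P u) (?P v)) t = (\<Sum>i\<le>q. cmp i t)"
    unfolding cmp_def frag_extend_fun_sum[OF finite_atMost, symmetric]
  proof (rule frag_extend_eq)
    fix x assume x: "x \<in> Poly_Mapping.keys t"
    obtain j u v where juv: "x = (j, u, v)" by (cases x)
    then have "j \<le> q" using x t(2) by (auto simp: tensor_basis_def)
    then show "(case x of (i, u, v) \<Rightarrow> tens i (?P u) (?P v)) =
        (\<Sum>i\<le>q. case x of (j, u, v) \<Rightarrow> if j = i then tens i (?P u) (?P v) else 0)"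
      by (simp add: juv)
  qed
  have fin: "Poly_Mapping.keys (\<Sum>i\<in>I. cmp i t) \<subseteq> tbasis G q \<and> red p (\<Sum>i\<in>I. cmp i t) \<in> T.cyc q \<and>
      hclass TC q (red p (\<Sum>i\<in>I. cmp i t)) = (\<Oplus>\<^bsub>H\<^esub>i\<in>I. hclass TC q (red p (cmp i t)))"
    if "finite I" "I \<subseteq> {..q}" for I
    using that
  proof (induction I rule: finite_induct)
    case empty
    have "red p 0 = \<zero>\<^bsub>T.cyc_mod q\<^esub>" by (simp add: T.chains_eq red_zero[where S = "tbasis G q"])
    then show ?case
      using submodule_zero[OF T.cyc_sub, of q] lin_hom_zero[OF T.cyc_module T.homology_module T.hclass_hom, of q]
      by (simp add: H_def[symmetric] H.M.finsum_empty)
  next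
    case (insert i I)
    have ci: "Poly_Mapping.keys (cmp i t) \<subseteq> tbasis G q" "red p (cmp i t) \<in> T.cyc q"
      using cmp[of i t] insert t(2) by auto
    have mem: "(\<lambda>i. hclass TC q (red p (cmp i t))) \<in> insert i I \<rightarrow> carrier H"
      using cmp[OF _ t(2)] insert by (auto simp: H_def intro!: T.hclass_closed)
    have "red p (cmp i t + (\<Sum>i\<in>I. cmp i t)) = red p (cmp i t) \<oplus>\<^bsub>T.cyc_mod q\<^esub> red p (\<Sum>i\<in>I. cmp i t)"
      by (simp add: T.chains_eq red_add[where S = "tbasis G q"])
    moreover have "red p (cmp i t) \<oplus>\<^bsub>T.cyc_mod q\<^esub> red p (\<Sum>i\<in>I. cmp i t) \<in> T.cyc q"
      using submodule_add[OF T.cyc_sub ci(2)] insert by simp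
    moreover have "Poly_Mapping.keys (cmp i t + (\<Sum>i\<in>I. cmp i t)) \<subseteq> tbasis G q"
      using ci insert keys_add[of "cmp i t" "\<Sum>i\<in>I. cmp i t"] by blast
    moreover have "hclass TC q (red p (cmp i t) \<oplus>\<^bsub>T.cyc_mod q\<^esub> red p (\<Sum>i\<in>I. cmp i t)) =
        hclass TC q (red p (cmp i t)) \<oplus>\<^bsub>H\<^esub> hclass TC q (red p (\<Sum>i\<in>I. cmp i t))"
      unfolding H_def using ci(2) insert by (intro lin_hom_add[OF T.hclass_hom]) auto
    moreover have "(\<Oplus>\<^bsub>H\<^esub>i\<in>insert i I. hclass TC q (red p (cmp i t))) =
        hclass TC q (red p (cmp i t)) \<oplus>\<^bsub>H\<^esub> (\<Oplus>\<^bsub>H\<^esub>i\<in>I. hclass TC q (red p (cmp i t)))"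
      using insert mem by (intro H.M.finsum_insert) auto
    ultimately show ?case using insert by simp
  qed
  define s where "s = (\<Sum>i\<le>q. cmp i t)"
  have s: "Poly_Mapping.keys s \<subseteq> tbasis G q" "red p s \<in> T.cyc q"
    "hclass TC q (red p s) = (\<Oplus>\<^bsub>H\<^esub>i\<in>{..q}. hclass TC q (red p (cmp i t)))"
    using fin[of "{..q}"] by (auto simp: s_def)
  have "red p (t - s) = red p (frag_extend (tensor_d G) b)"
    using red_diff_cong[OF b(2) refl, of s] by (simp add: sum s_def)
  then have "z \<ominus>\<^bsub>chains TC q\<^esub> red p s \<in> T.bnd q"
    unfolding T.bnd_iff t(1) T.chains_eq red_diff[OF t(2) s(1), symmetric] using b(1) by blast
  then have Us: "U = (\<Oplus>\<^bsub>H\<^esub>i\<in>{..q}. hclass TC q (red p (cmp i t)))"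
    using T.hclass_eq_iff[OF z(1) s(2)] z(2) s(3) by simp
  have "\<forall>i\<in>{..q}. \<exists>\<tau>. \<tau> \<in> carrier (tensor (Fp p) (homology CC i) (homology CC (q - i))) \<and>
      tensor_lift (Fp p) H (kbeta q i) \<tau> = hclass TC q (red p (cmp i t))"
    using cmp[OF _ t(2)] unfolding Im_def by force
  then obtain \<tau> where \<tau>: "\<And>i. i \<le> q \<Longrightarrow> \<tau> i \<in> carrier (tensor (Fp p) (homology CC i) (homology CC (q - i)))"
    "\<And>i. i \<le> q \<Longrightarrow> tensor_lift (Fp p) H (kbeta q i) (\<tau> i) = hclass TC q (red p (cmp i t))"
    by (metis atMost_iff)
  have "restrict \<tau> {..q} \<in> kunneth_sum (Fp p) (nerve G) (nerve G) q"
    using \<tau>(1) by (auto simp: kunneth_sum_def)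
  moreover have "kunneth_alg (Fp p) (nerve G) (nerve G) q (restrict \<tau> {..q}) =
      (\<Oplus>\<^bsub>H\<^esub>i\<in>{..q}. tensor_lift (Fp p) H (kbeta q i) (restrict \<tau> {..q} i))"
    by (simp add: kunneth_alg_def Let_def H_def kbeta_def)
  moreover have "\<dots> = U"
    unfolding Us using \<tau> lin_hom_closed[OF lift_hom] cmp[OF _ t(2)]
    by (intro H.M.finsum_cong') (auto simp: H_def intro!: T.hclass_closed)
  ultimately show ?thesis by metis
qed

end


section \<open>The differential on homology classes\<close>

lemma ring_as_mod_simps [simp]:
  "carrier (ring_as_mod R) = carrier R" "\<zero>\<^bsub>ring_as_mod R\<^esub> = \<zero>\<^bsub>R\<^esub>"
  "a \<oplus>\<^bsub>ring_as_mod R\<^esub> b = a \<oplus>\<^bsub>R\<^esub> b" "a \<odot>\<^bsub>ring_as_mod R\<^esub> b = a \<otimes>\<^bsub>R\<^esub> b"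
  by (simp_all add: ring_as_mod_def)

lemma ring_as_mod_module: "cring R \<Longrightarrow> module R (ring_as_mod R)"
proof -
  assume "cring R"
  then interpret cring R .
  show ?thesis
  proof (rule moduleI)
    show "abelian_group (ring_as_mod R)"
    proof (rule abelian_groupI)
      fix a assume "a \<in> carrier (ring_as_mod R)"
      then show "\<exists>b\<in>carrier (ring_as_mod R). b \<oplus>\<^bsub>ring_as_mod R\<^esub> a = \<zero>\<^bsub>ring_as_mod R\<^esub>"
        by (intro bexI[of _ "\<ominus>\<^bsub>R\<^esub> a"]) (simp_all add: l_neg)
    qed (simp_all add: a_ac)
  qed (use \<open>cring R\<close> in \<open>simp_all add: l_distr r_distr m_assoc\<close>)
qed

locale nerve_character = nerve_group +
  fixes \<nu> :: "'a \<Rightarrow> int"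
  assumes \<nu>_closed: "g \<in> carrier G \<Longrightarrow> \<nu> g \<in> carrier (Zp p)"
    and \<nu>_mult: "g \<in> carrier G \<Longrightarrow> h \<in> carrier G \<Longrightarrow> \<nu> (g \<otimes> h) = (\<nu> g + \<nu> h) mod int p"
begin

text \<open>The cap product with the 1-cocycle \<open>\<nu>\<close>, evaluated on the front
  edge.\<close>

fun cap :: "'a list \<Rightarrow> 'a list \<Rightarrow>\<^sub>0 int" where
  "cap [] = 0"
| "cap (g # w) = frag_cmul (\<nu> g) (frag_of w)"

text \<open>Contraction of the left factor with \<open>\<nu>\<close>, a cochain supported in degree
  one; there \<open>hd\<close> reads off the only letter.\<close>

fun slant :: "nat \<times> 'a list \<times> 'a list \<Rightarrow> 'a list \<Rightarrow>\<^sub>0 int" where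
  "slant (i, u, v) = (if i = 1 then frag_cmul (\<nu> (hd u)) (frag_of v) else 0)"

text \<open>A scalar is written as a chain on a one-point basis, so that \<open>lft\<close> and its
  rules apply to it too.\<close>

definition nuval :: "'a list \<Rightarrow> unit \<Rightarrow>\<^sub>0 int" where
  "nuval u = frag_cmul (\<nu> (hd u)) (frag_of ())"

lemma slant_tens:
  "frag_extend slant (tens i c d) =
     (if i = 1 then frag_cmul (poly_mapping.lookup (frag_extend nuval c) ()) d else 0)"
proof (cases "i = 1")
  case True
  have "frag_extend slant (tens 1 c d) = frag_extend (\<lambda>x. frag_cmul (\<nu> (hd x)) d) c"
    by (simp add: frag_extend_tens frag_extend_fun_cmul frag_expansion[symmetric])
  also have "\<dots> = frag_cmul (poly_mapping.lookup (frag_extend nuval c) ()) d"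
    by (induction c rule: frag_linear_induct)
      (auto simp: frag_extend_diff nuval_def lookup_minus frag_cmul_diff_distrib)
  finally show ?thesis using True by simp
next
  case False
  then show ?thesis by (simp add: frag_extend_tens frag_extend_eq_0)
qed

text \<open>\<open>\<nu>\<close> is a cocycle modulo \<open>p\<close>, so left degree two
  contributes nothing. Left degree one contributes the differential of the right factor with its
  sign (-1)^1, and in all other degrees both sides are zero.\<close>

lemma slant_comm:
  assumes "x \<in> tbasis G q"
  shows "red p (frag_extend slant (tensor_d G x)) = red p (- frag_extend (bar_d G) (slant x))"
proof -
  obtain i u v where x: "x = (i, u, v)" by (cases x)
  have u: "length u = i" "set u \<subseteq> carrier G" using assms by (auto simp: x tbasis_iff)
  consider "i = 0" | g where "i = 1" "u = [g]" | g h where "i = 2" "u = [g, h]" | "2 < i"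
    using u(1) by (cases u; cases "tl u"; cases "tl (tl u)") auto
  then show ?thesis
  proof cases
    case 1
    then show ?thesis using u by (simp add: x frag_extend_add slant_tens frag_extend_cmul)
  next
    case 2
    then show ?thesis
      by (simp add: x frag_extend_add frag_extend_diff frag_extend_minus slant_tens frag_extend_cmul nuval_def)
  next
    case 3
    have "(\<nu> h - (\<nu> (g \<otimes> h) - \<nu> g)) mod int p = 0"
      using \<nu>_mult[of g h] 3 u minus_mod_eq_mult_div[of "\<nu> g + \<nu> h" "int p"]
      by (simp add: algebra_simps)
    then have "red p (frag_cmul (\<nu> h - (\<nu> (g \<otimes> h) - \<nu> g)) (frag_of v)) = red p (frag_cmul 0 (frag_of v))"
      by (intro red_cmul_cong) auto
    then show ?thesis
      using 3 by (simp add: x frag_extend_add frag_extend_diff slant_tens frag_extend_cmul nuval_def lookup_minus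
          frag_cmul_diff_distrib)
  next
    case 4
    then have "i - Suc 0 \<noteq> Suc 0" by arith
    with 4 show ?thesis by (simp add: x frag_extend_add slant_tens frag_extend_cmul)
  qed
qed

lemma slant_keys: "x \<in> tbasis G (Suc n) \<Longrightarrow> Poly_Mapping.keys (slant x) \<subseteq> N n"
  by (cases x) (auto simp: tbasis_iff nerve_simplices)

definition slant_star :: "nat \<Rightarrow> (nat \<times> 'a list \<times> 'a list \<Rightarrow> int) set \<Rightarrow> ('a list \<Rightarrow> int) set" where
  "slant_star n = homology_map CC n (lft p slant)"

lemma slant_star:
  shows "z \<in> T.cyc (Suc n) \<Longrightarrow> lft p slant z \<in> C.cyc n"
    and "z \<in> T.cyc (Suc n) \<Longrightarrow> slant_star n (hclass TC (Suc n) z) = hclass CC n (lft p slant z)"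
    and "slant_star n \<in> lin_hom (Fp p) (homology TC (Suc n)) (homology CC n)"
proof -
  have c1: "red p (frag_extend (bar_d G) (slant x)) = red p (frag_cmul (-1) (frag_extend slant (tensor_d G x)))"
    and c2: "red p (frag_extend slant (tensor_d G x)) = red p (frag_cmul (-1) (frag_extend (bar_d G) (slant x)))"
    if "x \<in> tbasis G m" for x m
    using slant_comm[OF that] red_diff_cong[OF refl slant_comm[OF that], of 0] by simp_all
  show "lft p slant z \<in> C.cyc n" if "z \<in> T.cyc (Suc n)"
    by (rule frag_homology_map(1)[OF T.frag_complex_axioms C.frag_complex_axioms, where \<epsilon> = "-1"];
        (rule refl slant_keys c1 c2 that | assumption))
  show "slant_star n (hclass TC (Suc n) z) = hclass CC n (lft p slant z)" if "z \<in> T.cyc (Suc n)"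
    unfolding slant_star_def
    by (rule frag_homology_map(3)[OF T.frag_complex_axioms C.frag_complex_axioms, where \<epsilon> = "-1"];
        (rule refl slant_keys c1 c2 that | assumption))
  show "slant_star n \<in> lin_hom (Fp p) (homology TC (Suc n)) (homology CC n)"
    unfolding slant_star_def
    by (rule frag_homology_map(4)[OF T.frag_complex_axioms C.frag_complex_axioms, where \<epsilon> = "-1"];
        (rule refl slant_keys c1 c2 | assumption))
qed

text \<open>Of the Alexander-Whitney summands of a diagonal simplex only the one with front face of
  length one survives; two prefixed letters give left degree at least two.\<close>

lemma aw_slant: "frag_extend slant (aw (zip w w)) = cap w"
proof (cases w)
  case (Cons g u)
  have 0: "frag_extend slant (tensor_cns a (tensor_cns b c)) = 0" for a b c
  proof (induction c rule: frag_linear_induct)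
    case (basis t)
    then show ?case by (cases t) simp
  qed (auto simp: frag_extend_diff)
  have "frag_extend slant (tensor_cns g (aw (zip u u))) = frag_cmul (\<nu> g) (frag_of u)"
    by (cases u) (auto simp: frag_extend_add 0 map_snd_zip)
  then show ?thesis by (simp add: Cons frag_extend_add)
qed simp

text \<open>Resolves the two coset maps in \<open>nu_star\<close>: \<open>\<nu>\<close> applied
  letterwise, then the evaluation on H_1 of the cyclic group. The latter is well defined because [h]
  - [(g + h) mod p] + [g] has value divisible by \<open>p\<close>.\<close>

lemma nu_star_hclass:
  assumes z: "z \<in> C.cyc 1"
  shows "nu_star p \<nu> (hclass CC 1 z) = lft p nuval z ()"
proof -
  have mZ: "monoid (Zp p)" by (simp add: group.is_monoid)
  interpret Z: frag_complex p "simplices (nerve (Zp p))" "bar_d (Zp p)" "sset_complex (Fp p) (nerve (Zp p))"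
    by (rule nerve_complex[OF mZ])
  let ?Z = "sset_complex (Fp p) (nerve (Zp p))"
  have k: "Poly_Mapping.keys (frag_of (map \<nu> x)) \<subseteq> simplices (nerve (Zp p)) n" if "x \<in> N n" for x n
    using that \<nu>_closed by (auto simp: nerve_simplices)
  have c1: "red p (frag_extend (bar_d (Zp p)) (frag_of (map \<nu> x))) = red p (frag_cmul 1 (frag_map (map \<nu>) (bar_d G x)))"
    and c2: "red p (frag_map (map \<nu>) (bar_d G x)) = red p (frag_cmul 1 (frag_extend (bar_d (Zp p)) (frag_of (map \<nu> x))))"
    if "x \<in> N n" for x n
    using that bar_d_map[of G \<nu> "Zp p" x] \<nu>_mult by (auto simp: nerve_simplices)
  have f: "lin_ext (Fp p) (free (simplices (nerve (Zp p)) 1)) (\<lambda>x. fbasis (Fp p) (map \<nu> x)) y =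
      lft p (\<lambda>x. frag_of (map \<nu> x)) y" if "y \<in> carrier (free (N 1))" for y
    using that k by (intro lin_ext_eq_lft) (auto simp: fbasis_eq)
  define y where "y = lft p (\<lambda>x. frag_of (map \<nu> x)) z"
  have y: "y \<in> Z.cyc 1"
    unfolding y_def
    by (rule frag_homology_map(1)[OF C.frag_complex_axioms Z.frag_complex_axioms f, where \<epsilon> = 1];
        (rule k z c1 c2 | assumption))
  have y_eq: "sset_homology_map (Fp p) (nerve (Zp p)) 1 (map \<nu>) (hclass CC 1 z) = hclass ?Z 1 y"
    unfolding y_def sset_homology_map_def
    by (rule frag_homology_map(3)[OF C.frag_complex_axioms Z.frag_complex_axioms f, where \<epsilon> = 1];
        (rule k z c1 c2 | assumption))
  \<comment> \<open>The integral model of the identification of H_1 of the cyclic group with the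
    field; as in \<open>nuval\<close>, scalars are chains on a point.\<close>
  define \<kappa> where "\<kappa> x = frag_cmul (hd x) (frag_of ())" for x :: "int list"
  have rmod: "module (Fp p) (ring_as_mod (Fp p))" by (rule ring_as_mod_module[OF Fp_cring])
  have \<kappa>hom: "lft p \<kappa> \<in> lin_hom (Fp p) (free (simplices (nerve (Zp p)) 1)) (free UNIV)"
    by (rule lft_hom) simp
  have "(\<lambda>f. lft p \<kappa> f ()) \<in> lin_hom (Fp p) (free (simplices (nerve (Zp p)) 1)) (ring_as_mod (Fp p))"
  proof (rule lin_homI)
    fix f g assume fg: "f \<in> carrier (free (simplices (nerve (Zp p)) 1))" "g \<in> carrier (free (simplices (nerve (Zp p)) 1))"
    show "lft p \<kappa> (f \<oplus>\<^bsub>free (simplices (nerve (Zp p)) 1)\<^esub> g) () = lft p \<kappa> f () \<oplus>\<^bsub>ring_as_mod (Fp p)\<^esub> lft p \<kappa> g ()"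
      using lin_hom_add[OF \<kappa>hom fg] by (simp add: free_simps(3) Fp_simps)
  next
    fix a f assume af: "a \<in> carrier (Fp p)" "f \<in> carrier (free (simplices (nerve (Zp p)) 1))"
    show "lft p \<kappa> (a \<odot>\<^bsub>free (simplices (nerve (Zp p)) 1)\<^esub> f) () = a \<odot>\<^bsub>ring_as_mod (Fp p)\<^esub> lft p \<kappa> f ()"
      using lin_hom_smult[OF \<kappa>hom af] by (simp add: free_simps(4) Fp_simps)
  next
    fix f assume "f \<in> carrier (free (simplices (nerve (Zp p)) 1))"
    then show "lft p \<kappa> f () \<in> carrier (ring_as_mod (Fp p))"
      using lin_hom_closed[OF \<kappa>hom] by (simp add: free_simps Fp_simps)
  qed
  note hom = this
  have hdc: "hd x \<in> {0..int p - 1}" if "x \<in> simplices (nerve (Zp p)) 1" for x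
    using that p_gt_1 by (cases x) (auto simp: nerve_simplices carrier_integer_mod_group)
  have ev: "lin_ext (Fp p) (ring_as_mod (Fp p)) hd f = lft p \<kappa> f ()"
    if "f \<in> carrier (free (simplices (nerve (Zp p)) 1))" for f
  proof (rule lin_hom_eqI[OF rmod lin_ext_hom[OF rmod] hom _ that])
    show "hd \<in> simplices (nerve (Zp p)) 1 \<rightarrow> carrier (ring_as_mod (Fp p))"
      using hdc by (auto simp: Fp_simps)
    fix x assume x: "x \<in> simplices (nerve (Zp p)) 1"
    have "lin_ext (Fp p) (ring_as_mod (Fp p)) hd (fbasis (Fp p) x) = hd x"
      using hdc[OF x] by (intro lin_ext_fbasis[OF rmod]) (auto simp: Fp_simps)
    also have "\<dots> = lft p \<kappa> (fbasis (Fp p) x) ()"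
      using hdc[OF x] by (simp add: fbasis_eq lft_red[OF refl] \<kappa>_def) (simp add: red_def)
    finally show "lin_ext (Fp p) (ring_as_mod (Fp p)) hd (fbasis (Fp p) x) = lft p \<kappa> (fbasis (Fp p) x) ()" .
  qed
  have "H1_Zp p (hclass ?Z 1 y) = lin_ext (Fp p) (ring_as_mod (Fp p)) hd y"
    unfolding H1_Zp_def
  proof (rule Z.the_elem_hclass[OF y])
    fix w assume w: "w \<in> Z.cyc 1" "hclass ?Z 1 w = hclass ?Z 1 y"
    obtain c where c: "w = red p c" "Poly_Mapping.keys c \<subseteq> simplices (nerve (Zp p)) 1"
      using w(1) by (rule Z.cycE)
    obtain b where b: "Poly_Mapping.keys b \<subseteq> simplices (nerve (Zp p)) (Suc 1)" "y = red p (c - frag_extend (bar_d (Zp p)) b)"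
      using Z.hclass_red_cong[OF w(1) y w(2) c] .
    have "red p (frag_extend \<kappa> (frag_extend (bar_d (Zp p)) b)) = red p (frag_extend (\<lambda>_. 0) b)"
      unfolding frag_extend_frag_extend
    proof (rule red_frag_extend_cong)
      fix x assume "x \<in> Poly_Mapping.keys b \<union> Poly_Mapping.keys b"
      then have "x \<in> simplices (nerve (Zp p)) 2" using b(1) by (auto simp: numeral_2_eq_2)
      then obtain g h where x: "x = [g, h]"
        by (auto simp: nerve_simplices numeral_2_eq_2 length_Suc_conv)
      have "frag_extend \<kappa> (bar_d (Zp p) x) = frag_cmul (h - ((g + h) mod int p - g)) (frag_of ())"
        by (simp add: x frag_extend_diff \<kappa>_def frag_cmul_diff_distrib)
      also have "red p \<dots> = red p (frag_cmul 0 (frag_of ()))"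
        using minus_mod_eq_mult_div[of "g + h" "int p"]
        by (intro red_cmul_cong) (simp_all add: algebra_simps)
      finally show "red p (frag_extend \<kappa> (bar_d (Zp p) x)) = red p 0" by simp
    qed simp
    then have "red p (frag_extend \<kappa> c) = red p (frag_extend \<kappa> (c - frag_extend (bar_d (Zp p)) b))"
      using red_diff_cong[OF refl, of p _ 0 "frag_extend \<kappa> c"] by (simp add: frag_extend_diff frag_extend_eq_0)
    then have "lft p \<kappa> w = lft p \<kappa> y"
      by (simp add: c(1) b(2) lft_red[OF refl])
    then show "lin_ext (Fp p) (ring_as_mod (Fp p)) hd w = lin_ext (Fp p) (ring_as_mod (Fp p)) hd y"
      using w(1) y Z.cyc_carrier by (simp add: ev Z.chains_eq)
  qed
  also have "\<dots> = lft p \<kappa> y ()"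
    using y Z.cyc_carrier by (simp add: ev Z.chains_eq)
  also have "\<dots> = lft p nuval z ()"
  proof -
    obtain c where c: "z = red p c" "Poly_Mapping.keys c \<subseteq> N 1" using z by (rule C.cycE)
    have "frag_extend \<kappa> (frag_map (map \<nu>) c) = frag_extend nuval c"
      unfolding frag_extend_frag_extend
    proof (rule frag_extend_eq)
      fix x assume "x \<in> Poly_Mapping.keys c"
      then have "length x = 1" using c(2) by (auto simp: nerve_simplices)
      then show "frag_extend \<kappa> (frag_of (map \<nu> x)) = nuval x"
        by (cases x) (auto simp: \<kappa>_def nuval_def)
    qed
    then show ?thesis by (simp add: y_def c(1) lft_red[OF refl])
  qed
  finally show ?thesis unfolding nu_star_def y_eq .
qed

lemma nu_star_hom: "nu_star p \<nu> \<in> lin_hom (Fp p) (homology CC 1) (ring_as_mod (Fp p))"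
proof -
  have hom: "lft p nuval \<in> lin_hom (Fp p) (free (N 1)) (free UNIV)"
    by (rule lft_hom) simp
  have carrier: "z \<in> C.cyc 1 \<Longrightarrow> z \<in> carrier (free (N 1))" for z
    using C.cyc_carrier[of z 1] by (simp add: C.chains_eq)
  show ?thesis
  proof (rule lin_homI)
    fix U V assume "U \<in> carrier (homology CC 1)" "V \<in> carrier (homology CC 1)"
    then obtain z w where z: "z \<in> C.cyc 1" "U = hclass CC 1 z" and w: "w \<in> C.cyc 1" "V = hclass CC 1 w"
      by (auto simp: C.hclass_surj[symmetric])
    have s: "z \<oplus>\<^bsub>free (N 1)\<^esub> w \<in> C.cyc 1"
      using submodule_add[OF C.cyc_sub z(1) w(1)] by (simp add: C.chains_eq)
    have "U \<oplus>\<^bsub>homology CC 1\<^esub> V = hclass CC 1 (z \<oplus>\<^bsub>free (N 1)\<^esub> w)"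
      using lin_hom_add[OF C.hclass_hom, of z 1 w] z w by (simp add: C.chains_eq)
    then have "nu_star p \<nu> (U \<oplus>\<^bsub>homology CC 1\<^esub> V) = lft p nuval (z \<oplus>\<^bsub>free (N 1)\<^esub> w) ()"
      using nu_star_hclass[OF s] by metis
    then show "nu_star p \<nu> (U \<oplus>\<^bsub>homology CC 1\<^esub> V) = nu_star p \<nu> U \<oplus>\<^bsub>ring_as_mod (Fp p)\<^esub> nu_star p \<nu> V"
      unfolding z(2) w(2) nu_star_hclass[OF z(1)] nu_star_hclass[OF w(1)]
        lin_hom_add[OF hom carrier[OF z(1)] carrier[OF w(1)]]
      by (simp add: free_simps(3) Fp_simps)
  next
    fix a U assume a: "a \<in> carrier (Fp p)" and "U \<in> carrier (homology CC 1)"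
    then obtain z where z: "z \<in> C.cyc 1" "U = hclass CC 1 z"
      by (auto simp: C.hclass_surj[symmetric])
    have s: "a \<odot>\<^bsub>free (N 1)\<^esub> z \<in> C.cyc 1"
      using submodule_smult[OF C.cyc_sub a z(1)] by (simp add: C.chains_eq)
    have "a \<odot>\<^bsub>homology CC 1\<^esub> U = hclass CC 1 (a \<odot>\<^bsub>free (N 1)\<^esub> z)"
      using lin_hom_smult[OF C.hclass_hom, of a z 1] z a by (simp add: C.chains_eq)
    then have "nu_star p \<nu> (a \<odot>\<^bsub>homology CC 1\<^esub> U) = lft p nuval (a \<odot>\<^bsub>free (N 1)\<^esub> z) ()"
      using nu_star_hclass[OF s] by metis
    then show "nu_star p \<nu> (a \<odot>\<^bsub>homology CC 1\<^esub> U) = a \<odot>\<^bsub>ring_as_mod (Fp p)\<^esub> nu_star p \<nu> U"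
      unfolding z(2) nu_star_hclass[OF z(1)] lin_hom_smult[OF hom a carrier[OF z(1)]]
      by (simp add: free_simps(4) Fp_simps)
  next
    fix U assume "U \<in> carrier (homology CC 1)"
    then obtain z where z: "z \<in> C.cyc 1" "U = hclass CC 1 z"
      by (auto simp: C.hclass_surj[symmetric])
    then show "nu_star p \<nu> U \<in> carrier (ring_as_mod (Fp p))"
      using lin_hom_closed[OF hom carrier[OF z(1)]]
      unfolding z(2) nu_star_hclass[OF z(1)] by (simp add: free_simps Fp_simps)
  qed
qed

lemma smult_bilinear:
  assumes "module (Fp p) M"
  shows "bilinear_map (Fp p) (ring_as_mod (Fp p)) M M (\<lambda>a n. a \<odot>\<^bsub>M\<^esub> n)"
proof -
  interpret module "Fp p" M by fact
  show ?thesis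
    unfolding bilinear_map_def
  proof (intro conjI ballI lin_homI)
    fix a b n assume ab: "a \<in> carrier (ring_as_mod (Fp p))" "b \<in> carrier (Fp p)" "n \<in> carrier M"
    have "b \<otimes>\<^bsub>Fp p\<^esub> a = a \<otimes>\<^bsub>Fp p\<^esub> b" by (simp add: Fp_simps mult.commute)
    then show "a \<odot>\<^bsub>M\<^esub> (b \<odot>\<^bsub>M\<^esub> n) = b \<odot>\<^bsub>M\<^esub> (a \<odot>\<^bsub>M\<^esub> n)"
      using ab smult_assoc1[of a b n] smult_assoc1[of b a n] by simp
  qed (simp_all add: smult_l_distr smult_r_distr smult_assoc1)
qed

text \<open>Both maps are linear and send the pure tensor of \<open>U\<close> and \<open>V\<close>
  to \<open>nu_star p \<nu> U\<close> times \<open>V\<close>. Here the abstract tensor product in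
  the definition of \<open>rho\<close> meets the slant product on chains.\<close>

lemma tensor_slant:
  assumes t: "t \<in> carrier (tensor (Fp p) (homology CC 1) (homology CC n))"
  shows "tensor_unit (Fp p) (homology CC n)
      (tensor_map (Fp p) (ring_as_mod (Fp p)) (homology CC n) (nu_star p \<nu>) id t) =
    slant_star n (tensor_lift (Fp p) (homology TC (Suc n)) (kbeta (Suc n) 1) t)"
proof -
  let ?H = "\<lambda>n. homology CC n" and ?R = "ring_as_mod (Fp p)"
  have R: "module (Fp p) ?R" by (rule ring_as_mod_module[OF Fp_cring])
  interpret HH: tensor_product "Fp p" "?H 1" "?H n" by (rule tensor_product_homology)
  interpret RH: tensor_product "Fp p" ?R "?H n"
    by (rule tensor_product.intro[OF R C.homology_module]) (simp add: Fp_simps)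
  have b1: "bilinear_map (Fp p) (?H 1) (?H n) (tensor (Fp p) ?R (?H n))
      (\<lambda>m k. pure_tensor (Fp p) ?R (?H n) (nu_star p \<nu> m) (id k))"
    using RH.pure_tensor_bilinear lin_hom_closed[OF nu_star_hom] lin_hom_comp[OF nu_star_hom]
    unfolding bilinear_map_def id_apply by blast
  have b2: "bilinear_map (Fp p) ?R (?H n) (?H n) (\<lambda>a k. a \<odot>\<^bsub>?H n\<^esub> k)"
    by (rule smult_bilinear[OF C.homology_module])
  have b3: "bilinear_map (Fp p) (?H 1) (?H n) (homology TC (Suc n)) (kbeta (Suc n) 1)"
    using kbeta_bilinear[of 1 "Suc n"] by simp
  note unit = RH.tensor_lift_hom[OF C.homology_module b2, folded tensor_unit_def]
  note map = HH.tensor_lift_hom[OF RH.tensor_module b1, folded tensor_map_def]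
  show ?thesis
  proof (rule tensor_hom_eqI[OF C.homology_module C.homology_module C.homology_module _ _ _ t,
        where h = "\<lambda>t. tensor_unit (Fp p) (?H n) (tensor_map (Fp p) ?R (?H n) (nu_star p \<nu>) id t)"
          and h' = "\<lambda>t. slant_star n (tensor_lift (Fp p) (homology TC (Suc n)) (kbeta (Suc n) 1) t)"])
    show "(\<lambda>t. tensor_unit (Fp p) (?H n) (tensor_map (Fp p) ?R (?H n) (nu_star p \<nu>) id t))
        \<in> lin_hom (Fp p) (tensor (Fp p) (?H 1) (?H n)) (?H n)"
      by (rule lin_hom_comp[OF map unit])
    show "(\<lambda>t. slant_star n (tensor_lift (Fp p) (homology TC (Suc n)) (kbeta (Suc n) 1) t))
        \<in> lin_hom (Fp p) (tensor (Fp p) (?H 1) (?H n)) (?H n)"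
      by (rule lin_hom_comp[OF HH.tensor_lift_hom[OF T.homology_module b3] slant_star(3)])
    fix U V assume U: "U \<in> carrier (?H 1)" and V: "V \<in> carrier (?H n)"
    obtain z where z: "z \<in> C.cyc 1" "U = hclass CC 1 z" using U by (auto simp: C.hclass_surj[symmetric])
    obtain w where w: "w \<in> C.cyc n" "V = hclass CC n w" using V by (auto simp: C.hclass_surj[symmetric])
    obtain c where c: "z = red p c" "Poly_Mapping.keys c \<subseteq> N 1" using z(1) by (rule C.cycE)
    obtain e where e: "w = red p e" "Poly_Mapping.keys e \<subseteq> N n" using w(1) by (rule C.cycE)
    have nuU: "nu_star p \<nu> U \<in> carrier (Fp p)" using lin_hom_closed[OF nu_star_hom U] by simp
    have "tensor_unit (Fp p) (?H n) (tensor_map (Fp p) ?R (?H n) (nu_star p \<nu>) id (pure_tensor (Fp p) (?H 1) (?H n) U V)) =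
        tensor_unit (Fp p) (?H n) (pure_tensor (Fp p) ?R (?H n) (nu_star p \<nu> U) V)"
      unfolding tensor_map_def HH.tensor_lift_pure[OF RH.tensor_module b1 U V] by simp
    also have "\<dots> = nu_star p \<nu> U \<odot>\<^bsub>?H n\<^esub> V"
      unfolding tensor_unit_def using nuU V by (intro RH.tensor_lift_pure[OF C.homology_module b2]) simp_all
    also have "\<dots> = hclass CC n (nu_star p \<nu> U \<odot>\<^bsub>chains CC n\<^esub> w)"
      using lin_hom_smult[OF C.hclass_hom nuU, of w n] w by simp
    also have "nu_star p \<nu> U \<odot>\<^bsub>chains CC n\<^esub> w = lft p slant (chain_tensor (Fp p) 1 z w)"
    proof -
      have "nu_star p \<nu> U = poly_mapping.lookup (frag_extend nuval c) () mod int p"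
        unfolding z(2) nu_star_hclass[OF z(1)] by (simp add: c(1) lft_red[OF refl]) (simp add: red_def)
      moreover have "red p (frag_cmul (poly_mapping.lookup (frag_extend nuval c) () mod int p) e) =
          red p (frag_cmul (poly_mapping.lookup (frag_extend nuval c) ()) e)"
        by (intro red_cmul_cong) auto
      ultimately show ?thesis
        by (simp add: c(1) e(1) chain_tensor_red lft_red[OF refl] slant_tens C.chains_eq red_cmul[symmetric])
    qed
    also have "hclass CC n (lft p slant (chain_tensor (Fp p) 1 z w)) =
        slant_star n (kbeta (Suc n) 1 U V)"
      using slant_star(2)[of "chain_tensor (Fp p) 1 z w" n] chain_tensor_cyc[of z 1 w "Suc n"]
        kbeta_hclass[of z 1 w "Suc n"] z w by simp
    also have "kbeta (Suc n) 1 U V = tensor_lift (Fp p) (homology TC (Suc n)) (kbeta (Suc n) 1)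
        (pure_tensor (Fp p) (?H 1) (?H n) U V)"
      by (rule HH.tensor_lift_pure[OF T.homology_module b3 U V, symmetric])
    finally show "tensor_unit (Fp p) (?H n) (tensor_map (Fp p) ?R (?H n) (nu_star p \<nu>) id (pure_tensor (Fp p) (?H 1) (?H n) U V)) =
      slant_star n (tensor_lift (Fp p) (homology TC (Suc n)) (kbeta (Suc n) 1) (pure_tensor (Fp p) (?H 1) (?H n) U V))" .
  qed
qed

text \<open>The slant product reads only left degree one, so the remaining Kuenneth summands drop
  out when \<open>rho\<close> is computed.\<close>

lemma slant_star_other:
  assumes "i \<le> Suc n" "i \<noteq> 1" and t: "t \<in> carrier (tensor (Fp p) (homology CC i) (homology CC (Suc n - i)))"
  shows "slant_star n (tensor_lift (Fp p) (homology TC (Suc n)) (kbeta (Suc n) i) t) = \<zero>\<^bsub>homology CC n\<^esub>"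
proof -
  let ?H = "\<lambda>n. homology CC n"
  interpret HH: tensor_product "Fp p" "?H i" "?H (Suc n - i)" by (rule tensor_product_homology)
  interpret Hn: module "Fp p" "?H n" by (rule C.homology_module)
  note b = kbeta_bilinear[OF assms(1)]
  show ?thesis
  proof (rule tensor_hom_eqI[OF C.homology_module C.homology_module C.homology_module _ _ _ t,
        where h = "\<lambda>t. slant_star n (tensor_lift (Fp p) (homology TC (Suc n)) (kbeta (Suc n) i) t)"
          and h' = "\<lambda>_. \<zero>\<^bsub>?H n\<^esub>"])
    show "(\<lambda>t. slant_star n (tensor_lift (Fp p) (homology TC (Suc n)) (kbeta (Suc n) i) t))
        \<in> lin_hom (Fp p) (tensor (Fp p) (?H i) (?H (Suc n - i))) (?H n)"
      by (rule lin_hom_comp[OF HH.tensor_lift_hom[OF T.homology_module b] slant_star(3)])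
    show "(\<lambda>_. \<zero>\<^bsub>?H n\<^esub>) \<in> lin_hom (Fp p) (tensor (Fp p) (?H i) (?H (Suc n - i))) (?H n)"
      by (rule lin_homI) (simp_all add: Hn.smult_r_null)
    fix U V assume U: "U \<in> carrier (?H i)" and V: "V \<in> carrier (?H (Suc n - i))"
    obtain z where z: "z \<in> C.cyc i" "U = hclass CC i z" using U by (auto simp: C.hclass_surj[symmetric])
    obtain w where w: "w \<in> C.cyc (Suc n - i)" "V = hclass CC (Suc n - i) w" using V by (auto simp: C.hclass_surj[symmetric])
    obtain c where c: "z = red p c" "Poly_Mapping.keys c \<subseteq> N i" using z(1) by (rule C.cycE)
    obtain e where e: "w = red p e" "Poly_Mapping.keys e \<subseteq> N (Suc n - i)" using w(1) by (rule C.cycE)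
    have "slant_star n (kbeta (Suc n) i U V) = hclass CC n (lft p slant (chain_tensor (Fp p) i z w))"
      using slant_star(2)[of "chain_tensor (Fp p) i z w" n] chain_tensor_cyc[OF z(1) w(1) assms(1)]
        kbeta_hclass[OF z(1) w(1) assms(1)] z w by simp
    also have "lft p slant (chain_tensor (Fp p) i z w) = \<zero>\<^bsub>C.cyc_mod n\<^esub>"
      using assms(2) by (simp add: c(1) e(1) chain_tensor_red lft_red[OF refl] slant_tens C.chains_eq
          red_zero[where S = "N n"])
    also have "hclass CC n \<zero>\<^bsub>C.cyc_mod n\<^esub> = \<zero>\<^bsub>?H n\<^esub>"
      by (rule lin_hom_zero[OF C.cyc_module C.homology_module C.hclass_hom])
    finally show "slant_star n (tensor_lift (Fp p) (homology TC (Suc n)) (kbeta (Suc n) i)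
        (pure_tensor (Fp p) (?H i) (?H (Suc n - i)) U V)) = \<zero>\<^bsub>?H n\<^esub>"
      by (simp add: HH.tensor_lift_pure[OF T.homology_module b U V])
  qed
qed

text \<open>
  As \<^const>\<open>kunneth\<close> inverts \<^const>\<open>kunneth_alg\<close> by \<^const>\<open>inv_into\<close>, surjectivity of the latter
  suffices here: the slant map does not depend on the choice of the preimage.
\<close>

theorem rho_hclass:
  assumes z: "z \<in> C.cyc (Suc n)"
  shows "rho p G \<nu> (Suc n) (hclass CC (Suc n) z) = hclass CC n (lft p cap z)"
proof -
  let ?q = "Suc n" and ?P = "prod_sset (nerve G) (nerve G)"
  obtain c where c: "z = red p c" "Poly_Mapping.keys c \<subseteq> N ?q" using z by (rule C.cycE)
  have dg_keys: "Poly_Mapping.keys (frag_of (x, x)) \<subseteq> simplices ?P m" if "x \<in> N m" for x m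
    using that by (simp add: keys_frag_of prod_sset_def)
  have dg: "frag_map (\<lambda>x. (x, x)) (bar_d G x) = prod_d G (x, x)" if "x \<in> N m" for x m
  proof -
    have "bar_d (G \<times>\<times> G) (map (\<lambda>g. (g, g)) x) = frag_map (map (\<lambda>g. (g, g))) (bar_d G x)"
      using that by (intro bar_d_map[symmetric]) (auto simp: nerve_simplices)
    moreover have "zip x x = map (\<lambda>g. (g, g)) x" by (simp add: zip_same_conv_map)
    ultimately show ?thesis by (simp add: prod_d_def frag_extend_frag_extend comp_def)
  qed
  have dg1: "red p (frag_extend (prod_d G) (frag_of (x, x))) =
        red p (frag_cmul 1 (frag_map (\<lambda>x. (x, x)) (bar_d G x)))"
    and dg2: "red p (frag_map (\<lambda>x. (x, x)) (bar_d G x)) =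
        red p (frag_cmul 1 (frag_extend (prod_d G) (frag_of (x, x))))" if "x \<in> N m" for x m
    using dg[OF that] by simp_all
  have dgf: "lin_ext (Fp p) (free (simplices ?P ?q)) (\<lambda>x. fbasis (Fp p) (x, x)) y = lft p (\<lambda>x. frag_of (x, x)) y"
    if "y \<in> carrier (free (N ?q))" for y
    using that dg_keys by (intro lin_ext_eq_lft) (auto simp: fbasis_eq)
  define y where "y = lft p (\<lambda>x. frag_of (x, x)) z"
  have y: "y \<in> P.cyc ?q"
    unfolding y_def
    by (rule frag_homology_map(1)[OF C.frag_complex_axioms P.frag_complex_axioms dgf, where \<epsilon> = 1];
        (rule dg_keys z dg1 dg2 | assumption))
  have y_eq: "sset_homology_map (Fp p) ?P ?q (\<lambda>x. (x, x)) (hclass CC ?q z) = hclass PC ?q y"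
    unfolding y_def sset_homology_map_def
    by (rule frag_homology_map(3)[OF C.frag_complex_axioms P.frag_complex_axioms dgf, where \<epsilon> = 1];
        (rule dg_keys z dg1 dg2 | assumption))
  have aw_keys': "Poly_Mapping.keys (case x of (u, v) \<Rightarrow> aw (zip u v)) \<subseteq> tbasis G m"
    if "x \<in> simplices ?P m" for x m
    using that aw_keys[of "fst x" "snd x" G m] by (cases x) simp
  have aw: "frag_extend (tensor_d G) (case x of (u, v) \<Rightarrow> aw (zip u v)) =
      frag_extend (\<lambda>(u, v). aw (zip u v)) (prod_d G x)" if "x \<in> simplices ?P m" for x m
  proof (cases x)
    case (Pair u v)
    then have "set (zip u v) \<subseteq> carrier G \<times> carrier G"
      using that by (auto simp: prod_simplices_iff nerve_simplices)
    then show ?thesis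
      by (simp add: Pair prod_d_def frag_extend_frag_extend zip_map_fst_snd aw_bar_d)
  qed
  have aw1: "red p (frag_extend (tensor_d G) (case x of (u, v) \<Rightarrow> aw (zip u v))) =
        red p (frag_cmul 1 (frag_extend (\<lambda>(u, v). aw (zip u v)) (prod_d G x)))"
    and aw2: "red p (frag_extend (\<lambda>(u, v). aw (zip u v)) (prod_d G x)) =
        red p (frag_cmul 1 (frag_extend (tensor_d G) (case x of (u, v) \<Rightarrow> aw (zip u v))))"
    if "x \<in> simplices ?P m" for x m
    using aw[OF that] by simp_all
  define \<tau> where "\<tau> = lft p (\<lambda>(u, v). aw (zip u v)) y"
  have \<tau>: "\<tau> \<in> T.cyc ?q"
    unfolding \<tau>_def
    by (rule frag_homology_map(1)[OF P.frag_complex_axioms T.frag_complex_axioms alexander_whitney_eq, where \<epsilon> = 1];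
        (rule aw_keys' y aw1 aw2 | assumption))
  have \<tau>_eq: "homology_map TC ?q (alexander_whitney (Fp p) (nerve G) (nerve G) ?q) (hclass PC ?q y) = hclass TC ?q \<tau>"
    unfolding \<tau>_def
    by (rule frag_homology_map(3)[OF P.frag_complex_axioms T.frag_complex_axioms alexander_whitney_eq, where \<epsilon> = 1];
        (rule aw_keys' y aw1 aw2 | assumption))
  define t where "t = kunneth (Fp p) (nerve G) (nerve G) ?q (hclass PC ?q y)"
  have "hclass TC ?q \<tau> \<in> kunneth_alg (Fp p) (nerve G) (nerve G) ?q ` kunneth_sum (Fp p) (nerve G) (nerve G) ?q"
    using kunneth_alg_surj[OF T.hclass_closed[OF \<tau>]] by blast
  then have t: "t \<in> kunneth_sum (Fp p) (nerve G) (nerve G) ?q"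
    "kunneth_alg (Fp p) (nerve G) (nerve G) ?q t = hclass TC ?q \<tau>"
    unfolding t_def kunneth_def \<tau>_eq by (rule inv_into_into, rule f_inv_into_f)
  have ti: "t i \<in> carrier (tensor (Fp p) (homology CC i) (homology CC (?q - i)))" if "i \<le> ?q" for i
    using t(1) that by (auto simp: kunneth_sum_def)
  interpret Hn: module "Fp p" "homology CC n" by (rule C.homology_module)
  have lift: "tensor_lift (Fp p) (homology TC ?q) (kbeta ?q i) (t i) \<in> carrier (homology TC ?q)" if "i \<le> ?q" for i
    by (rule lin_hom_closed[OF tensor_product.tensor_lift_hom[OF tensor_product_homology T.homology_module
          kbeta_bilinear[OF that]] ti[OF that]])
  have "hclass TC ?q \<tau> = (\<Oplus>\<^bsub>homology TC ?q\<^esub>i\<in>{..?q}. tensor_lift (Fp p) (homology TC ?q) (kbeta ?q i) (t i))"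
    unfolding t(2)[symmetric] by (simp add: kunneth_alg_def Let_def kbeta_def)
  then have "slant_star n (hclass TC ?q \<tau>) =
      (\<Oplus>\<^bsub>homology CC n\<^esub>i\<in>{..?q}. slant_star n (tensor_lift (Fp p) (homology TC ?q) (kbeta ?q i) (t i)))"
    using lift lin_hom_finsum[OF T.homology_module C.homology_module slant_star(3), of "{..?q}"] by simp
  \<comment> \<open>The slant product kills all summands except \<open>i = 1\<close>, the one that
    \<open>nabla\<close> selects.\<close>
  also have "\<dots> = (\<Oplus>\<^bsub>homology CC n\<^esub>i\<in>{..?q}. if 1 = i then
      slant_star n (tensor_lift (Fp p) (homology TC ?q) (kbeta ?q i) (t i)) else \<zero>\<^bsub>homology CC n\<^esub>)"
    using lift lin_hom_closed[OF slant_star(3)] slant_star_other[OF _ _ ti]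
    by (intro Hn.M.finsum_cong') auto
  also have "\<dots> = slant_star n (tensor_lift (Fp p) (homology TC ?q) (kbeta ?q 1) (t 1))"
    using lift lin_hom_closed[OF slant_star(3)] by (intro Hn.M.finsum_singleton) auto
  also have "\<dots> = tensor_unit (Fp p) (homology CC n)
      (tensor_map (Fp p) (ring_as_mod (Fp p)) (homology CC n) (nu_star p \<nu>) id (t 1))"
    using ti[of 1] by (intro tensor_slant[symmetric]) simp
  also have "\<dots> = rho p G \<nu> ?q (hclass CC ?q z)"
    by (simp add: rho_def nabla_def y_eq t_def)
  finally have "rho p G \<nu> ?q (hclass CC ?q z) = hclass CC n (lft p slant \<tau>)"
    using slant_star(2)[OF \<tau>] by simp
  also have "lft p slant \<tau> = lft p cap z"
    by (simp add: \<tau>_def y_def c(1) lft_red[OF refl] frag_extend_frag_extend aw_slant)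
  finally show ?thesis .
qed

end


section \<open>The filtration by powers of the augmentation ideal\<close>

text \<open>(1 + X)^p is 1 + X^p modulo \<open>p\<close>, so below degree \<open>p\<close> the
  coefficients of (1 + X)^n depend only on n modulo \<open>p\<close>. This makes coefficients with
  respect to the powers of t - 1 compatible with t^p = 1.\<close>

lemma choose_mod_prime:
  assumes "Factorial_Ring.prime p" "s < p" "x < p" "y < p"
  shows "int ((x + y) mod p choose s) mod int p = int (x + y choose s) mod int p"
proof (cases "x + y < p")
  case False
  define a where "a = x + y - p"
  have a: "x + y = p + a" "a < p" using False assms by (auto simp: a_def)
  \<comment> \<open>Vandermonde's identity; every p choose k with 0 < k \<le> s < p is divisible by
    \<open>p\<close>, so only the summand k = 0 remains.\<close>
  have "(p + a choose s) = (\<Sum>k\<le>s. (p choose k) * (a choose (s - k)))"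
    by (rule vandermonde[symmetric])
  also have "\<dots> = (a choose s) + (\<Sum>k\<in>{1..s}. (p choose k) * (a choose (s - k)))"
    by (simp add: atMost_atLeast0 sum.atLeast_Suc_atMost)
  finally have "(p + a choose s) = (a choose s) + (\<Sum>k\<in>{1..s}. (p choose k) * (a choose (s - k)))" .
  moreover have "p dvd (\<Sum>k\<in>{1..s}. (p choose k) * (a choose (s - k)))"
    using assms(1,2) by (intro dvd_sum dvd_mult2 dvd_choose_prime) auto
  ultimately have "(p + a choose s) mod p = (a choose s) mod p" by auto
  then show ?thesis using a by (simp flip: zmod_int)
qed simp

context nerve_character
begin

lemma \<nu>_range: "g \<in> carrier G \<Longrightarrow> 0 \<le> \<nu> g \<and> \<nu> g < int p"
  using \<nu>_closed[of g] p_gt_1 by (auto simp: carrier_integer_mod_group)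

definition act :: "int \<Rightarrow> 'a \<Rightarrow> int" where
  "act x g = (x + \<nu> g) mod int p"

sublocale A: right_action G act "{0..<int p}"
proof
  show "act x g \<in> {0..<int p}" if "x \<in> {0..<int p}" "g \<in> carrier G" for x g
    using p_gt_1 by (simp add: act_def)
  show "act x (g \<otimes> h) = act (act x g) h" if "x \<in> {0..<int p}" "g \<in> carrier G" "h \<in> carrier G" for x g h
    using that by (simp add: act_def \<nu>_mult mod_simps ac_simps)
qed

abbreviation aD :: "int \<times> 'a list \<Rightarrow> int \<times> 'a list \<Rightarrow>\<^sub>0 int" where
  "aD \<equiv> act_d G act"

text \<open>Degrees are integers here because the filtered complex is indexed by all integers; in
  negative degrees the set is empty.\<close>

definition NI :: "int \<Rightarrow> 'a list set" where
  "NI q = {w. int (length w) = q \<and> set w \<subseteq> carrier G}"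

definition XI :: "int \<Rightarrow> (int \<times> 'a list) set" where
  "XI q = {0..<int p} \<times> NI q"

lemma NI_int: "NI (int n) = N n"
  by (auto simp: NI_def nerve_simplices)

lemma aD_keys: "x \<in> XI q \<Longrightarrow> Poly_Mapping.keys (aD x) \<subseteq> XI (q - 1)"
proof
  fix t assume x: "x \<in> XI q" and t: "t \<in> Poly_Mapping.keys (aD x)"
  obtain y w z u where yw: "x = (y, w)" and zu: "t = (z, u)" by (cases x; cases t)
  have "z \<in> {0..<int p} \<and> Suc (length u) = length w \<and> set u \<subseteq> carrier G"
    by (rule A.act_d_keys[of y]) (use x t in \<open>auto simp: yw zu XI_def NI_def\<close>)
  then show "t \<in> XI (q - 1)" using x by (auto simp: yw zu XI_def NI_def)
qed

lemma aD_aD: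
  assumes "Poly_Mapping.keys c \<subseteq> XI q"
  shows "frag_extend aD (frag_extend aD c) = 0"
  unfolding frag_extend_frag_extend
  by (rule frag_extend_eq_0) (use assms A.act_d_act_d in \<open>auto simp: XI_def NI_def\<close>)

text \<open>
  The \<open>s\<close>-th component with respect to the basis \<open>(t - 1)\<^sup>s\<close> of the group ring of the cyclic group,
  as \<open>t\<^sup>x\<close> is the sum of the \<open>(x choose s) (t - 1)\<^sup>s\<close>; \<open>power_lift s w\<close> is \<open>(t - 1)\<^sup>s \<otimes> w\<close>.
\<close>

definition coef :: "nat \<Rightarrow> int \<times> 'a list \<Rightarrow> 'a list \<Rightarrow>\<^sub>0 int" where
  "coef s = (\<lambda>(x, w). frag_cmul (int (nat x choose s)) (frag_of w))"

primrec power_lift :: "nat \<Rightarrow> 'a list \<Rightarrow> int \<times> 'a list \<Rightarrow>\<^sub>0 int" where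
  "power_lift 0 w = frag_of (0, w)"
| "power_lift (Suc s) w = frag_map (\<lambda>(x, u). (x + 1, u)) (power_lift s w) - power_lift s w"

text \<open>Only the exponents 0..s occur in (t - 1)^s, so for s < p the lift stays within
  \<open>{0..<p}\<close> and no exponent has to be reduced.\<close>

lemma power_lift_keys: "Poly_Mapping.keys (power_lift s w) \<subseteq> {0..int s} \<times> {w}"
proof (induction s)
  case (Suc s)
  have "Poly_Mapping.keys (frag_map (\<lambda>(x, u). (x + 1, u)) (power_lift s w)) \<subseteq> {0..int (Suc s)} \<times> {w}"
    using Suc by (intro keys_frag_extend_subset) (auto simp: keys_frag_of)
  then show ?case
    using Suc keys_diff[of "frag_map (\<lambda>(x, u). (x + 1, u)) (power_lift s w)" "power_lift s w"] by fastforce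
qed (simp add: keys_frag_of)

text \<open>Pascal's rule: multiplication by t = 1 + (t - 1) adds the coefficient of the preceding
  power. Exponents are nonnegative because \<open>coef\<close> passes through
  \<open>nat\<close>.\<close>

lemma coef_shift:
  assumes "Poly_Mapping.keys c \<subseteq> {0..} \<times> UNIV"
  shows "frag_extend (coef 0) (frag_map (\<lambda>(x, u). (x + 1, u)) c) = frag_extend (coef 0) c"
    and "frag_extend (coef (Suc j)) (frag_map (\<lambda>(x, u). (x + 1, u)) c) =
      frag_extend (coef (Suc j)) c + frag_extend (coef j) c"
proof -
  have nat: "nat (x + 1) = Suc (nat x)" if "(x, w) \<in> Poly_Mapping.keys c" for x w
    using that assms by auto
  have "coef 0 (x + 1, w) = coef 0 (x, w)" for x w
    by (simp add: coef_def)
  then show "frag_extend (coef 0) (frag_map (\<lambda>(x, u). (x + 1, u)) c) = frag_extend (coef 0) c"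
    unfolding frag_extend_frag_extend by (intro frag_extend_eq) auto
  have "coef (Suc j) (x + 1, w) = coef (Suc j) (x, w) + coef j (x, w)"
    if "(x, w) \<in> Poly_Mapping.keys c" for x w
    by (simp add: coef_def nat[OF that] frag_cmul_distrib)
  then show "frag_extend (coef (Suc j)) (frag_map (\<lambda>(x, u). (x + 1, u)) c) =
      frag_extend (coef (Suc j)) c + frag_extend (coef j) c"
    unfolding frag_extend_frag_extend frag_extend_fun_add[symmetric] by (intro frag_extend_eq) auto
qed

lemma coef_powr_lift: "frag_extend (coef j) (power_lift s w) = (if j = s then frag_of w else 0)"
proof (induction s arbitrary: j)
  case 0
  then show ?case by (cases j) (auto simp: coef_def)
next
  case (Suc s)
  have "Poly_Mapping.keys (power_lift s w) \<subseteq> {0..} \<times> UNIV" using power_lift_keys[of s w] by auto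
  from coef_shift[OF this] show ?case by (cases j) (auto simp: frag_extend_diff Suc)
qed

text \<open>The binomial theorem for t^n = (1 + (t - 1))^n, by repeated multiplication with
  t.\<close>

lemma power_lift_expansion:
  "frag_of (int n, w) = (\<Sum>s\<le>n. frag_cmul (int (n choose s)) (power_lift s w))"
proof (induction n)
  case (Suc n)
  let ?S = "frag_map (\<lambda>(x, u::'a list). (x + 1 :: int, u))"
  have S: "?S (power_lift s w) = power_lift (Suc s) w + power_lift s w" for s by simp
  have "frag_of (int (Suc n), w) = ?S (frag_of (int n, w))" by (simp add: ac_simps)
  also have "\<dots> = (\<Sum>s\<le>n. frag_cmul (int (n choose s)) (power_lift (Suc s) w)) +
      (\<Sum>s\<le>n. frag_cmul (int (n choose s)) (power_lift s w))"
    unfolding Suc by (simp add: frag_extend_sum coef_def frag_extend_cmul S frag_cmul_distrib2 sum.distrib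
        del: power_lift.simps)
  also have "(\<Sum>s\<le>n. frag_cmul (int (n choose s)) (power_lift s w)) =
      (\<Sum>s\<le>Suc n. frag_cmul (int (n choose s)) (power_lift s w))"
    by (simp del: power_lift.simps)
  also have "(\<Sum>s\<le>n. frag_cmul (int (n choose s)) (power_lift (Suc s) w)) + \<dots> =
      (\<Sum>s\<le>Suc n. frag_cmul (int (Suc n choose s)) (power_lift s w))"
    unfolding sum.atMost_Suc_shift
    by (simp add: frag_cmul_distrib sum.distrib del: power_lift.simps sum.atMost_Suc)
  finally show ?case .
qed simp

text \<open>Exponents below \<open>p\<close> involve only powers of t - 1 below the p-th, so the
  first \<open>p\<close> coefficients determine a chain. This yields the separation axiom
  \<open>\<sigma>_sep\<close> of the filtered complex.\<close>

lemma coef_expansion: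
  assumes "Poly_Mapping.keys c \<subseteq> XI q"
  shows "c = (\<Sum>s<p. frag_extend (power_lift s) (frag_extend (coef s) c))"
proof -
  have "c = frag_extend frag_of c" by (rule frag_expansion)
  also have "\<dots> = frag_extend (\<lambda>x. \<Sum>s<p. frag_extend (power_lift s) (coef s x)) c"
  proof (rule frag_extend_eq)
    fix x assume "x \<in> Poly_Mapping.keys c"
    then have "x \<in> XI q" using assms by blast
    then obtain y w where y: "x = (y, w)" "0 \<le> y" "y < int p" by (auto simp: XI_def)
    define n where "n = nat y"
    have x: "x = (int n, w)" "n < p" using y by (auto simp: n_def)
    have "(\<Sum>s<p. frag_extend (power_lift s) (coef s x)) = (\<Sum>s<p. frag_cmul (int (n choose s)) (power_lift s w))"
      by (simp add: x coef_def frag_extend_cmul)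
    also have "\<dots> = (\<Sum>s\<le>n. frag_cmul (int (n choose s)) (power_lift s w))"
      using x(2) by (intro sum.mono_neutral_right) auto
    finally show "frag_of x = (\<Sum>s<p. frag_extend (power_lift s) (coef s x))"
      using power_lift_expansion[of n w] by (simp add: x(1))
  qed
  also have "\<dots> = (\<Sum>s<p. frag_extend (power_lift s) (frag_extend (coef s) c))"
    by (simp add: frag_extend_fun_sum frag_extend_frag_extend)
  finally show ?thesis .
qed

text \<open>The coefficient of (t - 1)^i in t^(\<nu> g), times d_0; on words over the carrier of
  \<open>G\<close> the case i = 1 is \<open>cap\<close>.\<close>

fun capn :: "nat \<Rightarrow> 'a list \<Rightarrow> 'a list \<Rightarrow>\<^sub>0 int" where
  "capn i [] = 0"
| "capn i (g # w) = frag_cmul (int (nat (\<nu> g) choose i)) (frag_of w)"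

text \<open>Only d_0 acts on the group ring of coefficients, by multiplication with t^(\<nu> g).
  Multiplying out the expansions in t - 1 leaves the ordinary bar differential for i = 0 and
  otherwise \<open>capn i\<close>, which raises the power by \<open>i\<close>.\<close>

lemma coef_aD:
  assumes c: "Poly_Mapping.keys c \<subseteq> XI q" and s: "s < p"
  shows "red p (frag_extend (coef s) (frag_extend aD c)) =
    red p (frag_extend (bar_d G) (frag_extend (coef s) c) +
      (\<Sum>i\<in>{1..s}. frag_extend (capn i) (frag_extend (coef (s - i)) c)))"
proof -
  have "red p (frag_extend (coef s) (aD x)) =
      red p (frag_extend (bar_d G) (coef s x) + (\<Sum>i\<in>{1..s}. frag_extend (capn i) (coef (s - i) x)))"
    if x: "x \<in> XI q" for x
  proof -
    obtain y w where yw: "x = (y, w)" "0 \<le> y" "y < int p" "set w \<subseteq> carrier G"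
      using x by (cases x) (auto simp: XI_def NI_def)
    show ?thesis
    proof (cases w)
      case Nil
      then show ?thesis by (simp add: yw coef_def frag_extend_cmul)
    next
      case (Cons g u)
      have g: "0 \<le> \<nu> g" "\<nu> g < int p" using \<nu>_range yw Cons by auto
      have e: "frag_extend (coef s) (at_base y d) = frag_cmul (int (nat y choose s)) d" for d
        by (induction d rule: frag_linear_induct) (auto simp: frag_extend_diff coef_def frag_cmul_diff_right)
      \<comment> \<open>Moving the base point reduces it modulo \<open>p\<close>; as s < p, the
        binomial coefficient changes only by a multiple of \<open>p\<close>.\<close>
      have "int (nat (act y g) choose s) mod int p = int (nat y + nat (\<nu> g) choose s) mod int p"
        using choose_mod_prime[OF prime_p s, of "nat y" "nat (\<nu> g)"] yw g
        by (simp add: act_def nat_mod_distrib nat_add_distrib nat_less_iff)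
      also have "(nat y + nat (\<nu> g) choose s) = (nat y choose s) + (\<Sum>i\<in>{1..s}. (nat (\<nu> g) choose i) * (nat y choose (s - i)))"
        using vandermonde[of "nat (\<nu> g)" "nat y" s]
        by (simp add: atMost_atLeast0 sum.atLeast_Suc_atMost add.commute)
      finally have m: "int (nat (act y g) choose s) mod int p = (int (nat y choose s) +
          (\<Sum>i\<in>{1..s}. int (nat (\<nu> g) choose i) * int (nat y choose (s - i)))) mod int p"
        by simp
      have sum: "(\<Sum>i\<in>I. frag_cmul (f i) (frag_of u)) = frag_cmul (\<Sum>i\<in>I. f i) (frag_of u)" if "finite I"
        for I :: "nat set" and f
        using that by (induction I rule: finite_induct) (auto simp: frag_cmul_distrib)
      have "frag_extend (bar_d G) (coef s x) + (\<Sum>i\<in>{1..s}. frag_extend (capn i) (coef (s - i) x)) =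
          frag_cmul (int (nat y choose s) + (\<Sum>i\<in>{1..s}. int (nat (\<nu> g) choose i) * int (nat y choose (s - i)))) (frag_of u)
          - frag_cmul (int (nat y choose s)) (bar_e G (g # u))"
        by (simp add: yw(1) Cons coef_def frag_extend_cmul sum frag_cmul_diff_right frag_cmul_distrib mult.commute
            del: bar_e.simps)
      moreover have "frag_extend (coef s) (aD x) = frag_cmul (int (nat (act y g) choose s)) (frag_of u)
          - frag_cmul (int (nat y choose s)) (bar_e G (g # u))"
        by (simp add: yw(1) Cons frag_extend_diff e del: bar_e.simps) (simp add: coef_def)
      ultimately show ?thesis using m by (auto intro: red_diff_cong red_cmul_cong)
    qed
  qed
  then have "red p (frag_extend (\<lambda>x. frag_extend (coef s) (aD x)) c) = red p (frag_extend
      (\<lambda>x. frag_extend (bar_d G) (coef s x) + (\<Sum>i\<in>{1..s}. frag_extend (capn i) (coef (s - i) x))) c)"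
    using c by (intro red_frag_extend_cong) auto
  then show ?thesis
    by (simp add: frag_extend_frag_extend frag_extend_fun_add frag_extend_fun_sum)
qed

lemma red_sum_zero: "finite I \<Longrightarrow> (\<And>i. i \<in> I \<Longrightarrow> red p (f i) = red p 0) \<Longrightarrow> red p (\<Sum>i\<in>I. f i) = red p 0"
proof (induction I rule: finite_induct)
  case (insert i I)
  then show ?case using red_add_cong[of p "f i" 0 "sum f I" 0] by simp
qed simp

lemma red_frag_extend_zero: "red p c = red p 0 \<Longrightarrow> red p (frag_extend \<phi> c) = red p 0"
  using red_frag_extend_cong[OF refl, of p c 0 \<phi>] by simp

text \<open>The corrections \<open>capn i\<close> read strictly lower coefficients, which vanish. So
  the differential respects the filtration and induces the bar differential on each graded
  piece.\<close>

lemma coef_aD_filtered: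
  assumes c: "Poly_Mapping.keys c \<subseteq> XI q" and s: "s < p"
    and zero: "\<And>j. j < s \<Longrightarrow> red p (frag_extend (coef j) c) = red p 0"
  shows "red p (frag_extend (coef s) (frag_extend aD c)) = red p (frag_extend (bar_d G) (frag_extend (coef s) c))"
proof -
  have "red p (\<Sum>i\<in>{1..s}. frag_extend (capn i) (frag_extend (coef (s - i)) c)) = red p 0"
    by (rule red_sum_zero) (auto intro: red_frag_extend_zero[OF zero])
  from red_add_cong[OF refl this] show ?thesis unfolding coef_aD[OF c s] by simp
qed

lemma frag_extend_cap: "Poly_Mapping.keys c \<subseteq> NI q \<Longrightarrow> frag_extend (capn 1) c = frag_extend cap c"
proof (rule frag_extend_eq)
  fix w assume "Poly_Mapping.keys c \<subseteq> NI q" "w \<in> Poly_Mapping.keys c"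
  then have "set w \<subseteq> carrier G" by (auto simp: NI_def)
  then show "capn 1 w = cap w" using \<nu>_range by (cases w) auto
qed

text \<open>One step above the leading coefficient only the correction with i = 1 survives. This is
  the source of the first differential.\<close>

lemma coef_aD_Suc:
  assumes c: "Poly_Mapping.keys c \<subseteq> XI q" and s: "Suc s < p"
    and zero: "\<And>j. j < s \<Longrightarrow> red p (frag_extend (coef j) c) = red p 0"
  shows "red p (frag_extend (coef (Suc s)) (frag_extend aD c)) =
    red p (frag_extend (bar_d G) (frag_extend (coef (Suc s)) c) + frag_extend (capn 1) (frag_extend (coef s) c))"
proof -
  have "red p (\<Sum>i\<in>{2..Suc s}. frag_extend (capn i) (frag_extend (coef (Suc s - i)) c)) = red p 0"
    by (rule red_sum_zero) (auto intro: red_frag_extend_zero[OF zero])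
  note tail = red_add_cong[OF refl this, of "frag_extend (capn 1) (frag_extend (coef s) c)"]
  have "(\<Sum>i\<in>{1..Suc s}. frag_extend (capn i) (frag_extend (coef (Suc s - i)) c)) =
      frag_extend (capn 1) (frag_extend (coef (Suc s - 1)) c) +
      (\<Sum>i\<in>{2..Suc s}. frag_extend (capn i) (frag_extend (coef (Suc s - i)) c))"
    unfolding numeral_2_eq_2 One_nat_def by (rule sum.atLeast_Suc_atMost) simp
  with tail have "red p (\<Sum>i\<in>{1..Suc s}. frag_extend (capn i) (frag_extend (coef (Suc s - i)) c)) =
      red p (frag_extend (capn 1) (frag_extend (coef s) c))"
    by simp
  from red_add_cong[OF refl this] show ?thesis unfolding coef_aD[OF c s] .
qed

section \<open>The action groupoid as a filtered complex\<close>

definition sig :: "int \<Rightarrow> int \<times> 'a list \<Rightarrow> 'a list \<Rightarrow>\<^sub>0 int" where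
  "sig s = (if s < 0 then (\<lambda>_. 0) else coef (nat s))"

lemma sig_int: "sig (int s) = coef s"
  by (simp add: sig_def)

lemma coef_keys: "x \<in> XI q \<Longrightarrow> Poly_Mapping.keys (coef s x) \<subseteq> NI q"
  by (cases x) (auto simp: coef_def XI_def)

lemma sig_keys: "x \<in> XI q \<Longrightarrow> Poly_Mapping.keys (sig s x) \<subseteq> NI q"
  using coef_keys by (simp add: sig_def)

lemma sig_high:
  assumes "Poly_Mapping.keys c \<subseteq> XI q" "int p \<le> s" shows "frag_extend (sig s) c = 0"
proof (rule frag_extend_eq_0)
  fix x assume "x \<in> Poly_Mapping.keys c"
  then have "0 \<le> fst x" "fst x < int p" using assms(1) by (auto simp: XI_def)
  then have "nat (fst x) < nat s" using assms(2) by linarith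
  then show "sig s x = 0" using assms(2) by (cases x) (simp add: sig_def coef_def binomial_eq_0)
qed

sublocale FC: filtered_complex "Fp p" "\<lambda>q. free (XI q)" "\<lambda>q. free (NI q)" "lft p aD" "\<lambda>s. lft p (sig s)" p
proof (rule filtered_complex.intro)
  show "module (Fp p) (free (XI q))" "module (Fp p) (free (NI q))" for q by (rule free_module)+
  show "lft p aD \<in> lin_hom (Fp p) (free (XI q)) (free (XI (q - 1)))" for q
    by (rule lft_hom) (rule aD_keys)
  show "lft p (sig s) \<in> lin_hom (Fp p) (free (XI q)) (free (NI q))" for s q
    by (rule lft_hom) (rule sig_keys)
  show "1 \<le> p" using p_gt_1 by simp
  show "carrier (free (XI q)) = {\<zero>\<^bsub>free (XI q)\<^esub>}" if "q < 0" for q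
  proof -
    have "XI q = {}" using that by (auto simp: XI_def NI_def)
    then show ?thesis using p_gt_1 by (auto simp: free_simps fun_eq_iff)
  qed
next
  fix q f assume "f \<in> carrier (free (XI q))"
  then obtain c where c: "f = red p c" "Poly_Mapping.keys c \<subseteq> XI q" by (rule carrier_redE)
  show "lft p aD (lft p aD f) = \<zero>\<^bsub>free (XI (q - 2))\<^esub>"
    by (simp add: c(1) lft_red[OF refl] aD_aD[OF c(2)] red_zero)
  show "lft p (sig s) f = \<zero>\<^bsub>free (NI q)\<^esub>" if "s < 0" for s
    using that by (simp add: c(1) lft_red[OF refl] sig_def frag_extend_eq_0 red_zero)
  show "lft p (sig s) f = \<zero>\<^bsub>free (NI q)\<^esub>" if "int p \<le> s" for s
    using sig_high[OF c(2) that] by (simp add: c(1) lft_red[OF refl] red_zero)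
  show "f = \<zero>\<^bsub>free (XI q)\<^esub>" if z: "\<And>s. lft p (sig s) f = \<zero>\<^bsub>free (NI q)\<^esub>"
  proof -
    have "red p (frag_extend (coef s) c) = red p 0" for s
      using z[of "int s"] by (simp add: c(1) lft_red[OF refl] sig_int red_zero[symmetric])
    from red_frag_extend_zero[OF this]
    have "red p (\<Sum>s<p. frag_extend (power_lift s) (frag_extend (coef s) c)) = red p 0"
      by (intro red_sum_zero) auto
    then show ?thesis using coef_expansion[OF c(2)] by (simp add: c(1) red_zero[symmetric])
  qed
  show "lft p (sig j) (lft p aD f) = \<zero>\<^bsub>free (NI (q - 1))\<^esub>"
    if z: "\<And>j. j < s \<Longrightarrow> lft p (sig j) f = \<zero>\<^bsub>free (NI q)\<^esub>" and j: "j < s" for s j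
  proof -
    have k: "Poly_Mapping.keys (frag_extend aD c) \<subseteq> XI (q - 1)"
      by (rule keys_frag_extend_subset) (use c(2) aD_keys in blast)
    have zc: "red p (frag_extend (coef i) c) = red p 0" if "int i < s" for i
      using z[OF that] by (simp add: c(1) lft_red[OF refl] sig_int red_zero[symmetric])
    consider "j < 0" | "int p \<le> j" | i where "j = int i" "i < p"
      by (metis linorder_not_le of_nat_less_iff zero_le_imp_eq_int)
    then show ?thesis
    proof cases
      case 1
      then show ?thesis by (simp add: c(1) lft_red[OF refl] sig_def frag_extend_eq_0 red_zero)
    next
      case 2
      then show ?thesis using sig_high[OF k] by (simp add: c(1) lft_red[OF refl] red_zero)
    next
      case 3
      have "red p (frag_extend (coef i) (frag_extend aD c)) = red p (frag_extend (bar_d G) (frag_extend (coef i) c))"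
        using 3 j by (intro coef_aD_filtered[OF c(2)] zc) auto
      also have "\<dots> = red p 0" using 3 j by (intro red_frag_extend_zero[OF zc]) auto
      finally show ?thesis
        by (simp add: c(1) lft_red[OF refl] 3 sig_int red_zero[symmetric])
    qed
  qed
qed


section \<open>The first page\<close>

lemma F_redE:
  assumes "f \<in> FC.F s q"
  obtains c where "f = red p c" "Poly_Mapping.keys c \<subseteq> XI q"
    "\<And>j. int j < s \<Longrightarrow> red p (frag_extend (coef j) c) = red p 0"
proof -
  obtain c where c: "f = red p c" "Poly_Mapping.keys c \<subseteq> XI q"
    using FC.F_carrier[OF assms] by (rule carrier_redE)
  have "red p (frag_extend (coef j) c) = red p 0" if "int j < s" for j
    using assms that by (auto simp: FC.F_def c(1) lft_red[OF refl] sig_int red_zero[symmetric])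
  then show ?thesis by (rule that[OF c])
qed

lemma sig_aD:
  assumes "f \<in> FC.F (int s) q" "s < p"
  shows "lft p (sig (int s)) (lft p aD f) = lft p (bar_d G) (lft p (sig (int s)) f)"
proof -
  obtain c where c: "f = red p c" "Poly_Mapping.keys c \<subseteq> XI q"
    "\<And>j. int j < int s \<Longrightarrow> red p (frag_extend (coef j) c) = red p 0"
    using assms(1) by (rule F_redE) blast
  then show ?thesis
    using coef_aD_filtered[OF c(2) assms(2)] by (simp add: c(1) lft_red[OF refl] sig_int)
qed

lemma lift_keys:
  assumes "Poly_Mapping.keys e \<subseteq> NI q" "s < p"
  shows "Poly_Mapping.keys (frag_extend (power_lift s) e) \<subseteq> XI q"
proof (rule keys_frag_extend_subset)
  fix w assume "w \<in> Poly_Mapping.keys e"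
  then have "{0..int s} \<times> {w} \<subseteq> XI q" using assms by (auto simp: XI_def)
  then show "Poly_Mapping.keys (power_lift s w) \<subseteq> XI q" using power_lift_keys by blast
qed

lemma coef_lift: "frag_extend (coef j) (frag_extend (power_lift s) e) = (if j = s then e else 0)"
  by (simp add: frag_extend_frag_extend coef_powr_lift frag_extend_eq_0 frag_expansion[symmetric])

lemma lift_F:
  assumes "Poly_Mapping.keys e \<subseteq> NI q" "s < p"
  shows "red p (frag_extend (power_lift s) e) \<in> FC.F (int s) q"
proof -
  have "lft p (sig j) (red p (frag_extend (power_lift s) e)) = \<zero>\<^bsub>free (NI q)\<^esub>" if "j < int s" for j
  proof (cases "j < 0")
    case False
    then obtain i where i: "j = int i" by (metis linorder_not_le zero_le_imp_eq_int)
    then show ?thesis using that by (simp add: lft_red[OF refl] sig_int coef_lift red_zero)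
  qed (simp add: lft_red[OF refl] sig_def frag_extend_eq_0 red_zero)
  then show ?thesis using red_carrier[OF lift_keys[OF assms]] by (simp add: FC.F_def)
qed

text \<open>The leading coefficient of the boundary of (t - 1)^s \<otimes> e is the boundary of
  \<open>e\<close>, which vanishes modulo \<open>p\<close>; so the boundary lies one step
  deeper.\<close>

lemma lift_A:
  assumes e: "Poly_Mapping.keys e \<subseteq> N n" and s: "s < p" and cyc: "red p e \<in> C.cyc n"
  shows "red p (frag_extend (power_lift s) e) \<in> FC.A 1 (int s) (int n)"
proof (rule FC.AI)
  have e': "Poly_Mapping.keys e \<subseteq> NI (int n)" using e by (simp add: NI_int)
  show F: "red p (frag_extend (power_lift s) e) \<in> FC.F (int s) (int n)" by (rule lift_F[OF e' s])
  have "lft p (sig (int s)) (lft p aD (red p (frag_extend (power_lift s) e))) =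
      red p (frag_extend (bar_d G) e)"
    unfolding sig_aD[OF F s] by (simp add: lft_red[OF refl] sig_int coef_lift)
  also have "\<dots> = \<zero>\<^bsub>free (NI (int n - 1))\<^esub>"
    using cyc by (simp add: C.cyc_red[OF e] red_zero[symmetric])
  finally show "lft p aD (red p (frag_extend (power_lift s) e)) \<in> FC.F (int s + 1) (int n - 1)"
    by (rule FC.F_SucI[OF FC.D_F[OF F]])
qed

lemma sig_lift: "lft p (sig (int s)) (red p (frag_extend (power_lift s) e)) = red p e"
  by (simp add: lft_red[OF refl] sig_int coef_lift)

text \<open>A leading coefficient is a cycle because the graded differential is the bar
  differential; conversely a cycle represented by \<open>e\<close> is the leading coefficient of (t
  - 1)^s \<otimes> e.\<close>

lemma first_page_cycles:
  assumes s: "s < p"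
  shows "FC.page_cycles 1 (int s) (int n) = C.cyc n"
proof (intro equalityI subsetI)
  fix z assume "z \<in> FC.page_cycles 1 (int s) (int n)"
  then obtain f where f: "f \<in> FC.A 1 (int s) (int n)" "z = lft p (sig (int s)) f"
    by (auto simp: FC.page_cycles_def)
  have "z \<in> carrier (free (N n))"
    using FC.\<sigma>_closed[OF FC.A_carrier[OF f(1)]] by (simp add: f(2) NI_int)
  then obtain e where e: "z = red p e" "Poly_Mapping.keys e \<subseteq> N n" by (rule carrier_redE)
  have "lft p (bar_d G) z = \<zero>\<^bsub>free (NI (int n - 1))\<^esub>"
    unfolding f(2) sig_aD[OF FC.A_F[OF f(1)] s, symmetric] by (rule FC.F_SucD[OF FC.A_D[OF f(1)]])
  then show "z \<in> C.cyc n"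
    unfolding e(1) C.cyc_red[OF e(2)] by (simp add: lft_red[OF refl] red_zero[symmetric])
next
  fix z assume z: "z \<in> C.cyc n"
  then obtain e where e: "z = red p e" "Poly_Mapping.keys e \<subseteq> N n" by (rule C.cycE)
  then show "z \<in> FC.page_cycles 1 (int s) (int n)"
    using lift_A[OF e(2) s] z unfolding FC.page_cycles_def
    by (intro image_eqI[of _ _ "red p (frag_extend (power_lift s) e)"]) (auto simp: sig_lift)
qed

text \<open>On the first page boundaries come from all chains of filtration degree \<open>s\<close>,
  as \<open>A 0 s\<close> is all of \<open>F s\<close>.\<close>

lemma first_page_boundaries:
  assumes s: "s < p"
  shows "FC.page_boundaries 1 (int s) (int n) = C.bnd n"
proof (intro equalityI subsetI)
  fix z assume "z \<in> FC.page_boundaries 1 (int s) (int n)"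
  then obtain f where f: "f \<in> FC.F (int s) (int (Suc n))" "z = lft p (sig (int s)) (lft p aD f)"
    using FC.A_F by (auto simp: FC.page_boundaries_def ac_simps) (metis FC.A_F add.commute)
  have "lft p (sig (int s)) f \<in> carrier (free (N (Suc n)))"
    using FC.\<sigma>_closed[OF FC.F_carrier[OF f(1)]] NI_int[of "Suc n"] by simp
  then obtain e where e: "lft p (sig (int s)) f = red p e" "Poly_Mapping.keys e \<subseteq> N (Suc n)"
    by (rule carrier_redE)
  then show "z \<in> C.bnd n"
    unfolding f(2) sig_aD[OF f(1) s] C.bnd_iff by (auto simp: lft_red[OF refl])
next
  fix z assume "z \<in> C.bnd n"
  then obtain e where e: "Poly_Mapping.keys e \<subseteq> N (Suc n)" "z = red p (frag_extend (bar_d G) e)"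
    by (auto simp: C.bnd_iff)
  let ?f = "red p (frag_extend (power_lift s) e)"
  have F: "?f \<in> FC.F (int s) (int n + 1)"
    using lift_F[OF _ s, of e "int (Suc n)"] e(1) NI_int[of "Suc n"] by (simp add: ac_simps)
  then have A: "?f \<in> FC.A (1 - 1) (int s - 1 + 1) (int n + 1)"
    using FC.D_F[OF F] by (intro FC.AI) simp_all
  have "z = lft p (sig (int s)) (lft p aD ?f)"
    unfolding sig_aD[OF F s] sig_lift e(2) by (simp add: lft_red[OF refl])
  then show "z \<in> FC.page_boundaries 1 (int s) (int n)"
    unfolding FC.page_boundaries_def using A by (rule image_eqI)
qed

text \<open>The graded pieces are the very chain modules of the nerve, whence an equality of
  modules.\<close>

lemma first_page:
  assumes "s < p"
  shows "FC.page 1 (int s) (int n) = group_homology (Fp p) G n"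
  unfolding FC.page_def first_page_cycles[OF assms] first_page_boundaries[OF assms] NI_int
    C.homology_eq C.chains_eq ..

text \<open>A class is represented by (t - 1)^s \<otimes> e, whose only nonzero coefficient is
  \<open>e\<close> in degree \<open>s\<close>. Modulo \<open>p\<close>, the coefficient of degree s
  + 1 of its boundary is then exactly \<open>cap\<close> of \<open>e\<close>, the form of
  \<open>rho\<close> on chains.\<close>

lemma first_page_diff:
  assumes s: "Suc s < p" and U: "U \<in> carrier (group_homology (Fp p) G (Suc n))"
  shows "FC.page_diff 1 (int s) (int (Suc n)) U = rho p G \<nu> (Suc n) U"
proof -
  obtain z where z: "z \<in> C.cyc (Suc n)" "U = hclass CC (Suc n) z"
    using U by (auto simp: C.hclass_surj[symmetric])
  obtain e where e: "z = red p e" "Poly_Mapping.keys e \<subseteq> N (Suc n)" using z(1) by (rule C.cycE)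
  have s': "s < p" using s by simp
  let ?c = "frag_extend (power_lift s) e"
  have c: "Poly_Mapping.keys ?c \<subseteq> XI (int (Suc n))"
    by (rule lift_keys[OF _ s']) (use e(2) NI_int[of "Suc n"] in simp)
  have A: "red p ?c \<in> FC.A 1 (int s) (int (Suc n))"
    using lift_A[OF e(2) s'] z(1) e(1) by simp
  have "FC.page_class 1 (int s) (int (Suc n)) (red p ?c) = U"
    unfolding FC.page_class_def first_page_boundaries[OF s'] sig_lift NI_int z(2) C.hclass_eq C.chains_eq e(1) ..
  then have "FC.page_diff 1 (int s) (int (Suc n)) U =
      FC.page_class 1 (int s + 1) (int (Suc n) - 1) (lft p aD (red p ?c))"
    using FC.page_diff_eq[OF A] by simp
  also have "\<dots> = FC.page_class 1 (int (Suc s)) (int n) (lft p aD (red p ?c))"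
    by (simp add: ac_simps)
  also have "\<dots> = hclass CC n (lft p (sig (int (Suc s))) (lft p aD (red p ?c)))"
    unfolding FC.page_class_def first_page_boundaries[OF s] NI_int C.hclass_eq C.chains_eq ..
  also have "lft p (sig (int (Suc s))) (lft p aD (red p ?c)) =
      red p (frag_extend (coef (Suc s)) (frag_extend aD ?c))"
    by (simp only: lft_red[OF refl] sig_int)
  also have "\<dots> = red p (frag_extend (bar_d G) (frag_extend (coef (Suc s)) ?c) + frag_extend (capn 1) (frag_extend (coef s) ?c))"
    by (rule coef_aD_Suc[OF c s]) (simp add: coef_lift)
  also have "\<dots> = lft p cap z"
    using frag_extend_cap[of e "int (Suc n)"] e(2) NI_int[of "Suc n"] by (simp add: coef_lift e(1) lft_red[OF refl])
  finally show ?thesis using rho_hclass[OF z(1)] z(2) by simp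
qed

end


section \<open>The total homology\<close>

lemma bar_e_carrier_update: "bar_e (G\<lparr>carrier := S\<rparr>) w = bar_e G w"
  by (induction w rule: induct_list012) auto

lemma bar_d_carrier_update: "bar_d (G\<lparr>carrier := S\<rparr>) w = bar_d G w"
  by (cases w) (auto simp: bar_e_carrier_update)

locale cyclic_extension = nerve_character +
  fixes K :: "'k monoid" and \<iota> :: "'k \<Rightarrow> 'a"
  assumes K_group: "group K" and \<iota>_mon: "\<iota> \<in> mon K G"
    and \<nu>_surj: "\<nu> ` carrier G = carrier (Zp p)"
    and exact: "\<iota> ` carrier K = kernel G (Zp p) \<nu>"
begin

lemma \<nu>_one: "\<nu> \<one> = 0"
proof -
  have "\<nu> \<one> = (\<nu> \<one> + \<nu> \<one>) mod int p" using \<nu>_mult[of \<one> \<one>] by simp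
  then have "(\<nu> \<one> + \<nu> \<one>) mod int p = (\<nu> \<one> + 0) mod int p" using \<nu>_range[of \<one>] by simp
  then have "\<nu> \<one> mod int p = 0 mod int p" by (simp add: mod_eq_dvd_iff)
  then show ?thesis using \<nu>_range[of \<one>] by simp
qed

lemma \<nu>_inv:
  assumes "g \<in> carrier G" shows "(\<nu> g + \<nu> (inv g)) mod int p = 0"
  using \<nu>_mult[of g "inv g"] assms by (simp add: \<nu>_one)

text \<open>A section of \<open>\<nu>\<close> as a map of sets, normalized at 0 so that the
  retraction onto \<open>K\<close> is the identity on words over \<open>K\<close> at the base point
  0.\<close>

definition sec :: "int \<Rightarrow> 'a" where
  "sec x = (if x = 0 then \<one> else SOME g. g \<in> carrier G \<and> \<nu> g = x)"

lemma sec: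
  assumes "x \<in> {0..<int p}" shows "sec x \<in> carrier G" "\<nu> (sec x) = x"
proof -
  have "x \<in> \<nu> ` carrier G"
    unfolding \<nu>_surj using assms p_gt_1 by (simp add: carrier_integer_mod_group)
  then have "\<exists>g. g \<in> carrier G \<and> \<nu> g = x" by blast
  note some = someI_ex[OF this]
  show "sec x \<in> carrier G"
    using some by (cases "x = 0") (simp_all add: sec_def)
  show "\<nu> (sec x) = x"
    using some by (cases "x = 0") (simp_all add: sec_def \<nu>_one)
qed

text \<open>The loop at 0 that runs to \<open>x\<close> along \<open>sec x\<close>, follows
  \<open>g\<close> and returns along the inverse of the section.\<close>

definition conjugate :: "int \<Rightarrow> 'a \<Rightarrow> 'a" where
  "conjugate x g = sec x \<otimes> g \<otimes> inv (sec (act x g))"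

lemma conjugate_closed: "x \<in> {0..<int p} \<Longrightarrow> g \<in> carrier G \<Longrightarrow> conjugate x g \<in> carrier G"
  using sec(1) A.act_closed by (auto simp: conjugate_def)

text \<open>The action is transitive: \<open>inv (sec x)\<close> moves \<open>x\<close> to the base
  point 0, and naturality holds by the choice of \<open>conjugate\<close>.\<close>

sublocale B: action_retract G act "{0..<int p}" "\<lambda>x. inv (sec x)" 0 conjugate
proof
  fix x assume x: "x \<in> {0..<int p}"
  show "inv (sec x) \<in> carrier G" using sec(1)[OF x] by simp
  show "act x (inv (sec x)) = 0" using \<nu>_inv[OF sec(1)[OF x]] by (simp add: act_def sec(2)[OF x])
  fix g assume g: "g \<in> carrier G"
  have y: "act x g \<in> {0..<int p}" using x g by (rule A.act_closed)
  show "conjugate x g \<in> carrier G" using x g by (rule conjugate_closed)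
  show "g \<otimes> inv (sec (act x g)) = inv (sec x) \<otimes> conjugate x g"
    using sec(1)[OF x] sec(1)[OF y] g by (simp add: conjugate_def m_assoc[symmetric])
  fix h assume h: "h \<in> carrier G"
  have z: "act (act x g) h \<in> {0..<int p}" using y h by (rule A.act_closed)
  have "inv (sec (act x g)) \<otimes> (sec (act x g) \<otimes> (h \<otimes> inv (sec (act (act x g) h)))) =
      h \<otimes> inv (sec (act (act x g) h))"
    using sec(1)[OF y] sec(1)[OF z] h by (simp add: m_assoc[symmetric])
  then show "conjugate x (g \<otimes> h) = conjugate x g \<otimes> conjugate (act x g) h"
    using sec(1)[OF x] sec(1)[OF y] sec(1)[OF z] g h A.act_mult[OF x g h] by (simp add: conjugate_def m_assoc)
qed

lemma conjugate_kernel: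
  assumes "x \<in> {0..<int p}" "g \<in> carrier G"
  shows "conjugate x g \<in> \<iota> ` carrier K"
proof -
  have y: "act x g \<in> {0..<int p}" using assms by (rule A.act_closed)
  have "\<nu> (conjugate x g) = (x + \<nu> g + \<nu> (inv (sec (act x g)))) mod int p"
    using sec[OF assms(1)] sec(1)[OF y] assms(2) by (simp add: conjugate_def \<nu>_mult mod_simps)
  also have "\<dots> = (act x g + \<nu> (inv (sec (act x g)))) mod int p"
    by (simp add: act_def mod_simps)
  also have "\<dots> = 0" using \<nu>_inv[OF sec(1)[OF y]] by (simp add: sec(2)[OF y])
  finally show ?thesis
    unfolding exact using conjugate_closed[OF assms] by (simp add: kernel_def)
qed

lemma rt_kernel: "x \<in> {0..<int p} \<Longrightarrow> set w \<subseteq> carrier G \<Longrightarrow> set (B.rt x w) \<subseteq> \<iota> ` carrier K"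
  by (induction w arbitrary: x) (simp_all add: conjugate_kernel A.act_closed del: atLeastLessThan_iff)

definition \<kappa> :: "'a \<Rightarrow> 'k" where
  "\<kappa> = inv_into (carrier K) \<iota>"

lemma \<iota>_simps:
  "k \<in> carrier K \<Longrightarrow> \<iota> k \<in> carrier G"
  "k \<in> carrier K \<Longrightarrow> l \<in> carrier K \<Longrightarrow> \<iota> (k \<otimes>\<^bsub>K\<^esub> l) = \<iota> k \<otimes> \<iota> l"
  "k \<in> carrier K \<Longrightarrow> \<kappa> (\<iota> k) = k"
  "k \<in> carrier K \<Longrightarrow> \<nu> (\<iota> k) = 0"
proof -
  show "k \<in> carrier K \<Longrightarrow> \<iota> k \<in> carrier G"
    "k \<in> carrier K \<Longrightarrow> l \<in> carrier K \<Longrightarrow> \<iota> (k \<otimes>\<^bsub>K\<^esub> l) = \<iota> k \<otimes> \<iota> l"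
    "k \<in> carrier K \<Longrightarrow> \<kappa> (\<iota> k) = k"
    using \<iota>_mon by (auto simp: mon_def hom_def \<kappa>_def)
  show "k \<in> carrier K \<Longrightarrow> \<nu> (\<iota> k) = 0"
    using exact by (auto simp: kernel_def)
qed

lemma \<kappa>_closed: "g \<in> \<iota> ` carrier K \<Longrightarrow> \<kappa> g \<in> carrier K"
  by (auto simp: \<iota>_simps)

lemma \<iota>_\<kappa>: "g \<in> \<iota> ` carrier K \<Longrightarrow> \<iota> (\<kappa> g) = g"
  by (auto simp: \<iota>_simps)

lemma \<kappa>_mult:
  assumes "g \<in> \<iota> ` carrier K" "h \<in> \<iota> ` carrier K"
  shows "\<kappa> (g \<otimes> h) = \<kappa> g \<otimes>\<^bsub>K\<^esub> \<kappa> h"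
proof -
  obtain k l where kl: "k \<in> carrier K" "g = \<iota> k" "l \<in> carrier K" "h = \<iota> l" using assms by auto
  have "k \<otimes>\<^bsub>K\<^esub> l \<in> carrier K"
    using kl K_group by (simp add: group.is_monoid monoid.m_closed)
  from \<iota>_simps(3)[OF this] show ?thesis using kl by (simp add: \<iota>_simps)
qed

section \<open>Comparison of the action groupoid with \<open>K\<close>\<close>

sublocale K: frag_complex p "simplices (nerve K)" "bar_d K" "sset_complex (Fp p) (nerve K)"
  by (rule nerve_complex) (simp add: K_group group.is_monoid)

abbreviation KC :: "(int, 'k list \<Rightarrow> int) complex_data" where
  "KC \<equiv> sset_complex (Fp p) (nerve K)"

text \<open>Retracted words have all their letters in the image of \<open>K\<close>, the stabilizer
  of 0, and so can be read as words over \<open>K\<close>.\<close>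

definition retr :: "int \<times> 'a list \<Rightarrow> 'k list \<Rightarrow>\<^sub>0 int" where
  "retr = (\<lambda>(x, w). frag_of (map \<kappa> (B.rt x w)))"

definition incl :: "'k list \<Rightarrow> int \<times> 'a list \<Rightarrow>\<^sub>0 int" where
  "incl ks = frag_of (0, map \<iota> ks)"

definition hmtp :: "int \<times> 'a list \<Rightarrow> int \<times> 'a list \<Rightarrow>\<^sub>0 int" where
  "hmtp = (\<lambda>(x, w). at_base x (B.htp x w))"

lemma XI_iff: "(x, w) \<in> XI (int n) \<longleftrightarrow> x \<in> {0..<int p} \<and> w \<in> N n"
  by (simp add: XI_def NI_int)

lemma retr_keys: "x \<in> XI (int n) \<Longrightarrow> Poly_Mapping.keys (retr x) \<subseteq> simplices (nerve K) n"
proof -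
  assume x: "x \<in> XI (int n)"
  obtain y w where yw: "x = (y, w)" by (cases x)
  then have "y \<in> {0..<int p}" "set w \<subseteq> carrier G" "length w = n" using x by (auto simp: XI_iff nerve_simplices)
  then show ?thesis
    using rt_kernel[of y w] by (auto simp: retr_def yw keys_frag_of nerve_simplices intro!: \<kappa>_closed)
qed

lemma incl_keys: "ks \<in> simplices (nerve K) n \<Longrightarrow> Poly_Mapping.keys (incl ks) \<subseteq> XI (int n)"
  using p_gt_1 by (auto simp: incl_def keys_frag_of XI_iff nerve_simplices \<iota>_simps)

lemma hmtp_keys: "x \<in> XI (int n) \<Longrightarrow> Poly_Mapping.keys (hmtp x) \<subseteq> XI (int (Suc n))"
proof -
  assume x: "x \<in> XI (int n)"
  obtain y w where yw: "x = (y, w)" by (cases x)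
  then have y: "y \<in> {0..<int p}" and w: "set w \<subseteq> carrier G" "length w = n"
    using x by (auto simp: XI_iff nerve_simplices)
  show ?thesis
    unfolding hmtp_def yw prod.case
  proof (rule keys_frag_extend_subset)
    fix u assume "u \<in> Poly_Mapping.keys (B.htp y w)"
    from B.htp_keys[OF y w(1) this] show "Poly_Mapping.keys (frag_of (y, u)) \<subseteq> XI (int (Suc n))"
      using y w unfolding keys_frag_of by (simp add: XI_iff nerve_simplices del: of_nat_Suc)
  qed
qed

lemma retr_aD:
  assumes "x \<in> XI (int n)"
  shows "frag_extend retr (aD x) = frag_extend (bar_d K) (retr x)"
proof -
  obtain y w where yw: "x = (y, w)" by (cases x)
  then have y: "y \<in> {0..<int p}" and w: "set w \<subseteq> carrier G"
    using assms by (auto simp: XI_iff nerve_simplices)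
  have "frag_extend retr (aD x) = frag_map (map \<kappa>) (frag_extend (\<lambda>(y, u). frag_of (B.rt y u)) (aD (y, w)))"
    unfolding yw frag_extend_frag_extend[of "\<lambda>x. frag_of (map \<kappa> x)"] by (intro frag_extend_eq) (auto simp: retr_def)
  \<comment> \<open>Multiplicativity of \<open>\<kappa>\<close> is available on the image of
    \<open>K\<close>; as the formula for \<open>bar_d\<close> does not involve the carrier, the
    latter is shrunk to that image before \<open>bar_d_map\<close> is applied.\<close>
  also have "\<dots> = frag_map (map \<kappa>) (bar_d (G\<lparr>carrier := \<iota> ` carrier K\<rparr>) (B.rt y w))"
    by (simp add: B.rt_act_d[OF y w] bar_d_carrier_update)
  also have "\<dots> = bar_d K (map \<kappa> (B.rt y w))"
    using rt_kernel[OF y w] by (intro bar_d_map) (auto simp: \<kappa>_mult)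
  finally show ?thesis by (simp add: retr_def yw)
qed

lemma incl_bar_d:
  assumes "ks \<in> simplices (nerve K) n"
  shows "frag_extend incl (bar_d K ks) = frag_extend aD (incl ks)"
proof -
  have ks: "set ks \<subseteq> carrier K" using assms by (simp add: nerve_simplices)
  have "frag_extend incl (bar_d K ks) = at_base 0 (frag_map (map \<iota>) (bar_d K ks))"
    by (simp add: frag_extend_frag_extend incl_def[abs_def])
  also have "frag_map (map \<iota>) (bar_d K ks) = bar_d G (map \<iota> ks)"
    using ks by (intro bar_d_map) (auto simp: \<iota>_simps)
  also have "at_base 0 (bar_d G (map \<iota> ks)) = aD (0, map \<iota> ks)"
    using ks by (cases ks) (auto simp: frag_extend_diff act_def \<iota>_simps simp del: bar_e.simps)
  finally show ?thesis unfolding incl_def[of ks] frag_extend_of .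
qed

text \<open>Holds strictly, not only up to homotopy, by the normalization of \<open>sec\<close> at
  0.\<close>

lemma retr_incl:
  assumes "set ks \<subseteq> carrier K"
  shows "frag_extend retr (incl ks) = frag_of ks"
proof -
  have "conjugate 0 (\<iota> k) = \<iota> k \<and> act 0 (\<iota> k) = 0" if "k \<in> carrier K" for k
    using that by (simp add: conjugate_def act_def \<iota>_simps sec_def)
  then have "B.rt 0 (map \<iota> ks) = map \<iota> ks"
    using assms by (induction ks) auto
  moreover have "map \<kappa> (map \<iota> ks) = ks"
    using assms by (induction ks) (auto simp: \<iota>_simps)
  ultimately show ?thesis
    by (simp add: incl_def retr_def del: map_map)
qed

lemma incl_retr:
  assumes "x \<in> XI (int n)"
  shows "frag_extend aD (hmtp x) + frag_extend hmtp (aD x) = frag_extend incl (retr x) - frag_of x"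
proof -
  obtain y w where yw: "x = (y, w)" by (cases x)
  then have y: "y \<in> {0..<int p}" and w: "set w \<subseteq> carrier G"
    using assms by (auto simp: XI_iff nerve_simplices)
  have "map \<iota> (map \<kappa> (B.rt y w)) = B.rt y w"
    using rt_kernel[OF y w] \<iota>_\<kappa> by (auto simp: comp_def subset_iff intro!: map_idI)
  then show ?thesis
    using B.act_htp[OF y w] by (simp add: yw hmtp_def retr_def incl_def)
qed

lemma cycles_iff:
  assumes "Poly_Mapping.keys c \<subseteq> XI (int n)"
  shows "red p c \<in> FC.cycles n \<longleftrightarrow> red p (frag_extend aD c) = red p 0"
  using red_carrier[OF assms] by (simp add: FC.cycles_def lft_red[OF refl] red_zero[symmetric])

lemma cyclesE:
  assumes "z \<in> FC.cycles n"
  obtains c where "z = red p c" "Poly_Mapping.keys c \<subseteq> XI (int n)" "red p (frag_extend aD c) = red p 0"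
proof -
  have "z \<in> carrier (free (XI (int n)))" using assms by (simp add: FC.cycles_def)
  then obtain c where "z = red p c" "Poly_Mapping.keys c \<subseteq> XI (int n)" by (rule carrier_redE)
  with assms that show ?thesis by (auto simp: cycles_iff)
qed

lemma retr_lin: "lft p retr \<in> lin_hom (Fp p) (free (XI (int n))) (chains KC n)"
  unfolding K.chains_eq by (rule lft_hom) (rule retr_keys)

lemma retr_frag_keys:
  "Poly_Mapping.keys c \<subseteq> XI (int n) \<Longrightarrow> Poly_Mapping.keys (frag_extend retr c) \<subseteq> simplices (nerve K) n"
  by (rule keys_frag_extend_subset) (use retr_keys in blast)

lemma retr_aD_frag:
  assumes "Poly_Mapping.keys c \<subseteq> XI (int n)"
  shows "frag_extend (bar_d K) (frag_extend retr c) = frag_extend retr (frag_extend aD c)"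
  unfolding frag_extend_frag_extend by (rule frag_extend_eq) (use assms retr_aD in auto)

lemma retr_cycles: "z \<in> FC.cycles n \<Longrightarrow> lft p retr z \<in> K.cyc n"
proof -
  assume "z \<in> FC.cycles n"
  then obtain c where c: "z = red p c" "Poly_Mapping.keys c \<subseteq> XI (int n)" "red p (frag_extend aD c) = red p 0"
    by (rule cyclesE)
  then show ?thesis
    using red_frag_extend_zero[OF c(3), of retr]
    by (simp add: lft_red[OF refl] K.cyc_red[OF retr_frag_keys[OF c(2)]] retr_aD_frag[OF c(2)])
qed

text \<open>Injectivity of the retraction on homology, in the form of the kernel condition in
  \<open>FC.converges\<close>.\<close>

lemma retr_bnd_iff:
  assumes z: "z \<in> FC.cycles n"
  shows "lft p retr z \<in> K.bnd n \<longleftrightarrow> z \<in> lft p aD ` carrier (free (XI (int n + 1)))"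
proof
  obtain c where c: "z = red p c" "Poly_Mapping.keys c \<subseteq> XI (int n)" "red p (frag_extend aD c) = red p 0"
    using z by (rule cyclesE)
  assume "lft p retr z \<in> K.bnd n"
  then obtain b where b: "Poly_Mapping.keys b \<subseteq> simplices (nerve K) (Suc n)"
    "red p (frag_extend retr c) = red p (frag_extend (bar_d K) b)"
    by (auto simp: K.bnd_iff c(1) lft_red[OF refl])
  \<comment> \<open>If the retraction of \<open>c\<close> is the boundary of \<open>b\<close> modulo
    \<open>p\<close>, the homotopy formula can be solved for \<open>c\<close>, up to the homotopy of
    its boundary, which vanishes modulo \<open>p\<close>. This is the resulting chain with boundary
    \<open>c\<close>.\<close>
  let ?b = "frag_extend incl b - frag_extend hmtp c"
  have "frag_extend (\<lambda>x. frag_extend aD (hmtp x) + frag_extend hmtp (aD x)) c =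
      frag_extend (\<lambda>x. frag_extend incl (retr x) - frag_of x) c"
    using c(2) incl_retr by (intro frag_extend_eq) auto
  then have "c = frag_extend incl (frag_extend retr c) - frag_extend aD (frag_extend hmtp c) - frag_extend hmtp (frag_extend aD c)"
    by (simp add: frag_extend_frag_extend frag_extend_fun_add frag_extend_fun_diff frag_expansion[symmetric] algebra_simps)
  then have "red p c = red p (frag_extend incl (frag_extend retr c) - frag_extend aD (frag_extend hmtp c) - frag_extend hmtp (frag_extend aD c))"
    by simp
  also have "\<dots> = red p (frag_extend incl (frag_extend (bar_d K) b) - frag_extend aD (frag_extend hmtp c) - 0)"
    by (intro red_diff_cong refl red_frag_extend_zero[OF c(3)] red_frag_extend_cong[OF refl b(2)])
  also have "frag_extend incl (frag_extend (bar_d K) b) = frag_extend aD (frag_extend incl b)"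
    unfolding frag_extend_frag_extend by (rule frag_extend_eq) (use b(1) incl_bar_d in auto)
  finally have "z = lft p aD (red p ?b)"
    by (simp add: c(1) lft_red[OF refl] frag_extend_diff)
  moreover have "Poly_Mapping.keys ?b \<subseteq> XI (int (Suc n))"
  proof -
    have "Poly_Mapping.keys (frag_extend incl b) \<subseteq> XI (int (Suc n))"
      by (rule keys_frag_extend_subset) (use b(1) incl_keys in blast)
    moreover have "Poly_Mapping.keys (frag_extend hmtp c) \<subseteq> XI (int (Suc n))"
      by (rule keys_frag_extend_subset) (use c(2) hmtp_keys in blast)
    ultimately show ?thesis using keys_diff[of "frag_extend incl b" "frag_extend hmtp c"] by blast
  qed
  then have "red p ?b \<in> carrier (free (XI (int n + 1)))"
    using red_carrier[of ?b "XI (int n + 1)"] by (simp add: add.commute)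
  ultimately show "z \<in> lft p aD ` carrier (free (XI (int n + 1)))" by (rule image_eqI)
next
  assume "z \<in> lft p aD ` carrier (free (XI (int n + 1)))"
  then obtain f where f: "f \<in> carrier (free (XI (int (Suc n))))" "z = lft p aD f"
    by (auto simp: add.commute)
  obtain e where e: "f = red p e" "Poly_Mapping.keys e \<subseteq> XI (int (Suc n))" using f(1) by (rule carrier_redE)
  then show "lft p retr z \<in> K.bnd n"
    unfolding K.bnd_iff f(2) using retr_frag_keys[OF e(2)] retr_aD_frag[OF e(2)]
    by (auto simp: e(1) lft_red[OF refl])
qed

text \<open>The retraction presents the homology of \<open>K\<close> as cycles modulo boundaries of
  the filtered complex: it is onto by \<open>retr_incl\<close> and has the right kernel by
  \<open>retr_bnd_iff\<close>.\<close>

lemma total_homology_converges: "converges_finitely (Fp p) FC.E FC.d (homology KC)"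
proof (rule FC.converges[where g = "\<lambda>n z. hclass KC n (lft p retr z)"])
  show "module (Fp p) (homology KC n)" for n by (rule K.homology_module)
  show "(\<lambda>z. hclass KC n (lft p retr z)) \<in> lin_hom (Fp p) ((free (XI (int n)))\<lparr>carrier := FC.cycles n\<rparr>) (homology KC n)" for n
  proof (rule lin_hom_comp[OF _ K.hclass_hom])
    show "lft p retr \<in> lin_hom (Fp p) ((free (XI (int n)))\<lparr>carrier := FC.cycles n\<rparr>) (K.cyc_mod n)"
      using retr_cycles by (intro lin_hom_corestrict lin_hom_restrict[OF retr_lin]) (auto simp: FC.cycles_def)
  qed
  show "(\<lambda>z. hclass KC n (lft p retr z)) ` FC.cycles n = carrier (homology KC n)" for n
  proof -
    have "lft p retr ` FC.cycles n = K.cyc n"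
    proof (intro equalityI subsetI)
      fix z assume "z \<in> K.cyc n"
      then obtain e where e: "z = red p e" "Poly_Mapping.keys e \<subseteq> simplices (nerve K) n"
        "red p (frag_extend (bar_d K) e) = red p 0" by (rule K.cycE)
      have k: "Poly_Mapping.keys (frag_extend incl e) \<subseteq> XI (int n)"
        by (rule keys_frag_extend_subset) (use e(2) incl_keys in blast)
      have "frag_extend aD (frag_extend incl e) = frag_extend incl (frag_extend (bar_d K) e)"
        unfolding frag_extend_frag_extend by (rule frag_extend_eq) (use e(2) incl_bar_d in auto)
      then have "red p (frag_extend incl e) \<in> FC.cycles n"
        unfolding cycles_iff[OF k] using red_frag_extend_zero[OF e(3)] by simp
      moreover have "frag_extend retr (frag_extend incl e) = frag_extend frag_of e"
        unfolding frag_extend_frag_extend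
        by (rule frag_extend_eq) (use e(2) retr_incl in \<open>auto simp: nerve_simplices subset_iff\<close>)
      then have "z = lft p retr (red p (frag_extend incl e))"
        by (simp add: e(1) lft_red[OF refl] frag_expansion[symmetric])
      ultimately show "z \<in> lft p retr ` FC.cycles n" by blast
    qed (use retr_cycles in blast)
    then show ?thesis unfolding K.hclass_surj[symmetric] by (metis image_image)
  qed
  show "hclass KC n (lft p retr z) = \<zero>\<^bsub>homology KC n\<^esub> \<longleftrightarrow> z \<in> lft p aD ` carrier (free (XI (int n + 1)))"
    if "z \<in> FC.cycles n" for n z
    unfolding K.hclass_eq_zero_iff[OF retr_cycles[OF that]] by (rule retr_bnd_iff[OF that])
qed

end

theorem corollary7p4:
  fixes p :: nat and K :: "'k monoid" and G :: "'a monoid"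
    and \<iota> :: "'k \<Rightarrow> 'a" and \<nu> :: "'a \<Rightarrow> int"
  assumes "Factorial_Ring.prime p"
    and "group K" and "group G"
    and "\<iota> \<in> mon K G"
    and "\<nu> \<in> epi G (Zp p)"
    and "\<iota> ` carrier K = kernel G (Zp p) \<nu>"
  shows "\<exists>(E :: nat \<Rightarrow> int \<Rightarrow> int \<Rightarrow> (int, ('a list \<Rightarrow> int) set) module) d.
    spectral_sequence (Fp p) E d \<and>
    (\<forall>s q :: nat. s \<le> p - 1 \<longrightarrow> E 1 (- int s) (int s + int q) = group_homology (Fp p) G q) \<and>
    (\<forall>a b. (\<nexists>s q :: nat. s \<le> p - 1 \<and> a = - int s \<and> b = int s + int q) \<longrightarrow> zero_mod (E 1 a b)) \<and>
    (\<forall>s q :: nat. s + 1 \<le> p - 1 \<longrightarrow> 1 \<le> q \<longrightarrow>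
      (\<forall>x \<in> carrier (group_homology (Fp p) G q).
        d 1 (- int s) (int s + int q) x = rho p G \<nu> q x)) \<and>
    converges_finitely (Fp p) E d (group_homology (Fp p) K)"
proof -
  have hom: "\<nu> \<in> hom G (Zp p)" "\<nu> ` carrier G = carrier (Zp p)"
    using assms(5) by (auto simp: epi_def)
  interpret cyclic_extension p G \<nu> K \<iota>
  proof (intro cyclic_extension.intro nerve_character.intro nerve_group.intro)
    show "mod_prime p" by (rule mod_prime.intro) fact
    show "group G" by fact
    show "nerve_character_axioms p G \<nu>"
      using hom(1) by (intro nerve_character_axioms.intro) (auto simp: hom_def)
    show "cyclic_extension_axioms p G \<nu> K \<iota>"
      by (rule cyclic_extension_axioms.intro) (fact assms hom)+
  qed
  have p: "s \<le> p - 1 \<longleftrightarrow> s < p" for s using p_gt_1 by auto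
  show ?thesis
  proof (intro exI[of _ FC.E] exI[of _ FC.d] conjI allI impI ballI)
    show "spectral_sequence (Fp p) FC.E FC.d" by (rule FC.is_spectral_sequence)
    show "converges_finitely (Fp p) FC.E FC.d (group_homology (Fp p) K)" by (rule total_homology_converges)
    show "FC.E 1 (- int s) (int s + int q) = group_homology (Fp p) G q" if "s \<le> p - 1" for s q
      using first_page[of s q] that p[of s] by (simp add: FC.E_def)
    show "zero_mod (FC.E 1 a b)" if "\<nexists>s q :: nat. s \<le> p - 1 \<and> a = - int s \<and> b = int s + int q" for a b
      unfolding FC.E_def
    \<comment> \<open>Outside the vanishing range, the filtration degree s = - a lies in 0..p - 1
      and the total degree q = a + b is nonnegative; these are the excluded witnesses.\<close>
    proof (rule FC.page_outside, rule ccontr)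
      assume "\<not> (- a < 0 \<or> int p \<le> - a \<or> a + b < 0)"
      then have "nat (- a) \<le> p - 1 \<and> a = - int (nat (- a)) \<and> b = int (nat (- a)) + int (nat (a + b))"
        by auto
      with that show False by blast
    qed
    show "FC.d 1 (- int s) (int s + int q) x = rho p G \<nu> q x"
      if "s + 1 \<le> p - 1" "1 \<le> q" "x \<in> carrier (group_homology (Fp p) G q)" for s q x
    proof -
      obtain n where n: "q = Suc n" using \<open>1 \<le> q\<close> by (cases q) auto
      have "Suc s < p" using \<open>s + 1 \<le> p - 1\<close> p[of "s + 1"] by simp
      from first_page_diff[OF this, of x n] show ?thesis using that(3) by (simp add: FC.d_def n)
    qed
  qed
qed

end
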